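(* Let $\Omega\subset\mathbb{R}^2$ be a bounded, open, simply connected Lipschitz domain such that $0\in\Omega$. Let $\alpha_0\in\{\tfrac12\}+\mathbb{Z}$. Let $n_0\ge1$ be such that the $n_0$-th eigenvalue $\lambda:=\lambda_{n_0}^{(0,\alpha_0)}$ of $(i\nabla+A_0^{\alpha_0})^2$ with Dirichlet boundary conditions on $\partial\Omega$ has multiplicity two. Let $\varphi_1,\varphi_2$ be two $K$-real eigenfunctions corresponding to $\lambda$, orthonormal in $L^2(\Omega,\mathbb{C})$ (hence linearly independent). Let $c_k,d_k\in\mathbb{R}$, $k=1,2$, be the coefficients in the expansions $$\varphi_k(r\cos t,r\sin t)=e^{i\alpha_0t}\,r^{1/2}\Big(c_k\cos\frac t2+d_k\sin\frac t2\Big)+f_k(r,t),\qquad f_k(r,t)=O(r^{3/2})\text{ as }r\to0^+\text{ uniformly in }t\in[0,2\pi].$$ Suppose that $\varphi_1$ and $\varphi_2$ satisfy all of the following: (i) $c_k^2+d_k^2\ne0$ for $k=1,2$; (ii) there does not exist $\gamma\in\mathbb{R}$ such that $(c_1,d_1)=\gamma(c_2,d_2)$; (iii) $\displaystyle\int_\Omega(i\nabla+A_0^{\alpha_0})\varphi_1\cdot A_0^{\alpha_0}\,\overline{\varphi_2}\,dx\ne0$. Then there exist a neighborhood $U\subset\Omega\times\mathbb{R}$ of $(0,\alpha_0)$ and $\varepsilon>0$ such that $$\{(a,\alpha)\in U:\ (i\nabla+A_a^\alpha)^2\text{ admits an eigenvalue of multiplicity two in }(\lambda-\varepsilon,\l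ambda+\varepsilon)\}=\{(0,\alpha_0)\}.$$
   Context: For $a=(a_1,a_2)\in\mathbb{R}^2$ and $\alpha\in\mathbb{R}$ the Aharonov--Bohm potential with pole $a$ and circulation $\alpha$ is $$A_a^\alpha(x_1,x_2)=\alpha\left(-\frac{x_2-a_2}{(x_1-a_1)^2+(x_2-a_2)^2},\ \frac{x_1-a_1}{(x_1-a_1)^2+(x_2-a_2)^2}\right).$$ For $a\in\Omega$, $H^{1,a}_0(\Omega,\mathbb{C})$ is the completion of $C_c^\infty(\Omega\setminus\{a\},\mathbb{C})$ with respect to the norm $\big(\|\nabla u\|_{L^2}^2+\|u\|_{L^2}^2+\|u/|x-a|\,\|_{L^2}^2\big)^{1/2}$. For $\alpha\notin\mathbb{Z}$, a number $\lambda$ is an eigenvalue of $(i\nabla+A_a^\alpha)^2$ with Dirichlet boundary conditions if there is $u\in H^{1,a}_0(\Omega,\mathbb{C})\setminus\{0\}$ (an eigenfunction) such that $$\int_\Omega(i\nabla+A_a^\alpha)u\cdot\overline{(i\nabla+A_a^\alpha)v}\,dx=\lambda\int_\Omega u\overline v\,dx\quad\text{for all }v\in H^{1,a}_0(\Omega,\mathbb{C}).$$ The eigenvalues form a diverging sequence of positive numbers of finite multiplicity (complex dimension of the eigenspace), enumerated as $0<\lambda_1^{(a,\alpha)}\le\lambda_2^{(a,\alpha)}\le\dots$, each repeated according to its multiplicity. Here $x\cdot y=x_1y_1+x_2y_2$ for $x,y\in\mathbb{C}^2$. Let $\theta_0:\mathbb{R}^2\setminus\{0\}\to[0,2\pi)$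 be the polar angle, $\theta_0(r\cos t,r\sin t)=t$ for $t\in[0,2\pi)$. For $\alpha_0\in\{\tfrac12\}+\mathbb{Z}$, $2\alpha_0$ is an odd integer and $u$ is called $K$-real if $e^{2i\alpha_0\theta_0}\overline u=u$ (for $\alpha_0=\tfrac12$: $e^{i\theta_0}\overline u=u$). Each eigenspace of $(i\nabla+A_0^{\alpha_0})^2$ has an $L^2$-orthonormal basis of $K$-real eigenfunctions, and every $K$-real eigenfunction has an expansion at $0$ of the form displayed in the claim, with real coefficients $c_k,d_k$ (possibly both zero). *)

theory Defs
  imports "HOL-Analysis.Analysis"
begin

text \<open>
  Each boundary point has a ball in which, after a rigid motion, the set is the part strictly above
  the graph of a Lipschitz function; \<open>e1, e2\<close> is the rotated (possibly reflected) frame.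
\<close>

definition lipschitz_boundary :: "(real^2) set \<Rightarrow> bool" where
  "lipschitz_boundary \<Omega> \<longleftrightarrow>
     (\<forall>p \<in> frontier \<Omega>. \<exists>r e1 e2 C \<gamma>. r > 0 \<and> norm e1 = 1 \<and> norm e2 = 1 \<and> e1 \<bullet> e2 = 0 \<and>
        C-lipschitz_on (UNIV :: real set) (\<gamma> :: real \<Rightarrow> real) \<and>
        \<Omega> \<inter> ball p r = {x \<in> ball p r. (x - p) \<bullet> e2 > \<gamma> ((x - p) \<bullet> e1)})"

definition partial_deriv :: "2 \<Rightarrow> (real^2 \<Rightarrow> complex) \<Rightarrow> real^2 \<Rightarrow> complex" where
  "partial_deriv i f x = frechet_derivative f (at x) (axis i 1)"

definition classical_grad :: "(real^2 \<Rightarrow> complex) \<Rightarrow> real^2 \<Rightarrow> complex^2" where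
  "classical_grad f x = (\<chi> i. partial_deriv i f x)"

primrec Ck :: "nat \<Rightarrow> (real^2 \<Rightarrow> complex) \<Rightarrow> bool" where
  "Ck 0 f \<longleftrightarrow> continuous_on UNIV f"
| "Ck (Suc k) f \<longleftrightarrow> (\<forall>x. f differentiable (at x)) \<and> (\<forall>i. Ck k (partial_deriv i f))"

definition test_functions :: "(real^2) set \<Rightarrow> (real^2 \<Rightarrow> complex) set" where
  "test_functions S = {\<phi>. (\<forall>k. Ck k \<phi>) \<and>
     compact (closure {x. \<phi> x \<noteq> 0}) \<and> closure {x. \<phi> x \<noteq> 0} \<subseteq> S}"

text \<open>
  The completion of the test functions on \<open>\<Omega> - {a}\<close> in the norm
  \<open>(\<parallel>\<nabla>u\<parallel>\<^sup>2 + \<parallel>u\<parallel>\<^sup>2 + \<parallel>u / |x - a|\<parallel>\<^sup>2)\<^sup>1\<^sup>/\<^sup>2\<close> is realised by functions: its elements are the \<open>L\<^sup>2\<close> limits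
  \<open>u\<close> of norm-Cauchy sequences, and \<open>\<nabla>u\<close> is the limit of the gradients, i.e. the weak gradient.
  \<open>H_limit \<Omega> a u g\<close> says that \<open>u\<close> is such a limit with gradient \<open>g\<close>. Both are determined only
  almost everywhere on \<open>\<Omega>\<close>. Square integrability of \<open>u\<close>, \<open>g\<close> and \<open>u / |x - a|\<close> follows from the
  convergence of the integral to 0. At \<open>x = a\<close> the quotient is 0, on a null set.
\<close>

definition H_limit :: "(real^2) set \<Rightarrow> real^2 \<Rightarrow> (real^2 \<Rightarrow> complex) \<Rightarrow> (real^2 \<Rightarrow> complex^2) \<Rightarrow> bool" where
  "H_limit \<Omega> a u g \<longleftrightarrow>
     u \<in> borel_measurable (lebesgue_on \<Omega>) \<and> g \<in> borel_measurable (lebesgue_on \<Omega>) \<and>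
     (\<exists>\<phi> :: nat \<Rightarrow> real^2 \<Rightarrow> complex. (\<forall>n. \<phi> n \<in> test_functions (\<Omega> - {a})) \<and>
        (\<lambda>n. \<integral>\<^sup>+ x. ennreal ((norm (classical_grad (\<phi> n) x - g x))\<^sup>2 + (norm (\<phi> n x - u x))\<^sup>2 +
                 (norm (\<phi> n x - u x) / norm (x - a))\<^sup>2) \<partial>lebesgue_on \<Omega>) \<longlonglongrightarrow> 0)"

definition H10 :: "(real^2) set \<Rightarrow> real^2 \<Rightarrow> (real^2 \<Rightarrow> complex) set" where
  "H10 \<Omega> a = {u. \<exists>g. H_limit \<Omega> a u g}"

definition grad :: "(real^2) set \<Rightarrow> real^2 \<Rightarrow> (real^2 \<Rightarrow> complex) \<Rightarrow> real^2 \<Rightarrow> complex^2" where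
  "grad \<Omega> a u = (SOME g. H_limit \<Omega> a u g)"

definition AB_potential :: "real^2 \<Rightarrow> real \<Rightarrow> real^2 \<Rightarrow> real^2" where
  "AB_potential a \<alpha> x =
     \<alpha> *\<^sub>R vector [- (x$2 - a$2) / ((x$1 - a$1)\<^sup>2 + (x$2 - a$2)\<^sup>2),
                     (x$1 - a$1) / ((x$1 - a$1)\<^sup>2 + (x$2 - a$2)\<^sup>2)]"

definition complex_vec :: "real^2 \<Rightarrow> complex^2" where
  "complex_vec v = (\<chi> i. complex_of_real (v$i))"

definition cnj_vec :: "complex^2 \<Rightarrow> complex^2" where
  "cnj_vec v = (\<chi> i. cnj (v$i))"

text \<open>The bilinear product on \<open>\<complex>\<^sup>2\<close>; the library's \<open>\<bullet>\<close> on this type is a real inner product.\<close>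

definition cdot :: "complex^2 \<Rightarrow> complex^2 \<Rightarrow> complex" where
  "cdot x y = x$1 * y$1 + x$2 * y$2"

text \<open>\<open>(i\<nabla> + A\<^sub>a\<^sup>\<alpha>) u\<close>\<close>

definition magnetic_grad ::
  "(real^2) set \<Rightarrow> real^2 \<Rightarrow> real \<Rightarrow> (real^2 \<Rightarrow> complex) \<Rightarrow> real^2 \<Rightarrow> complex^2" where
  "magnetic_grad \<Omega> a \<alpha> u x = \<i> *s grad \<Omega> a u x + u x *s complex_vec (AB_potential a \<alpha> x)"

definition eigenspace :: "(real^2) set \<Rightarrow> real^2 \<Rightarrow> real \<Rightarrow> real \<Rightarrow> (real^2 \<Rightarrow> complex) set" where
  "eigenspace \<Omega> a \<alpha> \<mu> = {u \<in> H10 \<Omega> a. \<forall>v \<in> H10 \<Omega> a.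
     (LINT x|lebesgue_on \<Omega>. cdot (magnetic_grad \<Omega> a \<alpha> u x) (cnj_vec (magnetic_grad \<Omega> a \<alpha> v x)))
       = complex_of_real \<mu> * (LINT x|lebesgue_on \<Omega>. u x * cnj (v x))}"

definition eigenfunction ::
  "(real^2) set \<Rightarrow> real^2 \<Rightarrow> real \<Rightarrow> real \<Rightarrow> (real^2 \<Rightarrow> complex) \<Rightarrow> bool" where
  "eigenfunction \<Omega> a \<alpha> \<mu> u \<longleftrightarrow>
     u \<in> eigenspace \<Omega> a \<alpha> \<mu> \<and> \<not> (AE x in lebesgue_on \<Omega>. u x = 0)"

text \<open>
  The eigenspace, modulo equality almost everywhere, has a complex basis with \<open>n\<close> elements.
  For \<open>n = 0\<close> this says that \<open>\<mu>\<close> is not an eigenvalue.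
\<close>

definition has_eigen_multiplicity :: "(real^2) set \<Rightarrow> real^2 \<Rightarrow> real \<Rightarrow> real \<Rightarrow> nat \<Rightarrow> bool" where
  "has_eigen_multiplicity \<Omega> a \<alpha> \<mu> n \<longleftrightarrow>
     (\<exists>b :: nat \<Rightarrow> real^2 \<Rightarrow> complex.
        (\<forall>j<n. b j \<in> eigenspace \<Omega> a \<alpha> \<mu>) \<and>
        (\<forall>z :: nat \<Rightarrow> complex. (AE x in lebesgue_on \<Omega>. (\<Sum>j<n. z j * b j x) = 0) \<longrightarrow> (\<forall>j<n. z j = 0)) \<and>
        (\<forall>u \<in> eigenspace \<Omega> a \<alpha> \<mu>. \<exists>z :: nat \<Rightarrow> complex.
           AE x in lebesgue_on \<Omega>. u x = (\<Sum>j<n. z j * b j x)))"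

text \<open>
  Nondecreasing enumeration with indices \<open>1, 2, \<dots>\<close>, in which every real number occurs as often as
  its multiplicity (so non-eigenvalues do not occur). Index 0 is irrelevant.
\<close>

definition enumerates_eigenvalues :: "(real^2) set \<Rightarrow> real^2 \<Rightarrow> real \<Rightarrow> (nat \<Rightarrow> real) \<Rightarrow> bool" where
  "enumerates_eigenvalues \<Omega> a \<alpha> L \<longleftrightarrow>
     mono_on {1..} L \<and>
     (\<forall>\<mu>. finite {n. n \<ge> 1 \<and> L n = \<mu>} \<and>
          has_eigen_multiplicity \<Omega> a \<alpha> \<mu> (card {n. n \<ge> 1 \<and> L n = \<mu>}))"

definition eigenval :: "(real^2) set \<Rightarrow> real^2 \<Rightarrow> real \<Rightarrow> nat \<Rightarrow> real" where
  "eigenval \<Omega> a \<alpha> = (SOME L. enumerates_eigenvalues \<Omega> a \<alpha> L)"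

text \<open>\<open>Arg2pi\<close> takes values in \<open>[0, 2\<pi>)\<close>.\<close>

definition polar_angle :: "real^2 \<Rightarrow> real" where
  "polar_angle x = Arg2pi (Complex (x$1) (x$2))"

definition K_real :: "(real^2) set \<Rightarrow> real \<Rightarrow> (real^2 \<Rightarrow> complex) \<Rightarrow> bool" where
  "K_real \<Omega> \<alpha>\<^sub>0 u \<longleftrightarrow>
     (AE x in lebesgue_on \<Omega>. exp (\<i> * complex_of_real (2 * \<alpha>\<^sub>0 * polar_angle x)) * cnj (u x) = u x)"

definition L2_inner :: "(real^2) set \<Rightarrow> (real^2 \<Rightarrow> complex) \<Rightarrow> (real^2 \<Rightarrow> complex) \<Rightarrow> complex" where
  "L2_inner \<Omega> u v = (LINT x|lebesgue_on \<Omega>. u x * cnj (v x))"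

text \<open>
  The remainder is \<open>O(r\<^sup>3\<^sup>/\<^sup>2)\<close> as \<open>r \<rightarrow> 0+\<close>, uniformly in \<open>t\<close>. This is a pointwise condition near 0 and
  refers to the representative of \<open>u\<close> that is continuous away from 0.
\<close>

definition expansion_at_0 :: "real \<Rightarrow> (real^2 \<Rightarrow> complex) \<Rightarrow> real \<Rightarrow> real \<Rightarrow> bool" where
  "expansion_at_0 \<alpha>\<^sub>0 u c d \<longleftrightarrow>
     (\<exists>C \<delta>. \<delta> > 0 \<and> (\<forall>r t. 0 < r \<and> r < \<delta> \<and> 0 \<le> t \<and> t \<le> 2 * pi \<longrightarrow>
        norm (u (vector [r * cos t, r * sin t])
              - exp (\<i> * complex_of_real (\<alpha>\<^sub>0 * t))
                  * complex_of_real (r powr (1/2) * (c * cos (t/2) + d * sin (t/2))))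
          \<le> C * r powr (3/2)))"

end

theory Submission
  imports Defs "HOL-Complex_Analysis.Great_Picard"
begin

text \<open>
 A flow \<open>\<Phi>\<^sub>a(x) = x + \<zeta>(x) a\<close>, with a cut-off \<open>\<zeta>\<close> equal to 1 near 0, moves the pole 0 to \<open>a\<close>, so that all eigenvalue
 problems live on the form domain of the pole 0 and depend on \<open>(a, \<alpha>)\<close> through coefficients. Hardy's inequality for
 half-integer circulation and Rellich's theorem give a spectral gap for the eigenvalue \<open>\<lambda>\<close>. If the eigenvalue \<open>\<mu>\<close> at
 \<open>(a, \<alpha>)\<close> is double, its eigenspace projects isomorphically onto that of \<open>\<lambda>\<close>; hence the \<open>2 \<times> 2\<close> matrix of the first
 variation of the form is scalar up to an error \<open>O(t (t + |\<mu> - \<lambda>|))\<close>, where \<open>t = |a| + |\<alpha> - \<alpha>\<^sub>0|\<close>.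

 In a K-real basis the variation in \<open>\<alpha>\<close> contributes an imaginary antisymmetric matrix, with off-diagonal entry a
 nonzero multiple of (iii), while the variation in \<open>a\<close> contributes a real part. Shrinking the support of \<open>\<zeta>\<close> to the pole,
 this real part becomes a multiple of \<open>Re (a w\<^sub>i w\<^sub>j)\<close> with \<open>w\<^sub>k = c\<^sub>k - i d\<^sub>k\<close> and \<open>a\<close> read as a complex number; by (ii) it is
 scalar only for \<open>a = 0\<close>. So \<open>t \<le> C t (t + |\<mu> - \<lambda>|)\<close>, which forces \<open>t = 0\<close>.
\<close>

section \<open>Smooth functions\<close>

text \<open>Two things obstruct a direct expansion: the perturbed eigenvalue \<mu> is known only to
  be near \<lambda>, and the expansions at the pole concern the functions, not their gradients.
  Against the first, every error term keeps a factor t: the unperturbed terms cancel exactly when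
  the transported equation is tested with the old eigenfunctions, so no bare power of |\<mu> -
  \<lambda>| is left over and the final inequality can be absorbed. Against the second, a
  Caccioppoli estimate on a shell around the pole turns closeness of functions into closeness of
  gradients in L2.

  All norms are those of the form at the unperturbed parameter, so Hardy's inequality is applied at
  half-integer circulation only. The cut-off equals 1 near 0 because the flow is a translation there
  and carries the potential exactly to the moved one; in fixed coordinates the two would differ by a
  term of size |a| / (|x| |x - a|). The support of \<zeta> is fixed by comparing its localisation
  error with the determinant behind (ii), before the neighbourhood of the parameter is chosen: the
  constants of the perturbation estimate depend on that support.\<close>

abbreviation tends_to :: "(nat => 'a :: topological_space) => 'a => bool" (infixr "---->" 60) where
 "X ----> L \<equiv> X \<longlonglongrightarrow> L"

abbreviation cx :: "real => complex" where "cx \<equiv> of_real"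

lemmas b_integral_add = Bochner_Integration.integral_add
 and b_integral_diff = Bochner_Integration.integral_diff
 and b_integral_cong = Bochner_Integration.integral_cong
 and b_integrable_add = Bochner_Integration.integrable_add
 and b_integrable_diff = Bochner_Integration.integrable_diff

lemma partial_deriv_eqI:
 "(f has_derivative f') (at x) ==> partial_deriv i f x = f' (axis i 1)"
 unfolding partial_deriv_def by (metis frechet_derivative_at)

text \<open>Functions that agree near \<open>x\<close> have the same derivatives there, so the
  choice operator behind \<open>frechet_derivative\<close> returns the same map for both,
  differentiable or not.\<close>

lemma partial_deriv_cong:
 assumes "open S" "x \<in> S" "!!y. y \<in> S ==> f y = g y"
 shows "partial_deriv i f x = partial_deriv i g x"
proof -
 have "(f has_derivative D) (at x) \<longleftrightarrow> (g has_derivative D) (at x)" for D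
  using assms has_derivative_transform_within_open[of _ D x UNIV S] by metis
 then show ?thesis unfolding partial_deriv_def frechet_derivative_def by simp
qed

lemma differentiable_cong_open:
 assumes "open S" "x \<in> S" "!!y. y \<in> S ==> f y = g y" "f differentiable (at x)"
 shows "g differentiable (at x)"
 using assms has_derivative_transform_within_open[of f _ x UNIV S g] unfolding differentiable_def by metis

lemma vec2_expand: "(h :: real^2) = h$1 *\<^sub>R axis 1 1 + h$2 *\<^sub>R axis 2 1"
 by (simp add: vec_eq_iff forall_2 axis_def)

lemma has_derivative_partial:
 assumes "f differentiable (at x)"
 shows "(f has_derivative (%h. h$1 *\<^sub>R partial_deriv 1 f x + h$2 *\<^sub>R partial_deriv 2 f x)) (at x)"
proof -
 let ?D = "frechet_derivative f (at x)"
 have D: "(f has_derivative ?D) (at x)" using assms frechet_derivative_works by blast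
 then interpret bounded_linear ?D by (rule has_derivative_bounded_linear)
 have "?D h = h$1 *\<^sub>R partial_deriv 1 f x + h$2 *\<^sub>R partial_deriv 2 f x" for h
  unfolding partial_deriv_def by (subst vec2_expand[of h]) (simp only: add scaleR)
 then have "?D = (%h. h$1 *\<^sub>R partial_deriv 1 f x + h$2 *\<^sub>R partial_deriv 2 f x)" by blast
 with D show ?thesis by simp
qed

lemma partial_deriv_mult:
 assumes "f differentiable (at x)" "g differentiable (at x)"
 shows "partial_deriv i (%x. f x * g x) x = partial_deriv i f x * g x + f x * partial_deriv i g x"
 using partial_deriv_eqI[OF has_derivative_mult[OF has_derivative_partial[OF assms(1)] has_derivative_partial[OF assms(2)]], of i]
  exhaust_2[of i] by (auto simp: axis_def)

lemma partial_deriv_add: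
 assumes "f differentiable (at x)" "g differentiable (at x)"
 shows "partial_deriv i (%x. f x + g x) x = partial_deriv i f x + partial_deriv i g x"
 using partial_deriv_eqI[OF has_derivative_add[OF has_derivative_partial[OF assms(1)] has_derivative_partial[OF assms(2)]], of i]
  exhaust_2[of i] by (auto simp: axis_def)

lemma partial_deriv_cmult:
 assumes "f differentiable (at x)"
 shows "partial_deriv i (%x. c * f x) x = c * partial_deriv i f x"
 using partial_deriv_mult[of "%_. c" x f i] assms partial_deriv_eqI[OF has_derivative_const[of c "at x"]] by simp

lemma partial_deriv_diff:
 assumes "f differentiable (at x)" "g differentiable (at x)"
 shows "partial_deriv i (%x. f x - g x) x = partial_deriv i f x - partial_deriv i g x"
 using partial_deriv_add[of f x "%x. (-1) * g x" i] partial_deriv_cmult[of g x i "-1"] assms by simp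

lemma partial_deriv_cnj:
 assumes "f differentiable (at x)"
 shows "partial_deriv i (%x. cnj (f x)) x = cnj (partial_deriv i f x)"
 using partial_deriv_eqI[OF has_derivative_cnj[OF has_derivative_partial[OF assms]], of i]
  exhaust_2[of i] by (auto simp: axis_def)

lemma partial_deriv_const: "partial_deriv i (%x. c) x = 0"
 using partial_deriv_eqI[OF has_derivative_const] by metis

lemma has_derivative_coord: "((%x :: real^2. cx (x$j)) has_derivative (%h. cx (h$j))) (at x)"
 by (intro has_derivative_of_real bounded_linear_imp_has_derivative bounded_linear_vec_nth)

lemma partial_deriv_coord: "partial_deriv i (%x. cx (x$j)) x = (if i = j then 1 else 0)"
 by (subst partial_deriv_eqI[OF has_derivative_coord]) (simp add: axis_def)

text \<open>A local form of \<open>Ck\<close>: radial powers and angular factors are smooth only off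
  the pole. Derivatives are taken in the whole plane, so the notion is meant for open sets.\<close>

primrec Ck_on :: "nat => (real^2) set => (real^2 => complex) => bool" where
 "Ck_on 0 S f \<longleftrightarrow> continuous_on S f"
| "Ck_on (Suc k) S f \<longleftrightarrow> (\<forall>x\<in>S. f differentiable (at x)) \<and> (\<forall>i. Ck_on k S (partial_deriv i f))"

definition smooth_on :: "(real^2) set => (real^2 => complex) => bool" where
 "smooth_on S f \<longleftrightarrow> (\<forall>k. Ck_on k S f)"

lemma Ck_on_UNIV: "Ck_on k UNIV f \<longleftrightarrow> Ck k f"
 by (induction k arbitrary: f) auto

lemma Ck_on_SucD: "Ck_on (Suc k) S f ==> Ck_on k S f"
proof (induction k arbitrary: f)
 case 0
 then show ?case
  by (auto intro!: continuous_at_imp_continuous_on differentiable_imp_continuous_within)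
qed auto

lemma Ck_on_cong:
 assumes "open S"
 shows "(!!y. y \<in> S ==> f y = g y) ==> Ck_on k S f ==> Ck_on k S g"
proof (induction k arbitrary: f g)
 case 0 then show ?case by (auto cong: continuous_on_cong)
next
 case (Suc k)
 have "Ck_on k S (partial_deriv i g)" for i
  using Suc.IH[of "partial_deriv i f" "partial_deriv i g"] Suc.prems
   partial_deriv_cong[OF assms, of _ f g i] by auto
 then show ?case using Suc.prems differentiable_cong_open[OF assms, of _ f g] by auto
qed

lemma Ck_on_subset: "Ck_on k S f ==> T \<subseteq> S ==> Ck_on k T f"
 by (induction k arbitrary: f) (auto intro: continuous_on_subset)

lemma Ck_on_Un: "open S ==> open T ==> Ck_on k S f ==> Ck_on k T f ==> Ck_on k (S \<union> T) f"
 by (induction k arbitrary: f) (auto intro: continuous_on_open_Un)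

lemma Ck_on_const: "Ck_on k S (%x. c)"
proof (induction k arbitrary: c)
 case (Suc k)
 have "partial_deriv i (%x. c) = (%x. 0)" for i using partial_deriv_const by blast
 with Suc[of 0] show ?case by simp
qed simp

lemma Ck_on_coord: "Ck_on k S (%x. cx (x$j))"
proof (cases k)
 case 0 then show ?thesis by (simp add: continuous_intros)
next
 case (Suc l)
 have "partial_deriv i (%x. cx (x$j)) = (%x. if i = j then 1 else 0)" for i
  using partial_deriv_coord by blast
 moreover have "(%x :: real^2. cx (x$j)) differentiable (at x)" for x
  using has_derivative_coord unfolding differentiable_def by blast
 ultimately show ?thesis using Suc Ck_on_const by simp
qed

lemma Ck_on_add:
 assumes "open S"
 shows "Ck_on k S f ==> Ck_on k S g ==> Ck_on k S (%x. f x + g x)"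
proof (induction k arbitrary: f g)
 case 0 then show ?case by (simp add: continuous_intros)
next
 case (Suc k)
 have "Ck_on k S (partial_deriv i (%x. f x + g x))" for i
  by (rule Ck_on_cong[OF assms _ Suc.IH[of "partial_deriv i f" "partial_deriv i g"]])
    (use Suc.prems in \<open>auto simp: partial_deriv_add\<close>)
 then show ?case using Suc.prems by auto
qed

lemma Ck_on_mult:
 assumes "open S"
 shows "Ck_on k S f ==> Ck_on k S g ==> Ck_on k S (%x. f x * g x)"
proof (induction k arbitrary: f g)
 case 0 then show ?case by (simp add: continuous_intros)
next
 case (Suc k)
 have "Ck_on k S (%x. partial_deriv i f x * g x + f x * partial_deriv i g x)" for i
  using Suc.prems Ck_on_SucD[of k S] by (intro Ck_on_add assms Suc.IH) auto
 then have "Ck_on k S (partial_deriv i (%x. f x * g x))" for i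
  by (rule Ck_on_cong[OF assms, rotated])
    (use Suc.prems in \<open>auto simp: partial_deriv_mult\<close>)
 then show ?case using Suc.prems by auto
qed

lemma Ck_on_cnj:
 assumes "open S"
 shows "Ck_on k S f ==> Ck_on k S (%x. cnj (f x))"
proof (induction k arbitrary: f)
 case 0 then show ?case by (simp add: continuous_intros)
next
 case (Suc k)
 have "Ck_on k S (partial_deriv i (%x. cnj (f x)))" for i
  by (rule Ck_on_cong[OF assms _ Suc.IH[of "partial_deriv i f"]])
    (use Suc.prems in \<open>auto simp: partial_deriv_cnj\<close>)
 moreover have "(%x. cnj (f x)) differentiable (at x)" if "x \<in> S" for x
  using has_derivative_cnj[OF has_derivative_partial[of f x]] Suc.prems that
  unfolding differentiable_def[of "%x. cnj (f x)"] by auto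
 ultimately show ?case by simp
qed

lemma has_derivative_Re_of_real:
 assumes "(%x. cx (f x)) differentiable (at x)"
 shows "(f has_derivative (%h. h$1 * Re (partial_deriv 1 (%x. cx (f x)) x)
      + h$2 * Re (partial_deriv 2 (%x. cx (f x)) x))) (at x)"
 using has_derivative_Re[OF has_derivative_partial[OF assms]] by simp

lemma partial_deriv_of_real:
 assumes "(f has_derivative f') (at x)"
 shows "partial_deriv i (%x. cx (f x)) x = cx (f' (axis i 1))"
 by (rule partial_deriv_eqI) (use assms in \<open>auto intro: derivative_intros\<close>)

text \<open>A set of real functions closed under differentiation takes the place of smoothness in one variable.\<close>

lemma Ck_on_family:
 assumes S: "open S" and fam: "!!g. g \<in> G ==> \<exists>g'\<in>G. \<forall>s\<in>T. (g has_real_derivative g' s) (at s)"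
  and f: "!!k. Ck_on k S (%x. cx (f x))" and T: "f ` S \<subseteq> T"
 shows "g \<in> G ==> Ck_on k S (%x. cx (g (f x)))"
proof (induction k arbitrary: g)
 case 0
 then obtain g' where g': "!!s. s \<in> T ==> (g has_real_derivative g' s) (at s)" using fam by blast
 then have "continuous_on T g" by (intro continuous_at_imp_continuous_on) (auto intro: DERIV_isCont)
 moreover have "continuous_on S (%x. Re (cx (f x)))"
  using f[of 0] by (intro continuous_intros) simp
 ultimately show ?case using T by (auto intro!: continuous_intros continuous_on_compose2[of T g S f])
next
 case (Suc k)
 then obtain g' where g': "g' \<in> G" "!!s. s \<in> T ==> (g has_real_derivative g' s) (at s)" using fam by blast
 let ?f = "%x. cx (f x)"
 have fd: "?f differentiable (at x)" if "x \<in> S" for x using f[of "Suc 0"] that by auto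
 have D: "((%x. g (f x)) has_derivative (%h. g' (f x) * (h$1 * Re (partial_deriv 1 ?f x) + h$2 * Re (partial_deriv 2 ?f x)))) (at x)"
  if "x \<in> S" for x
  using has_derivative_compose[OF has_derivative_Re_of_real[OF fd[OF that]], of g "(*) (g' (f x))"]
   g'(2)[of "f x"] T that by (auto simp: has_field_derivative_def)
 have pd: "partial_deriv i (%x. cx (g (f x))) x = cx (g' (f x)) * partial_deriv i ?f x"
  if "x \<in> S" for x i
  using partial_deriv_of_real[OF D[OF that], of i] partial_deriv_of_real[OF has_derivative_Re_of_real[OF fd[OF that]], of i]
  by simp
 have "Ck_on k S (partial_deriv i ?f)" for i using f[of "Suc k"] by simp
 then have "Ck_on k S (%x. cx (g' (f x)) * partial_deriv i ?f x)" for i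
  by (intro Ck_on_mult S Suc.IH g')
 then have "Ck_on k S (partial_deriv i (%x. cx (g (f x))))" for i
  by (rule Ck_on_cong[OF S, rotated]) (use pd in auto)
 moreover have "(%x. cx (g (f x))) differentiable (at x)" if "x \<in> S" for x
  unfolding differentiable_def by (rule exI, rule has_derivative_of_real, rule D[OF that])
 ultimately show ?case by simp
qed

section \<open>Composition with maps of the plane\<close>

lemma has_derivative_vec2:
 fixes F :: "real^2 => real^2"
 assumes "!!j. ((%x. F x $ j) has_derivative (%h. D h $ j)) (at x)"
 shows "(F has_derivative D) (at x)"
 unfolding has_derivative_componentwise_within[of F D x UNIV]
 using assms by (auto simp: Basis_vec_def inner_axis)

lemma partial_deriv_compose:
 fixes F :: "real^2 => real^2"
 assumes F: "!!j. (%x. cx (F x $ j)) differentiable (at x)" and f: "f differentiable (at (F x))"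
 shows "(%x. f (F x)) differentiable (at x)"
  "partial_deriv i (%x. f (F x)) x =
   partial_deriv i (%x. cx (F x $ 1)) x * partial_deriv 1 f (F x)
   + partial_deriv i (%x. cx (F x $ 2)) x * partial_deriv 2 f (F x)"
proof -
 define c where "c i j = Re (partial_deriv i (%x. cx (F x $ j)) x)" for i j
 have dc: "((%x. F x $ j) has_derivative (%h. h$1 * c 1 j + h$2 * c 2 j)) (at x)" for j
  unfolding c_def by (rule has_derivative_Re_of_real[OF F])
 then have dF: "(F has_derivative (%h. \<chi> j. h$1 * c 1 j + h$2 * c 2 j)) (at x)"
  by (intro has_derivative_vec2) simp
 note D = has_derivative_compose[OF dF has_derivative_partial[OF f]]
 show "(%x. f (F x)) differentiable (at x)" using D by (auto simp: differentiable_def)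
 have "partial_deriv i (%x. cx (F x $ j)) x = cx (c i j)" for j
  using partial_deriv_of_real[OF dc[of j], of i] exhaust_2[of i] by (auto simp: axis_def)
 then show "partial_deriv i (%x. f (F x)) x =
   partial_deriv i (%x. cx (F x $ 1)) x * partial_deriv 1 f (F x)
   + partial_deriv i (%x. cx (F x $ 2)) x * partial_deriv 2 f (F x)"
  using partial_deriv_eqI[OF D, of i] exhaust_2[of i] by (auto simp: axis_def scaleR_conv_of_real)
qed

text \<open>Induction on the order: the chain rule expresses the partial derivatives of the
  composition through those of \<open>F\<close> and through the partial derivatives of
  \<open>f\<close> at \<open>F x\<close>, each with one order of smoothness less.\<close>

lemma Ck_on_compose:
 fixes F :: "real^2 => real^2"
 assumes S: "open S" and T: "F ` S \<subseteq> T"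
 shows "(!!j. Ck_on k S (%x. cx (F x $ j))) ==> Ck_on k T f ==> Ck_on k S (%x. f (F x))"
proof (induction k arbitrary: f)
 case 0
 have "continuous_on S (%x. F x $ j)" for j
  using continuous_on_Re[of S "%x. cx (F x $ j)"] 0(1)[of j] by simp
 then have "continuous_on S (%x. \<chi> j. F x $ j)" by (intro continuous_on_vec_lambda)
 then have "continuous_on S F" by (simp only: vec_lambda_eta)
 then show ?case using 0(2) T by (auto intro: continuous_on_compose2)
next
 case (Suc k)
 have d: "(%x. cx (F x $ j)) differentiable (at x)" "f differentiable (at (F x))" if "x \<in> S" for x j
  using Suc.prems T that by auto
 have c: "Ck_on k S (partial_deriv i (%x. cx (F x $ j)))" for i j using Suc.prems(1)[of j] by simp
 have f': "Ck_on k S (%x. partial_deriv j f (F x))" for j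
  by (rule Suc.IH) (use Suc.prems Ck_on_SucD[OF Suc.prems(1)] in simp_all)
 have "Ck_on k S (%x. partial_deriv i (%x. cx (F x $ 1)) x * partial_deriv 1 f (F x)
   + partial_deriv i (%x. cx (F x $ 2)) x * partial_deriv 2 f (F x))" for i
  by (intro Ck_on_add Ck_on_mult S c f')
 then have "Ck_on k S (partial_deriv i (%x. f (F x)))" for i
  by (rule Ck_on_cong[OF S, rotated]) (use partial_deriv_compose(2) d in auto)
 then show ?case using partial_deriv_compose(1) d by auto
qed

lemma smooth_on_const: "smooth_on S (%x. c)" by (simp add: smooth_on_def Ck_on_const)
lemma smooth_on_coord: "smooth_on S (%x. cx (x$j))" by (simp add: smooth_on_def Ck_on_coord)
lemma smooth_on_add: "open S ==> smooth_on S f ==> smooth_on S g ==> smooth_on S (%x. f x + g x)"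
 by (simp add: smooth_on_def Ck_on_add)
lemma smooth_on_mult: "open S ==> smooth_on S f ==> smooth_on S g ==> smooth_on S (%x. f x * g x)"
 by (simp add: smooth_on_def Ck_on_mult)
lemma smooth_on_diff: "open S ==> smooth_on S f ==> smooth_on S g ==> smooth_on S (%x. f x - g x)"
 using smooth_on_add[of S f "%x. (-1) * g x"] smooth_on_mult[of S "%x. -1" g] smooth_on_const by simp
lemma smooth_on_power: "open S ==> smooth_on S f ==> smooth_on S (%x. f x ^ n)"
 by (induction n) (auto intro: smooth_on_const smooth_on_mult)
lemma smooth_on_cnj: "open S ==> smooth_on S f ==> smooth_on S (%x. cnj (f x))"
 by (simp add: smooth_on_def Ck_on_cnj)
lemma smooth_on_cong: "open S ==> smooth_on S f ==> (!!y. y \<in> S ==> f y = g y) ==> smooth_on S g"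
 unfolding smooth_on_def by (blast intro: Ck_on_cong)
lemma smooth_on_subset: "smooth_on S f ==> T \<subseteq> S ==> smooth_on T f"
 unfolding smooth_on_def by (blast intro: Ck_on_subset)
lemma smooth_on_Un: "open S ==> open T ==> smooth_on S f ==> smooth_on T f ==> smooth_on (S \<union> T) f"
 unfolding smooth_on_def by (blast intro: Ck_on_Un)
lemma smooth_on_partial: "smooth_on S f ==> smooth_on S (partial_deriv i f)"
 unfolding smooth_on_def using Ck_on.simps(2) by blast
lemma smooth_on_differentiable: "smooth_on S f ==> x \<in> S ==> f differentiable (at x)"
 unfolding smooth_on_def using Ck_on.simps(2) by blast
lemma smooth_on_continuous: "smooth_on S f ==> continuous_on S f"
 unfolding smooth_on_def using Ck_on.simps(1) by blast

lemma smooth_onI: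
 assumes "!!x. x \<in> S ==> f differentiable (at x)" "!!i. smooth_on S (partial_deriv i f)"
 shows "smooth_on S f"
proof -
 have "Ck_on (Suc k) S f" for k using assms by (auto simp: smooth_on_def)
 then show ?thesis using Ck_on_SucD by (auto simp: smooth_on_def)
qed

lemma smooth_on_family:
 assumes "open S" "!!g. g \<in> G ==> \<exists>g'\<in>G. \<forall>s\<in>T. (g has_real_derivative g' s) (at s)"
  and "smooth_on S (%x. cx (f x))" "f ` S \<subseteq> T" "g \<in> G"
 shows "smooth_on S (%x. cx (g (f x)))"
 using assms Ck_on_family[of S G T f g] unfolding smooth_on_def by blast

lemma smooth_on_compose:
 fixes F :: "real^2 => real^2"
 assumes "open S" "F ` S \<subseteq> T" "!!j. smooth_on S (%x. cx (F x $ j))" "smooth_on T f"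
 shows "smooth_on S (%x. f (F x))"
 unfolding smooth_on_def
proof
 fix k show "Ck_on k S (%x. f (F x))"
  by (rule Ck_on_compose[OF assms(1,2)]) (use assms(3,4) in \<open>auto simp: smooth_on_def\<close>)
qed

text \<open>The functions \<open>c * s powr r\<close> form a family closed under differentiation on
  the positive half-line; the scalar \<open>c\<close> absorbs the exponents that come down.\<close>

lemma smooth_on_powr:
 assumes "open S" "smooth_on S (%x. cx (f x))" "!!x. x \<in> S ==> f x > 0"
 shows "smooth_on S (%x. cx (f x powr r))"
proof (rule smooth_on_family[OF assms(1) _ assms(2), of "{g. \<exists>c r. g = (%s. c * s powr r)}" "{0<..}"])
 fix g :: "real => real" assume "g \<in> {g. \<exists>c r. g = (%s. c * s powr r)}"
 then obtain c r where g: "g = (%s. c * s powr r)" by blast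
 show "\<exists>g'\<in>{g. \<exists>c r. g = (%s. c * s powr r)}. \<forall>s\<in>{0<..}. (g has_real_derivative g' s) (at s)"
  by (rule bexI[of _ "%s. (c * r) * s powr (r - 1)"])
    (auto simp: g intro!: derivative_eq_intros has_real_derivative_powr)
next
 show "(%s. s powr r) \<in> {g. \<exists>c r. g = (%s. c * s powr r)}"
  by (rule CollectI, rule exI[of _ 1], rule exI[of _ r]) simp
qed (use assms in auto)

lemma smooth_on_inverse:
 assumes "open S" "smooth_on S (%x. cx (f x))" "!!x. x \<in> S ==> f x > 0"
 shows "smooth_on S (%x. cx (1 / f x))"
 by (rule smooth_on_cong[OF assms(1) smooth_on_powr[OF assms, where r = "-1"]])
   (use assms(3) in \<open>auto simp: powr_minus_divide powr_one dual_order.strict_implies_order\<close>)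

section \<open>Square-integrable functions\<close>

definition L2 :: "'a measure => ('a => 'b :: {banach, second_countable_topology}) => bool" where
 "L2 M f \<longleftrightarrow> f \<in> borel_measurable M \<and> integrable M (%x. (norm (f x))^2)"

text \<open>If the square of the norm is not integrable, the value is 0 by the convention for
  integrals, so this is a norm only in company of \<open>L2\<close>. General Banach values let
  scalars, vector fields and triples be treated alike.\<close>

definition l2 :: "'a measure => ('a => 'b :: {banach, second_countable_topology}) => real" where
 "l2 M f = sqrt (LINT x|M. (norm (f x))^2)"

lemma L2_measurable: "L2 M f ==> f \<in> borel_measurable M" by (simp add: L2_def)

lemma l2_nonneg: "0 <= l2 M f" by (simp add: l2_def)

lemma l2_power2: "(l2 M f)^2 = (LINT x|M. (norm (f x))^2)" by (simp add: l2_def)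

lemma L2_nn_integral: "L2 M f ==> (\<integral>\<^sup>+x. ennreal ((norm (f x))^2) \<partial>M) = ennreal ((l2 M f)^2)"
 unfolding l2_power2 by (rule nn_integral_eq_integral) (auto simp: L2_def)

lemma L2I_nn_integral:
 assumes "f \<in> borel_measurable M" "(\<integral>\<^sup>+x. ennreal ((norm (f x))^2) \<partial>M) < \<infinity>"
 shows "L2 M f"
 unfolding L2_def using assms by (auto intro!: integrableI_bounded)

lemma l2_le_nn_integral:
 assumes "L2 M f" "(\<integral>\<^sup>+x. ennreal ((norm (f x))^2) \<partial>M) <= ennreal (c^2)" "c >= 0"
 shows "l2 M f <= c"
proof -
 have "(l2 M f)^2 <= c^2" using assms by (simp add: L2_nn_integral)
 then show ?thesis using assms(3) power2_le_imp_le by blast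
qed

lemma L2_cong_AE:
 assumes "L2 M f" "g \<in> borel_measurable M" "AE x in M. f x = g x"
 shows "L2 M g" "l2 M g = l2 M f"
proof -
 have e: "AE x in M. (norm (f x))^2 = (norm (g x))^2" using assms(3) by auto
 have [measurable]: "f \<in> borel_measurable M" "g \<in> borel_measurable M" using assms by (auto simp: L2_def)
 show "L2 M g" using assms e integrable_cong_AE[of "%x. (norm (f x))^2" M "%x. (norm (g x))^2"]
  by (auto simp: L2_def)
 show "l2 M g = l2 M f" unfolding l2_def by (subst integral_cong_AE[OF _ _ e]) auto
qed

lemma L2_product:
 assumes "L2 M f" "L2 M g"
 shows "integrable M (%x. norm (f x) * norm (g x))"
  "(LINT x|M. norm (f x) * norm (g x)) <= l2 M f * l2 M g"
proof -
 have [measurable]: "f \<in> borel_measurable M" "g \<in> borel_measurable M" using assms by (auto simp: L2_def)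
 have b: "norm (f x) * norm (g x) <= (norm (f x))^2 + (norm (g x))^2" for x
  using sum_squares_bound[of "norm (f x)" "norm (g x)"] mult_nonneg_nonneg[OF norm_ge_zero[of "f x"] norm_ge_zero[of "g x"]]
  by linarith
 have "integrable M (%x. (norm (f x))^2 + (norm (g x))^2)" using assms by (auto simp: L2_def)
 then show i: "integrable M (%x. norm (f x) * norm (g x))"
  by (rule Bochner_Integration.integrable_bound) (use b in \<open>auto simp: abs_mult\<close>)
 have "(\<integral>\<^sup>+x. ennreal (norm (f x)) * ennreal (norm (g x)) \<partial>M)^2
   <= (\<integral>\<^sup>+x. ennreal (norm (f x))^2 \<partial>M) * (\<integral>\<^sup>+x. ennreal (norm (g x))^2 \<partial>M)"
  by (rule Cauchy_Schwarz_nn_integral) auto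
 moreover have "(\<integral>\<^sup>+x. ennreal (norm (f x)) * ennreal (norm (g x)) \<partial>M)
   = ennreal (LINT x|M. norm (f x) * norm (g x))"
  using nn_integral_eq_integral[OF i] by (simp add: ennreal_mult)
 moreover have n: "(LINT x|M. norm (f x) * norm (g x)) >= 0" by (rule Bochner_Integration.integral_nonneg) auto
 moreover have "(\<integral>\<^sup>+x. ennreal (norm (f x))^2 \<partial>M) = ennreal ((l2 M f)^2)"
  "(\<integral>\<^sup>+x. ennreal (norm (g x))^2 \<partial>M) = ennreal ((l2 M g)^2)"
  using L2_nn_integral[OF assms(1)] L2_nn_integral[OF assms(2)] by (simp_all add: ennreal_power)
 ultimately have "ennreal ((LINT x|M. norm (f x) * norm (g x))^2) <= ennreal ((l2 M f)^2) * ennreal ((l2 M g)^2)"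
  by (simp only: ennreal_power)
 also have "... = ennreal ((l2 M f)^2 * (l2 M g)^2)" by (simp add: ennreal_mult)
 finally have "ennreal ((LINT x|M. norm (f x) * norm (g x))^2) <= ennreal ((l2 M f)^2 * (l2 M g)^2)" .
 then have "(LINT x|M. norm (f x) * norm (g x))^2 <= (l2 M f * l2 M g)^2"
  by (simp add: power_mult_distrib)
 moreover have "0 <= l2 M f * l2 M g" by (simp add: l2_nonneg)
 ultimately show "(LINT x|M. norm (f x) * norm (g x)) <= l2 M f * l2 M g"
  by (rule power2_le_imp_le)
qed

text \<open>The working form of Cauchy-Schwarz: a measurable integrand dominated almost everywhere
  by a product. The error terms of the perturbed forms are later estimated in this shape.\<close>

lemma L2_bound:
 fixes F :: "'a => 'c :: {banach, second_countable_topology}"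
 assumes "L2 M f" "L2 M g" and F: "F \<in> borel_measurable M"
  and b: "AE x in M. norm (F x) <= K * (norm (f x) * norm (g x))" and K: "K >= 0"
 shows "integrable M F" "norm (LINT x|M. F x) <= K * (l2 M f * l2 M g)"
proof -
 note p = L2_product[OF assms(1,2)]
 have i: "integrable M (%x. K * (norm (f x) * norm (g x)))" using p by auto
 show I: "integrable M F"
  by (rule Bochner_Integration.integrable_bound[OF i F]) (use b K in \<open>auto simp: abs_mult\<close>)
 have "norm (LINT x|M. F x) <= (LINT x|M. norm (F x))" by (rule integral_norm_bound)
 also have "... <= (LINT x|M. K * (norm (f x) * norm (g x)))"
  by (rule integral_mono_AE) (use I i b in auto)
 also have "... <= K * (l2 M f * l2 M g)" using p K by (simp add: mult_left_mono)
 finally show "norm (LINT x|M. F x) <= K * (l2 M f * l2 M g)" .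
qed

lemma L2_dominated:
 assumes "L2 M f" "F \<in> borel_measurable M" "AE x in M. norm (F x) <= K * norm (f x)" "K >= 0"
 shows "L2 M F" "l2 M F <= K * l2 M f"
proof -
 have m: "(%x. (norm (F x))^2) \<in> borel_measurable M" using assms(2) by measurable
 have "AE x in M. norm ((norm (F x))^2) <= K^2 * (norm (f x) * norm (f x))"
  using assms(3)
 proof eventually_elim
  case (elim x)
  then have "(norm (F x))^2 <= (K * norm (f x))^2" by (intro power_mono) auto
  then show ?case by (simp add: power2_eq_square algebra_simps)
 qed
 note B = L2_bound[OF assms(1,1) m this zero_le_power2]
 show "L2 M F" using B assms(2) by (simp add: L2_def)
 have "(l2 M F)^2 <= (K * l2 M f)^2" using B(2) unfolding l2_power2[of M F] by (simp add: power2_eq_square algebra_simps)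
 then show "l2 M F <= K * l2 M f" using l2_nonneg[of M f] assms(4) power2_le_imp_le by (metis mult_nonneg_nonneg)
qed

lemma L2_add:
 assumes "L2 M f" "L2 M g"
 shows "L2 M (%x. f x + g x)" "l2 M (%x. f x + g x) <= l2 M f + l2 M g"
proof -
 have [measurable]: "f \<in> borel_measurable M" "g \<in> borel_measurable M" using assms by (auto simp: L2_def)
 note p = L2_product[OF assms]
 have i: "integrable M (%x. (norm (f x))^2 + 2 * (norm (f x) * norm (g x)) + (norm (g x))^2)"
  using assms p by (auto simp: L2_def)
 have b: "(norm (f x + g x))^2 <= (norm (f x))^2 + 2 * (norm (f x) * norm (g x)) + (norm (g x))^2" for x
  using power_mono[OF norm_triangle_ineq[of "f x" "g x"], of 2] by (simp add: power2_eq_square algebra_simps)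
 have I: "integrable M (%x. (norm (f x + g x))^2)"
  by (rule Bochner_Integration.integrable_bound[OF i]) (use b in \<open>auto intro: order_trans[OF _ abs_ge_self]\<close>)
 then show "L2 M (%x. f x + g x)" by (simp add: L2_def)
 have "(l2 M (%x. f x + g x))^2 <= (LINT x|M. (norm (f x))^2 + 2 * (norm (f x) * norm (g x)) + (norm (g x))^2)"
  unfolding l2_power2 by (rule integral_mono[OF I i b])
 also have "... = (l2 M f)^2 + 2 * (LINT x|M. norm (f x) * norm (g x)) + (l2 M g)^2"
  using assms p by (simp add: l2_power2 L2_def)
 also have "... <= (l2 M f + l2 M g)^2" using p by (simp add: power2_eq_square algebra_simps)
 finally show "l2 M (%x. f x + g x) <= l2 M f + l2 M g"
  using l2_nonneg[of M f] l2_nonneg[of M g] power2_le_imp_le by (metis add_nonneg_nonneg)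
qed

lemma L2_cmult:
 fixes f :: "'a => complex"
 assumes "L2 M f"
 shows "L2 M (%x. c * f x)"
 using assms by (intro L2_dominated(1)[OF assms, where K = "norm c"]) (auto simp: L2_def norm_mult)

lemma L2_uminus:
 assumes "L2 M f"
 shows "L2 M (%x. - f x)" "l2 M (%x. - f x) = l2 M f"
 using assms by (auto simp: L2_def l2_def)

lemma L2_diff:
 assumes "L2 M f" "L2 M g"
 shows "L2 M (%x. f x - g x)" "l2 M (%x. f x - g x) <= l2 M f + l2 M g"
 using L2_add[OF assms(1) L2_uminus(1)[OF assms(2)]] L2_uminus(2)[OF assms(2)] by auto

lemma l2_diff_commute: "l2 M (%x. f x - g x) = l2 M (%x. g x - f x)"
 by (simp add: l2_def norm_minus_commute)

lemma l2_triangle: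
 assumes "L2 M f" "L2 M g" "L2 M h"
 shows "l2 M (%x. f x - h x) <= l2 M (%x. f x - g x) + l2 M (%x. g x - h x)"
 using L2_add(2)[OF L2_diff(1)[OF assms(1,2)] L2_diff(1)[OF assms(2,3)]] by simp

lemma l2_le_add_diff:
 assumes "L2 M f" "L2 M g"
 shows "l2 M f <= l2 M g + l2 M (%x. f x - g x)"
 using L2_add(2)[OF assms(2) L2_diff(1)[OF assms]] by simp

lemma l2_tendsto:
 assumes "!!n. L2 M (f n)" "L2 M g" "(%n. l2 M (%x. f n x - g x)) ----> 0"
 shows "(%n. l2 M (f n)) ----> l2 M g"
proof (rule LIM_zero_cancel, rule Lim_null_comparison[OF always_eventually assms(3)], rule allI)
 fix n
 show "norm (l2 M (f n) - l2 M g) <= l2 M (%x. f n x - g x)"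
  using l2_le_add_diff[OF assms(1)[of n] assms(2)] l2_le_add_diff[OF assms(2) assms(1)[of n]]
   l2_diff_commute[of M g "f n"] by auto
qed

lemma l2_eq_0_iff:
 assumes "L2 M f" shows "l2 M f = 0 \<longleftrightarrow> (AE x in M. f x = 0)"
 using assms integral_nonneg_eq_0_iff_AE[of M "%x. (norm (f x))^2"] by (auto simp: L2_def l2_def)

lemma L2_integrable:
 assumes "finite_measure M" "L2 M f"
 shows "integrable M f" "(LINT x|M. norm (f x)) <= sqrt (measure M (space M)) * l2 M f"
proof -
 interpret finite_measure M by fact
 have one: "L2 M (%x. 1 :: real)" by (simp add: L2_def)
 have "l2 M (%x. 1 :: real) = sqrt (measure M (space M))" by (simp add: l2_def)
 then show "(LINT x|M. norm (f x)) <= sqrt (measure M (space M)) * l2 M f"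
  using L2_product(2)[OF one assms(2)] by simp
 show "integrable M f" using L2_product(1)[OF one assms(2)] assms(2) by (simp add: L2_def integrable_norm_iff)
qed

text \<open>On a finite measure space an L2-Cauchy sequence is L1-Cauchy and so has a subsequence
  converging almost everywhere; Fatou's lemma makes its pointwise limit the L2 limit of the whole
  sequence. The subsequence is part of the conclusion because pointwise relations between components
  of the limit are read off from it.\<close>

theorem L2_complete:
 fixes f :: "nat => 'a => 'b :: {banach, second_countable_topology}"
 assumes fin: "finite_measure M" and L: "!!n. L2 M (f n)"
  and C: "!!e. e > 0 ==> \<exists>N. \<forall>m\<ge>N. \<forall>n\<ge>N. l2 M (%x. f m x - f n x) < e"
 obtains r g where "strict_mono r" "L2 M g" "(%n. l2 M (%x. f n x - g x)) ----> 0"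
  "AE x in M. (%n. f (r n) x) ----> g x"
proof -
 define c where "c = sqrt (measure M (space M)) + 1"
 have c: "c > 0" unfolding c_def by (smt (verit) measure_nonneg real_sqrt_ge_zero)
 have [measurable]: "f n \<in> borel_measurable M" for n using L by (simp add: L2_def)
 have L1: "\<exists>N. \<forall>i\<ge>N. \<forall>j\<ge>N. LINT x|M. norm (f i x - f j x) < e" if "e > 0" for e
 proof -
  obtain N where N: "!!m n. m >= N ==> n >= N ==> l2 M (%x. f m x - f n x) < e / c"
   using C[of "e / c"] \<open>e > 0\<close> c by auto
  have "LINT x|M. norm (f i x - f j x) < e" if "i >= N" "j >= N" for i j
  proof -
   have "(LINT x|M. norm (f i x - f j x)) <= sqrt (measure M (space M)) * l2 M (%x. f i x - f j x)"
    by (rule L2_integrable(2)[OF fin L2_diff(1)[OF L L]])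
   also have "... <= c * l2 M (%x. f i x - f j x)" by (intro mult_right_mono) (auto simp: c_def l2_nonneg)
   also have "... < c * (e / c)" using N[OF that] c by (intro mult_strict_left_mono)
   finally show ?thesis using c by simp
  qed
  then show ?thesis by blast
 qed
 obtain r where r: "strict_mono r" and cau: "AE x in M. Cauchy (%i. f (r i) x)"
  using cauchy_L1_AE_cauchy_subseq[of M f] L2_integrable(1)[OF fin L] L1 by blast
 define g where "g x = lim (%i. f (r i) x)" for x
 have gm [measurable]: "g \<in> borel_measurable M" unfolding g_def by measurable
 have lim: "AE x in M. (%n. f (r n) x) ----> g x"
  using cau by eventually_elim (simp add: g_def Cauchy_convergent_iff convergent_LIMSEQ_iff)
 have key: "(\<integral>\<^sup>+x. ennreal ((norm (f n x - g x))^2) \<partial>M) <= ennreal (e^2)"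
  if N: "!!m n. m >= N ==> n >= N ==> l2 M (%x. f m x - f n x) < e" and n: "n >= N" and e: "e > 0" for e N n
 proof -
  have "(\<integral>\<^sup>+x. ennreal ((norm (f n x - g x))^2) \<partial>M)
    = (\<integral>\<^sup>+x. liminf (%k. ennreal ((norm (f n x - f (r k) x))^2)) \<partial>M)"
  proof (rule nn_integral_cong_AE, use lim in eventually_elim)
   case (elim x)
   have "(%k. ennreal ((norm (f n x - f (r k) x))^2)) ----> ennreal ((norm (f n x - g x))^2)"
    by (intro tendsto_ennrealI tendsto_intros elim)
   then show ?case by (rule lim_imp_Liminf[symmetric, rotated]) simp
  qed
  also have "... <= liminf (%k. \<integral>\<^sup>+x. ennreal ((norm (f n x - f (r k) x))^2) \<partial>M)"
   by (rule nn_integral_liminf) measurable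
  also have "... <= liminf (%k. ennreal (e^2))"
  proof (rule Liminf_mono, rule eventually_sequentiallyI[of N])
   fix k assume "N <= k"
   then have "r k >= N" using seq_suble[OF r, of k] by simp
   then have "l2 M (%x. f n x - f (r k) x) < e" using N n by auto
   then show "(\<integral>\<^sup>+x. ennreal ((norm (f n x - f (r k) x))^2) \<partial>M) <= ennreal (e^2)"
    using l2_nonneg by (subst L2_nn_integral[OF L2_diff(1)[OF L L]]) (auto intro!: ennreal_leI power_mono)
  qed
  also have "... = ennreal (e^2)" by (simp add: Liminf_const)
  finally show ?thesis .
 qed
 have Ld: "L2 M (%x. f n x - g x) \<and> l2 M (%x. f n x - g x) <= e"
  if N: "!!m n. m >= N ==> n >= N ==> l2 M (%x. f m x - f n x) < e" and n: "n >= N" and e: "e > 0" for e N n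
 proof -
  note k = key[OF N n e]
  have "L2 M (%x. f n x - g x)" using k by (intro L2I_nn_integral) (auto intro: le_less_trans simp: top_unique)
  then show ?thesis using l2_le_nn_integral[OF _ k] e by auto
 qed
 have lim2: "(%n. l2 M (%x. f n x - g x)) ----> 0"
 proof (rule LIMSEQ_I)
  fix e :: real assume e: "e > 0"
  obtain N where "!!m n. m >= N ==> n >= N ==> l2 M (%x. f m x - f n x) < e / 2"
   using C[of "e / 2"] e by auto
  from Ld[OF this] e have *: "l2 M (%x. f n x - g x) <= e / 2" if "n >= N" for n using that by auto
  have "norm (l2 M (%x. f n x - g x) - 0) < e" if "n >= N" for n
   using e *[OF that] l2_nonneg[of M "%x. f n x - g x"] by simp
  then show "\<exists>no. \<forall>n\<ge>no. norm (l2 M (%x. f n x - g x) - 0) < e" by blast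
 qed
 obtain N where N: "!!m n. m >= N ==> n >= N ==> l2 M (%x. f m x - f n x) < 1" using C[of 1] by auto
 have "L2 M (%x. f N x - g x)" using Ld[OF N] by auto
 from L2_diff(1)[OF L[of N] this] have "L2 M g" by simp
 with r lim lim2 that show ?thesis by blast
qed

lemma L2_bilinear:
 fixes p :: "'b :: {banach, second_countable_topology} => 'c :: {banach, second_countable_topology} => 'd :: {banach, second_countable_topology}"
 assumes "bounded_bilinear p" "L2 M f" "L2 M g"
 shows "integrable M (%x. p (f x) (g x))"
proof -
 interpret bounded_bilinear p by fact
 obtain K where K: "K > 0" "!!a b. norm (p a b) <= norm a * norm b * K" using pos_bounded by blast
 have c: "continuous_on UNIV (%z. p (fst z) (snd z))"
  by (rule continuous_on) (rule continuous_on_fst continuous_on_snd continuous_on_id)+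
 have m: "(%x. p (f x) (g x)) \<in> borel_measurable M"
  using borel_measurable_continuous_Pair[OF assms(2,3)[THEN L2_measurable] c] .
 show ?thesis by (rule L2_bound(1)[OF assms(2,3) m, of K]) (use K in \<open>auto simp: algebra_simps\<close>)
qed

lemma L2_bilinear_tendsto:
 fixes p :: "'b :: {banach, second_countable_topology} => 'c :: {banach, second_countable_topology} => 'd :: {banach, second_countable_topology}"
 assumes b: "bounded_bilinear p" and f: "!!n. L2 M (f n)" "L2 M f'" "(%n. l2 M (%x. f n x - f' x)) ----> 0"
  and g: "!!n. L2 M (g n)" "L2 M g'" "(%n. l2 M (%x. g n x - g' x)) ----> 0"
 shows "(%n. LINT x|M. p (f n x) (g n x)) ----> (LINT x|M. p (f' x) (g' x))"
proof -
 interpret bounded_bilinear p by fact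
 obtain K where K: "K > 0" "!!a b. norm (p a b) <= norm a * norm b * K" using pos_bounded by blast
 have B: "norm (LINT x|M. p (u x) (v x)) <= K * (l2 M u * l2 M v)" if "L2 M u" "L2 M v" for u v
  by (rule L2_bound(2)[OF that borel_measurable_integrable[OF L2_bilinear[OF b that]]])
   (use K in \<open>auto simp: algebra_simps\<close>)
 have le: "norm ((LINT x|M. p (f n x) (g n x)) - (LINT x|M. p (f' x) (g' x)))
   <= K * (l2 M (%x. f n x - f' x) * l2 M (g n)) + K * (l2 M f' * l2 M (%x. g n x - g' x))" for n
 proof -
  note i = L2_bilinear[OF b f(1)[of n] g(1)[of n]] L2_bilinear[OF b f(2) g(1)[of n]] L2_bilinear[OF b f(2) g(2)]
  have "(LINT x|M. p (f n x - f' x) (g n x)) = (LINT x|M. p (f n x) (g n x)) - (LINT x|M. p (f' x) (g n x))"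
   unfolding diff_left by (rule b_integral_diff[OF i(1,2)])
  moreover have "(LINT x|M. p (f' x) (g n x - g' x)) = (LINT x|M. p (f' x) (g n x)) - (LINT x|M. p (f' x) (g' x))"
   unfolding diff_right by (rule b_integral_diff[OF i(2,3)])
  ultimately have "(LINT x|M. p (f n x) (g n x)) - (LINT x|M. p (f' x) (g' x))
   = (LINT x|M. p (f n x - f' x) (g n x)) + (LINT x|M. p (f' x) (g n x - g' x))" by simp
  then show ?thesis
   by (simp only:) (rule order_trans[OF norm_triangle_ineq add_mono[OF B[OF L2_diff(1)[OF f(1) f(2)] g(1)] B[OF f(2) L2_diff(1)[OF g(1) g(2)]]]])
 qed
 have "(%n. K * (l2 M (%x. f n x - f' x) * l2 M (g n)) + K * (l2 M f' * l2 M (%x. g n x - g' x)))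
   ----> K * (0 * l2 M g') + K * (l2 M f' * 0)"
  by (intro tendsto_intros f(3) g(3) l2_tendsto g)
 then have t: "(%n. K * (l2 M (%x. f n x - f' x) * l2 M (g n)) + K * (l2 M f' * l2 M (%x. g n x - g' x))) ----> 0"
  by (simp only: mult_zero_left mult_zero_right add_0_left)
 have "(%n. (LINT x|M. p (f n x) (g n x)) - (LINT x|M. p (f' x) (g' x))) ----> 0"
  by (rule Lim_null_comparison[OF always_eventually[OF allI[OF le]] t])
 then show ?thesis by (rule LIM_zero_cancel)
qed

section \<open>Hardy's inequality\<close>

lemma nn_integral_translate:
 fixes c :: "'a::euclidean_space"
 assumes [measurable]: "f \<in> borel_measurable borel"
 shows "(\<integral>\<^sup>+x. f (c + x) \<partial>lborel) = (\<integral>\<^sup>+x. f x \<partial>lborel)"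
 by (subst (2) lborel_distr_plus[of c, symmetric]) (simp add: nn_integral_distr)

lemma integral_translate:
 fixes c :: "'a::euclidean_space" and f :: "'a => complex"
 assumes [measurable]: "f \<in> borel_measurable borel"
 shows "(LINT x|lborel. f (c + x)) = (LINT x|lborel. f x)"
 by (subst (2) lborel_distr_plus[of c, symmetric]) (simp add: integral_distr)

lemma line_derivative:
 assumes "f differentiable (at (x + s *\<^sub>R v))"
 shows "((%s. f (x + s *\<^sub>R v)) has_vector_derivative
   (v$1 *\<^sub>R partial_deriv 1 f (x + s *\<^sub>R v) + v$2 *\<^sub>R partial_deriv 2 f (x + s *\<^sub>R v))) (at s within S)"
proof -
 have "((%s. x + s *\<^sub>R v) has_derivative (%h. h *\<^sub>R v)) (at s within S)"
  by (auto intro!: derivative_eq_intros)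
 from has_derivative_compose[OF this has_derivative_partial[OF assms]]
 show ?thesis by (simp add: has_vector_derivative_def scaleR_add_right)
qed

lemma norm_vec2: fixes x :: "real^2" shows "(norm x)^2 = (x$1)^2 + (x$2)^2"
 by (simp add: norm_vec_def L2_set_def sum_2)

lemma norm_cvec2: fixes x :: "complex^2" shows "(norm x)^2 = (norm (x$1))^2 + (norm (x$2))^2"
 by (simp add: norm_vec_def L2_set_def sum_2)

lemma norm_real_lincomb:
 fixes v :: "real^2" and z :: "complex^2"
 shows "norm (v$1 *\<^sub>R z$1 + v$2 *\<^sub>R z$2) <= norm v * norm z"
proof -
 have "norm (v$1 *\<^sub>R z$1 + v$2 *\<^sub>R z$2) <= \<bar>v$1\<bar> * norm (z$1) + \<bar>v$2\<bar> * norm (z$2)"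
  by (rule norm_triangle_le) simp
 moreover have "\<bar>v$1\<bar> * norm (z$1) + \<bar>v$2\<bar> * norm (z$2) <= norm v * norm z"
 proof (rule power2_le_imp_le)
  have "0 <= (\<bar>v$1\<bar> * norm (z$2) - \<bar>v$2\<bar> * norm (z$1))^2" by simp
  then show "(\<bar>v$1\<bar> * norm (z$1) + \<bar>v$2\<bar> * norm (z$2))^2 <= (norm v * norm z)^2"
   unfolding power_mult_distrib norm_vec2 norm_cvec2
   by (simp add: power2_eq_square algebra_simps) (simp add: abs_mult_self_eq mult.assoc[symmetric])
 qed simp
 ultimately show ?thesis by simp
qed

lemma bounded_support_bound:
 fixes g :: "real^2 => complex"
 assumes "continuous_on UNIV g" "!!x. norm x >= R ==> g x = 0"
 obtains B where "B >= 0" "!!x. norm (g x) <= B"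
proof -
 have "bounded (g ` cball 0 R)"
  using assms(1) by (intro compact_imp_bounded compact_continuous_image) (auto intro: continuous_on_subset)
 then have "\<exists>B. \<forall>x\<in>cball 0 R. norm (g x) <= B" by (auto simp: bounded_iff)
 then obtain B where B: "!!x. x \<in> cball 0 R ==> norm (g x) <= B" by blast
 have "norm (g x) <= \<bar>B\<bar>" for x
  using B[of x] assms(2)[of x] by (cases "norm x <= R") auto
 then show ?thesis using that[of "\<bar>B\<bar>"] by auto
qed

lemma bounded_support_integrable:
 fixes g :: "real^2 => complex"
 assumes "continuous_on UNIV g" "!!x. norm x >= R ==> g x = 0"
 shows "integrable lborel g"
proof -
 have "integrable lborel (%x. indicator (cball 0 R) x *\<^sub>R g x)"
  by (rule borel_integrable_compact) (use assms in \<open>auto intro: continuous_on_subset\<close>)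
 moreover have "(%x. indicator (cball 0 R) x *\<^sub>R g x) = g"
  using assms(2) by (auto simp: fun_eq_iff indicator_def)
 ultimately show ?thesis by simp
qed

lemma partial_deriv_support:
 assumes "!!x. norm x >= R ==> f x = 0" "norm x > R"
 shows "partial_deriv i f x = 0"
proof -
 have "open (- cball 0 R :: (real^2) set)" by auto
 from partial_deriv_cong[OF this, of x f "%_. 0" i] show ?thesis
  using assms by (auto simp: partial_deriv_const)
qed

text \<open>Translation invariance makes the integrals of all difference quotients vanish.\<close>

lemma integral_partial_deriv:
 assumes f: "!!x. f differentiable (at x)" and c: "continuous_on UNIV (partial_deriv i f)"
  and R: "!!x. norm x >= R ==> f x = 0"
 shows "(LINT x|lborel. partial_deriv i f x) = 0"
proof -
 define e where "e = (axis i 1 :: real^2)"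
 define h where "h n = 1 / real (Suc n)" for n
 have h: "0 < h n" "h n <= 1" for n by (auto simp: h_def)
 have h0: "h ----> 0" unfolding h_def by (rule LIMSEQ_Suc[OF lim_1_over_n])
 define D where "D n x = (f (h n *\<^sub>R e + x) - f x) /\<^sub>R h n" for n x
 have norm_e: "norm e = 1" by (simp add: e_def norm_axis_1)
 have fc: "continuous_on UNIV f"
  using f by (intro continuous_at_imp_continuous_on) (auto intro: differentiable_imp_continuous_within)
 have [measurable]: "f \<in> borel_measurable borel" by (rule borel_measurable_continuous_onI[OF fc])
 have [measurable]: "partial_deriv i f \<in> borel_measurable borel" by (rule borel_measurable_continuous_onI[OF c])
 have p0: "partial_deriv i f x = 0" if "norm x > R" for x by (rule partial_deriv_support[OF R that])
 obtain B where B: "B >= 0" "!!x. norm (partial_deriv i f x) <= B"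
  using bounded_support_bound[OF c, of "R + 1"] p0 by (auto simp: less_le_trans)
 have ld: "((%s. f (x + s *\<^sub>R e)) has_vector_derivative partial_deriv i f (x + s *\<^sub>R e)) (at s within S)" for x s S
  using line_derivative[OF f[of "x + s *\<^sub>R e"], of S] exhaust_2[of i] by (auto simp: e_def axis_def)
 have bound: "norm (D n x) <= B * indicator (cball 0 (R + 1)) x" for n x
 proof (cases "norm x <= R + 1")
  case True
  have "norm (f (x + h n *\<^sub>R e) - f (x + 0 *\<^sub>R e)) <= B * norm (h n - 0)"
  proof (rule differentiable_bound[of "{0..h n}" "%s. f (x + s *\<^sub>R e)" "%s k. k *\<^sub>R partial_deriv i f (x + s *\<^sub>R e)"])
   show "onorm (%k. k *\<^sub>R partial_deriv i f (x + s *\<^sub>R e)) <= B" for s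
    by (rule onorm_le) (use B(2) in \<open>auto simp: mult_right_mono mult.commute[of B] intro!: mult_left_mono\<close>)
  qed (use ld h[of n] in \<open>auto simp: has_vector_derivative_def\<close>)
  moreover have "norm (D n x) = norm (f (x + h n *\<^sub>R e) - f x) / h n"
   using h[of n] by (simp add: D_def divide_inverse mult.commute add.commute)
  ultimately show ?thesis using True h[of n] by (simp add: pos_divide_le_eq indicator_def)
 next
  case False
  have "norm x <= norm (h n *\<^sub>R e + x) + norm (h n *\<^sub>R e)" using norm_triangle_ineq4[of "h n *\<^sub>R e + x" "h n *\<^sub>R e"] by simp
  then have "norm (h n *\<^sub>R e + x) >= R" using False h[of n] norm_e by simp
  then show ?thesis using False R[of x] R[of "h n *\<^sub>R e + x"] by (simp add: D_def indicator_def)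
 qed
 have lim: "(%n. D n x) ----> partial_deriv i f x" for x
 proof -
  have "((%s. f (x + s *\<^sub>R e)) has_derivative (%k. k *\<^sub>R partial_deriv i f x)) (at 0)"
   using ld[of x 0 UNIV] by (simp add: has_vector_derivative_def)
  then have "((%k. norm (f (x + k *\<^sub>R e) - f x - k *\<^sub>R partial_deriv i f x) / norm k) \<longlongrightarrow> 0) (at 0)"
   by (simp add: has_derivative_at)
  moreover have "filterlim h (at 0) sequentially"
   using h0 h(1) by (auto simp: filterlim_at less_imp_neq[symmetric] intro!: always_eventually)
  ultimately have "(%n. norm (f (x + h n *\<^sub>R e) - f x - h n *\<^sub>R partial_deriv i f x) / norm (h n)) ----> 0"
   by (rule filterlim_compose)
  moreover have "norm (f (x + h n *\<^sub>R e) - f x - h n *\<^sub>R partial_deriv i f x) / norm (h n) = norm (D n x - partial_deriv i f x)" for n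
  proof -
   have "D n x - partial_deriv i f x = (f (x + h n *\<^sub>R e) - f x - h n *\<^sub>R partial_deriv i f x) /\<^sub>R h n"
    using h(1)[of n] by (simp add: D_def scaleR_diff_right add.commute)
   then show ?thesis by (simp add: divide_inverse mult.commute)
  qed
  ultimately have "(%n. norm (D n x - partial_deriv i f x)) ----> 0" by simp
  then show ?thesis using LIM_zero_cancel tendsto_norm_zero_iff by blast
 qed
 have int: "integrable lborel f" by (rule bounded_support_integrable[OF fc R])
 have intT: "integrable lborel (%x. f (h n *\<^sub>R e + x))" for n
 proof (rule bounded_support_integrable[of _ "R + 1"])
  show "continuous_on UNIV (%x. f (h n *\<^sub>R e + x))"
   by (rule continuous_on_compose2[OF fc]) (auto intro: continuous_intros)
  fix x :: "real^2" assume "R + 1 <= norm x"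
  moreover have "norm x <= norm (h n *\<^sub>R e + x) + norm (h n *\<^sub>R e)" using norm_triangle_ineq4[of "h n *\<^sub>R e + x" "h n *\<^sub>R e"] by simp
  ultimately show "f (h n *\<^sub>R e + x) = 0" using h[of n] norm_e by (intro R) simp
 qed
 have I0: "(LINT x|lborel. D n x) = 0" for n
  unfolding D_def using int intT[of n] integral_translate[of f "h n *\<^sub>R e"] by simp
 have "(%n. LINT x|lborel. D n x) ----> (LINT x|lborel. partial_deriv i f x)"
 proof (rule integral_dominated_convergence[where w = "%x. B * indicator (cball 0 (R + 1)) x"])
  show "D n \<in> borel_measurable lborel" for n unfolding D_def by measurable
  show "integrable lborel (%x :: real^2. B * indicator (cball 0 (R + 1)) x)"
   by (rule integrable_mult_right) (simp add: integrable_indicator_iff emeasure_bounded_finite[simplified])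
 qed (use bound lim in auto)
 then show ?thesis by (simp add: I0 LIMSEQ_const_iff)
qed

text \<open>The fundamental theorem of calculus followed by Cauchy-Schwarz on the interval. The
  right-hand side is a nonnegative integral so that it can be integrated over further variables by
  Tonelli.\<close>

lemma ftc_square:
 fixes w :: "real => complex"
 assumes ab: "a <= b" and w: "!!s. (w has_vector_derivative w' s) (at s within {a..b})" and c: "continuous_on {a..b} w'"
 shows "ennreal ((norm (w b - w a))^2) <= ennreal (b - a) * (\<integral>\<^sup>+s. ennreal ((norm (w' s))^2) * indicator {a..b} s \<partial>lborel)"
proof -
 define F where "F s = indicator {a..b} s *\<^sub>R w' s" for s
 have F: "(LINT s|lborel. F s) = w b - w a"
  unfolding F_def by (rule integral_FTC_atLeastAtMost) (use assms in auto)
 have "integrable lborel (%s. indicator {a..b} s *\<^sub>R (norm (w' s))^2)"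
  using c by (intro borel_integrable_compact continuous_intros) auto
 moreover have "indicator {a..b} s *\<^sub>R (norm (w' s))^2 = (norm (F s))^2" for s by (auto simp: F_def indicator_def)
 moreover have "integrable lborel F" unfolding F_def by (rule borel_integrable_compact) (use c in auto)
 ultimately have LF: "L2 lborel F" by (auto simp: L2_def)
 have i2: "(norm (indicator {a..b} s :: real))^2 = indicator {a..b} s" for s :: real by (simp add: indicator_def)
 have L1: "L2 lborel (indicator {a..b} :: real => real)" unfolding L2_def i2 using ab by simp
 have l1: "(l2 lborel (indicator {a..b} :: real => real))^2 = b - a"
  unfolding l2_power2 i2 using ab by simp
 have "norm (LINT s|lborel. F s) <= 1 * (l2 lborel (indicator {a..b} :: real => real) * l2 lborel F)"
  by (rule L2_bound(2)[OF L1 LF L2_measurable[OF LF]]) (auto simp: F_def indicator_def)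
 then have "(norm (w b - w a))^2 <= (l2 lborel (indicator {a..b} :: real => real) * l2 lborel F)^2"
  unfolding F by (intro power_mono) auto
 then have "(norm (w b - w a))^2 <= (b - a) * (l2 lborel F)^2" by (simp add: power_mult_distrib l1)
 then have "ennreal ((norm (w b - w a))^2) <= ennreal (b - a) * ennreal ((l2 lborel F)^2)"
  using ab by (simp add: ennreal_mult[symmetric] ennreal_leI)
 also have "ennreal ((l2 lborel F)^2) = (\<integral>\<^sup>+s. ennreal ((norm (w' s))^2) * indicator {a..b} s \<partial>lborel)"
  unfolding L2_nn_integral[OF LF, symmetric] by (rule nn_integral_cong) (auto simp: F_def indicator_def)
 finally show ?thesis .
qed

section \<open>Rotations of the plane\<close>

definition rot :: "real => real^2 => real^2" where
 "rot s x = vector [cos s * x$1 - sin s * x$2, sin s * x$1 + cos s * x$2]"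

lemma rot_nth: "rot s x $ 1 = cos s * x$1 - sin s * x$2" "rot s x $ 2 = sin s * x$1 + cos s * x$2"
 by (simp_all add: rot_def)

lemma rot_inverse: "rot (- s) (rot s x) = x" "rot s (rot (- s) x) = x"
proof -
 have cc: "cos s * (cos s * a) + sin s * (sin s * a) = a" for a
  using sin_cos_squared_add3[of s] by (metis distrib_right mult.assoc mult_1)
 then show "rot (- s) (rot s x) = x" "rot s (rot (- s) x) = x"
  by (simp_all add: vec_eq_iff forall_2 rot_nth algebra_simps cc)
qed

lemma norm_rot: "norm (rot s x) = norm x"
proof -
 have "(norm (rot s x))^2 = ((sin s)^2 + (cos s)^2) * (norm x)^2"
  unfolding norm_vec2 rot_nth by (simp only: power2_eq_square) algebra
 then show ?thesis by (simp add: power2_eq_iff_nonneg)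
qed

lemma orthogonal_rot: "orthogonal_transformation (rot s)"
 unfolding orthogonal_transformation norm_rot
 by (auto intro!: linearI simp: vec_eq_iff forall_2 rot_nth algebra_simps)

lemma continuous_rot: "continuous_on UNIV (%z. rot (fst z) (snd z))"
proof -
 have "rot s x = (\<chi> j. if j = 1 then cos s * x$1 - sin s * x$2 else sin s * x$1 + cos s * x$2)" for s x
  by (simp add: vec_eq_iff forall_2 rot_nth)
 then show ?thesis
  by (simp only:) (intro continuous_on_vec_lambda, rename_tac j, case_tac "j = 1", auto intro!: continuous_intros)
qed

lemma rot_measurable [measurable]: "rot s \<in> borel_measurable borel"
 using orthogonal_transformation_linear[OF orthogonal_rot[of s]]
 by (intro borel_measurable_continuous_onI linear_continuous_on) (simp add: linear_conv_bounded_linear)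

text \<open>Agreement on boxes suffices. The preimage of a box is its image under the opposite
  rotation, and orthogonal maps preserve Lebesgue measure.\<close>

lemma lborel_rot: "distr lborel borel (rot s) = lborel"
proof (rule lborel_eqI[symmetric])
 fix l u :: "real^2" assume lu: "!!b. b \<in> Basis ==> l \<bullet> b <= u \<bullet> b"
 have eq: "rot s -` box l u = rot (- s) ` box l u"
 proof (intro set_eqI iffI)
  fix x assume "x \<in> rot s -` box l u"
  then have "rot (- s) (rot s x) \<in> rot (- s) ` box l u" by (intro imageI) simp
  then show "x \<in> rot (- s) ` box l u" by (simp only: rot_inverse)
 next
  fix x assume "x \<in> rot (- s) ` box l u"
  then show "x \<in> rot s -` box l u" by (elim imageE) (simp only: vimage_eq rot_inverse)
 qed
 have "emeasure (distr lborel borel (rot s)) (box l u) = emeasure lborel (rot s -` box l u)"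
  by (subst emeasure_distr) auto
 also have "... = emeasure lebesgue (rot s -` box l u)"
  using measurable_sets[OF rot_measurable, of "box l u" s] by simp
 also have "... = emeasure lebesgue (box l u)"
  unfolding eq using measurable_orthogonal_image[OF orthogonal_rot, of "box l u" "- s"]
   measure_orthogonal_image[OF orthogonal_rot, of "box l u" "- s"]
  by (simp add: emeasure_eq_measure2)
 also have "... = emeasure lborel (box l u)" by simp
 also have "... = (\<Prod>b\<in>Basis. (u - l) \<bullet> b)" using lu by (rule emeasure_lborel_box)
 finally show "emeasure (distr lborel borel (rot s)) (box l u) = (\<Prod>b\<in>Basis. (u - l) \<bullet> b)" .
qed simp

lemma nn_integral_rot:
 assumes [measurable]: "f \<in> borel_measurable borel"
 shows "(\<integral>\<^sup>+x. f (rot s x) \<partial>lborel) = (\<integral>\<^sup>+x. f x \<partial>lborel)"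
 by (subst (2) lborel_rot[of s, symmetric]) (simp add: nn_integral_distr)

section \<open>Test functions\<close>

lemma test_functions_smooth: "u \<in> test_functions S ==> smooth_on UNIV u"
 by (simp add: test_functions_def smooth_on_def Ck_on_UNIV)

lemma test_functions_zero: "u \<in> test_functions S ==> x \<notin> S ==> u x = 0"
 using closure_subset[of "{x. u x ~= 0}"] by (auto simp: test_functions_def)

lemma test_functions_partial_zero:
 assumes "u \<in> test_functions S" "x \<notin> closure {x. u x ~= 0}"
 shows "partial_deriv i u x = 0"
proof -
 have "partial_deriv i u x = partial_deriv i (%_. 0) x"
  by (rule partial_deriv_cong[of "- closure {x. u x ~= 0}"])
    (use assms closure_subset[of "{x. u x ~= 0}"] in auto)
 then show ?thesis by (simp add: partial_deriv_const)
qed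

lemma test_functions_partial: "u \<in> test_functions S ==> partial_deriv i u \<in> test_functions S"
proof -
 assume u: "u \<in> test_functions S"
 have sub: "{x. partial_deriv i u x ~= 0} \<subseteq> closure {x. u x ~= 0}"
  using test_functions_partial_zero[OF u] by blast
 then have sub': "closure {x. partial_deriv i u x ~= 0} \<subseteq> closure {x. u x ~= 0}"
  by (simp add: closure_minimal)
 have "compact (closure {x. partial_deriv i u x ~= 0})"
  using u sub' compact_closure bounded_subset[OF _ sub']
  by (auto simp: test_functions_def compact_eq_bounded_closed)
 moreover have "Ck k (partial_deriv i u)" for k
  using smooth_on_partial[OF test_functions_smooth[OF u]] by (simp add: smooth_on_def Ck_on_UNIV)
 ultimately show ?thesis using u sub' by (auto simp: test_functions_def)
qed

lemma test_functions_differentiable: "u \<in> test_functions S ==> u differentiable (at x)"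
 using smooth_on_differentiable[OF test_functions_smooth] by blast

lemma test_functions_continuous: "u \<in> test_functions S ==> continuous_on UNIV u"
 using smooth_on_continuous[OF test_functions_smooth] by blast

lemma test_functions_borel: "u \<in> test_functions S ==> u \<in> borel_measurable borel"
 by (rule borel_measurable_continuous_onI[OF test_functions_continuous])

lemma test_functions_partial_borel: "u \<in> test_functions S ==> partial_deriv i u \<in> borel_measurable borel"
 by (rule test_functions_borel[OF test_functions_partial])

lemma classical_grad_borel:
 assumes "u \<in> test_functions S" shows "classical_grad u \<in> borel_measurable borel"
proof (rule borel_measurable_continuous_onI)
 show "continuous_on UNIV (classical_grad u)"
  unfolding classical_grad_def[abs_def]
  by (intro continuous_on_vec_lambda test_functions_continuous[OF test_functions_partial[OF assms]])
qed

lemma test_functions_bounded_support: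
 assumes "u \<in> test_functions S"
 obtains R where "!!x. norm x >= R ==> u x = 0"
proof -
 have "bounded (closure {x. u x ~= 0})" using assms by (auto simp: test_functions_def compact_eq_bounded_closed)
 then obtain R where R: "!!x. x \<in> closure {x. u x ~= 0} ==> norm x <= R" by (auto simp: bounded_iff)
 have "u x = 0" if "norm x >= R + 1" for x
  using R[of x] closure_subset[of "{x. u x ~= 0}"] that by fastforce
 then show ?thesis using that by blast
qed

lemma test_functions_vanish_near:
 assumes "u \<in> test_functions (S - {a})"
 obtains r where "r > 0" "!!x. dist x a < r ==> u x = 0"
proof -
 have "open (- closure {x. u x ~= 0})" "a \<in> - closure {x. u x ~= 0}" using assms by (auto simp: test_functions_def)
 then obtain r where r: "r > 0" "ball a r \<subseteq> - closure {x. u x ~= 0}" by (auto simp: open_contains_ball)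
 have "u x = 0" if "dist x a < r" for x
  using r(2) that closure_subset[of "{x. u x ~= 0}"] by (auto simp: subset_iff dist_commute)
 with r(1) that show ?thesis by blast
qed

lemma test_functions_subset: "u \<in> test_functions S ==> S \<subseteq> T ==> u \<in> test_functions T"
 by (auto simp: test_functions_def)

lemma test_functionsI:
 assumes "smooth_on UNIV u" "compact K" "K \<subseteq> S" "!!x. x \<notin> K ==> u x = 0"
 shows "u \<in> test_functions S"
proof -
 have "closure {x. u x ~= 0} \<subseteq> K"
  using assms(2,4) by (intro closure_minimal compact_imp_closed) auto
 moreover from this have "compact (closure {x. u x ~= 0})"
  using assms(2) by (meson bounded_subset closed_closure compact_eq_bounded_closed)
 ultimately show ?thesis using assms by (auto simp: test_functions_def smooth_on_def Ck_on_UNIV)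
qed

section \<open>The Aharonov-Bohm potential\<close>

lemma AB_potential_nth:
 "AB_potential a al x $ 1 = - al * (x$2 - a$2) / (norm (x - a))^2"
 "AB_potential a al x $ 2 = al * (x$1 - a$1) / (norm (x - a))^2"
 by (simp_all add: AB_potential_def norm_vec2 right_diff_distrib diff_divide_distrib)

lemma AB_potential_scale: "AB_potential a al x = al *\<^sub>R AB_potential a 1 x"
 by (simp add: AB_potential_def)

text \<open>Valid at the pole too, where both sides are 0 by the convention for division.\<close>

lemma norm_AB_potential: "norm (AB_potential a al x) = \<bar>al\<bar> / norm (x - a)"
proof (cases "x = a")
 case True
 then have "AB_potential a al x = 0" by (simp add: AB_potential_def vec_eq_iff forall_2)
 with True show ?thesis by simp
next
 case False
 then have n: "(norm (x - a))^2 > 0" by simp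
 have "(norm (AB_potential a al x))^2 = al^2 * ((x$1 - a$1)^2 + (x$2 - a$2)^2) / ((norm (x - a))^2)^2"
  unfolding norm_vec2[of "AB_potential a al x"] AB_potential_nth
  by (simp add: power_mult_distrib power_divide add_divide_distrib[symmetric] distrib_left add.commute)
 also have "... = al^2 * (norm (x - a))^2 / ((norm (x - a))^2)^2"
  by (simp only: norm_vec2[of "x - a"] vector_minus_component)
 also have "... = (\<bar>al\<bar> / norm (x - a))^2"
  using n by (simp add: power_divide power2_eq_square)
 finally show ?thesis by (simp add: power2_eq_iff_nonneg)
qed

lemma AB_potential_borel [measurable]: "(%x. AB_potential a al x $ j) \<in> borel_measurable borel"
proof -
 have [measurable]: "(%x :: real^2. x $ i) \<in> borel_measurable borel" for i
  by (intro borel_measurable_continuous_onI continuous_intros)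
 show ?thesis using exhaust_2[of j] by (auto simp: AB_potential_nth intro!: borel_measurable_divide)
qed

definition classical_magnetic_grad :: "real^2 => real => (real^2 => complex) => real^2 => complex^2" where
 "classical_magnetic_grad a al u x = \<i> *s classical_grad u x + u x *s complex_vec (AB_potential a al x)"

lemma classical_magnetic_grad_nth:
 "classical_magnetic_grad a al u x $ j = \<i> * partial_deriv j u x + u x * of_real (AB_potential a al x $ j)"
 by (simp add: classical_magnetic_grad_def classical_grad_def complex_vec_def)

lemma borel_measurable_cvec2:
 fixes f :: "'a => complex^2"
 assumes [measurable]: "!!j. (%x. f x $ j) \<in> borel_measurable M"
 shows "f \<in> borel_measurable M"
proof -
 have "f x = (\<Sum>j\<in>UNIV. axis j (f x $ j))" for x by (simp add: vec_eq_iff axis_def forall_2 sum_2)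
 moreover have "(%x. axis j (f x $ j) :: complex^2) \<in> borel_measurable M" for j
 proof (rule measurable_compose[OF assms(1)[of j] borel_measurable_continuous_onI])
  show "continuous_on UNIV (axis j :: complex => complex^2)"
   unfolding axis_def by (rule continuous_on_vec_lambda, rename_tac i, case_tac "i = j") auto
 qed
 then have "(%x. \<Sum>j\<in>UNIV. axis j (f x $ j)) \<in> borel_measurable M" by (intro borel_measurable_sum)
 ultimately show ?thesis by (simp only: flip: ext)
qed

lemma classical_magnetic_grad_borel:
 assumes "u \<in> test_functions S"
 shows "classical_magnetic_grad a al u \<in> borel_measurable borel"
proof (rule borel_measurable_cvec2)
 note [measurable] = test_functions_borel[OF assms] test_functions_partial_borel[OF assms]
 show "(%x. classical_magnetic_grad a al u x $ j) \<in> borel_measurable borel" for j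
  unfolding classical_magnetic_grad_nth by measurable
qed

lemma rot_derivative:
 assumes "u differentiable (at (rot s x))"
 shows "((%s. u (rot s x)) has_vector_derivative
  ((- rot s x $ 2) *\<^sub>R partial_deriv 1 u (rot s x) + (rot s x $ 1) *\<^sub>R partial_deriv 2 u (rot s x))) (at s within T)"
proof -
 have "((%s. rot s x $ 1) has_derivative (%h. h * (- rot s x $ 2))) (at s within T)"
  "((%s. rot s x $ 2) has_derivative (%h. h * (rot s x $ 1))) (at s within T)"
  unfolding rot_nth by (auto intro!: derivative_eq_intros simp: algebra_simps)
 then have "((%s. rot s x) has_derivative (%h. h *\<^sub>R (vector [- rot s x $ 2, rot s x $ 1]))) (at s within T)"
  unfolding has_derivative_componentwise_within[of "%s. rot s x"]
  by (auto simp: Basis_vec_def inner_axis forall_2 has_derivative_def)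
 from has_derivative_compose[OF this has_derivative_partial[OF assms]]
 show ?thesis by (simp add: has_vector_derivative_def scaleR_add_right scaleR_diff_right)
qed

lemma nn_integral_swap:
 fixes f :: "'a::euclidean_space => 'b::euclidean_space => ennreal"
 assumes "(%z. f (fst z) (snd z)) \<in> borel_measurable borel"
 shows "(\<integral>\<^sup>+x. \<integral>\<^sup>+y. f x y \<partial>lborel \<partial>lborel) = (\<integral>\<^sup>+y. \<integral>\<^sup>+x. f x y \<partial>lborel \<partial>lborel)"
proof -
 have "case_prod f \<in> borel_measurable (lborel \<Otimes>\<^sub>M lborel)"
  using assms by (simp add: lborel_prod case_prod_beta')
 from lborel_pair.Fubini'[OF this] show ?thesis by simp
qed

text \<open>For half-integer circulation the twisted rotations \<open>s \<mapsto> exp(- i al s) u(R\<^sub>s x)\<close> change sign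
 over a full turn, which controls \<open>u\<close> by its angular magnetic derivative.\<close>

lemma hardy_test_functions:
 assumes u: "u \<in> test_functions (S - {0})" and al: "exp ((2 * pi) *\<^sub>R (- \<i> * cx al)) = -1"
 shows "(\<integral>\<^sup>+x. ennreal ((norm (u x) / norm x)^2) \<partial>lborel)
  <= ennreal (pi^2) * (\<integral>\<^sup>+x. ennreal ((norm (classical_magnetic_grad 0 al u x))^2) \<partial>lborel)"
proof -
 define P where "P = classical_magnetic_grad 0 al u"
 have [measurable]: "P \<in> borel_measurable borel" unfolding P_def by (rule classical_magnetic_grad_borel[OF u])
 define c where "c = - \<i> * cx al"
 define w' where "w' x s = exp (s *\<^sub>R c) * (c * u (rot s x)
   + ((- rot s x $ 2) *\<^sub>R partial_deriv 1 u (rot s x) + (rot s x $ 1) *\<^sub>R partial_deriv 2 u (rot s x)))" for x s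
 have u0: "u 0 = 0" by (rule test_functions_zero[OF u]) simp
 have w: "((%s. exp (s *\<^sub>R c) * u (rot s x)) has_vector_derivative w' x s) (at s within T)" for x s T
  using has_vector_derivative_mult[OF exp_scaleR_has_vector_derivative_right[of c s T]
    rot_derivative[OF test_functions_differentiable[OF u], where s = s and x = x and T = T]]
  by (simp add: w'_def algebra_simps)
 have cr: "continuous_on T (%s. rot s x)" for x T
  by (rule continuous_on_compose2[OF continuous_rot, of T "%s. (s, x)", simplified]) (auto intro: continuous_intros)
 have cw: "continuous_on T (w' x)" for x T
  unfolding w'_def[abs_def]
  by (intro continuous_intros cr
    continuous_on_compose2[OF test_functions_continuous[OF u] cr]
    continuous_on_compose2[OF test_functions_continuous[OF test_functions_partial[OF u]] cr]) auto
 have nc: "norm (exp (s *\<^sub>R c)) = 1" for s by (simp add: c_def norm_exp_eq_Re)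
 have bound: "norm (w' x s) <= norm x * norm (P (rot s x))" for x s
 proof (cases "x = 0")
  case True
  then have "rot s x = 0" by (simp add: vec_eq_iff forall_2 rot_nth)
  then show ?thesis by (simp add: w'_def u0 True)
 next
  case False
  define y where "y = rot s x"
  have ny: "norm y = norm x" by (simp add: y_def norm_rot)
  then have y0: "(norm y)^2 ~= 0" using False by simp
  define v where "v = (vector [- y$2, y$1] :: real^2)"
  have "(norm v)^2 = (norm y)^2" by (simp add: v_def norm_vec2)
  then have nv: "norm v = norm x" using ny by (simp add: power2_eq_iff_nonneg)
  have "- (y$2 * AB_potential 0 al y $ 1) + y$1 * AB_potential 0 al y $ 2 = al * ((y$1)^2 + (y$2)^2) / (norm y)^2"
   unfolding AB_potential_nth by (simp add: power2_eq_square add_divide_distrib[symmetric] algebra_simps)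
  then have A: "- (y$2 * AB_potential 0 al y $ 1) + y$1 * AB_potential 0 al y $ 2 = al"
   using y0 unfolding norm_vec2[symmetric] by simp
  have "v$1 *\<^sub>R P y $ 1 + v$2 *\<^sub>R P y $ 2 = \<i> * ((- y$2) *\<^sub>R partial_deriv 1 u y + y$1 *\<^sub>R partial_deriv 2 u y)
    + u y * cx (- (y$2 * AB_potential 0 al y $ 1) + y$1 * AB_potential 0 al y $ 2)"
   by (simp add: v_def P_def classical_magnetic_grad_nth scaleR_conv_of_real algebra_simps)
  also have "... = \<i> * (c * u y + ((- y$2) *\<^sub>R partial_deriv 1 u y + y$1 *\<^sub>R partial_deriv 2 u y))"
   unfolding A by (simp add: c_def algebra_simps)
  finally have "norm (v$1 *\<^sub>R P y $ 1 + v$2 *\<^sub>R P y $ 2) = norm (w' x s)"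
   unfolding w'_def y_def[symmetric] norm_mult nc by (simp add: norm_mult)
  then show ?thesis using norm_real_lincomb[of v "P y"] unfolding nv y_def by simp
 qed
 have e2: "exp ((2 * pi) *\<^sub>R c) = -1" using al by (simp add: c_def)
 \<comment> \<open>Over a full turn the twisted function passes from u(x) to -u(x), a change of size
   2 |u(x)|. The interval has length 2 pi and the derivative carries a factor |x|, so 4 |u|^2 is at
   most 2 pi |x|^2 times the integral; division by 4 |x|^2 leaves pi / 2.\<close>
 have pt: "ennreal ((norm (u x) / norm x)^2)
   <= ennreal (pi / 2) * (\<integral>\<^sup>+s. ennreal ((norm (P (rot s x)))^2) * indicator {0..2*pi} s \<partial>lborel)" for x
 proof (cases "x = 0")
  case False
  have r: "rot (2 * pi) x = x" "rot 0 x = x" by (simp_all add: vec_eq_iff forall_2 rot_nth)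
  define k where "k = 1 / (2 * norm x)^2"
  have k: "k >= 0" "k * (norm x)^2 = 1 / 4" using False by (simp_all add: k_def power_mult_distrib)
  have "ennreal ((norm (exp ((2 * pi) *\<^sub>R c) * u (rot (2 * pi) x) - exp (0 *\<^sub>R c) * u (rot 0 x)))^2)
   <= ennreal (2 * pi - 0) * (\<integral>\<^sup>+s. ennreal ((norm (w' x s))^2) * indicator {0..2*pi} s \<partial>lborel)"
   by (rule ftc_square[OF _ w cw]) simp
  also have "... <= ennreal (2 * pi - 0) * (\<integral>\<^sup>+s. ennreal ((norm x)^2) * (ennreal ((norm (P (rot s x)))^2) * indicator {0..2*pi} s) \<partial>lborel)"
   using bound[of x] by (intro mult_left_mono nn_integral_mono)
    (auto simp: indicator_def ennreal_mult[symmetric] power_mult_distrib[symmetric] intro!: ennreal_leI power_mono)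
  also have "... = ennreal (2 * pi * (norm x)^2) * (\<integral>\<^sup>+s. ennreal ((norm (P (rot s x)))^2) * indicator {0..2*pi} s \<partial>lborel)"
  proof (subst nn_integral_cmult)
   have [measurable]: "(%s. rot s x) \<in> borel_measurable borel" by (intro borel_measurable_continuous_onI cr)
   show "(%s. ennreal ((norm (P (rot s x)))^2) * indicator {0..2 * pi} s) \<in> borel_measurable lborel" by measurable
  qed (simp add: ennreal_mult mult.assoc)
  finally have "ennreal k * ennreal ((norm (exp ((2 * pi) *\<^sub>R c) * u (rot (2 * pi) x) - exp (0 *\<^sub>R c) * u (rot 0 x)))^2)
   <= ennreal k * (ennreal (2 * pi * (norm x)^2) * (\<integral>\<^sup>+s. ennreal ((norm (P (rot s x)))^2) * indicator {0..2*pi} s \<partial>lborel))"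
   by (rule mult_left_mono) simp
  moreover have "ennreal k * ennreal (2 * pi * (norm x)^2) = ennreal (pi / 2)"
   using k by (simp add: ennreal_mult[symmetric] mult.left_commute mult.commute[of _ k])
  moreover have "ennreal k * ennreal ((norm (exp ((2 * pi) *\<^sub>R c) * u (rot (2 * pi) x) - exp (0 *\<^sub>R c) * u (rot 0 x)))^2)
    = ennreal ((norm (u x) / norm x)^2)"
  proof -
   have "norm (- u x - u x) = 2 * norm (u x)" using norm_mult[of "-2" "u x"] by simp
   then show ?thesis
    unfolding e2 r using k(1) by (simp add: ennreal_mult[symmetric] k_def power_divide power_mult_distrib)
  qed
  ultimately show ?thesis by (simp add: mult.assoc[symmetric])
 qed (simp add: u0)
 have [measurable]: "(%z. rot (fst z) (snd z)) \<in> borel_measurable borel"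
  by (rule borel_measurable_continuous_onI[OF continuous_rot])
 have [measurable]: "(%z. rot (snd z) (fst z)) \<in> borel_measurable borel"
  by (rule borel_measurable_continuous_onI, rule continuous_on_compose2[OF continuous_rot, of _ "%z. (snd z, fst z)", simplified])
    (auto intro!: continuous_intros)
 have [measurable]: "(%z :: (real^2) \<times> real. snd z) \<in> borel_measurable borel"
  by (intro borel_measurable_continuous_onI continuous_intros)
 have m2: "(%z. ennreal ((norm (P (rot (snd z) (fst z))))^2) * indicator {0..2*pi} (snd z)) \<in> borel_measurable borel"
  by measurable
 have mi: "(%x. \<integral>\<^sup>+s. ennreal ((norm (P (rot s x)))^2) * indicator {0..2*pi} s \<partial>lborel) \<in> borel_measurable borel"
  using lborel.borel_measurable_nn_integral_fst[of "%z. ennreal ((norm (P (rot (snd z) (fst z))))^2) * indicator {0..2*pi} (snd z)" lborel]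
   m2 by (simp add: lborel_prod)
 have "(\<integral>\<^sup>+x. ennreal ((norm (u x) / norm x)^2) \<partial>lborel)
   <= (\<integral>\<^sup>+x. ennreal (pi / 2) * (\<integral>\<^sup>+s. ennreal ((norm (P (rot s x)))^2) * indicator {0..2*pi} s \<partial>lborel) \<partial>lborel)"
  by (rule nn_integral_mono) (rule pt)
 also have "... = ennreal (pi / 2) * (\<integral>\<^sup>+x. \<integral>\<^sup>+s. ennreal ((norm (P (rot s x)))^2) * indicator {0..2*pi} s \<partial>lborel \<partial>lborel)"
  using mi by (simp add: nn_integral_cmult)
 \<comment> \<open>After the exchange of integrals, rotation invariance makes the inner integral
   independent of the angle. The outer one then contributes 2 pi, and pi / 2 * 2 pi is the constant
   pi^2.\<close>
 also have "(\<integral>\<^sup>+x. \<integral>\<^sup>+s. ennreal ((norm (P (rot s x)))^2) * indicator {0..2*pi} s \<partial>lborel \<partial>lborel)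
   = (\<integral>\<^sup>+s. \<integral>\<^sup>+x. ennreal ((norm (P (rot s x)))^2) * indicator {0..2*pi} s \<partial>lborel \<partial>lborel)"
  by (rule nn_integral_swap) (rule m2)
 also have "... = (\<integral>\<^sup>+s. (\<integral>\<^sup>+x. ennreal ((norm (P x))^2) \<partial>lborel) * indicator {0..2*pi} s \<partial>lborel)"
 proof (rule nn_integral_cong)
  fix s :: real
  have "(\<integral>\<^sup>+x. ennreal ((norm (P (rot s x)))^2) * indicator {0..2*pi} s \<partial>lborel)
    = (\<integral>\<^sup>+x. ennreal ((norm (P (rot s x)))^2) \<partial>lborel) * indicator {0..2*pi} s"
   by (rule nn_integral_multc) measurable
  then show "(\<integral>\<^sup>+x. ennreal ((norm (P (rot s x)))^2) * indicator {0..2*pi} s \<partial>lborel)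
   = (\<integral>\<^sup>+x. ennreal ((norm (P x))^2) \<partial>lborel) * indicator {0..2*pi} s"
   using nn_integral_rot[of "%x. ennreal ((norm (P x))^2)" s] by simp
 qed
 also have "... = (\<integral>\<^sup>+x. ennreal ((norm (P x))^2) \<partial>lborel) * ennreal (2 * pi)"
  by (simp add: nn_integral_cmult)
 also have "ennreal (pi / 2) * ... = ennreal (pi^2) * (\<integral>\<^sup>+x. ennreal ((norm (P x))^2) \<partial>lborel)"
  by (simp add: mult.commute[of _ "ennreal (2 * pi)"] mult.assoc[symmetric] ennreal_mult[symmetric] power2_eq_square)
 finally show ?thesis unfolding P_def .
qed

lemma support_zero: "x \<notin> closure {x. u x ~= 0} ==> u x = 0"
 using closure_subset[of "{x. u x ~= 0}"] by blast

lemma test_functions_add: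
 assumes "u \<in> test_functions S" "v \<in> test_functions S"
 shows "(%x. u x + v x) \<in> test_functions S"
proof (rule test_functionsI)
 show "smooth_on UNIV (%x. u x + v x)" using assms[THEN test_functions_smooth] by (intro smooth_on_add) auto
 show "compact (closure {x. u x ~= 0} \<union> closure {x. v x ~= 0})" "closure {x. u x ~= 0} \<union> closure {x. v x ~= 0} \<subseteq> S"
  using assms by (auto simp: test_functions_def)
 show "u x + v x = 0" if "x \<notin> closure {x. u x ~= 0} \<union> closure {x. v x ~= 0}" for x
  using that support_zero[of x u] support_zero[of x v] by simp
qed

lemma test_functions_mult:
 assumes "u \<in> test_functions S" "smooth_on UNIV v"
 shows "(%x. v x * u x) \<in> test_functions S"
proof (rule test_functionsI)
 show "smooth_on UNIV (%x. v x * u x)"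
  by (intro smooth_on_mult test_functions_smooth[OF assms(1)] assms(2)) simp
 show "compact (closure {x. u x ~= 0})" "closure {x. u x ~= 0} \<subseteq> S"
  using assms by (auto simp: test_functions_def)
 show "v x * u x = 0" if "x \<notin> closure {x. u x ~= 0}" for x
  using that support_zero[of x u] by simp
qed

text \<open>The multiplier may be singular at the pole because the test function vanishes near it:
  the product is smooth off \<open>a\<close> and zero on a ball around \<open>a\<close>, and these
  two open sets cover the plane.\<close>

lemma test_functions_mult_off:
 assumes u: "u \<in> test_functions (S - {a})" and v: "smooth_on (- {a}) v"
 shows "(%x. v x * u x) \<in> test_functions (S - {a})"
proof (rule test_functionsI)
 obtain r where r: "r > 0" "!!x. dist x a < r ==> u x = 0" using test_functions_vanish_near[OF u] by blast
 have "smooth_on (- {a}) (%x. v x * u x)"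
  by (intro smooth_on_mult v smooth_on_subset[OF test_functions_smooth[OF u]]) auto
 moreover have "smooth_on (ball a r) (%x. v x * u x)"
  by (rule smooth_on_cong[OF open_ball smooth_on_const[of _ 0]]) (use r(2) in \<open>auto simp: dist_commute\<close>)
 ultimately have "smooth_on (- {a} \<union> ball a r) (%x. v x * u x)" by (intro smooth_on_Un) auto
 moreover have "- {a} \<union> ball a r = UNIV" using r(1) by auto
 ultimately show "smooth_on UNIV (%x. v x * u x)" by simp
 show "compact (closure {x. u x ~= 0})" "closure {x. u x ~= 0} \<subseteq> S - {a}"
  using u by (auto simp: test_functions_def)
 show "v x * u x = 0" if "x \<notin> closure {x. u x ~= 0}" for x
  using that support_zero[of x u] by simp
qed

lemma test_functions_cmult: "u \<in> test_functions S ==> (%x. c * u x) \<in> test_functions S"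
 by (rule test_functions_mult[OF _ smooth_on_const])

lemma test_functions_diff:
 "u \<in> test_functions S ==> v \<in> test_functions S ==> (%x. u x - v x) \<in> test_functions S"
 using test_functions_add[OF _ test_functions_cmult[of v S "-1"]] by simp

text \<open>\<open>ftc_square\<close> along the segment from x to x + z, integrated over x; by
  translation invariance every point of the segment contributes the same gradient integral.\<close>

lemma translation_estimate:
 assumes u: "u \<in> test_functions S"
 shows "(\<integral>\<^sup>+x. ennreal ((norm (u (x + z) - u x))^2) \<partial>lborel)
  <= ennreal ((norm z)^2) * (\<integral>\<^sup>+x. ennreal ((norm (classical_grad u x))^2) \<partial>lborel)"
proof -
 define g where "g = classical_grad u"
 have [measurable]: "g \<in> borel_measurable borel" unfolding g_def by (rule classical_grad_borel[OF u])
 define w' where "w' x s = z$1 *\<^sub>R g (x + s *\<^sub>R z) $ 1 + z$2 *\<^sub>R g (x + s *\<^sub>R z) $ 2" for x and s :: real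
 have w: "((%s. u (x + s *\<^sub>R z)) has_vector_derivative w' x s) (at s within T)" for x s T
  using line_derivative[OF test_functions_differentiable[OF u]] by (simp add: w'_def g_def classical_grad_def)
 have cr: "continuous_on T (%s. x + s *\<^sub>R z)" for x and T :: "real set" by (intro continuous_intros)
 have cw: "continuous_on T (w' x)" for x T
  unfolding w'_def[abs_def] g_def classical_grad_def
  by (simp, intro continuous_intros continuous_on_compose2[OF test_functions_continuous[OF test_functions_partial[OF u]] cr]) auto
 have pt: "ennreal ((norm (u (x + z) - u x))^2) <= (\<integral>\<^sup>+s. ennreal ((norm z)^2 * (norm (g (x + s *\<^sub>R z)))^2) * indicator {0..1} s \<partial>lborel)" for x
 proof -
  have "ennreal ((norm (u (x + 1 *\<^sub>R z) - u (x + 0 *\<^sub>R z)))^2)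
   <= ennreal (1 - 0) * (\<integral>\<^sup>+s. ennreal ((norm (w' x s))^2) * indicator {0..1} s \<partial>lborel)"
   by (rule ftc_square[OF _ w cw]) simp
  also have "... <= ennreal (1 - 0) * (\<integral>\<^sup>+s. ennreal ((norm z)^2 * (norm (g (x + s *\<^sub>R z)))^2) * indicator {0..1} s \<partial>lborel)"
   using norm_real_lincomb[of z] by (intro mult_left_mono nn_integral_mono)
    (auto simp: indicator_def power_mult_distrib[symmetric] w'_def intro!: ennreal_leI power_mono)
  finally show ?thesis by simp
 qed
 have m2: "(%q. ennreal ((norm z)^2 * (norm (g (fst q + snd q *\<^sub>R z)))^2) * indicator {0..1} (snd q)) \<in> borel_measurable borel"
 proof -
  have [measurable]: "(%q :: (real^2) \<times> real. fst q + snd q *\<^sub>R z) \<in> borel_measurable borel"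
   "(%q :: (real^2) \<times> real. snd q) \<in> borel_measurable borel"
   by (intro borel_measurable_continuous_onI continuous_intros)+
  show ?thesis by measurable
 qed
 have "(\<integral>\<^sup>+x. ennreal ((norm (u (x + z) - u x))^2) \<partial>lborel)
   <= (\<integral>\<^sup>+x. \<integral>\<^sup>+s. ennreal ((norm z)^2 * (norm (g (x + s *\<^sub>R z)))^2) * indicator {0..1} s \<partial>lborel \<partial>lborel)"
  by (rule nn_integral_mono) (rule pt)
 also have "... = (\<integral>\<^sup>+s. \<integral>\<^sup>+x. ennreal ((norm z)^2 * (norm (g (x + s *\<^sub>R z)))^2) * indicator {0..1} s \<partial>lborel \<partial>lborel)"
  by (rule nn_integral_swap) (rule m2)
 also have "... = (\<integral>\<^sup>+s. (ennreal ((norm z)^2) * (\<integral>\<^sup>+x. ennreal ((norm (g x))^2) \<partial>lborel)) * indicator {0..1} (s :: real) \<partial>lborel)"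
 proof (rule nn_integral_cong)
  fix s :: real
  have "(\<integral>\<^sup>+x. ennreal ((norm z)^2 * (norm (g (x + s *\<^sub>R z)))^2) * indicator {0..1} s \<partial>lborel)
    = (\<integral>\<^sup>+x. ennreal ((norm z)^2 * (norm (g (x + s *\<^sub>R z)))^2) \<partial>lborel) * indicator {0..1} s"
   by (rule nn_integral_multc) measurable
  also have "(\<integral>\<^sup>+x. ennreal ((norm z)^2 * (norm (g (x + s *\<^sub>R z)))^2) \<partial>lborel)
    = (\<integral>\<^sup>+x. ennreal ((norm z)^2 * (norm (g x))^2) \<partial>lborel)"
   using nn_integral_translate[of "%x. ennreal ((norm z)^2 * (norm (g x))^2)" "s *\<^sub>R z"] by (simp add: add.commute)
  also have "... = ennreal ((norm z)^2) * (\<integral>\<^sup>+x. ennreal ((norm (g x))^2) \<partial>lborel)"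
   by (simp add: ennreal_mult nn_integral_cmult)
  finally show "(\<integral>\<^sup>+x. ennreal ((norm z)^2 * (norm (g (x + s *\<^sub>R z)))^2) * indicator {0..1} s \<partial>lborel)
    = (ennreal ((norm z)^2) * (\<integral>\<^sup>+x. ennreal ((norm (g x))^2) \<partial>lborel)) * indicator {0..1} s" .
 qed
 also have "... = ennreal ((norm z)^2) * (\<integral>\<^sup>+x. ennreal ((norm (g x))^2) \<partial>lborel)"
  by (simp add: nn_integral_cmult)
 finally show ?thesis unfolding g_def .
qed

text \<open>A Poincare inequality in which the mean is kept as a separate term: m u(x) is the
  integral over the cell of u(x) - u(y) plus the integral of u, and the square of a sum is at most
  twice the sum of the squares.\<close>

lemma mean_value_on_cell:
 fixes u :: "'a::euclidean_space => complex"
 assumes Q[measurable]: "Q \<in> sets borel" and m: "emeasure lborel Q = ennreal m" "m > 0" and u: "L2 lborel u"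
 shows "(\<integral>\<^sup>+x. ennreal ((norm (u x))^2) * indicator Q x \<partial>lborel)
  <= ennreal (2 / m) * (\<integral>\<^sup>+x. (\<integral>\<^sup>+y. ennreal ((norm (u x - u y))^2) * indicator Q y \<partial>lborel) * indicator Q x \<partial>lborel)
   + ennreal (2 / m * (norm (LINT y|lborel. indicator Q y *\<^sub>R u y))^2)"
proof -
 have um[measurable]: "u \<in> borel_measurable borel" using u by (simp add: L2_def)
 let ?c = "LINT y|lborel. indicator Q y *\<^sub>R u y"
 have mQ: "measure lborel Q = m" using m by (simp add: measure_def)
 have i2: "(norm (indicator Q s :: real))^2 = indicator Q s" for s by (simp add: indicator_def)
 have L1: "L2 lborel (indicator Q :: 'a => real)" unfolding L2_def i2 using m(1) by (simp add: ennreal_less_top)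
 have l1: "(l2 lborel (indicator Q :: 'a => real))^2 = m" unfolding l2_power2 i2 using mQ by simp
 have Lu: "L2 lborel (%y. indicator Q y *\<^sub>R u y)"
  by (rule L2_dominated(1)[OF u, of _ 1]) (auto simp: indicator_def)
 have iu: "integrable lborel (%y. indicator Q y *\<^sub>R u y)"
  by (rule L2_bound(1)[OF L1 u, of _ 1]) (auto simp: indicator_def)
 have pt: "ennreal ((norm (u x))^2) * indicator Q x
   <= ennreal (2 / m) * ((\<integral>\<^sup>+y. ennreal ((norm (u x - u y))^2) * indicator Q y \<partial>lborel) * indicator Q x)
    + ennreal (2 / m^2 * (norm ?c)^2) * indicator Q x" for x
 proof (cases "x \<in> Q")
  case True
  define v where "v y = indicator Q y *\<^sub>R (u x - u y)" for y
  have ic: "integrable lborel (%y. indicator Q y *\<^sub>R u x)" using m by (simp add: ennreal_less_top)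
  have Lc: "L2 lborel (%y. indicator Q y *\<^sub>R u x)"
   by (rule L2_dominated(1)[OF L1, of _ "norm (u x)"]) (auto simp: indicator_def)
  have Lv: "L2 lborel v"
   using L2_diff(1)[OF Lc Lu] by (simp add: v_def[abs_def] scaleR_diff_right)
  have "norm (LINT y|lborel. v y) <= 1 * (l2 lborel (indicator Q :: 'a => real) * l2 lborel v)"
   by (rule L2_bound(2)[OF L1 Lv L2_measurable[OF Lv]]) (auto simp: v_def indicator_def)
  then have "(norm (LINT y|lborel. v y))^2 <= (l2 lborel (indicator Q :: 'a => real) * l2 lborel v)^2"
   by (intro power_mono) auto
  then have vb: "(norm (LINT y|lborel. v y))^2 <= m * (l2 lborel v)^2" by (simp add: power_mult_distrib l1)
  have "(LINT y|lborel. v y) = m *\<^sub>R u x - ?c"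
   unfolding v_def scaleR_diff_right using b_integral_diff[OF ic iu] m mQ by simp
  then have "m *\<^sub>R u x = (LINT y|lborel. v y) + ?c" by simp
  then have "m * norm (u x) <= norm (LINT y|lborel. v y) + norm ?c"
   using m(2) norm_triangle_ineq[of "LINT y|lborel. v y" ?c] by (metis abs_of_pos norm_scaleR)
  then have "(m * norm (u x))^2 <= (norm (LINT y|lborel. v y) + norm ?c)^2"
   using m(2) by (intro power_mono) auto
  also have "... <= 2 * (norm (LINT y|lborel. v y))^2 + 2 * (norm ?c)^2"
   using sum_squares_bound[of "norm (LINT y|lborel. v y)" "norm ?c"] by (simp add: power2_sum)
  also have "... <= 2 * (m * (l2 lborel v)^2) + 2 * (norm ?c)^2" using vb by simp
  finally have "(norm (u x))^2 <= 2 / m * (l2 lborel v)^2 + 2 / m^2 * (norm ?c)^2"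
   using m(2) by (simp add: field_simps power2_eq_square)
  then have "ennreal ((norm (u x))^2) <= ennreal (2 / m) * ennreal ((l2 lborel v)^2) + ennreal (2 / m^2 * (norm ?c)^2)"
   using m(2) by (simp add: ennreal_mult[symmetric] ennreal_plus[symmetric] ennreal_leI del: ennreal_plus)
  also have "ennreal ((l2 lborel v)^2) = (\<integral>\<^sup>+y. ennreal ((norm (u x - u y))^2) * indicator Q y \<partial>lborel)"
   unfolding L2_nn_integral[OF Lv, symmetric] by (rule nn_integral_cong) (auto simp: v_def indicator_def)
  finally show ?thesis using True by simp
 qed simp
 have m2: "(%x. (\<integral>\<^sup>+y. ennreal ((norm (u x - u y))^2) * indicator Q y \<partial>lborel) * indicator Q x) \<in> borel_measurable borel"
 proof -
  have [measurable]: "(%z :: 'a \<times> 'a. fst z) \<in> borel_measurable borel" "(%z :: 'a \<times> 'a. snd z) \<in> borel_measurable borel"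
   by (intro borel_measurable_continuous_onI continuous_intros)+
  have "(%z. ennreal ((norm (u (fst z) - u (snd z)))^2) * indicator Q (snd z)) \<in> borel_measurable borel" by measurable
  then have [measurable]: "(%x. \<integral>\<^sup>+y. ennreal ((norm (u x - u y))^2) * indicator Q y \<partial>lborel) \<in> borel_measurable borel"
   using lborel.borel_measurable_nn_integral_fst[of "%z. ennreal ((norm (u (fst z) - u (snd z)))^2) * indicator Q (snd z)" lborel]
   by (simp add: lborel_prod)
  show ?thesis by measurable
 qed
 have "(\<integral>\<^sup>+x. ennreal ((norm (u x))^2) * indicator Q x \<partial>lborel)
  <= (\<integral>\<^sup>+x. ennreal (2 / m) * ((\<integral>\<^sup>+y. ennreal ((norm (u x - u y))^2) * indicator Q y \<partial>lborel) * indicator Q x)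
    + ennreal (2 / m^2 * (norm ?c)^2) * indicator Q x \<partial>lborel)"
  by (rule nn_integral_mono) (rule pt)
 also have "... = ennreal (2 / m) * (\<integral>\<^sup>+x. (\<integral>\<^sup>+y. ennreal ((norm (u x - u y))^2) * indicator Q y \<partial>lborel) * indicator Q x \<partial>lborel)
   + ennreal (2 / m^2 * (norm ?c)^2) * ennreal m"
  using m2 by (simp add: nn_integral_add nn_integral_cmult m(1) borel_measurable_times)
 also have "ennreal (2 / m^2 * (norm ?c)^2) * ennreal m = ennreal (2 / m * (norm ?c)^2)"
  using m(2) by (simp add: ennreal_mult[symmetric] power2_eq_square)
 finally show ?thesis .
qed

section \<open>Rellich's theorem for test functions\<close>

text \<open>Half-open squares of side \<open>h\<close>, so that every point of the plane lies in
  exactly one, found by rounding down its coordinates divided by \<open>h\<close>.\<close>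

definition grid_cell :: "real => int \<times> int => (real^2) set" where
 "grid_cell h k = {x. h * of_int (fst k) <= x$1 \<and> x$1 < h * (of_int (fst k) + 1)
   \<and> h * of_int (snd k) <= x$2 \<and> x$2 < h * (of_int (snd k) + 1)}"

lemma grid_cell_iff:
 assumes "h > 0"
 shows "x \<in> grid_cell h k \<longleftrightarrow> k = (\<lfloor>x$1 / h\<rfloor>, \<lfloor>x$2 / h\<rfloor>)"
proof -
 have "h * of_int i <= t \<and> t < h * (of_int i + 1) \<longleftrightarrow> i = \<lfloor>t / h\<rfloor>" for i :: int and t
  using assms by (auto simp: floor_eq_iff eq_commute[of i] pos_le_divide_eq pos_divide_less_eq mult.commute)
 then show ?thesis by (cases k) (auto simp: grid_cell_def)
qed

lemma coord_borel [measurable]: "(%x :: real^2. x $ i) \<in> borel_measurable borel"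
 by (intro borel_measurable_continuous_onI continuous_intros)

lemma grid_cell_borel [measurable]: "grid_cell h k \<in> sets borel"
 unfolding grid_cell_def by measurable

lemma Basis_real2: "(Basis :: (real^2) set) = {axis 1 1, axis 2 1}"
 by (auto simp: Basis_vec_def) (metis exhaust_2)

lemma emeasure_box2:
 assumes "a1 <= b1" "a2 <= b2"
 shows "emeasure lborel (cbox (vector [a1, a2]) (vector [b1, b2] :: real^2)) = ennreal ((b1 - a1) * (b2 - a2))"
  "emeasure lborel (box (vector [a1, a2]) (vector [b1, b2] :: real^2)) = ennreal ((b1 - a1) * (b2 - a2))"
proof -
 have ne: "axis 1 1 ~= (axis 2 1 :: real^2)" by (simp add: axis_eq_axis)
 show "emeasure lborel (cbox (vector [a1, a2]) (vector [b1, b2] :: real^2)) = ennreal ((b1 - a1) * (b2 - a2))"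
  "emeasure lborel (box (vector [a1, a2]) (vector [b1, b2] :: real^2)) = ennreal ((b1 - a1) * (b2 - a2))"
  using assms ne by (simp_all add: emeasure_lborel_cbox_eq emeasure_lborel_box_eq Basis_real2 inner_axis)
qed

lemma emeasure_grid_cell:
 assumes "h > 0" shows "emeasure lborel (grid_cell h k) = ennreal (h^2)"
proof (rule antisym)
 let ?l = "vector [h * of_int (fst k), h * of_int (snd k)] :: real^2"
 let ?u = "vector [h * (of_int (fst k) + 1), h * (of_int (snd k) + 1)] :: real^2"
 have s: "(h * (of_int (fst k) + 1) - h * of_int (fst k)) * (h * (of_int (snd k) + 1) - h * of_int (snd k)) = h^2"
  by (simp add: power2_eq_square algebra_simps)
 have "grid_cell h k \<subseteq> cbox ?l ?u" "box ?l ?u \<subseteq> grid_cell h k"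
  by (auto simp: grid_cell_def mem_box_cart forall_2)
 then have "emeasure lborel (grid_cell h k) <= emeasure lborel (cbox ?l ?u)"
  "emeasure lborel (box ?l ?u) <= emeasure lborel (grid_cell h k)"
  by (auto intro!: emeasure_mono)
 moreover have "emeasure lborel (cbox ?l ?u) = ennreal (h^2)" "emeasure lborel (box ?l ?u) = ennreal (h^2)"
  using assms by (simp_all add: emeasure_box2 s)
 ultimately show "emeasure lborel (grid_cell h k) <= ennreal (h^2)" "ennreal (h^2) <= emeasure lborel (grid_cell h k)"
  by simp_all
qed

lemma L2_bounded_support:
 fixes g :: "real^2 => complex"
 assumes "continuous_on UNIV g" "!!x. norm x >= R ==> g x = 0"
 shows "L2 lborel g"
proof -
 have "integrable lborel (%x. cx ((norm (g x))^2))"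
  by (rule bounded_support_integrable[of _ R]) (use assms in \<open>auto intro!: continuous_intros\<close>)
 from integrable_Re[OF this] have "integrable lborel (%x. (norm (g x))^2)" by simp
 then show ?thesis using borel_measurable_continuous_onI[OF assms(1)] by (simp add: L2_def)
qed

lemma test_functions_L2: "u \<in> test_functions S ==> L2 lborel u"
 using L2_bounded_support[OF test_functions_continuous] test_functions_bounded_support by metis

lemma L2_cvec2:
 fixes f :: "'a => complex^2"
 assumes "!!j. L2 M (%x. f x $ j)"
 shows "L2 M f"
 using assms borel_measurable_cvec2[of f M] unfolding L2_def norm_cvec2 by auto

lemma classical_grad_L2: "u \<in> test_functions S ==> L2 lborel (classical_grad u)"
 by (rule L2_cvec2) (simp add: classical_grad_def test_functions_L2[OF test_functions_partial])

text \<open>Two points of one cell differ by a vector z of the square B of side 2h around 0. All the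
  double integrals over cells together are therefore at most an integral over z in B of squared
  translation differences, each bounded through |z|^2 <= 2 h^2. With area 4 h^2 for B and the factor
  2 / h^2 of \<open>mean_value_on_cell\<close>, the constant is 2 * 4 * 2 = 16.\<close>

lemma grid_poincare:
 assumes u: "u \<in> test_functions S" and h: "h > 0" and F: "finite F"
  and cover: "!!x. x \<in> S ==> \<exists>k\<in>F. x \<in> grid_cell h k"
 shows "(l2 lborel u)^2 <= 16 * h^2 * (l2 lborel (classical_grad u))^2
  + (\<Sum>k\<in>F. 2 / h^2 * (norm (LINT y|lborel. indicator (grid_cell h k) y *\<^sub>R u y))^2)"
proof -
 let ?Q = "grid_cell h"
 let ?c = "%k. 2 / h^2 * (norm (LINT y|lborel. indicator (?Q k) y *\<^sub>R u y))^2"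
 define G where "G x y = ennreal ((norm (u x - u y))^2)" for x y
 define B where "B = cbox (vector [-h, -h]) (vector [h, h] :: real^2)"
 have Bb[measurable]: "B \<in> sets borel" by (simp add: B_def)
 note [measurable] = test_functions_borel[OF u]
 have [measurable]: "(%z :: (real^2) \<times> (real^2). fst z) \<in> borel_measurable borel" "(%z :: (real^2) \<times> (real^2). snd z) \<in> borel_measurable borel"
  by (intro borel_measurable_continuous_onI continuous_intros)+
 have inner: "(%x. \<integral>\<^sup>+y. G x y * indicator (?Q k) y \<partial>lborel) \<in> borel_measurable borel" for k
 proof -
  have "(%z. G (fst z) (snd z) * indicator (?Q k) (snd z)) \<in> borel_measurable borel" unfolding G_def by measurable
  then show ?thesis
   using lborel.borel_measurable_nn_integral_fst[of "%z. G (fst z) (snd z) * indicator (?Q k) (snd z)" lborel]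
   by (simp add: lborel_prod)
 qed
 \<comment> \<open>The cells are disjoint, so at most one summand differs from 0.\<close>
 have ov: "(\<Sum>k\<in>F. indicator (?Q k) y * indicator (?Q k) x) <= (indicator B (y - x) :: ennreal)" for x y :: "real^2"
 proof (cases "\<exists>k\<in>F. x \<in> ?Q k \<and> y \<in> ?Q k")
  case True
  then obtain k where k: "k \<in> F" "x \<in> ?Q k" "y \<in> ?Q k" by blast
  have "(\<Sum>k'\<in>F. indicator (?Q k') y * indicator (?Q k') x) = (\<Sum>k'\<in>F. if k' = k then 1 else (0 :: ennreal))"
   using k by (intro sum.cong) (auto simp: indicator_def grid_cell_iff[OF h])
  also have "... = 1" using k(1) F by simp
  also have "y - x \<in> B" using k(2,3) by (auto simp: B_def grid_cell_def mem_box_cart forall_2 algebra_simps)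
  ultimately show ?thesis by simp
 next
  case False
  then have "(\<Sum>k\<in>F. indicator (?Q k) y * indicator (?Q k) x) = (0 :: ennreal)"
   by (intro sum.neutral) (auto simp: indicator_def)
  then show ?thesis by simp
 qed
 have dbl: "(\<Sum>k\<in>F. \<integral>\<^sup>+x. (\<integral>\<^sup>+y. G x y * indicator (?Q k) y \<partial>lborel) * indicator (?Q k) x \<partial>lborel)
   <= ennreal (8 * h^2 * h^2) * (\<integral>\<^sup>+x. ennreal ((norm (classical_grad u x))^2) \<partial>lborel)"
 proof -
  have "(\<Sum>k\<in>F. \<integral>\<^sup>+x. (\<integral>\<^sup>+y. G x y * indicator (?Q k) y \<partial>lborel) * indicator (?Q k) x \<partial>lborel)
    = (\<integral>\<^sup>+x. (\<Sum>k\<in>F. (\<integral>\<^sup>+y. G x y * indicator (?Q k) y \<partial>lborel) * indicator (?Q k) x) \<partial>lborel)"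
   using inner by (intro nn_integral_sum[symmetric]) (auto intro!: borel_measurable_times)
  also have "... = (\<integral>\<^sup>+x. \<integral>\<^sup>+y. G x y * (\<Sum>k\<in>F. indicator (?Q k) y * indicator (?Q k) x) \<partial>lborel \<partial>lborel)"
  proof (rule nn_integral_cong)
   fix x
   have [measurable]: "G x \<in> borel_measurable borel" unfolding G_def by measurable
   have "(\<Sum>k\<in>F. (\<integral>\<^sup>+y. G x y * indicator (?Q k) y \<partial>lborel) * indicator (?Q k) x)
     = (\<Sum>k\<in>F. (\<integral>\<^sup>+y. G x y * indicator (?Q k) y * indicator (?Q k) x \<partial>lborel))"
    by (intro sum.cong refl nn_integral_multc[symmetric]) measurable
   also have "... = (\<integral>\<^sup>+y. (\<Sum>k\<in>F. G x y * indicator (?Q k) y * indicator (?Q k) x) \<partial>lborel)"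
    by (intro nn_integral_sum[symmetric]) measurable
   finally show "(\<Sum>k\<in>F. (\<integral>\<^sup>+y. G x y * indicator (?Q k) y \<partial>lborel) * indicator (?Q k) x)
     = (\<integral>\<^sup>+y. G x y * (\<Sum>k\<in>F. indicator (?Q k) y * indicator (?Q k) x) \<partial>lborel)"
    by (simp add: sum_distrib_left mult.assoc)
  qed
  also have "... <= (\<integral>\<^sup>+x. \<integral>\<^sup>+y. G x y * indicator B (y - x) \<partial>lborel \<partial>lborel)"
   using ov by (intro nn_integral_mono mult_left_mono) auto
  also have "... = (\<integral>\<^sup>+x. \<integral>\<^sup>+z. G x (x + z) * indicator B z \<partial>lborel \<partial>lborel)"
  proof (rule nn_integral_cong)
   fix x
   have "(%y. G x y * indicator B (y - x)) \<in> borel_measurable borel" unfolding G_def by measurable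
   from nn_integral_translate[OF this, of x]
   show "(\<integral>\<^sup>+y. G x y * indicator B (y - x) \<partial>lborel) = (\<integral>\<^sup>+z. G x (x + z) * indicator B z \<partial>lborel)" by simp
  qed
  also have "... = (\<integral>\<^sup>+z. \<integral>\<^sup>+x. G x (x + z) * indicator B z \<partial>lborel \<partial>lborel)"
  proof (rule nn_integral_swap)
   show "(%z. G (fst z) (fst z + snd z) * indicator B (snd z)) \<in> borel_measurable borel" unfolding G_def by measurable
  qed
  also have "... <= (\<integral>\<^sup>+z. ennreal (2 * h^2) * (\<integral>\<^sup>+x. ennreal ((norm (classical_grad u x))^2) \<partial>lborel) * indicator B z \<partial>lborel)"
  proof (rule nn_integral_mono)
   fix z :: "real^2"
   have [measurable]: "(%x. G x (x + z)) \<in> borel_measurable borel" unfolding G_def by measurable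
   have "(\<integral>\<^sup>+x. G x (x + z) * indicator B z \<partial>lborel) = (\<integral>\<^sup>+x. G x (x + z) \<partial>lborel) * indicator B z"
    by (rule nn_integral_multc) measurable
   also have "... <= ennreal (2 * h^2) * (\<integral>\<^sup>+x. ennreal ((norm (classical_grad u x))^2) \<partial>lborel) * indicator B z"
   proof (cases "z \<in> B")
    case True
    then have "\<bar>z$1\<bar> <= h" "\<bar>z$2\<bar> <= h" by (auto simp: B_def mem_box_cart forall_2)
    then have nz: "(norm z)^2 <= 2 * h^2"
     unfolding norm_vec2 using power_mono[of "\<bar>z$1\<bar>" h 2] power_mono[of "\<bar>z$2\<bar>" h 2] by simp
    then show ?thesis
     using order_trans[OF translation_estimate[OF u, of z] mult_right_mono[OF ennreal_leI[OF nz]]] True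
     by (simp add: G_def norm_minus_commute)
   qed simp
   finally show "(\<integral>\<^sup>+x. G x (x + z) * indicator B z \<partial>lborel)
     <= ennreal (2 * h^2) * (\<integral>\<^sup>+x. ennreal ((norm (classical_grad u x))^2) \<partial>lborel) * indicator B z" .
  qed
  also have "... = ennreal (2 * h^2) * (\<integral>\<^sup>+x. ennreal ((norm (classical_grad u x))^2) \<partial>lborel) * emeasure lborel B"
   by (subst nn_integral_cmult) auto
  also have "emeasure lborel B = ennreal (4 * h^2)"
   using h by (simp add: B_def emeasure_box2 power2_eq_square)
  also have "ennreal (2 * h^2) * (\<integral>\<^sup>+x. ennreal ((norm (classical_grad u x))^2) \<partial>lborel) * ennreal (4 * h^2)
    = ennreal (2 * h^2) * ennreal (4 * h^2) * (\<integral>\<^sup>+x. ennreal ((norm (classical_grad u x))^2) \<partial>lborel)"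
   by (simp only: mult.assoc mult.commute[of _ "ennreal (4 * h^2)"] mult.left_commute)
  also have "ennreal (2 * h^2) * ennreal (4 * h^2) = ennreal (8 * h^2 * h^2)"
   by (simp add: ennreal_mult[symmetric] mult_ac)
  finally show ?thesis .
 qed
 have "ennreal ((l2 lborel u)^2) = (\<integral>\<^sup>+x. ennreal ((norm (u x))^2) \<partial>lborel)"
  by (rule L2_nn_integral[OF test_functions_L2[OF u], symmetric])
 also have "... <= (\<integral>\<^sup>+x. (\<Sum>k\<in>F. ennreal ((norm (u x))^2) * indicator (?Q k) x) \<partial>lborel)"
 proof (rule nn_integral_mono)
  fix x :: "real^2"
  show "ennreal ((norm (u x))^2) <= (\<Sum>k\<in>F. ennreal ((norm (u x))^2) * indicator (?Q k) x)"
  proof (cases "x \<in> S")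
   case True
   then obtain k where k: "k \<in> F" "x \<in> ?Q k" using cover by blast
   have "ennreal ((norm (u x))^2) = ennreal ((norm (u x))^2) * indicator (?Q k) x" using k by simp
   also have "... <= (\<Sum>k\<in>F. ennreal ((norm (u x))^2) * indicator (?Q k) x)"
    by (rule member_le_sum[OF k(1)]) (use F in auto)
   finally show ?thesis .
  next
   case False then show ?thesis using test_functions_zero[OF u False] by simp
  qed
 qed
 also have "... = (\<Sum>k\<in>F. \<integral>\<^sup>+x. ennreal ((norm (u x))^2) * indicator (?Q k) x \<partial>lborel)"
  by (intro nn_integral_sum) measurable
 also have "... <= (\<Sum>k\<in>F. ennreal (2 / h^2) * (\<integral>\<^sup>+x. (\<integral>\<^sup>+y. G x y * indicator (?Q k) y \<partial>lborel) * indicator (?Q k) x \<partial>lborel)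
   + ennreal (?c k))"
  unfolding G_def using h by (intro sum_mono mean_value_on_cell test_functions_L2[OF u] emeasure_grid_cell) auto
 also have "... = ennreal (2 / h^2) * (\<Sum>k\<in>F. \<integral>\<^sup>+x. (\<integral>\<^sup>+y. G x y * indicator (?Q k) y \<partial>lborel) * indicator (?Q k) x \<partial>lborel)
   + (\<Sum>k\<in>F. ennreal (?c k))"
  by (simp add: sum.distrib sum_distrib_left)
 also have "... <= ennreal (2 / h^2) * (ennreal (8 * h^2 * h^2) * (\<integral>\<^sup>+x. ennreal ((norm (classical_grad u x))^2) \<partial>lborel))
   + (\<Sum>k\<in>F. ennreal (?c k))"
  by (intro add_right_mono mult_left_mono dbl) simp
 also have "... = ennreal (16 * h^2 * (l2 lborel (classical_grad u))^2 + (\<Sum>k\<in>F. ?c k))"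
 proof -
  have "ennreal (2 / h^2) * (ennreal (8 * h^2 * h^2) * ennreal ((l2 lborel (classical_grad u))^2))
   = ennreal (16 * h^2 * (l2 lborel (classical_grad u))^2)"
   using h by (simp add: ennreal_mult[symmetric] power4_eq_xxxx power2_eq_square)
  moreover have "(\<Sum>k\<in>F. ennreal (?c k)) = ennreal (\<Sum>k\<in>F. ?c k)" by (rule sum_ennreal) simp
  moreover have "0 <= (\<Sum>k\<in>F. ?c k)" by (intro sum_nonneg) simp
  ultimately show ?thesis
   unfolding L2_nn_integral[OF classical_grad_L2[OF u]] by (simp add: ennreal_plus)
 qed
 finally show ?thesis
  by (subst (asm) ennreal_le_iff) (auto intro!: add_nonneg_nonneg sum_nonneg)
qed

text \<open>Compactness through countably many numbers. A diagonal subsequence makes the integrals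
  over all cells of all side lengths 1 / (j + 1) converge at once. For a given tolerance one mesh is
  fine enough to make the gradient term of \<open>grid_poincare\<close> small, and finitely many
  cell integrals of that mesh control the rest.\<close>

theorem rellich_test_functions:
 assumes u: "!!n. u n \<in> test_functions S" and S: "bounded S"
  and C: "!!n. l2 lborel (u n) <= C" "!!n. l2 lborel (classical_grad (u n)) <= C"
 obtains r :: "nat => nat" where "strict_mono r"
  "!!e. e > 0 ==> \<exists>N. \<forall>m\<ge>N. \<forall>n\<ge>N. l2 lborel (%x. u (r m) x - u (r n) x) < e"
proof -
 define h where "h j = 1 / real (Suc j)" for j
 have h: "h j > 0" "h j <= 1" for j by (auto simp: h_def)
 have C0: "C >= 0" using C(1)[of 0] l2_nonneg[of lborel "u 0"] by linarith
 define f where "f n p = (LINT y|lborel. indicator (grid_cell (h (fst p)) (snd p)) y *\<^sub>R u n y)" for n and p :: "nat \<times> int \<times> int"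
 have fb: "norm (f n p) <= C" for n p
 proof -
  let ?Q = "grid_cell (h (fst p)) (snd p)"
  have i2: "(norm (indicator ?Q s :: real))^2 = indicator ?Q s" for s by (simp add: indicator_def)
  have L1: "L2 lborel (indicator ?Q :: real^2 => real)" unfolding L2_def i2 using emeasure_grid_cell[OF h(1)] by simp
  have "(l2 lborel (indicator ?Q :: real^2 => real))^2 = (h (fst p))^2"
   unfolding l2_power2 i2 using emeasure_grid_cell[OF h(1), of "fst p" "snd p"] by (simp add: measure_def)
  then have l1: "l2 lborel (indicator ?Q :: real^2 => real) = h (fst p)"
   using h(1)[of "fst p"] l2_nonneg[of lborel "indicator ?Q :: real^2 => real"] by (simp add: power2_eq_iff_nonneg)
  have [measurable]: "u n \<in> borel_measurable borel" by (rule test_functions_borel[OF u])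
  have "norm (f n p) <= 1 * (l2 lborel (indicator ?Q :: real^2 => real) * l2 lborel (u n))"
   unfolding f_def by (rule L2_bound(2)[OF L1 test_functions_L2[OF u]]) (auto simp: indicator_def)
  also have "... <= 1 * (1 * C)" unfolding l1
   by (intro mult_left_mono mult_mono h C l2_nonneg) auto
  finally show ?thesis by simp
 qed
 obtain r where r: "strict_mono r" "!!p. p \<in> UNIV ==> \<exists>l. (%n. f (r n) p) ----> l"
  using function_convergent_subsequence[of "UNIV :: (nat \<times> int \<times> int) set" f C] fb by auto
 have "\<forall>p. \<exists>l. (%n. f (r n) p) ----> l" using r(2) by blast
 from choice[OF this] obtain l where l: "!!p. (%n. f (r n) p) ----> l p" by blast
 have "\<exists>N. \<forall>m\<ge>N. \<forall>n\<ge>N. l2 lborel (%x. u (r m) x - u (r n) x) < e" if e: "e > 0" for e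
 proof -
  \<comment> \<open>64 = 16 * 2^2: the difference of two members of the sequence has a gradient of
    norm at most 2C.\<close>
  have "(%j. 64 * (h j)^2 * C^2) ----> 64 * 0^2 * C^2"
   unfolding h_def by (intro tendsto_intros LIMSEQ_Suc[OF lim_1_over_n])
  then have "(%j. 64 * (h j)^2 * C^2) ----> 0" by simp
  then have "eventually (%j. 64 * (h j)^2 * C^2 < e^2 / 2) sequentially"
   by (rule order_tendstoD) (use e in simp)
  then obtain j where j: "64 * (h j)^2 * C^2 < e^2 / 2" by (auto dest: eventually_happens)
  obtain R where R: "!!x. x \<in> S ==> norm x <= R" using S by (auto simp: bounded_iff)
  define K where "K = \<lceil>\<bar>R\<bar> / h j\<rceil> + 1"
  define F where "F = {-K..K} \<times> {-K..K}"
  have F: "finite F" by (simp add: F_def)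
  have cover: "\<exists>k\<in>F. x \<in> grid_cell (h j) k" if "x \<in> S" for x
  proof (rule bexI)
   show "x \<in> grid_cell (h j) (\<lfloor>x$1 / h j\<rfloor>, \<lfloor>x$2 / h j\<rfloor>)" using grid_cell_iff[OF h(1)] by blast
   have "\<bar>x$i\<bar> / h j <= \<bar>R\<bar> / h j" for i
    using R[OF that] component_le_norm_cart[of x i] h(1)[of j] by (intro divide_right_mono) auto
   then have "\<bar>x$i / h j\<bar> <= \<bar>R\<bar> / h j" for i using h(1)[of j] by simp
   then have "-K <= \<lfloor>x$i / h j\<rfloor> \<and> \<lfloor>x$i / h j\<rfloor> <= K" for i
   using le_of_int_ceiling[of "\<bar>R\<bar> / h j"] unfolding K_def le_floor_iff floor_le_iff abs_le_iff
   by (auto simp del: le_of_int_ceiling) (smt (verit))+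
   then show "(\<lfloor>x$1 / h j\<rfloor>, \<lfloor>x$2 / h j\<rfloor>) \<in> F" by (simp add: F_def)
  qed
  define q where "q m n = (\<Sum>k\<in>F. 2 / (h j)^2 * (norm (f (r m) (j, k) - f (r n) (j, k)))^2)" for m n
  \<comment> \<open>Chosen so that the cell terms add up to at most e^2 / 2; the summand 1 keeps the
    divisor positive.\<close>
  define \<delta> where "\<delta> = e^2 / 2 / ((card F + 1) * (2 / (h j)^2))"
  have \<delta>: "\<delta> > 0" using e h(1)[of j] by (simp add: \<delta>_def)
  have "\<exists>N. \<forall>m\<ge>N. \<forall>n\<ge>N. \<forall>k\<in>F. norm (f (r m) (j, k) - f (r n) (j, k)) < sqrt \<delta>"
  proof -
   have "\<exists>N. \<forall>m\<ge>N. \<forall>n\<ge>N. norm (f (r m) p - f (r n) p) < sqrt \<delta>" for p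
    using l[of p] \<delta> by (metis LIMSEQ_imp_Cauchy CauchyD real_sqrt_gt_zero)
   then obtain N where N: "!!p m n. m >= N p ==> n >= N p ==> norm (f (r m) p - f (r n) p) < sqrt \<delta>" by metis
   have "N (j, k) <= (\<Sum>k\<in>F. N (j, k))" if "k \<in> F" for k by (rule member_le_sum[OF that]) (use F in auto)
   then show ?thesis using N by (meson order_trans)
  qed
  then obtain N where N: "!!m n k. m >= N ==> n >= N ==> k \<in> F ==> norm (f (r m) (j, k) - f (r n) (j, k)) < sqrt \<delta>" by blast
  have "l2 lborel (%x. u (r m) x - u (r n) x) < e" if mn: "m >= N" "n >= N" for m n
  proof -
   let ?v = "%x. u (r m) x - u (r n) x"
   have v: "?v \<in> test_functions S" by (intro test_functions_diff u)
   have g: "classical_grad ?v = (%x. classical_grad (u (r m)) x - classical_grad (u (r n)) x)"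
    by (auto simp: fun_eq_iff vec_eq_iff classical_grad_def partial_deriv_diff test_functions_differentiable[OF u])
   have "l2 lborel (classical_grad ?v) <= 2 * C"
    unfolding g using L2_diff(2)[OF classical_grad_L2[OF u[of "r m"]] classical_grad_L2[OF u[of "r n"]]] C(2)[of "r m"] C(2)[of "r n"]
    by linarith
   then have "(l2 lborel (classical_grad ?v))^2 <= (2 * C)^2" by (intro power_mono l2_nonneg)
   then have 1: "16 * (h j)^2 * (l2 lborel (classical_grad ?v))^2 < e^2 / 2"
   proof -
    have "16 * (h j)^2 * (l2 lborel (classical_grad ?v))^2 <= 16 * (h j)^2 * (2 * C)^2"
     by (rule mult_left_mono) (use \<open>(l2 lborel (classical_grad ?v))^2 <= (2 * C)^2\<close> in simp_all)
    also have "16 * (h j)^2 * (2 * C)^2 = 64 * (h j)^2 * C^2" by (simp add: power_mult_distrib)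
    finally show ?thesis using j by linarith
   qed
   have fd: "(LINT y|lborel. indicator (grid_cell (h j) k) y *\<^sub>R ?v y) = f (r m) (j, k) - f (r n) (j, k)" for k
   proof -
    have i: "integrable lborel (%y. indicator (grid_cell (h j) k) y *\<^sub>R u n' y)" for n'
    proof (rule Bochner_Integration.integrable_bound)
     obtain R where "!!x. norm x >= R ==> u n' x = 0" using test_functions_bounded_support[OF u] by blast
     then show "integrable lborel (u n')" by (rule bounded_support_integrable[OF test_functions_continuous[OF u]])
     have [measurable]: "u n' \<in> borel_measurable borel" by (rule test_functions_borel[OF u])
     show "(%y. indicator (grid_cell (h j) k) y *\<^sub>R u n' y) \<in> borel_measurable lborel" by measurable
    qed (auto simp: indicator_def)
    show ?thesis unfolding f_def scaleR_diff_right by (simp add: b_integral_diff[OF i i])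
   qed
   have "(\<Sum>k\<in>F. 2 / (h j)^2 * (norm (LINT y|lborel. indicator (grid_cell (h j) k) y *\<^sub>R ?v y))^2)
     <= (\<Sum>k\<in>F. 2 / (h j)^2 * \<delta>)"
   proof (rule sum_mono)
    fix k assume "k \<in> F"
    then have "(norm (f (r m) (j, k) - f (r n) (j, k)))^2 <= (sqrt \<delta>)^2" by (intro power_mono less_imp_le[OF N[OF mn]]) auto
    then show "2 / (h j)^2 * (norm (LINT y|lborel. indicator (grid_cell (h j) k) y *\<^sub>R ?v y))^2 <= 2 / (h j)^2 * \<delta>"
     unfolding fd using \<delta> by (intro mult_left_mono) auto
   qed
   also have "... = card F * (2 / (h j)^2 * \<delta>)" by simp
   also have "... <= (card F + 1) * (2 / (h j)^2) * \<delta>"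
    using mult_right_mono[of "real (card F)" "real (card F + 1)" "2 / (h j)^2 * \<delta>"] \<delta> by (simp only: mult.assoc) simp
   also have "... = e^2 / 2"
   proof -
    have "real (card F + 1) * (2 / (h j)^2) ~= 0" using h(1)[of j] by simp
    then show ?thesis unfolding \<delta>_def by (metis nonzero_mult_div_cancel_left times_divide_eq_right)
   qed
   finally have "(l2 lborel ?v)^2 < e^2" using grid_poincare[OF v h(1)[of j] F cover] 1 by simp
   then show ?thesis using e by (simp add: power_less_imp_less_base)
  qed
  then show ?thesis by blast
 qed
 with r(1) that show ?thesis by blast
qed

section \<open>The magnetic form and its form domain\<close>

lemma norm_smult: "norm (c *s (v :: complex^2)) = norm c * norm v"
proof -
 have "(norm (c *s v))^2 = (norm c * norm v)^2"
  unfolding norm_cvec2 power_mult_distrib by (simp add: norm_mult power_mult_distrib algebra_simps)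
 then show ?thesis by (simp add: power2_eq_iff_nonneg)
qed

lemma norm_complex_vec: "norm (complex_vec v) = norm v"
proof -
 have "(norm (complex_vec v))^2 = (norm v)^2" unfolding norm_cvec2 norm_vec2 by (simp add: complex_vec_def)
 then show ?thesis by (simp add: power2_eq_iff_nonneg)
qed

definition cip :: "complex^2 => complex^2 => complex" where
 "cip x y = cdot x (cnj_vec y)"

lemma cip_eq: "cip x y = x$1 * cnj (y$1) + x$2 * cnj (y$2)"
 by (simp add: cip_def cdot_def cnj_vec_def)

lemma norm_cip: "norm (cip x y) <= norm x * norm y"
proof -
 have "norm (cip x y) <= norm (x$1) * norm (y$1) + norm (x$2) * norm (y$2)"
  unfolding cip_eq by (rule norm_triangle_le) (simp add: norm_mult)
 moreover have "norm (x$1) * norm (y$1) + norm (x$2) * norm (y$2) <= norm x * norm y"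
 proof (rule power2_le_imp_le)
  have "0 <= (norm (x$1) * norm (y$2) - norm (x$2) * norm (y$1))^2" by simp
  then show "(norm (x$1) * norm (y$1) + norm (x$2) * norm (y$2))^2 <= (norm x * norm y)^2"
   unfolding power_mult_distrib norm_cvec2 by (simp add: power2_eq_square algebra_simps)
 qed simp
 ultimately show ?thesis by simp
qed

lemma bounded_bilinear_cip: "bounded_bilinear cip"
 by (rule bounded_bilinear.intro)
   (auto simp: cip_eq algebra_simps scaleR_add_right intro!: exI[of _ 1] norm_cip[unfolded cip_eq])

lemma bounded_bilinear_mult_cnj: "bounded_bilinear (%a b :: complex. a * cnj b)"
 by (rule bounded_bilinear.comp[OF bounded_bilinear_mult bounded_linear_ident bounded_linear_cnj])

lemma integral_by_parts:
 assumes u: "u \<in> test_functions S" and v: "smooth_on UNIV v"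
 shows "(LINT x|lborel. partial_deriv i u x * v x) = - (LINT x|lborel. u x * partial_deriv i v x)"
proof -
 obtain R where R: "!!x. norm x >= R ==> u x = 0" using test_functions_bounded_support[OF u] by blast
 obtain R' where R': "!!x. norm x >= R' ==> partial_deriv i u x = 0"
  using test_functions_bounded_support[OF test_functions_partial[OF u]] by blast
 note c = test_functions_continuous[OF u] test_functions_continuous[OF test_functions_partial[OF u]]
  smooth_on_continuous[OF v] smooth_on_continuous[OF smooth_on_partial[OF v]]
 have d: "u differentiable (at x)" "v differentiable (at x)" for x
  using test_functions_differentiable[OF u] smooth_on_differentiable[OF v] by auto
 have p: "partial_deriv i (%x. u x * v x) = (%x. partial_deriv i u x * v x + u x * partial_deriv i v x)"
  by (simp add: fun_eq_iff partial_deriv_mult d)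
 have "(LINT x|lborel. partial_deriv i (%x. u x * v x) x) = 0"
 proof (rule integral_partial_deriv)
  show "(%x. u x * v x) differentiable (at x)" for x using d by simp
  show "continuous_on UNIV (partial_deriv i (%x. u x * v x))" unfolding p by (intro continuous_intros c)
  show "u x * v x = 0" if "norm x >= R" for x using R[OF that] by simp
 qed
 moreover have "integrable lborel (%x. partial_deriv i u x * v x)"
  by (rule bounded_support_integrable[of _ R']) (auto intro!: continuous_intros c simp: R')
 moreover have "integrable lborel (%x. u x * partial_deriv i v x)"
  by (rule bounded_support_integrable[of _ R]) (auto intro!: continuous_intros c simp: R)
 ultimately have "(LINT x|lborel. partial_deriv i u x * v x) + (LINT x|lborel. u x * partial_deriv i v x) = 0"
  unfolding p by (simp add: b_integral_add)
 then show ?thesis by (simp add: eq_neg_iff_add_eq_0)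
qed

text \<open>Its L2 norm is the norm of the form domain, so limits, bounds and completeness in that
  norm become statements about \<open>L2\<close> for a single vector-valued function.\<close>

definition triple :: "real^2 => (real^2 => complex) => (real^2 => complex^2) => real^2 => (complex^2) \<times> complex \<times> complex" where
 "triple a u g x = (g x, u x, u x / cx (norm (x - a)))"

lemma norm_triple: "(norm (triple a u g x))^2 = (norm (g x))^2 + (norm (u x))^2 + (norm (u x) / norm (x - a))^2"
 by (simp add: triple_def norm_prod_def norm_divide)

lemma norm_triple_le: "norm (g x) <= norm (triple a u g x)" "norm (u x) <= norm (triple a u g x)"
 "norm (u x) / norm (x - a) <= norm (triple a u g x)"
 by (rule power2_le_imp_le, simp_all add: norm_triple)+

lemma norm_triple_le_sum: "norm (triple a u g x) <= norm (g x) + norm (u x) + norm (u x) / norm (x - a)"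
proof (rule power2_le_imp_le)
 have "A^2 + B^2 + C^2 <= (A + B + C)^2" if "A >= 0" "B >= 0" "C >= 0" for A B C :: real
  using that by (simp add: power2_eq_square algebra_simps)
 then show "(norm (triple a u g x))^2 <= (norm (g x) + norm (u x) + norm (u x) / norm (x - a))^2"
  unfolding norm_triple by simp
qed simp

lemma triple_diff: "triple a u g x - triple a v h x = triple a (%x. u x - v x) (%x. g x - h x) x"
 by (simp add: triple_def diff_divide_distrib)

lemma triple_add: "triple a u g x + triple a v h x = triple a (%x. u x + v x) (%x. g x + h x) x"
 by (simp add: triple_def add_divide_distrib)

text \<open>The magnetic gradient with an explicit candidate \<open>g\<close> for the gradient of
  \<open>u\<close>. Working with pairs keeps the choice made by \<open>grad\<close> out of the
  estimates.\<close>

definition pgrad :: "real^2 => real => (real^2 => complex) => (real^2 => complex^2) => real^2 => complex^2" where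
 "pgrad a al u g x = \<i> *s g x + u x *s complex_vec (AB_potential a al x)"

lemma norm_pgrad_le: "norm (pgrad a al u g x) <= (1 + \<bar>al\<bar>) * norm (triple a u g x)"
proof -
 have "norm (pgrad a al u g x) <= norm (g x) + \<bar>al\<bar> * (norm (u x) / norm (x - a))"
  unfolding pgrad_def by (rule norm_triangle_le) (simp add: norm_smult norm_complex_vec norm_AB_potential mult.commute)
 also have "... <= norm (triple a u g x) + \<bar>al\<bar> * norm (triple a u g x)"
  by (intro add_mono mult_left_mono norm_triple_le) simp
 finally show ?thesis by (simp add: algebra_simps)
qed

lemma pgrad_diff: "pgrad a al u g x - pgrad a al v h x = pgrad a al (%x. u x - v x) (%x. g x - h x) x"
 by (simp add: pgrad_def vec_eq_iff algebra_simps)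

lemma pgrad_lin: "pgrad a al (%x. c * u x + v x) (%x. c *s g x + h x) x = c *s pgrad a al u g x + pgrad a al v h x"
 by (simp add: pgrad_def vec_eq_iff algebra_simps)

lemma norm_grad_le_pgrad: "norm (g x) <= norm (pgrad a al u g x) + \<bar>al\<bar> * (norm (u x) / norm (x - a))"
proof -
 have "\<i> *s g x = pgrad a al u g x - u x *s complex_vec (AB_potential a al x)" by (simp add: pgrad_def)
 then have "norm (\<i> *s g x) <= norm (pgrad a al u g x) + norm (u x *s complex_vec (AB_potential a al x))"
  by (metis norm_triangle_ineq4)
 then show ?thesis by (simp add: norm_smult norm_complex_vec norm_AB_potential mult.commute)
qed

lemma classical_grad_mult:
 assumes u: "u \<in> test_functions (S - {a})" and h: "smooth_on (- {a}) h"
 shows "classical_grad (%x. h x * u x) = (%x. h x *s classical_grad u x + u x *s classical_grad h x)"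
proof
 fix x
 show "classical_grad (%x. h x * u x) x = h x *s classical_grad u x + u x *s classical_grad h x"
 proof (cases "x = a")
  case True
  then have "u x = 0" "partial_deriv i u x = 0" "partial_deriv i (%x. h x * u x) x = 0" for i
   using test_functions_zero[OF u] test_functions_zero[OF test_functions_partial[OF u]]
    test_functions_zero[OF test_functions_partial[OF test_functions_mult_off[OF u h]]] by auto
  then show ?thesis by (simp add: classical_grad_def vec_eq_iff)
 next
  case False
  then show ?thesis
   by (simp add: vec_eq_iff classical_grad_def partial_deriv_mult test_functions_differentiable[OF u] smooth_on_differentiable[OF h])
 qed
qed

section \<open>The form domain on a bounded open set\<close>

locale bounded_domain =
 fixes \<Omega> :: "(real^2) set"
 assumes bdd: "bounded \<Omega>" and opn: "open \<Omega>"
begin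

abbreviation "M \<equiv> lebesgue_on \<Omega>"

abbreviation meas :: "(real^2 => 'a :: topological_space) => bool" where
 "meas f \<equiv> f \<in> borel_measurable M"

abbreviation "test a \<equiv> test_functions (\<Omega> - {a})"

abbreviation "ip u v \<equiv> L2_inner \<Omega> u v"

lemma domain_sets: "\<Omega> \<in> sets lebesgue" "\<Omega> \<in> sets borel"
 using opn by auto

lemma finite_M: "finite_measure M"
 using bdd opn by (intro finite_measure_lebesgue_on lmeasurable_open)

lemma borel_M: "f \<in> borel_measurable borel ==> meas f"
 by (intro measurable_restrict_space1 measurable_completion) simp

lemma nn_integral_M:
 assumes "f \<in> borel_measurable borel" "!!x. x \<notin> \<Omega> ==> f x = 0"
 shows "(\<integral>\<^sup>+x. f x \<partial>M) = (\<integral>\<^sup>+x. f x \<partial>lborel)"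
proof -
 have "(\<integral>\<^sup>+x. f x \<partial>M) = (\<integral>\<^sup>+x. f x * indicator \<Omega> x \<partial>lebesgue)"
  using domain_sets by (simp add: nn_integral_restrict_space)
 also have "... = (\<integral>\<^sup>+x. f x \<partial>lebesgue)" by (rule nn_integral_cong) (auto simp: indicator_def assms(2))
 finally show ?thesis by (simp add: nn_integral_completion)
qed

lemma integral_M:
 fixes f :: "real^2 => 'b :: euclidean_space"
 assumes "f \<in> borel_measurable borel" "!!x. x \<notin> \<Omega> ==> f x = 0"
 shows "(LINT x|M. f x) = (LINT x|lborel. f x)"
proof -
 have "(LINT x|M. f x) = (LINT x|lebesgue. indicator \<Omega> x *\<^sub>R f x)"
  using domain_sets by (simp add: integral_restrict_space)
 also have "... = (LINT x|lebesgue. f x)"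
  by (rule b_integral_cong) (auto simp: indicator_def assms(2))
 also have "... = (LINT x|lborel. f x)" using assms(1) by (intro integral_completion) simp
 finally show ?thesis .
qed

lemma l2_M:
 fixes f :: "real^2 => 'b :: {banach, second_countable_topology}"
 assumes f: "f \<in> borel_measurable borel" "!!x. x \<notin> \<Omega> ==> f x = 0"
 shows "L2 M f \<longleftrightarrow> L2 lborel f" "l2 M f = l2 lborel f"
proof -
 have [measurable]: "f \<in> borel_measurable borel" by fact
 have n: "(\<integral>\<^sup>+x. ennreal ((norm (f x))^2) \<partial>M) = (\<integral>\<^sup>+x. ennreal ((norm (f x))^2) \<partial>lborel)"
  by (rule nn_integral_M) (auto simp: f(2))
 have "(LINT x|M. (norm (f x))^2) = (LINT x|lborel. (norm (f x))^2)" by (rule integral_M) (auto simp: f(2))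
 then show "l2 M f = l2 lborel f" by (simp add: l2_def)
 show "L2 M f \<longleftrightarrow> L2 lborel f"
 proof
  assume "L2 M f"
  from L2_nn_integral[OF this] show "L2 lborel f" unfolding n by (intro L2I_nn_integral) auto
 next
  assume "L2 lborel f"
  from L2_nn_integral[OF this] show "L2 M f" unfolding n[symmetric] by (intro L2I_nn_integral borel_M f(1)) auto
 qed
qed

lemma triple_measurable:
 assumes [measurable]: "meas u" "meas g"
 shows "meas (triple a u g)"
proof -
 have [measurable]: "meas (%x. cx (norm (x - a)))"
  by (intro borel_M borel_measurable_continuous_onI continuous_intros)
 show ?thesis unfolding triple_def[abs_def] by measurable
qed

lemma test_functions_triple:
 assumes "fi \<in> test a"
 shows "L2 M (triple a fi (classical_grad fi))"
proof -
 have z: "fi x = 0" "classical_grad fi x = 0" if "x \<notin> \<Omega>" for x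
  using that test_functions_zero[OF assms] test_functions_zero[OF test_functions_partial[OF assms]]
  by (auto simp: classical_grad_def vec_eq_iff)
 have L: "L2 M fi" "L2 M (classical_grad fi)"
  using l2_M(1)[OF test_functions_borel[OF assms] z(1)] l2_M(1)[OF classical_grad_borel[OF assms] z(2)]
   test_functions_L2[OF assms] classical_grad_L2[OF assms] by auto
 obtain r where r: "r > 0" "!!x. dist x a < r ==> fi x = 0" using test_functions_vanish_near[OF assms] by blast
 have b: "norm (fi x) / norm (x - a) <= 1 / r * norm (fi x)" for x
 proof (cases "dist x a < r")
  case False
  then have "norm (fi x) / norm (x - a) <= norm (fi x) / r"
   using r(1) by (intro divide_left_mono mult_pos_pos) (auto simp: dist_norm)
  then show ?thesis by simp
 qed (use r in simp)
 have L3: "L2 M (%x. norm (classical_grad fi x) + (1 + 1 / r) * norm (fi x))"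
  by (intro L2_add(1) L2_dominated(1)[OF L(1), where K = "1 + 1 / r"] L2_dominated(1)[OF L(2), where K = 1])
    (use r L in \<open>auto simp: L2_def\<close>)
 have "norm (triple a fi (classical_grad fi) x) <= 1 * norm (norm (classical_grad fi x) + (1 + 1 / r) * norm (fi x))" for x
  using norm_triple_le_sum[of a fi "classical_grad fi" x] b[of x] r(1) by (simp add: algebra_simps)
 then show ?thesis
  using L2_dominated(1)[OF L3 triple_measurable[OF L2_measurable[OF L(1)] L2_measurable[OF L(2)]] AE_I2 zero_le_one]
  by blast
qed

lemma H_limitE:
 assumes "H_limit \<Omega> a u g"
 obtains fi where "!!n. fi n \<in> test a" "L2 M (triple a u g)"
  "(%n. l2 M (%x. triple a (fi n) (classical_grad (fi n)) x - triple a u g x)) ----> 0"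
proof -
 note H = assms[unfolded H_limit_def]
 note m = H[THEN conjunct1] H[THEN conjunct2, THEN conjunct1]
 obtain fi where P: "(\<forall>n. fi n \<in> test a) \<and>
   (%n. \<integral>\<^sup>+ x. ennreal ((norm (classical_grad (fi n) x - g x))^2 + (norm (fi n x - u x))^2 +
         (norm (fi n x - u x) / norm (x - a))^2) \<partial>M) ----> 0"
  using H[THEN conjunct2, THEN conjunct2] by (elim exE) (erule that)
 note lim = P[THEN conjunct2]
 have fi: "!!n. fi n \<in> test a" using P by (rule conjunct1[THEN spec])
 let ?d = "%n x. triple a (fi n) (classical_grad (fi n)) x - triple a u g x"
 have lim': "(%n. \<integral>\<^sup>+ x. ennreal ((norm (?d n x))^2) \<partial>M) ----> 0"
  using lim by (simp only: triple_diff norm_triple)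
 note Lt = test_functions_triple[OF fi]
 have md: "meas (?d n)" for n
  using L2_measurable[OF Lt[of n]] triple_measurable[OF m] by (rule borel_measurable_diff)
 \<comment> \<open>A single approximant at finite distance already makes the limit square
   integrable.\<close>
 have "eventually (%n. (\<integral>\<^sup>+ x. ennreal ((norm (?d n x))^2) \<partial>M) < 1) sequentially"
  using lim' by (rule order_tendstoD) simp
 then obtain n where "(\<integral>\<^sup>+ x. ennreal ((norm (?d n x))^2) \<partial>M) < 1" by (auto dest: eventually_happens)
 then have "L2 M (?d n)" using md by (intro L2I_nn_integral) (auto intro: less_trans)
 from L2_diff(1)[OF Lt[of n] this] have LT: "L2 M (triple a u g)" by simp
 have "(%n. ennreal ((l2 M (?d n))^2)) ----> 0"
  using lim' by (simp only: L2_nn_integral[OF L2_diff(1)[OF Lt LT]])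
 then have "(%n. (l2 M (?d n))^2) ----> 0" by (subst (asm) ennreal_tendsto_0_iff) auto
 from tendsto_real_sqrt[OF this] have "(%n. l2 M (?d n)) ----> 0" by (simp add: l2_nonneg)
 with fi LT that show ?thesis by blast
qed

lemma H_limitI:
 assumes fi: "!!n. fi n \<in> test a" and m: "meas u" "meas g"
  and LT: "L2 M (triple a u g)"
  and lim: "(%n. l2 M (%x. triple a (fi n) (classical_grad (fi n)) x - triple a u g x)) ----> 0"
 shows "H_limit \<Omega> a u g"
proof -
 have "(%n. (l2 M (%x. triple a (fi n) (classical_grad (fi n)) x - triple a u g x))^2) ----> 0"
  using tendsto_power[OF lim, of 2] by simp
 then have "(%n. ennreal ((l2 M (%x. triple a (fi n) (classical_grad (fi n)) x - triple a u g x))^2)) ----> 0"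
  by (subst ennreal_tendsto_0_iff) auto
 then have "(%n. \<integral>\<^sup>+ x. ennreal ((norm (triple a (fi n) (classical_grad (fi n)) x - triple a u g x))^2) \<partial>M) ----> 0"
  by (simp only: L2_nn_integral[OF L2_diff(1)[OF test_functions_triple[OF fi] LT]])
 then have "(%n. \<integral>\<^sup>+ x. ennreal ((norm (classical_grad (fi n) x - g x))^2 + (norm (fi n x - u x))^2 +
         (norm (fi n x - u x) / norm (x - a))^2) \<partial>M) ----> 0"
  by (simp only: triple_diff norm_triple)
 then show ?thesis using fi m unfolding H_limit_def by blast
qed

lemma H_limit_measurable:
 assumes "H_limit \<Omega> a u g" shows "meas u" "meas g"
 using assms by (auto simp: H_limit_def)

lemma H_limit_L2:
 assumes "H_limit \<Omega> a u g"
 shows "L2 M (triple a u g)" "L2 M g" "L2 M u" "L2 M (%x. u x / cx (norm (x - a)))"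
  "L2 M (pgrad a al u g)"
proof -
 show T: "L2 M (triple a u g)" using H_limitE[OF assms] by blast
 note m = H_limit_measurable[OF assms]
 note [measurable] = m
 have [measurable]: "meas (%x. cx (norm (x - a)))"
  by (intro borel_M borel_measurable_continuous_onI continuous_intros)
 show "L2 M g" by (rule L2_dominated(1)[OF T, of _ 1]) (use norm_triple_le in \<open>auto simp: m\<close>)
 show "L2 M u" by (rule L2_dominated(1)[OF T, of _ 1]) (use norm_triple_le in \<open>auto simp: m\<close>)
 show "L2 M (%x. u x / cx (norm (x - a)))"
  by (rule L2_dominated(1)[OF T, of _ 1]) (use norm_triple_le in \<open>auto simp: norm_divide\<close>)
 have [measurable]: "meas (%x. cx (AB_potential a al x $ j))" for j
  by (rule borel_M) measurable
 have "meas (pgrad a al u g)"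
 proof (rule borel_measurable_cvec2)
  have [measurable]: "meas (%x. g x $ j)" for j
   by (rule measurable_compose[OF m(2)]) (intro borel_measurable_continuous_onI continuous_intros)
  show "meas (%x. pgrad a al u g x $ j)" for j
   unfolding pgrad_def complex_vec_def by simp measurable
 qed
 then show "L2 M (pgrad a al u g)"
  by (rule L2_dominated(1)[OF T, of _ "1 + \<bar>al\<bar>"]) (use norm_pgrad_le in auto)
qed

lemma classical_grad_add:
 assumes "u \<in> test_functions S" "v \<in> test_functions S"
 shows "classical_grad (%x. u x + v x) = (%x. classical_grad u x + classical_grad v x)"
 by (auto simp: fun_eq_iff vec_eq_iff classical_grad_def partial_deriv_add test_functions_differentiable[OF assms(1)]
   test_functions_differentiable[OF assms(2)])

lemma H_limit_add:
 assumes "H_limit \<Omega> a u g" "H_limit \<Omega> a v h"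
 shows "H_limit \<Omega> a (%x. u x + v x) (%x. g x + h x)"
proof -
 obtain fi where fi: "!!n. fi n \<in> test a" and T: "L2 M (triple a u g)"
  and lim: "(%n. l2 M (%x. triple a (fi n) (classical_grad (fi n)) x - triple a u g x)) ----> 0"
  using H_limitE[OF assms(1)] by blast
 obtain \<psi> where \<psi>: "!!n. \<psi> n \<in> test a" and T': "L2 M (triple a v h)"
  and lim': "(%n. l2 M (%x. triple a (\<psi> n) (classical_grad (\<psi> n)) x - triple a v h x)) ----> 0"
  using H_limitE[OF assms(2)] by blast
 note m = H_limit_measurable[OF assms(1)] H_limit_measurable[OF assms(2)]
 let ?d = "%n x. triple a (fi n) (classical_grad (fi n)) x - triple a u g x"
 let ?d' = "%n x. triple a (\<psi> n) (classical_grad (\<psi> n)) x - triple a v h x"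
 show ?thesis
 proof (rule H_limitI)
  show "(%x. fi n x + \<psi> n x) \<in> test a" for n by (intro test_functions_add fi \<psi>)
  show "meas (%x. u x + v x)" "meas (%x. g x + h x)"
   using m by (auto intro: borel_measurable_add)
  show "L2 M (triple a (%x. u x + v x) (%x. g x + h x))"
   using L2_add(1)[OF T T'] by (simp only: triple_add)
  have "(%x. triple a (%x. fi n x + \<psi> n x) (classical_grad (%x. fi n x + \<psi> n x)) x - triple a (%x. u x + v x) (%x. g x + h x) x)
    = (%x. ?d n x + ?d' n x)" for n
   unfolding classical_grad_add[OF fi \<psi>] by (simp add: triple_def fun_eq_iff add_divide_distrib algebra_simps)
  then have b: "l2 M (%x. triple a (%x. fi n x + \<psi> n x) (classical_grad (%x. fi n x + \<psi> n x)) x - triple a (%x. u x + v x) (%x. g x + h x) x)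
    <= l2 M (?d n) + l2 M (?d' n)" for n
   using L2_add(2)[OF L2_diff(1)[OF test_functions_triple[OF fi[of n]] T] L2_diff(1)[OF test_functions_triple[OF \<psi>[of n]] T']]
   by simp
  have z: "(%n. l2 M (?d n) + l2 M (?d' n)) ----> 0" using tendsto_add[OF lim lim'] by simp
  show "(%n. l2 M (%x. triple a (%x. fi n x + \<psi> n x) (classical_grad (%x. fi n x + \<psi> n x)) x - triple a (%x. u x + v x) (%x. g x + h x) x)) ----> 0"
   by (rule tendsto_sandwich[OF always_eventually[OF allI[OF l2_nonneg]] always_eventually[OF allI[OF b]] tendsto_const z])
 qed
qed

lemma AE_M_neq: "AE x in M. x ~= a"
proof -
 have "AE x in lebesgue. x ~= a" using AE_lborel_singleton[of a] by (rule AE_completion)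
 then show ?thesis using domain_sets by (subst AE_restrict_space_iff) auto
qed

text \<open>A transfer principle: an operation compatible with differences, which maps test
  functions to test functions with a known rule for the gradient and is bounded from the norm at
  \<open>a\<close> to the norm at \<open>b\<close>, maps limits to limits. Multiplication, change of
  variables and conjugation are the instances.\<close>

lemma H_limit_map:
 assumes H: "H_limit \<Omega> a u g"
  and test: "!!v. v \<in> test a ==> T v \<in> test b"
   "!!v. v \<in> test a ==> classical_grad (T v) = G v (classical_grad v)"
  and diff: "!!v f v' f' x. triple b (T v) (G v f) x - triple b (T v') (G v' f') x
   = triple b (T (%x. v x - v' x)) (G (%x. v x - v' x) (%x. f x - f' x)) x"
  and meas: "!!v f. meas v ==> meas f ==> meas (T v) \<and> meas (G v f)"
  and bound: "!!v f. L2 M (triple a v f) ==> meas v ==> meas f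
   ==> L2 M (triple b (T v) (G v f)) \<and> l2 M (triple b (T v) (G v f)) <= C * l2 M (triple a v f)"
 shows "H_limit \<Omega> b (T u) (G u g)"
proof -
 obtain fi where fi: "!!n. fi n \<in> test a" and L: "L2 M (triple a u g)"
  and lim: "(%n. l2 M (%x. triple a (fi n) (classical_grad (fi n)) x - triple a u g x)) ----> 0"
  using H_limitE[OF H] by blast
 note m = H_limit_measurable[OF H]
 have le: "l2 M (%x. triple b (T (fi n)) (classical_grad (T (fi n))) x - triple b (T u) (G u g) x)
   <= C * l2 M (%x. triple a (fi n) (classical_grad (fi n)) x - triple a u g x)" for n
 proof -
  have "meas (%x. fi n x - u x)" "meas (%x. classical_grad (fi n) x - g x)"
   using borel_M[OF test_functions_borel[OF fi[of n]]] borel_M[OF classical_grad_borel[OF fi[of n]]] m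
   by (auto intro: borel_measurable_diff)
  moreover have "L2 M (triple a (%x. fi n x - u x) (%x. classical_grad (fi n) x - g x))"
   using L2_diff(1)[OF test_functions_triple[OF fi] L] by (simp only: triple_diff)
  ultimately have "l2 M (triple b (T (%x. fi n x - u x)) (G (%x. fi n x - u x) (%x. classical_grad (fi n) x - g x)))
   <= C * l2 M (triple a (%x. fi n x - u x) (%x. classical_grad (fi n) x - g x))"
   using bound by blast
  then show ?thesis unfolding test(2)[OF fi] diff triple_diff[of a] .
 qed
 have z: "(%n. C * l2 M (%x. triple a (fi n) (classical_grad (fi n)) x - triple a u g x)) ----> 0"
  using tendsto_mult[OF tendsto_const lim, of C] by simp
 show ?thesis
  by (rule H_limitI[OF test(1)[OF fi] meas[OF m, THEN conjunct1] meas[OF m, THEN conjunct2] bound[OF L m, THEN conjunct1]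
    tendsto_sandwich[OF always_eventually[OF allI[OF l2_nonneg]] always_eventually[OF allI[OF le]] tendsto_const z]])
qed

text \<open>The gradient of the multiplier may grow like 1 / |x - a|, since the product with
  \<open>u\<close> is then controlled by the weighted term of the norm. This covers the angular
  factors, which are discontinuous at the pole.\<close>

lemma H_limit_mult_off:
 assumes H: "H_limit \<Omega> a u g" and h: "smooth_on (- {a}) h"
  and B: "!!x. x \<in> \<Omega> - {a} ==> norm (h x) <= B1" "!!x. x \<in> \<Omega> - {a} ==> norm (classical_grad h x) <= B2 / norm (x - a)"
 shows "H_limit \<Omega> a (%x. h x * u x) (%x. h x *s g x + u x *s classical_grad h x)"
proof -
 define K where "K = 3 * \<bar>B1\<bar> + \<bar>B2\<bar>"
 have bound: "norm (triple a (%x. h x * v x) (%x. h x *s f x + v x *s classical_grad h x) x) <= K * norm (triple a v f x)"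
  if x: "x \<in> \<Omega> - {a}" for v f x
 proof -
  have B': "norm (h x) <= \<bar>B1\<bar>" "norm (classical_grad h x) <= \<bar>B2\<bar> / norm (x - a)"
   using B(1)[OF x] order_trans[OF B(2)[OF x] divide_right_mono[OF abs_ge_self]] by auto
  have "norm (v x) * norm (classical_grad h x) <= norm (v x) * (\<bar>B2\<bar> / norm (x - a))" by (rule mult_left_mono[OF B'(2)]) simp
  then have B2: "norm (v x) * norm (classical_grad h x) <= (norm (v x) / norm (x - a)) * \<bar>B2\<bar>" by simp
  have "norm (triple a (%x. h x * v x) (%x. h x *s f x + v x *s classical_grad h x) x)
   <= norm (h x *s f x + v x *s classical_grad h x) + norm (h x * v x) + norm (h x * v x) / norm (x - a)"
   by (rule norm_triple_le_sum)
  also have "... <= (norm (h x) * norm (f x) + norm (v x) * norm (classical_grad h x)) + norm (h x) * norm (v x) + norm (h x) * (norm (v x) / norm (x - a))"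
   using norm_triangle_ineq[of "h x *s f x" "v x *s classical_grad h x"] by (simp add: norm_smult norm_mult)
  also have "... <= (\<bar>B1\<bar> * norm (triple a v f x) + norm (triple a v f x) * \<bar>B2\<bar>) + \<bar>B1\<bar> * norm (triple a v f x) + \<bar>B1\<bar> * norm (triple a v f x)"
   by (intro add_mono mult_mono B'(1) order_trans[OF B2 mult_right_mono] norm_triple_le) auto
  finally show ?thesis by (simp add: K_def algebra_simps)
 qed
 have mh: "meas h" "!!j. meas (%x. classical_grad h x $ j)"
  by (auto simp: classical_grad_def intro!: borel_M borel_measurable_continuous_countable_exceptions[of "{a}"]
    smooth_on_continuous smooth_on_partial h)
 have mg: "meas (%x. h x *s f x + v x *s classical_grad h x)"
  if [measurable]: "meas v" "meas f" for v f
 proof (rule borel_measurable_cvec2)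
  note [measurable] = mh
  have [measurable]: "meas (%x. f x $ j)" for j
   by (rule measurable_compose[OF that(2)]) (intro borel_measurable_continuous_onI continuous_intros)
  show "meas (%x. (h x *s f x + v x *s classical_grad h x) $ j)" for j
   by simp
 qed
 have AEb: "AE x in M. norm (triple a (%x. h x * v x) (%x. h x *s f x + v x *s classical_grad h x) x) <= K * norm (triple a v f x)" for v f
  using AE_M_neq[of a] AE_space[of M] by eventually_elim (auto intro: bound)
 have K0: "K >= 0" by (simp add: K_def)
 show ?thesis
 proof (rule H_limit_map[OF H, where T = "%v x. h x * v x" and G = "%v f x. h x *s f x + v x *s classical_grad h x" and C = K])
  fix v :: "real^2 => complex" and f :: "real^2 => complex^2"
  assume m: "meas v" "meas f"
  have mv: "meas (%x. h x * v x)" using m mh by auto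
  then show "meas (%x. h x * v x) \<and> meas (%x. h x *s f x + v x *s classical_grad h x)"
   using mg[OF m] by simp
  assume L: "L2 M (triple a v f)"
  show "L2 M (triple a (%x. h x * v x) (%x. h x *s f x + v x *s classical_grad h x))
   \<and> l2 M (triple a (%x. h x * v x) (%x. h x *s f x + v x *s classical_grad h x)) <= K * l2 M (triple a v f)"
   using L2_dominated[OF L triple_measurable[OF mv mg[OF m]] AEb K0] by simp
 qed ((rule test_functions_mult_off[OF _ h] classical_grad_mult[OF _ h], assumption)+,
   simp_all add: triple_def vec_eq_iff algebra_simps diff_divide_distrib)
qed

lemma H_limit_mult:
 assumes H: "H_limit \<Omega> a u g" and h: "smooth_on UNIV h"
 shows "H_limit \<Omega> a (%x. h x * u x) (%x. h x *s g x + u x *s classical_grad h x)"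
proof -
 have "continuous_on UNIV (%x. norm (x - a) *\<^sub>R classical_grad h x)"
  unfolding classical_grad_def[abs_def]
  by (intro continuous_on_vec_lambda continuous_intros smooth_on_continuous smooth_on_partial h)
 then have "bounded (h ` closure \<Omega>)" "bounded ((%x. norm (x - a) *\<^sub>R classical_grad h x) ` closure \<Omega>)"
  using bdd smooth_on_continuous[OF h] by (auto intro!: compact_imp_bounded compact_continuous_image intro: continuous_on_subset)
 then obtain B1 B2 where B: "\<forall>x\<in>closure \<Omega>. norm (h x) <= B1" "\<forall>x\<in>closure \<Omega>. norm (x - a) * norm (classical_grad h x) <= B2"
  unfolding bounded_iff by auto
 show ?thesis
 proof (rule H_limit_mult_off[OF H smooth_on_subset[OF h]])
  fix x assume x: "x \<in> \<Omega> - {a}"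
  then have "x \<in> closure \<Omega>" using closure_subset[of \<Omega>] by auto
  then show "norm (h x) <= B1" "norm (classical_grad h x) <= B2 / norm (x - a)"
   using B x by (auto simp: pos_le_divide_eq mult.commute)
 qed simp
qed

lemma classical_grad_const: "classical_grad (%x. c) = (%x. 0)"
 by (simp add: fun_eq_iff vec_eq_iff classical_grad_def partial_deriv_const)

lemma H_limit_cmult: "H_limit \<Omega> a u g ==> H_limit \<Omega> a (%x. c * u x) (%x. c *s g x)"
 using H_limit_mult[OF _ smooth_on_const[of UNIV c], of a u g] by (simp add: classical_grad_const)

lemma H_limit_diff:
 assumes "H_limit \<Omega> a u g" "H_limit \<Omega> a v h"
 shows "H_limit \<Omega> a (%x. u x - v x) (%x. g x - h x)"
 using H_limit_add[OF assms(1) H_limit_cmult[OF assms(2), of "-1"]] by simp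

lemma test_functions_H_limit:
 assumes "fi \<in> test a"
 shows "H_limit \<Omega> a fi (classical_grad fi)"
 by (rule H_limitI[of "%_. fi"])
   (use assms in \<open>auto simp: l2_def intro: borel_M test_functions_borel classical_grad_borel test_functions_triple\<close>)

text \<open>The weak gradient is tested against the derivatives of its own approximants.\<close>

lemma H_limit_grad_zero:
 assumes H: "H_limit \<Omega> a w d" and w: "AE x in M. w x = 0"
 shows "AE x in M. d x = 0"
proof -
 obtain fi where fi: "!!n. fi n \<in> test a" and T: "L2 M (triple a w d)"
  and lim: "(%n. l2 M (%x. triple a (fi n) (classical_grad (fi n)) x - triple a w d x)) ----> 0"
  using H_limitE[OF H] by blast
 note L = H_limit_L2[OF H] and Lp = H_limit_L2[OF test_functions_H_limit[OF fi]]
 have comp: "(%n. l2 M (%x. fi n x - w x)) ----> 0" "!!j. (%n. l2 M (%x. partial_deriv j (fi n) x - d x $ j)) ----> 0"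
  and Lj: "!!j. L2 M (%x. d x $ j)"
 proof -
  have dm: "meas (%x. d x $ j)" for j
   by (rule measurable_compose[OF L2_measurable[OF L(2)]]) (intro borel_measurable_continuous_onI continuous_intros)
  have jn: "norm (v $ j) <= norm v" for v :: "complex^2" and j
   by (rule power2_le_imp_le) (use exhaust_2[of j] in \<open>auto simp: norm_cvec2\<close>)
  show Lj: "L2 M (%x. d x $ j)" for j by (rule L2_dominated(1)[OF L(2) dm, of _ 1]) (auto simp: jn)
  have LL: "L2 M (%x. triple a (fi n) (classical_grad (fi n)) x - triple a w d x)" for n
   by (rule L2_diff(1)[OF Lp(1) L(1)])
  have m1: "meas (%x. fi n x - w x)" for n
   using L2_measurable[OF L2_diff(1)[OF Lp(3) L(3)]] .
  have m2: "meas (%x. partial_deriv j (fi n) x - d x $ j)" for n j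
   using borel_M[OF test_functions_partial_borel[OF fi[of n], of j]] dm by (rule borel_measurable_diff)
  have b1: "l2 M (%x. fi n x - w x) <= 1 * l2 M (%x. triple a (fi n) (classical_grad (fi n)) x - triple a w d x)" for n
  proof (rule L2_dominated(2)[OF LL m1], rule AE_I2)
   fix x show "norm (fi n x - w x) <= 1 * norm (triple a (fi n) (classical_grad (fi n)) x - triple a w d x)"
    unfolding triple_diff mult_1 by (rule norm_triple_le)
  qed simp
  have b2: "l2 M (%x. partial_deriv j (fi n) x - d x $ j) <= 1 * l2 M (%x. triple a (fi n) (classical_grad (fi n)) x - triple a w d x)" for n j
  proof (rule L2_dominated(2)[OF LL m2], rule AE_I2)
   fix x
   have "norm (partial_deriv j (fi n) x - d x $ j) = norm ((classical_grad (fi n) x - d x) $ j)" by (simp add: classical_grad_def)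
   also have "... <= norm (classical_grad (fi n) x - d x)" by (rule jn)
   also have "... <= norm (triple a (fi n) (classical_grad (fi n)) x - triple a w d x)"
    unfolding triple_diff by (rule norm_triple_le)
   finally show "norm (partial_deriv j (fi n) x - d x $ j) <= 1 * norm (triple a (fi n) (classical_grad (fi n)) x - triple a w d x)" by simp
  qed simp
  have z: "(%n. 1 * l2 M (%x. triple a (fi n) (classical_grad (fi n)) x - triple a w d x)) ----> 0" using lim by simp
  show "(%n. l2 M (%x. fi n x - w x)) ----> 0"
   by (rule tendsto_sandwich[OF always_eventually[OF allI[OF l2_nonneg]] always_eventually[OF allI[OF b1]] tendsto_const z])
  show "(%n. l2 M (%x. partial_deriv j (fi n) x - d x $ j)) ----> 0" for j
   by (rule tendsto_sandwich[OF always_eventually[OF allI[OF l2_nonneg]] always_eventually[OF allI[OF b2]] tendsto_const z])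
 qed
 have z0: "L2 M (%x :: real^2. 0 :: complex)" by (simp add: L2_def)
 have limw: "(%n. l2 M (%x. fi n x - 0)) ----> 0"
 proof -
  have "l2 M (%x. fi n x - 0) = l2 M (%x. fi n x - w x)" for n
   by (rule L2_cong_AE(2)[OF L2_diff(1)[OF Lp(3) L(3)]])
     (use w L2_measurable[OF Lp(3)[of n]] in auto)
  then show ?thesis using comp(1) by simp
 qed
 have Lpd: "L2 M (partial_deriv j (fi n))" for j n
  using H_limit_L2(3)[OF test_functions_H_limit[OF test_functions_partial[OF fi]]] .
 have "l2 M (%x. d x $ j) = 0" for j
 proof -
  \<comment> \<open>Integration by parts moves the derivative from the approximant
    \<open>fi n\<close> to the fixed \<open>fi m\<close>; as n grows, \<open>fi n\<close> tends to
    \<open>w\<close>, which is 0 almost everywhere. Letting m grow afterwards gives the squared norm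
    of the component of \<open>d\<close>.\<close>
  have orth: "(LINT x|M. d x $ j * cnj (partial_deriv j (fi m) x)) = 0" for m
  proof -
   let ?v = "%x. cnj (partial_deriv j (fi m) x)"
   have sv: "smooth_on UNIV ?v" by (intro smooth_on_cnj test_functions_smooth[OF test_functions_partial[OF fi]]) simp
   note ph = test_functions_partial[OF fi[of m], of j]
   have pv: "partial_deriv j ?v x = cnj (partial_deriv j (partial_deriv j (fi m)) x)" for x
    by (rule partial_deriv_cnj[OF test_functions_differentiable[OF ph]])
   have z: "v x = 0" if "v \<in> test a" "x \<notin> \<Omega>" for v x using test_functions_zero[OF that(1)] that(2) by auto
   have ibp: "(LINT x|M. partial_deriv j (fi n) x * ?v x) = - (LINT x|M. fi n x * cnj (partial_deriv j (partial_deriv j (fi m)) x))" for n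
   proof -
    note mm = test_functions_borel[OF fi[of n]] test_functions_borel[OF test_functions_partial[OF fi[of n], of j]]
     test_functions_borel[OF ph] test_functions_borel[OF test_functions_partial[OF ph, of j]]
    note [measurable] = mm
    have [measurable]: "cnj \<in> borel_measurable borel" by (intro borel_measurable_continuous_onI continuous_intros)
    have "(%x. fi n x * cnj (partial_deriv j (partial_deriv j (fi m)) x)) \<in> borel_measurable borel"
     "(%x. partial_deriv j (fi n) x * cnj (partial_deriv j (fi m) x)) \<in> borel_measurable borel" by measurable
    then show ?thesis
     using integral_by_parts[OF fi[of n] sv, of j] unfolding pv
     by (subst (1 2) integral_M) (auto simp: z[OF fi] z[OF ph])
   qed
   have 1: "(%n. LINT x|M. partial_deriv j (fi n) x * ?v x) ----> (LINT x|M. d x $ j * ?v x)"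
    by (rule L2_bilinear_tendsto[OF bounded_bilinear_mult_cnj Lpd Lj comp(2) Lpd Lpd]) (simp add: l2_def)
   have 2: "(%n. LINT x|M. fi n x * cnj (partial_deriv j (partial_deriv j (fi m)) x)) ----> (LINT x|M. 0 * cnj (partial_deriv j (partial_deriv j (fi m)) x))"
    using H_limit_L2(3)[OF test_functions_H_limit[OF test_functions_partial[OF ph, of j]]]
    by (intro L2_bilinear_tendsto[OF bounded_bilinear_mult_cnj Lp(3) z0 limw]) (simp_all add: l2_def)
   have "(%n. LINT x|M. partial_deriv j (fi n) x * ?v x) ----> 0"
    unfolding ibp using tendsto_minus[OF 2] by simp
   from LIMSEQ_unique[OF 1 this] show ?thesis .
  qed
  have "(%m. LINT x|M. d x $ j * cnj (partial_deriv j (fi m) x)) ----> (LINT x|M. d x $ j * cnj (d x $ j))"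
   by (rule L2_bilinear_tendsto[OF bounded_bilinear_mult_cnj Lj Lj _ Lpd Lj comp(2)]) (simp add: l2_def)
  then have "(LINT x|M. d x $ j * cnj (d x $ j)) = 0" unfolding orth by (simp add: LIMSEQ_const_iff)
  moreover have "(LINT x|M. d x $ j * cnj (d x $ j)) = cx ((l2 M (%x. d x $ j))^2)"
   unfolding l2_power2 complex_norm_square[symmetric] by (rule integral_complex_of_real)
  ultimately show ?thesis by simp
 qed
 then have "AE x in M. d x $ j = 0" for j using l2_eq_0_iff[OF Lj] by blast
 then have "AE x in M. d x $ 1 = 0 \<and> d x $ 2 = 0" by (simp add: AE_conj_iff)
 then show ?thesis by eventually_elim (simp add: vec_eq_iff forall_2)
qed

lemma H_limit_grad_unique:
 assumes "H_limit \<Omega> a u g" "H_limit \<Omega> a v h" "AE x in M. u x = v x"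
 shows "AE x in M. g x = h x"
 using H_limit_grad_zero[OF H_limit_diff[OF assms(1,2)]] assms(3) by simp

lemma H10_grad: "u \<in> H10 \<Omega> a ==> H_limit \<Omega> a u (grad \<Omega> a u)"
 unfolding H10_def grad_def by (simp add: someI_ex)

lemma H_limit_grad: "H_limit \<Omega> a u g ==> AE x in M. grad \<Omega> a u x = g x"
 by (rule H_limit_grad_unique[OF H10_grad]) (auto simp: H10_def)

end

section \<open>The spectral gap\<close>

lemma cip_self: "cip x x = cx ((norm x)^2)"
 by (simp add: cip_eq norm_cvec2 complex_norm_square[symmetric] del: of_real_power)

lemma cip_cmult_left: "cip (c *s x) y = c * cip x y"
 by (simp add: cip_eq algebra_simps)

text \<open>Half-integrality of the circulation is passed on in this form: the twisting factor of
  Hardy's inequality is -1 after a full turn.\<close>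

lemma exp_half_turn: "exp ((2 * pi) *\<^sub>R (- \<i> * cx (1/2 + of_int m))) = -1"
proof -
 have "(2 * pi) *\<^sub>R (- \<i> * cx (1/2 + of_int m)) = \<i> * cx (- pi + 2 * pi * of_int (- m))"
  by (simp add: scaleR_conv_of_real algebra_simps)
 then have "exp ((2 * pi) *\<^sub>R (- \<i> * cx (1/2 + of_int m))) = cis (- pi) * cis (2 * pi * of_int (- m))"
  by (simp only: cis_conv_exp[symmetric] cis_mult)
 also have "cis (2 * pi * of_int (- m)) = 1" by (rule cis_multiple_2pi) simp
 also have "cis (- pi) = -1" by (simp add: complex_eq_iff)
 finally show ?thesis by simp
qed

context bounded_domain
begin

abbreviation "tdist a u g v h \<equiv> l2 M (%x. triple a u g x - triple a v h x)"

definition mform :: "real => (real^2 => complex) => (real^2 => complex^2) => (real^2 => complex) => (real^2 => complex^2) => complex" where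
 "mform al u g v h = (LINT x|M. cip (pgrad 0 al u g x) (pgrad 0 al v h x))"

lemma H_limit_approx:
 assumes "H_limit \<Omega> a u g" "e > 0"
 shows "\<exists>fi. fi \<in> test a \<and> tdist a fi (classical_grad fi) u g < e"
proof -
 obtain fi where fi: "!!n. fi n \<in> test a"
  and lim: "(%n. tdist a (fi n) (classical_grad (fi n)) u g) ----> 0"
  using H_limitE[OF assms(1)] by blast
 have "eventually (%n. tdist a (fi n) (classical_grad (fi n)) u g < e) sequentially"
  using lim assms(2) by (rule order_tendstoD)
 from eventually_happens'[OF sequentially_bot this] obtain n
  where "tdist a (fi n) (classical_grad (fi n)) u g < e" by (elim exE)
 with fi[of n] show ?thesis by (intro exI[of _ "fi n"] conjI)
qed

lemma H_limit_approx_seq: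
 fixes u :: "nat => real^2 => complex"
 assumes "!!n. H_limit \<Omega> a (u n) (g n)"
 obtains fi where "!!n. fi n \<in> test a"
  "!!n. l2 M (%x. triple a (fi n) (classical_grad (fi n)) x - triple a (u n) (g n) x) < 1 / real (Suc n)"
proof -
 have "\<forall>n. \<exists>fi. fi \<in> test a \<and> l2 M (%x. triple a fi (classical_grad fi) x - triple a (u n) (g n) x) < 1 / real (Suc n)"
  using H_limit_approx[OF assms] by simp
 from choice[OF this] obtain fi where *: "\<forall>n. fi n \<in> test a \<and>
  l2 M (%x. triple a (fi n) (classical_grad (fi n)) x - triple a (u n) (g n) x) < 1 / real (Suc n)" by (elim exE)
 show ?thesis by (rule that[OF *[rule_format, THEN conjunct1] *[rule_format, THEN conjunct2]])
qed

lemma inverse_Suc_small: "e > 0 ==> \<exists>N. \<forall>n\<ge>N. 1 / real (Suc n) < (e :: real)"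
 using order_tendstoD(2)[OF LIMSEQ_Suc[OF lim_1_over_n], of e] by (simp add: eventually_sequentially)

text \<open>The L2 limit of the triples is again a triple: along the subsequence converging almost
  everywhere, the third component stays the second divided by |x - a|. Passing to test functions at
  distance below 1 / (n + 1) exhibits the limit as one of test functions.\<close>

lemma H_limit_complete:
 fixes u :: "nat => real^2 => complex"
 assumes H: "!!n. H_limit \<Omega> a (u n) (g n)"
  and C: "!!e. e > 0 ==> \<exists>N. \<forall>m\<ge>N. \<forall>n\<ge>N. l2 M (%x. triple a (u m) (g m) x - triple a (u n) (g n) x) < e"
 obtains v h where "H_limit \<Omega> a v h" "(%n. tdist a (u n) (g n) v h) ----> 0"
proof -
 obtain fi where fi: "!!n. fi n \<in> test a"
  and cl: "!!n. l2 M (%x. triple a (fi n) (classical_grad (fi n)) x - triple a (u n) (g n) x) < 1 / real (Suc n)"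
  using H_limit_approx_seq[of a u g, OF H] by blast
 define F where "F n = triple a (fi n) (classical_grad (fi n))" for n
 define U where "U n = triple a (u n) (g n)" for n
 have LF: "L2 M (F n)" for n unfolding F_def by (rule test_functions_triple[OF fi])
 have LU: "L2 M (U n)" for n unfolding U_def by (rule H_limit_L2(1)[OF H])
 have cl': "l2 M (%x. F n x - U n x) < 1 / real (Suc n)" for n using cl by (simp add: F_def U_def)
 have CF: "\<exists>N. \<forall>m\<ge>N. \<forall>n\<ge>N. l2 M (%x. F m x - F n x) < e" if e: "e > 0" for e
 proof -
  obtain N1 where N1: "!!m n. m >= N1 ==> n >= N1 ==> l2 M (%x. U m x - U n x) < e / 3"
   using C[of "e / 3"] e by (auto simp: U_def)
  obtain N2 where N2: "!!n. n >= N2 ==> 1 / real (Suc n) < e / 3" using inverse_Suc_small[of "e / 3"] e by auto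
  have "l2 M (%x. F m x - F n x) < e" if "m >= max N1 (N2 :: nat)" "n >= max N1 (N2 :: nat)" for m n
  proof -
   have "l2 M (%x. F m x - F n x) <= l2 M (%x. F m x - U m x) + (l2 M (%x. U m x - U n x) + l2 M (%x. U n x - F n x))"
    using l2_triangle[OF LF[of m] LU[of m] LF[of n]] l2_triangle[OF LU[of m] LU[of n] LF[of n]] by linarith
   moreover have "l2 M (%x. U n x - F n x) = l2 M (%x. F n x - U n x)" by (rule l2_diff_commute)
   ultimately show ?thesis using N1[of m n] N2[of m] N2[of n] cl'[of m] cl'[of n] that by simp
  qed
  then show ?thesis by blast
 qed
 obtain r T where r: "strict_mono r" and T: "L2 M T" and lim: "(%n. l2 M (%x. F n x - T x)) ----> 0"
  and ae: "AE x in M. (%n. F (r n) x) ----> T x"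
  using L2_complete[OF finite_M LF CF] by blast
 define v where "v x = fst (snd (T x))" for x
 define h where "h x = fst (T x)" for x
 have mT: "meas T" by (rule L2_measurable[OF T])
 have mv: "meas v"
  unfolding v_def by (rule measurable_compose[OF mT]) (intro borel_measurable_continuous_onI continuous_intros)
 have mh: "meas h"
  unfolding h_def by (rule measurable_compose[OF mT]) (intro borel_measurable_continuous_onI continuous_intros)
 have eq: "AE x in M. T x = triple a v h x"
  using ae
 proof eventually_elim
  case (elim x)
  have 1: "(%n. snd (snd (F (r n) x))) ----> snd (snd (T x))" by (intro tendsto_intros elim)
  have "(%n. fst (snd (F (r n) x)) * inverse (cx (norm (x - a)))) ----> v x * inverse (cx (norm (x - a)))"
   unfolding v_def by (intro tendsto_intros elim)
  then have 2: "(%n. snd (snd (F (r n) x))) ----> v x * inverse (cx (norm (x - a)))"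
   by (simp add: F_def triple_def divide_inverse)
  from LIMSEQ_unique[OF 1 2] show ?case by (simp add: triple_def v_def h_def prod_eq_iff divide_inverse)
 qed
 note T' = L2_cong_AE(1)[OF T triple_measurable[OF mv mh] eq]
 have le: "l2 M (%x. F n x - triple a v h x) = l2 M (%x. F n x - T x)" for n
  by (rule L2_cong_AE(2)[OF L2_diff(1)[OF LF T] L2_measurable[OF L2_diff(1)[OF LF T']]]) (use eq in eventually_elim, simp)
 have lim': "(%n. l2 M (%x. F n x - triple a v h x)) ----> 0" unfolding le by (rule lim)
 have "H_limit \<Omega> a v h" by (rule H_limitI[OF fi mv mh T']) (use lim' in \<open>simp add: F_def\<close>)
 moreover have "(%n. l2 M (%x. U n x - triple a v h x)) ----> 0"
 proof -
  have b: "l2 M (%x. U n x - triple a v h x) <= 1 / real (Suc n) + l2 M (%x. F n x - triple a v h x)" for n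
   using l2_triangle[OF LU[of n] LF[of n] T'] cl'[of n] l2_diff_commute[of M "U n" "F n"] by linarith
  have z: "(%n. 1 / real (Suc n) + l2 M (%x. F n x - triple a v h x)) ----> 0"
   using tendsto_add[OF LIMSEQ_Suc[OF lim_1_over_n] lim'] by simp
  show ?thesis
   by (rule tendsto_sandwich[OF always_eventually[OF allI[OF l2_nonneg]] always_eventually[OF allI[OF b]] tendsto_const z])
 qed
 ultimately show ?thesis using that by (simp add: U_def)
qed

text \<open>Test functions at distance below 1 / (n + 1) stay bounded, so compactness for test
  functions applies to them, and the approximation errors vanish along any subsequence.\<close>

lemma rellich:
 fixes u :: "nat => real^2 => complex"
 assumes H: "!!n. H_limit \<Omega> a (u n) (g n)" and B: "!!n. l2 M (triple a (u n) (g n)) <= C"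
 obtains r :: "nat => nat" where "strict_mono r"
  "!!e. e > 0 ==> \<exists>N. \<forall>m\<ge>N. \<forall>n\<ge>N. l2 M (%x. u (r m) x - u (r n) x) < e"
proof -
 obtain fi where fi: "!!n. fi n \<in> test a"
  and cl: "!!n. l2 M (%x. triple a (fi n) (classical_grad (fi n)) x - triple a (u n) (g n) x) < 1 / real (Suc n)"
  using H_limit_approx_seq[of a u g, OF H] by blast
 note LF = test_functions_triple[OF fi] and LU = H_limit_L2(1)[OF H]
 have bF: "l2 M (triple a (fi n) (classical_grad (fi n))) <= C + 1" for n
 proof -
  have "1 / real (Suc n) <= 1" by simp
  then show ?thesis using l2_le_add_diff[OF LF[of n] LU[of n]] cl[of n] B[of n] by linarith
 qed
 have z: "fi n x = 0" "classical_grad (fi n) x = 0" if "x \<notin> \<Omega>" for n x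
  using that test_functions_zero[OF fi] test_functions_zero[OF test_functions_partial[OF fi]]
  by (auto simp: classical_grad_def vec_eq_iff)
 have t: "fi n \<in> test_functions \<Omega>" for n using test_functions_subset[OF fi] by blast
 note mp = test_functions_borel[OF fi] and mg = classical_grad_borel[OF fi]
 have b1: "l2 lborel (fi n) <= C + 1" for n
 proof -
  have "l2 M (fi n) <= 1 * l2 M (triple a (fi n) (classical_grad (fi n)))"
   by (rule L2_dominated(2)[OF LF borel_M[OF mp]]) (auto simp: norm_triple_le)
  then show ?thesis using bF[of n] l2_M(2)[OF mp z(1), of n] by simp
 qed
 have b2: "l2 lborel (classical_grad (fi n)) <= C + 1" for n
 proof -
  have "l2 M (classical_grad (fi n)) <= 1 * l2 M (triple a (fi n) (classical_grad (fi n)))"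
   by (rule L2_dominated(2)[OF LF borel_M[OF mg]]) (auto simp: norm_triple_le)
  then show ?thesis using bF[of n] l2_M(2)[OF mg z(2), of n] by simp
 qed
 obtain r :: "nat => nat" where r: "strict_mono r"
  and C: "!!e. e > 0 ==> \<exists>N. \<forall>m\<ge>N. \<forall>n\<ge>N. l2 lborel (%x. fi (r m) x - fi (r n) x) < e"
  using rellich_test_functions[of fi \<Omega> "C + 1", OF t bdd b1 b2] by blast
 have "\<exists>N. \<forall>m\<ge>N. \<forall>n\<ge>N. l2 M (%x. u (r m) x - u (r n) x) < e" if e: "e > 0" for e
 proof -
  obtain N1 where N1: "!!m n. m >= N1 ==> n >= N1 ==> l2 lborel (%x. fi (r m) x - fi (r n) x) < e / 3"
   using C[of "e / 3"] e by auto
  obtain N2 where N2: "!!n. n >= N2 ==> 1 / real (Suc n) < e / 3" using inverse_Suc_small[of "e / 3"] e by auto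
  note Lu = H_limit_L2(3)[OF H] and Lp = H_limit_L2(3)[OF test_functions_H_limit[OF fi]]
  have d: "l2 M (%x. fi n x - u n x) < 1 / real (Suc n)" for n
  proof -
   have "l2 M (%x. fi n x - u n x) <= 1 * l2 M (%x. triple a (fi n) (classical_grad (fi n)) x - triple a (u n) (g n) x)"
   proof (rule L2_dominated(2)[OF L2_diff(1)[OF LF LU] L2_measurable[OF L2_diff(1)[OF Lp Lu]]], rule AE_I2)
    show "norm (fi n x - u n x) <= 1 * norm (triple a (fi n) (classical_grad (fi n)) x - triple a (u n) (g n) x)" for x
     unfolding triple_diff mult_1 by (rule norm_triple_le)
   qed simp
   then show ?thesis using cl[of n] by simp
  qed
  have "l2 M (%x. u (r m) x - u (r n) x) < e" if mn: "m >= max N1 (N2 :: nat)" "n >= max N1 (N2 :: nat)" for m n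
  proof -
   have rm: "r m >= N2" "r n >= N2" using seq_suble[OF r, of m] seq_suble[OF r, of n] mn by auto
   have "l2 M (%x. fi (r m) x - fi (r n) x) = l2 lborel (%x. fi (r m) x - fi (r n) x)"
    by (rule l2_M(2)) (auto simp: z intro: borel_measurable_diff mp)
   moreover have "l2 M (%x. u (r m) x - u (r n) x) <= l2 M (%x. u (r m) x - fi (r m) x) + (l2 M (%x. fi (r m) x - fi (r n) x) + l2 M (%x. fi (r n) x - u (r n) x))"
    using l2_triangle[OF Lu[of "r m"] Lp[of "r m"] Lu[of "r n"]] l2_triangle[OF Lp[of "r m"] Lp[of "r n"] Lu[of "r n"]] by linarith
   ultimately show ?thesis
    using l2_diff_commute[of M "u (r m)" "fi (r m)"] N1[of m n] N2[OF rm(1)] N2[OF rm(2)] d[of "r m"] d[of "r n"] mn by simp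
  qed
  then show ?thesis by blast
 qed
 with r that show ?thesis by blast
qed

lemma triple_limit_components:
 fixes u :: "nat => real^2 => complex" and k :: "nat => real^2 => complex^2"
 assumes Hu: "!!n. H_limit \<Omega> a (u n) (k n)" and H: "H_limit \<Omega> a v g"
  and lim: "(%n. tdist a (u n) (k n) v g) ----> 0"
 shows "(%n. l2 M (%x. pgrad a al (u n) (k n) x - pgrad a al v g x)) ----> 0"
  "(%n. l2 M (%x. u n x - v x)) ----> 0"
  "(%n. l2 M (%x. u n x / cx (norm (x - a)) - v x / cx (norm (x - a)))) ----> 0"
proof -
 note Lp = H_limit_L2[OF Hu] and Lu = H_limit_L2[OF H]
 note LD = L2_diff(1)[OF Lp(1) Lu(1)]
 have sq: "f ----> 0" if "!!n. 0 <= f n" "!!n. f n <= K * tdist a (u n) (k n) v g" for f :: "nat => real" and K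
  by (rule tendsto_sandwich[OF always_eventually[OF allI[OF that(1)]] always_eventually[OF allI[OF that(2)]] tendsto_const])
    (use tendsto_mult[OF tendsto_const[of K] lim] in simp)
 show "(%n. l2 M (%x. pgrad a al (u n) (k n) x - pgrad a al v g x)) ----> 0"
 proof (rule sq[OF l2_nonneg])
  show "l2 M (%x. pgrad a al (u n) (k n) x - pgrad a al v g x)
   <= (1 + \<bar>al\<bar>) * tdist a (u n) (k n) v g" for n
  proof (rule L2_dominated(2)[OF LD L2_measurable[OF L2_diff(1)[OF Lp(5) Lu(5)]]], rule AE_I2)
   show "norm (pgrad a al (u n) (k n) x - pgrad a al v g x)
    <= (1 + \<bar>al\<bar>) * norm (triple a (u n) (k n) x - triple a v g x)" for x
    unfolding pgrad_diff triple_diff by (rule norm_pgrad_le)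
  qed simp
 qed
 show "(%n. l2 M (%x. u n x - v x)) ----> 0"
 proof (rule sq[OF l2_nonneg])
  show "l2 M (%x. u n x - v x) <= 1 * tdist a (u n) (k n) v g" for n
  proof (rule L2_dominated(2)[OF LD L2_measurable[OF L2_diff(1)[OF Lp(3) Lu(3)]]], rule AE_I2)
   show "norm (u n x - v x) <= 1 * norm (triple a (u n) (k n) x - triple a v g x)" for x
    unfolding triple_diff mult_1 by (rule norm_triple_le)
  qed simp
 qed
 show "(%n. l2 M (%x. u n x / cx (norm (x - a)) - v x / cx (norm (x - a)))) ----> 0"
 proof (rule sq[OF l2_nonneg])
  show "l2 M (%x. u n x / cx (norm (x - a)) - v x / cx (norm (x - a)))
    <= 1 * tdist a (u n) (k n) v g" for n
  proof (rule L2_dominated(2)[OF LD L2_measurable[OF L2_diff(1)[OF Lp(4) Lu(4)]]], rule AE_I2)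
   show "norm (u n x / cx (norm (x - a)) - v x / cx (norm (x - a)))
     <= 1 * norm (triple a (u n) (k n) x - triple a v g x)" for x
    unfolding triple_diff mult_1 diff_divide_distrib[symmetric]
    using norm_triple_le(3)[of "%x. u n x - v x" x a "%x. k n x - g x"] by (simp add: norm_divide)
  qed simp
 qed
qed

lemma hardy:
 assumes H: "H_limit \<Omega> 0 u g" and al: "exp ((2 * pi) *\<^sub>R (- \<i> * cx al)) = -1"
 shows "l2 M (%x. u x / cx (norm (x - 0))) <= pi * l2 M (pgrad 0 al u g)"
proof -
 obtain fi where fi: "!!n. fi n \<in> test 0"
  and lim: "(%n. tdist 0 (fi n) (classical_grad (fi n)) u g) ----> 0"
  using H_limitE[OF H] by blast
 note Lp = H_limit_L2[OF test_functions_H_limit[OF fi]] and Lu = H_limit_L2[OF H]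
 have le: "l2 M (%x. fi n x / cx (norm (x - 0))) <= pi * l2 M (pgrad 0 al (fi n) (classical_grad (fi n)))" for n
 proof -
  let ?P = "classical_magnetic_grad 0 al (fi n)"
  have z: "fi n x = 0" "?P x = 0" if "x \<notin> \<Omega>" for x
   using that test_functions_zero[OF fi] test_functions_zero[OF test_functions_partial[OF fi]]
   by (auto simp: classical_magnetic_grad_nth vec_eq_iff)
  note [measurable] = test_functions_borel[OF fi[of n]] classical_magnetic_grad_borel[OF fi[of n], of 0 al]
  have eP: "pgrad 0 al (fi n) (classical_grad (fi n)) = ?P"
   by (simp add: fun_eq_iff pgrad_def classical_magnetic_grad_def)
  have "(\<integral>\<^sup>+x. ennreal ((norm (fi n x / cx (norm (x - 0))))^2) \<partial>M) = (\<integral>\<^sup>+x. ennreal ((norm (fi n x) / norm x)^2) \<partial>M)"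
   by (simp add: norm_divide)
  also have "... = (\<integral>\<^sup>+x. ennreal ((norm (fi n x) / norm x)^2) \<partial>lborel)" by (rule nn_integral_M) (auto simp: z)
  also have "... <= ennreal (pi^2) * (\<integral>\<^sup>+x. ennreal ((norm (?P x))^2) \<partial>lborel)"
   by (rule hardy_test_functions[OF fi al])
  also have "(\<integral>\<^sup>+x. ennreal ((norm (?P x))^2) \<partial>lborel) = (\<integral>\<^sup>+x. ennreal ((norm (?P x))^2) \<partial>M)"
   by (rule nn_integral_M[symmetric]) (auto simp: z)
  also have "... = ennreal ((l2 M ?P)^2)" unfolding eP[symmetric] by (rule L2_nn_integral[OF Lp(5)])
  also have "ennreal (pi^2) * ennreal ((l2 M ?P)^2) = ennreal ((pi * l2 M ?P)^2)"
   by (simp add: ennreal_mult[symmetric] power_mult_distrib)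
  finally show ?thesis unfolding eP by (intro l2_le_nn_integral Lp(4)) (auto simp: l2_nonneg)
 qed
 note t = triple_limit_components[OF test_functions_H_limit[OF fi] H lim]
 show ?thesis
  by (rule LIMSEQ_le[OF l2_tendsto[OF Lp(4) Lu(4) t(3)] tendsto_mult[OF tendsto_const l2_tendsto[OF Lp(5) Lu(5) t(1)]]])
    (use le in auto)
qed

text \<open>Hardy's inequality bounds u / |x| by the magnetic energy. The same quantity dominates
  the potential term, which is |al| |u| / |x|, and u itself, because |x| is bounded on the domain.
  The constant \<open>k\<close> adds up these contributions: |al| for the gradient, the radius for
  u, and 1 for the weight.\<close>

lemma coercive:
 assumes al: "exp ((2 * pi) *\<^sub>R (- \<i> * cx al)) = -1"
 obtains C where "C > 0" "!!u g. H_limit \<Omega> 0 u g ==> l2 M (triple 0 u g) <= C * l2 M (pgrad 0 al u g)"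
proof -
 obtain R where R: "!!x. x \<in> \<Omega> ==> norm x <= R" using bdd by (auto simp: bounded_iff)
 define k where "k = \<bar>al\<bar> + \<bar>R\<bar> + 1"
 have k0: "k >= 0" by (simp add: k_def)
 have "l2 M (triple 0 u g) <= (1 + k * pi) * l2 M (pgrad 0 al u g)" if H: "H_limit \<Omega> 0 u g" for u g
 proof -
  note L = H_limit_L2[OF H]
  let ?F = "%x. norm (pgrad 0 al u g x) + k * norm (u x / cx (norm (x - 0)))"
  have L1: "L2 M (%x. norm (pgrad 0 al u g x))" "l2 M (%x. norm (pgrad 0 al u g x)) <= 1 * l2 M (pgrad 0 al u g)"
   using L(5)[where al = al] borel_measurable_norm by (auto simp: L2_def l2_def)
  have m2: "meas (%x. k * norm (u x / cx (norm (x - 0))))"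
   using L2_measurable[OF L(4)] by (intro borel_measurable_times borel_measurable_norm) auto
  have L2': "L2 M (%x. k * norm (u x / cx (norm (x - 0))))"
   "l2 M (%x. k * norm (u x / cx (norm (x - 0)))) <= k * l2 M (%x. u x / cx (norm (x - 0)))"
   by (rule L2_dominated[OF L(4) m2]; use k0 in \<open>auto simp: norm_mult norm_divide\<close>)+
  note F = L2_add[OF L1(1) L2'(1)]
  have main: "norm (triple 0 u g x) <= 1 * norm (?F x)" if x: "x \<in> \<Omega>" "x ~= 0" for x
  proof -
   let ?w = "norm (u x) / norm (x - 0)"
   have u: "norm (u x) <= \<bar>R\<bar> * ?w"
    using R[OF x(1)] mult_right_mono[of "norm x" "\<bar>R\<bar>" ?w] x(2) by simp
   have "norm (triple 0 u g x) <= norm (g x) + norm (u x) + ?w" by (rule norm_triple_le_sum)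
   also have "... <= (norm (pgrad 0 al u g x) + \<bar>al\<bar> * ?w) + norm (u x) + ?w"
    using norm_grad_le_pgrad[of g x 0 al u] by simp
   also have "... <= norm (pgrad 0 al u g x) + k * ?w" using u unfolding k_def distrib_right mult_1_left by linarith
   also have "... <= 1 * norm (?F x)" using k0 by (simp add: norm_divide)
   finally show ?thesis .
  qed
  have "AE x in M. norm (triple 0 u g x) <= 1 * norm (?F x)"
   using AE_M_neq[of 0] AE_space[of M] by eventually_elim (rule main, simp_all)
  then have "l2 M (triple 0 u g) <= 1 * l2 M ?F"
   using L2_dominated(2)[of M ?F "triple 0 u g" 1] F(1) L2_measurable[OF L(1)] by simp
  then have "l2 M (triple 0 u g) <= l2 M ?F" by simp
  also have "... <= l2 M (pgrad 0 al u g) + k * (pi * l2 M (pgrad 0 al u g))"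
   using F(2) L1(2) L2'(2) mult_left_mono[OF hardy[OF H al] k0] by linarith
  finally show ?thesis by (simp add: algebra_simps)
 qed
 moreover have "1 + k * pi > 0" using k0 by (simp add: add_pos_nonneg)
 ultimately show ?thesis using that by blast
qed

lemma mform_integrable:
 assumes "H_limit \<Omega> 0 u g" "H_limit \<Omega> 0 v h"
 shows "integrable M (%x. cip (pgrad 0 al u g x) (pgrad 0 al v h x))"
 by (rule L2_bilinear[OF bounded_bilinear_cip H_limit_L2(5)[OF assms(1)] H_limit_L2(5)[OF assms(2)]])

lemma L2_inner_integrable:
 assumes "L2 M u" "L2 M v" shows "integrable M (%x. u x * cnj (v x))"
 by (rule L2_bilinear[OF bounded_bilinear_mult_cnj assms])

lemma norm_L2_inner_le:
 assumes "L2 M u" "L2 M v"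
 shows "norm (ip u v) <= l2 M u * l2 M v"
 using L2_bound(2)[OF assms borel_measurable_integrable[OF L2_inner_integrable[OF assms]] AE_I2, of 1]
 unfolding L2_inner_def by (simp add: norm_mult)

lemma mform_self: "mform al u g u g = cx ((l2 M (pgrad 0 al u g))^2)"
 unfolding mform_def cip_self l2_power2 by (rule integral_complex_of_real)

lemma L2_inner_self: "ip u u = cx ((l2 M u)^2)"
 unfolding L2_inner_def complex_norm_square[symmetric] l2_power2 by (rule integral_complex_of_real)

lemma mform_diff_left:
 assumes "H_limit \<Omega> 0 u g" "H_limit \<Omega> 0 v h" "H_limit \<Omega> 0 w k"
 shows "mform al (%x. u x - v x) (%x. g x - h x) w k = mform al u g w k - mform al v h w k"
proof -
 have "cip (pgrad 0 al (%x. u x - v x) (%x. g x - h x) x) (pgrad 0 al w k x)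
  = cip (pgrad 0 al u g x) (pgrad 0 al w k x) - cip (pgrad 0 al v h x) (pgrad 0 al w k x)" for x
  unfolding pgrad_diff[symmetric] by (rule bounded_bilinear.diff_left[OF bounded_bilinear_cip])
 then show ?thesis unfolding mform_def
  using b_integral_diff[OF mform_integrable[OF assms(1,3), of al] mform_integrable[OF assms(2,3), of al]] by simp
qed

lemma mform_cmult_left:
 "mform al (%x. c * u x) (%x. c *s g x) w k = c * mform al u g w k"
proof -
 have "pgrad 0 al (%x. c * u x) (%x. c *s g x) x = c *s pgrad 0 al u g x" for x
  using pgrad_lin[of 0 al c u "%_. 0" g "%_. 0" x] by (simp add: pgrad_def)
 then show ?thesis unfolding mform_def by (simp add: cip_cmult_left)
qed

lemma L2_inner_diff_left:
 assumes "L2 M u" "L2 M v" "L2 M w"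
 shows "ip (%x. u x - v x) w = ip u w - ip v w"
 unfolding L2_inner_def left_diff_distrib
 by (rule b_integral_diff[OF L2_inner_integrable[OF assms(1,3)] L2_inner_integrable[OF assms(2,3)]])

lemma L2_inner_add_left:
 assumes "L2 M u" "L2 M v" "L2 M w"
 shows "ip (%x. u x + v x) w = ip u w + ip v w"
 unfolding L2_inner_def distrib_right
 by (rule b_integral_add[OF L2_inner_integrable[OF assms(1,3)] L2_inner_integrable[OF assms(2,3)]])

lemma L2_inner_cmult_left: "ip (%x. c * u x) w = c * ip u w"
 unfolding L2_inner_def by (simp add: mult.assoc)

lemma l2_pgrad_cmult: "l2 M (pgrad 0 al (%x. c * u x) (%x. c *s g x)) = norm c * l2 M (pgrad 0 al u g)"
proof -
 have "pgrad 0 al (%x. c * u x) (%x. c *s g x) x = c *s pgrad 0 al u g x" for x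
  using pgrad_lin[of 0 al c u "%_. 0" g "%_. 0" x] by (simp add: pgrad_def)
 then show ?thesis unfolding l2_def by (simp add: norm_smult power_mult_distrib real_sqrt_mult)
qed

text \<open>Boundedness of the inverse of the operator minus \<open>lam\<close> on the complement of the eigenspace.\<close>

theorem spectral_gap:
 fixes \<Phi> :: "(real^2 => complex) set" and lam :: real
 assumes al: "exp ((2 * pi) *\<^sub>R (- \<i> * cx al)) = -1"
  and \<Phi>: "!!fi. fi \<in> \<Phi> ==> L2 M fi"
  and ker: "!!u g. H_limit \<Omega> 0 u g ==> (!!fi. fi \<in> \<Phi> ==> ip u fi = 0)
   ==> (!!v h. H_limit \<Omega> 0 v h ==> mform al u g v h = lam * ip u v) ==> AE x in M. u x = 0"
 obtains C where "C > 0"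
  "!!u g \<rho>. H_limit \<Omega> 0 u g ==> (!!fi. fi \<in> \<Phi> ==> ip u fi = 0)
   ==> 0 <= \<rho> ==> (!!v h. H_limit \<Omega> 0 v h ==> norm (mform al u g v h - lam * ip u v) <= \<rho> * l2 M (pgrad 0 al v h))
   ==> l2 M (pgrad 0 al u g) <= C * \<rho>"
proof (rule ccontr)
 define P where "P u g \<rho> \<longleftrightarrow> H_limit \<Omega> 0 u g \<and> (\<forall>fi\<in>\<Phi>. ip u fi = 0) \<and> 0 <= \<rho>
   \<and> (\<forall>v h. H_limit \<Omega> 0 v h --> norm (mform al u g v h - lam * ip u v) <= \<rho> * l2 M (pgrad 0 al v h))" for u g \<rho>
 note bounded = that
 assume "\<not> thesis"
 then have "\<exists>u g \<rho>. P u g \<rho> \<and> \<not> l2 M (pgrad 0 al u g) <= C * \<rho>" if "C > 0" for C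
  using bounded[of C] that \<open>\<not> thesis\<close> unfolding P_def by blast
 then have "\<forall>n. \<exists>u g \<rho>. P u g \<rho> \<and> l2 M (pgrad 0 al u g) > real (Suc n) * \<rho>"
  by (metis not_le of_nat_0_less_iff zero_less_Suc)
 then obtain u g \<rho> where P: "!!n. P (u n) (g n) (\<rho> n)" and big: "!!n. l2 M (pgrad 0 al (u n) (g n)) > real (Suc n) * \<rho> n"
  by metis
 define t where "t n = l2 M (pgrad 0 al (u n) (g n))" for n
 have t0: "t n > 0" for n
 proof -
  have "0 <= real (Suc n) * \<rho> n" using P[of n] by (simp add: P_def)
  then show ?thesis using big[of n] unfolding t_def by linarith
 qed
 \<comment> \<open>Violating functions normalised to energy 1; for the constant n + 1 their residual
   is at most 1 / (n + 1).\<close>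
 define U where "U n x = cx (1 / t n) * u n x" for n x
 define G where "G n x = cx (1 / t n) *s g n x" for n x
 have HU: "H_limit \<Omega> 0 (U n) (G n)" for n
  using H_limit_cmult[of 0 "u n" "g n" "cx (1 / t n)"] P[of n] unfolding P_def U_def G_def by simp
 have nU: "l2 M (pgrad 0 al (U n) (G n)) = 1" for n
  using l2_pgrad_cmult[of al "cx (1 / t n)" "u n" "g n"] t0[of n]
  unfolding U_def[abs_def] G_def[abs_def] t_def[symmetric] by (simp add: norm_divide)
 have oU: "ip (U n) fi = 0" if "fi \<in> \<Phi>" for n fi
  using L2_inner_cmult_left[of "cx (1 / t n)" "u n" fi] P[of n] that unfolding P_def U_def[abs_def] by simp
 have rU: "norm (mform al (U n) (G n) v h - lam * ip (U n) v) <= 1 / real (Suc n) * l2 M (pgrad 0 al v h)"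
  if "H_limit \<Omega> 0 v h" for n v h
 proof -
  have "mform al (U n) (G n) v h - lam * ip (U n) v
    = cx (1 / t n) * (mform al (u n) (g n) v h - lam * ip (u n) v)"
   unfolding U_def[abs_def] G_def[abs_def] mform_cmult_left L2_inner_cmult_left by (simp add: algebra_simps)
  then have "norm (mform al (U n) (G n) v h - lam * ip (U n) v)
    = 1 / t n * norm (mform al (u n) (g n) v h - lam * ip (u n) v)"
   using t0[of n] by (simp add: norm_mult norm_divide)
  also have "... <= 1 / t n * (\<rho> n * l2 M (pgrad 0 al v h))"
   using P[of n] that t0[of n] by (intro mult_left_mono) (auto simp: P_def)
  also have "... = (\<rho> n / t n) * l2 M (pgrad 0 al v h)" by simp
  also have "... <= 1 / real (Suc n) * l2 M (pgrad 0 al v h)"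
  proof (rule mult_right_mono[OF _ l2_nonneg])
   show "\<rho> n / t n <= 1 / real (Suc n)"
    using big[of n] t0[of n] unfolding t_def[symmetric] by (simp add: field_simps)
  qed
  finally show ?thesis .
 qed
 obtain K where K: "K > 0" "!!u g. H_limit \<Omega> 0 u g ==> l2 M (triple 0 u g) <= K * l2 M (pgrad 0 al u g)"
  using coercive[OF al] by blast
 have bU: "l2 M (triple 0 (U n) (G n)) <= K" for n using K(2)[OF HU[of n]] nU[of n] by simp
 obtain r :: "nat => nat" where r: "strict_mono r"
  and C: "!!e. e > 0 ==> \<exists>N. \<forall>m\<ge>N. \<forall>n\<ge>N. l2 M (%x. U (r m) x - U (r n) x) < e"
  using rellich[of 0 U G K, OF HU bU] by blast
 note LU = H_limit_L2[OF HU]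
 \<comment> \<open>The difference of two residual inequalities is tested with the difference of the
   functions. The energy distance is thereby controlled by the residuals and the L2 distance, so
   convergence in L2 improves to convergence in the form domain.\<close>
 have sq: "(l2 M (pgrad 0 al (%x. U m x - U n x) (%x. G m x - G n x)))^2
   <= 2 * (1 / real (Suc m) + 1 / real (Suc n)) + \<bar>lam\<bar> * (l2 M (%x. U m x - U n x))^2" for m n
 proof -
  let ?w = "%x. U m x - U n x" and ?k = "%x. G m x - G n x"
  have Hw: "H_limit \<Omega> 0 ?w ?k" by (rule H_limit_diff[OF HU HU])
  let ?p = "l2 M (pgrad 0 al ?w ?k)"
  have p2: "?p <= 2"
  proof -
   have "l2 M (%x. pgrad 0 al (U m) (G m) x - pgrad 0 al (U n) (G n) x) <= l2 M (pgrad 0 al (U m) (G m)) + l2 M (pgrad 0 al (U n) (G n))"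
    by (rule L2_diff(2)[OF LU(5) LU(5)])
   then show ?thesis by (simp add: nU pgrad_diff)
  qed
  have "mform al ?w ?k ?w ?k = (mform al (U m) (G m) ?w ?k - lam * ip (U m) ?w)
    - (mform al (U n) (G n) ?w ?k - lam * ip (U n) ?w) + lam * ip ?w ?w"
   unfolding mform_diff_left[OF HU HU Hw] L2_inner_diff_left[OF LU(3) LU(3) H_limit_L2(3)[OF Hw]]
   by (simp add: algebra_simps)
  then have "norm (mform al ?w ?k ?w ?k) <= (1 / real (Suc m) * ?p + 1 / real (Suc n) * ?p) + norm (lam * ip ?w ?w)"
   using rU[OF Hw, of m] rU[OF Hw, of n] norm_triangle_le norm_triangle_le_diff by (smt (verit))
  moreover have "norm (mform al ?w ?k ?w ?k) = ?p^2" unfolding mform_self norm_of_real by simp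
  moreover have "norm (lam * ip ?w ?w) = \<bar>lam\<bar> * (l2 M ?w)^2" unfolding L2_inner_self norm_mult norm_of_real by simp
  moreover have "1 / real (Suc m) * ?p + 1 / real (Suc n) * ?p <= 2 * (1 / real (Suc m) + 1 / real (Suc n))"
   using mult_left_mono[OF p2, of "1 / real (Suc m) + 1 / real (Suc n)"] by (simp add: algebra_simps)
  ultimately show ?thesis by linarith
 qed
 have CT: "\<exists>N. \<forall>m\<ge>N. \<forall>n\<ge>N. l2 M (%x. triple 0 (U (r m)) (G (r m)) x - triple 0 (U (r n)) (G (r n)) x) < e" if e: "e > 0" for e
 proof -
  define d where "d = (e / K)^2"
  have d: "d > 0" using e K(1) by (simp add: d_def)
  \<comment> \<open>The L2 part receives half of \<open>d\<close>; the two residuals contribute 2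
    (d/8 + d/8), the other half.\<close>
  define s where "s = sqrt (d / (2 * (\<bar>lam\<bar> + 1)))"
  have s: "s > 0" using d by (simp add: s_def)
  have s2: "(\<bar>lam\<bar> + 1) * s^2 = d / 2" using d by (simp add: s_def field_simps)
  obtain N1 where N1: "!!m n. m >= N1 ==> n >= N1 ==> l2 M (%x. U (r m) x - U (r n) x) < s" using C[OF s] by auto
  obtain N2 where N2: "!!n. n >= N2 ==> 1 / real (Suc n) < d / 8" using inverse_Suc_small[of "d / 8"] d by auto
  have arith: "X < d" if "Y <= Z" "X <= 2 * (a + b) + Y" "Z = d / 2" "a < d / 8" "b < d / 8" for X Y Z a b :: real
  proof -
   have "2 * (a + b) < 2 * (d / 8 + d / 8)" using that(4,5) by (intro mult_strict_left_mono add_strict_mono) auto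
   then show ?thesis using that(1-3) by simp
  qed
  have "l2 M (%x. triple 0 (U (r m)) (G (r m)) x - triple 0 (U (r n)) (G (r n)) x) < e"
   if mn: "m >= max N1 N2" "n >= max N1 N2" for m n
  proof -
   let ?w = "%x. U (r m) x - U (r n) x" and ?k = "%x. G (r m) x - G (r n) x"
   have rm: "r m >= N2" "r n >= N2" using seq_suble[OF r, of m] seq_suble[OF r, of n] mn by auto
   have "(l2 M ?w)^2 <= s^2" using N1[of m n] mn by (intro power_mono l2_nonneg) auto
   then have "\<bar>lam\<bar> * (l2 M ?w)^2 <= (\<bar>lam\<bar> + 1) * s^2" by (intro mult_mono) auto
   then have "(l2 M (pgrad 0 al ?w ?k))^2 < d"
    by (rule arith[OF _ sq s2 N2[OF rm(1)] N2[OF rm(2)]])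
   then have "l2 M (pgrad 0 al ?w ?k) < e / K" unfolding d_def
    by (rule power_less_imp_less_base) (use e K(1) in simp)
   then have "K * l2 M (pgrad 0 al ?w ?k) < e" using K(1) by (simp add: field_simps)
   moreover have "l2 M (triple 0 ?w ?k) <= K * l2 M (pgrad 0 al ?w ?k)" by (rule K(2)[OF H_limit_diff[OF HU HU]])
   ultimately show ?thesis unfolding triple_diff by linarith
  qed
  then show ?thesis by blast
 qed
 obtain v h where Hv: "H_limit \<Omega> 0 v h"
  and lim: "(%n. tdist 0 (U (r n)) (G (r n)) v h) ----> 0"
  using H_limit_complete[of 0 "%n. U (r n)" "%n. G (r n)", OF HU CT] by blast
 note Lv = H_limit_L2[OF Hv]
 have lp: "(%n. l2 M (%x. pgrad 0 al (U (r n)) (G (r n)) x - pgrad 0 al v h x)) ----> 0"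
  and lu: "(%n. l2 M (%x. U (r n) x - v x)) ----> 0"
  using triple_limit_components[OF HU Hv lim] by auto
 have nv: "l2 M (pgrad 0 al v h) = 1"
  using l2_tendsto[of M "%n. pgrad 0 al (U (r n)) (G (r n))", OF LU(5) Lv(5) lp] by (simp add: nU LIMSEQ_const_iff)
 have Iv: "(%n. ip (U (r n)) w) ----> ip v w" if "L2 M w" for w
  unfolding L2_inner_def
  by (rule L2_bilinear_tendsto[OF bounded_bilinear_mult_cnj LU(3) Lv(3) lu that that]) (simp add: l2_def)
 have ov: "ip v fi = 0" if "fi \<in> \<Phi>" for fi
  using Iv[OF \<Phi>[OF that]] oU[OF that] by (simp add: LIMSEQ_const_iff)
 have ev: "mform al v h w k = lam * ip v w" if Hw: "H_limit \<Omega> 0 w k" for w k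
 proof -
  note Lw = H_limit_L2[OF Hw]
  have m: "(%n. mform al (U (r n)) (G (r n)) w k) ----> mform al v h w k"
   unfolding mform_def
   by (rule L2_bilinear_tendsto[OF bounded_bilinear_cip LU(5) Lv(5) lp Lw(5) Lw(5)]) (simp add: l2_def)
  have 1: "(%n. mform al (U (r n)) (G (r n)) w k - lam * ip (U (r n)) w) ----> mform al v h w k - lam * ip v w"
   by (intro tendsto_intros m Iv Lw(3))
  have b: "norm (mform al (U (r n)) (G (r n)) w k - lam * ip (U (r n)) w) <= 1 / real (Suc n) * l2 M (pgrad 0 al w k)" for n
  proof -
   have "1 / real (Suc (r n)) <= 1 / real (Suc n)" using seq_suble[OF r, of n] by (simp add: field_simps)
   then show ?thesis using rU[OF Hw, of "r n"] l2_nonneg[of M "pgrad 0 al w k"] mult_right_mono order_trans by blast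
  qed
  have "(%n. 1 / real (Suc n) * l2 M (pgrad 0 al w k)) ----> 0 * l2 M (pgrad 0 al w k)"
   by (intro tendsto_mult LIMSEQ_Suc[OF lim_1_over_n] tendsto_const)
  then have "(%n. 1 / real (Suc n) * l2 M (pgrad 0 al w k)) ----> 0" by simp
  from Lim_null_comparison[OF always_eventually[OF allI[OF b]] this]
  have "(%n. mform al (U (r n)) (G (r n)) w k - lam * ip (U (r n)) w) ----> 0" .
  from LIMSEQ_unique[OF 1 this] show ?thesis by simp
 qed
 have v0: "AE x in M. v x = 0" by (rule ker[OF Hv ov ev])
 have "AE x in M. pgrad 0 al v h x = 0"
  using v0 H_limit_grad_zero[OF Hv v0] by eventually_elim (simp add: pgrad_def)
 then have "l2 M (pgrad 0 al v h) = 0" using l2_eq_0_iff[OF Lv(5)] by blast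
 with nv show False by simp
qed

end

section \<open>Changes of variables\<close>

text \<open>Transposed relative to the usual Jacobian matrix: \<open>i\<close> is the direction of
  differentiation, \<open>j\<close> the component of the map.\<close>

definition jac :: "(real^2 => real^2) => 2 => 2 => real^2 => real" where
 "jac F i j x = Re (partial_deriv i (%x. cx (F x $ j)) x)"

definition jdet :: "(real^2 => real^2) => real^2 => real" where
 "jdet F x = jac F 1 1 x * jac F 2 2 x - jac F 2 1 x * jac F 1 2 x"

lemma has_derivative_jac:
 assumes "!!j. smooth_on UNIV (%x. cx (F x $ j))"
 shows "(F has_derivative (%h. \<chi> j. h$1 * jac F 1 j x + h$2 * jac F 2 j x)) (at x)"
proof (rule has_derivative_vec2)
 show "((%x. F x $ j) has_derivative (%h. (\<chi> j. h$1 * jac F 1 j x + h$2 * jac F 2 j x) $ j)) (at x)" for j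
  using has_derivative_Re_of_real[OF smooth_on_differentiable[OF assms[of j]], of x] by (simp add: jac_def)
qed

lemma det_matrix_jac: "det (matrix (%h. \<chi> j. h$1 * jac F 1 j x + h$2 * jac F 2 j x)) = jdet F x"
 by (simp add: det_2 matrix_def jdet_def axis_def)

lemma jac_continuous:
 assumes "!!j. smooth_on UNIV (%x. cx (F x $ j))"
 shows "continuous_on UNIV (jac F i j)"
 unfolding jac_def[abs_def]
 by (intro continuous_on_Re smooth_on_continuous smooth_on_partial assms)

lemma of_real_jac:
 assumes "!!j. smooth_on UNIV (%x. cx (F x $ j))"
 shows "partial_deriv i (%x. cx (F x $ j)) x = cx (jac F i j x)"
proof -
 have "(%x. cx (F x $ j)) differentiable (at x)" using smooth_on_differentiable[OF assms] by blast
 from partial_deriv_of_real[OF has_derivative_Re_of_real[OF this], of i] show ?thesis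
  unfolding jac_def by (metis Re_complex_of_real)
qed

text \<open>If \<open>g\<close> is the gradient of u, this is the gradient of u composed with
  \<open>F\<close>, by the chain rule.\<close>

definition pull :: "(real^2 => real^2) => (real^2 => complex^2) => real^2 => complex^2" where
 "pull F g x = (\<chi> i. cx (jac F i 1 x) * g (F x) $ 1 + cx (jac F i 2 x) * g (F x) $ 2)"

lemma classical_grad_compose:
 assumes F: "!!j. smooth_on UNIV (%x. cx (F x $ j))" and u: "u \<in> test_functions S"
 shows "classical_grad (%x. u (F x)) x = pull F (classical_grad u) x"
 using partial_deriv_compose(2)[of F x u, OF smooth_on_differentiable[OF F] test_functions_differentiable[OF u]]
 by (simp add: vec_eq_iff classical_grad_def pull_def of_real_jac[OF F])

context bounded_domain
begin

text \<open>Symmetric in the two maps, so that every fact about \<open>F\<close> also serves for its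
  inverse. The uniform constant 2 suffices because only maps close to the identity occur.\<close>

definition diffeo :: "(real^2 => real^2) => (real^2 => real^2) => bool" where
 "diffeo F G \<longleftrightarrow> (\<forall>x. G (F x) = x \<and> F (G x) = x \<and> (F x \<in> \<Omega> \<longleftrightarrow> x \<in> \<Omega>)) \<and>
  (\<forall>j. smooth_on UNIV (%x. cx (F x $ j)) \<and> smooth_on UNIV (%x. cx (G x $ j))) \<and>
  (\<forall>x y. norm (F x - F y) <= 2 * norm (x - y) \<and> norm (G x - G y) <= 2 * norm (x - y)) \<and>
  (\<forall>i j x. \<bar>jac F i j x\<bar> <= 2 \<and> \<bar>jac G i j x\<bar> <= 2)"

lemma diffeo_sym: "diffeo F G ==> diffeo G F"
 unfolding diffeo_def by metis

lemma diffeoD: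
 assumes "diffeo F G"
 shows "G (F x) = x" "F (G x) = x" "F x \<in> \<Omega> \<longleftrightarrow> x \<in> \<Omega>" "smooth_on UNIV (%x. cx (F x $ j))"
  "norm (F x - F y) <= 2 * norm (x - y)" "\<bar>jac F i j x\<bar> <= 2"
 using assms unfolding diffeo_def by blast+

lemma jdet_bound: "diffeo F G ==> \<bar>jdet F x\<bar> <= 8"
proof -
 assume d: "diffeo F G"
 have "\<bar>jac F 1 1 x * jac F 2 2 x\<bar> <= 2 * 2" "\<bar>jac F 2 1 x * jac F 1 2 x\<bar> <= 2 * 2"
  unfolding abs_mult by (intro mult_mono diffeoD(6)[OF d]; simp)+
 then show ?thesis unfolding jdet_def by linarith
qed

lemma jdet_borel: "diffeo F G ==> jdet F \<in> borel_measurable borel"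
 unfolding jdet_def[abs_def]
 by (intro borel_measurable_continuous_onI continuous_intros jac_continuous diffeoD(4))

lemma diffeo_image_lmeasurable:
 assumes d: "diffeo F G" and B: "B \<in> sets lebesgue" "B \<subseteq> \<Omega>"
 shows "F ` B \<in> lmeasurable" "((%x. \<bar>jdet F x\<bar>) has_integral measure lebesgue (F ` B)) B"
proof -
 have D: "(F has_derivative (%h. \<chi> j. h$1 * jac F 1 j x + h$2 * jac F 2 j x)) (at x within B)" for x
  using has_derivative_jac[OF diffeoD(4)[OF d]] has_derivative_at_withinI by blast
 have inj: "inj_on F B" by (rule inj_on_inverseI[of _ G]) (simp add: diffeoD(1)[OF d])
 have Bm: "B \<in> lmeasurable" using B bdd bounded_subset bounded_set_imp_lmeasurable by blast
 have "(%x. \<bar>jdet F x\<bar>) integrable_on B"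
 proof (rule measurable_bounded_by_integrable_imp_integrable[of _ _ "%_. 8"])
  have "(%x. \<bar>jdet F x\<bar>) \<in> borel_measurable lebesgue"
   using jdet_borel[OF d] by (intro borel_measurable_abs measurable_completion) simp
  then show "(%x. \<bar>jdet F x\<bar>) \<in> borel_measurable (lebesgue_on B)" by (rule measurable_restrict_space1)
  show "(%_. 8 :: real) integrable_on B" using Bm by (rule integrable_on_const)
 qed (use jdet_bound[OF d] B in auto)
 then have "(%x. \<bar>det (matrix (%h. \<chi> j. h$1 * jac F 1 j x + h$2 * jac F 2 j x))\<bar>) integrable_on B"
  unfolding det_matrix_jac .
 then have I: "F ` B \<in> lmeasurable" using measurable_differentiable_image_eq[OF B(1) D inj] by blast
 then show "F ` B \<in> lmeasurable" .
 show "((%x. \<bar>jdet F x\<bar>) has_integral measure lebesgue (F ` B)) B"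
  using has_measure_differentiable_image[OF B(1) D inj, of "measure lebesgue (F ` B)"] I
  unfolding det_matrix_jac by blast
qed

lemma sets_M: "B \<in> sets M \<longleftrightarrow> B \<subseteq> \<Omega> \<and> B \<in> sets lebesgue"
 using domain_sets by (simp add: sets_restrict_space_iff)

lemma diffeo_vimage:
 assumes "diffeo F G" "B \<subseteq> \<Omega>" shows "F -` B \<inter> \<Omega> = G ` B"
proof -
 have "x \<in> G ` B" if "F x \<in> B" for x using that diffeoD(1)[OF assms(1), of x] by (metis image_eqI)
 moreover have "F (G y) \<in> B" "G y \<in> \<Omega>" if "y \<in> B" for y
  using that assms(2) diffeoD(2)[OF assms(1), of y] diffeoD(3)[OF assms(1), of "G y"] by auto
 ultimately show ?thesis by auto
qed

lemma diffeo_measurable: "diffeo F G ==> F \<in> measurable M M"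
proof (rule measurableI)
 assume d: "diffeo F G"
 fix B assume "B \<in> sets M"
 then have B: "B \<subseteq> \<Omega>" "B \<in> sets lebesgue" by (auto simp: sets_M)
 have "F -` B \<inter> space M = G ` B" using diffeo_vimage[OF d B(1)] by simp
 moreover have "G ` B \<in> lmeasurable" by (rule diffeo_image_lmeasurable(1)[OF diffeo_sym[OF d] B(2,1)])
 moreover have "G ` B \<subseteq> \<Omega>" using B diffeoD(3)[OF diffeo_sym[OF d]] by auto
 ultimately show "F -` B \<inter> space M \<in> sets M" by (auto simp: sets_M)
qed (auto simp: diffeoD(3))

text \<open>The change of variables formula as an identity of measures, checked on sets by the
  formula for the measure of a differentiable image. The versions for nonnegative and for complex
  integrands both follow from it.\<close>

lemma diffeo_distr:
 assumes d: "diffeo F G"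
 shows "distr (density M (%x. ennreal \<bar>jdet F x\<bar>)) M F = M"
proof (rule measure_eqI)
 fix B assume "B \<in> sets (distr (density M (%x. ennreal \<bar>jdet F x\<bar>)) M F)"
 then have B: "B \<in> sets M" by simp
 then have B': "B \<subseteq> \<Omega>" "B \<in> sets lebesgue" by (auto simp: sets_M)
 define A where "A = G ` B"
 have A: "A \<in> sets lebesgue" "A \<subseteq> \<Omega>"
  using diffeo_image_lmeasurable(1)[OF diffeo_sym[OF d] B'(2,1)] B' diffeoD(3)[OF diffeo_sym[OF d]] by (auto simp: A_def)
 have FA: "F ` A = B" using diffeoD(2)[OF d] by (auto simp: A_def image_image)
 have jm [measurable]: "meas (%x. ennreal \<bar>jdet F x\<bar>)"
  using borel_M[OF jdet_borel[OF d]] by measurable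
 note [measurable] = diffeo_measurable[OF d]
 have "emeasure (distr (density M (%x. ennreal \<bar>jdet F x\<bar>)) M F) B = emeasure (density M (%x. ennreal \<bar>jdet F x\<bar>)) (F -` B \<inter> \<Omega>)"
  using B by (subst emeasure_distr) auto
 also have "F -` B \<inter> \<Omega> = A" unfolding A_def by (rule diffeo_vimage[OF d B'(1)])
 also have "emeasure (density M (%x. ennreal \<bar>jdet F x\<bar>)) A = (\<integral>\<^sup>+x. ennreal \<bar>jdet F x\<bar> * indicator A x \<partial>M)"
  by (rule emeasure_density[OF jm]) (use A in \<open>auto simp: sets_M\<close>)
 also have "... = (\<integral>\<^sup>+x. ennreal \<bar>jdet F x\<bar> * indicator A x * indicator \<Omega> x \<partial>lebesgue)"
  using domain_sets by (simp add: nn_integral_restrict_space)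
 also have "... = (\<integral>\<^sup>+x. ennreal (indicator A x * \<bar>jdet F x\<bar>) \<partial>lborel)"
  unfolding nn_integral_completion using A(2) by (intro nn_integral_cong) (auto simp: indicator_def)
 also have "... = ennreal (measure lebesgue B)"
  using nn_integral_has_integral_lebesgue[OF _ diffeo_image_lmeasurable(2)[OF d A]] unfolding FA by simp
 also have "... = emeasure lebesgue B"
  using diffeo_image_lmeasurable(1)[OF d A] unfolding FA by (simp add: emeasure_eq_measure2)
 also have "... = emeasure M B" using B' domain_sets by (simp add: emeasure_restrict_space)
 finally show "emeasure (distr (density M (%x. ennreal \<bar>jdet F x\<bar>)) M F) B = emeasure M B" .
qed simp

lemma nn_integral_diffeo:
 assumes d: "diffeo F G" and f: "meas f"
 shows "(\<integral>\<^sup>+x. f x \<partial>M) = (\<integral>\<^sup>+x. ennreal \<bar>jdet F x\<bar> * f (F x) \<partial>M)"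
proof -
 note [measurable] = f diffeo_measurable[OF d] borel_M[OF jdet_borel[OF d]]
 show ?thesis
  by (subst diffeo_distr[OF d, symmetric]) (simp add: nn_integral_distr nn_integral_density)
qed

lemma integral_diffeo:
 fixes f :: "real^2 => complex"
 assumes d: "diffeo F G" and f: "meas f"
 shows "(LINT x|M. f x) = (LINT x|M. cx \<bar>jdet F x\<bar> * f (F x))"
proof -
 note [measurable] = f diffeo_measurable[OF d] borel_M[OF jdet_borel[OF d]]
 show ?thesis
  by (subst diffeo_distr[OF d, symmetric]) (simp add: integral_distr integral_density scaleR_conv_of_real)
qed

lemma L2_diffeo:
 assumes d: "diffeo F G" and f: "L2 M f"
 shows "L2 M (%x. f (F x))" "l2 M (%x. f (F x)) <= 3 * l2 M f"
proof -
 have m: "meas (%x. f (F x))"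
  by (rule measurable_compose[OF diffeo_measurable[OF d] L2_measurable[OF f]])
 have [measurable]: "meas f" by (rule L2_measurable[OF f])
 have "(\<integral>\<^sup>+x. ennreal ((norm (f (F x)))^2) \<partial>M) = (\<integral>\<^sup>+x. ennreal \<bar>jdet G x\<bar> * ennreal ((norm (f (F (G x))))^2) \<partial>M)"
  by (rule nn_integral_diffeo[OF diffeo_sym[OF d]]) (use m in measurable)
 \<comment> \<open>The determinant is bounded by 8, enlarged to 9 to have the square of 3.\<close>
 also have "... <= (\<integral>\<^sup>+x. ennreal 9 * ennreal ((norm (f x))^2) \<partial>M)"
  using jdet_bound[OF diffeo_sym[OF d]] diffeoD(2)[OF d]
  by (intro nn_integral_mono mult_mono ennreal_leI) (auto intro: order_trans[of _ 8])
 also have "... = ennreal 9 * ennreal ((l2 M f)^2)" by (simp add: nn_integral_cmult L2_nn_integral[OF f])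
 also have "... = ennreal ((3 * l2 M f)^2)"
  by (subst ennreal_mult[symmetric]) (simp_all add: power_mult_distrib)
 finally have b: "(\<integral>\<^sup>+x. ennreal ((norm (f (F x)))^2) \<partial>M) <= ennreal ((3 * l2 M f)^2)" .
 show L: "L2 M (%x. f (F x))" by (rule L2I_nn_integral[OF m]) (rule le_less_trans[OF b], simp)
 show "l2 M (%x. f (F x)) <= 3 * l2 M f" by (rule l2_le_nn_integral[OF L b]) (simp add: l2_nonneg)
qed

lemma AE_diffeo:
 fixes f :: "real^2 => complex"
 assumes "diffeo F G" "L2 M f" "AE x in M. f x = 0"
 shows "AE x in M. f (F x) = 0"
proof -
 have "l2 M f = 0" using assms(2,3) l2_eq_0_iff by blast
 then have "l2 M (%x. f (F x)) = 0" using L2_diffeo(2)[OF assms(1,2)] l2_nonneg[of M "%x. f (F x)"] by simp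
 then show ?thesis using l2_eq_0_iff[OF L2_diffeo(1)[OF assms(1,2)]] by blast
qed

lemma test_functions_diffeo:
 assumes d: "diffeo F G" and b: "F b = a" and fi: "fi \<in> test a"
 shows "(%x. fi (F x)) \<in> test b"
proof -
 let ?K = "closure {x. fi x ~= 0}"
 have K: "compact ?K" "?K \<subseteq> \<Omega> - {a}" using fi by (auto simp: test_functions_def)
 have cG: "continuous_on UNIV G"
  using has_derivative_jac[OF diffeoD(4)[OF diffeo_sym[OF d]]]
  by (intro continuous_at_imp_continuous_on) (auto intro: has_derivative_continuous)
 show ?thesis
 proof (rule test_functionsI)
  show "smooth_on UNIV (%x. fi (F x))"
   by (rule smooth_on_compose[of UNIV F UNIV]) (auto intro: diffeoD(4)[OF d] test_functions_smooth[OF fi])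
  show "compact (G ` ?K)" by (intro compact_continuous_image K(1) continuous_on_subset[OF cG]) simp
  show "G ` ?K \<subseteq> \<Omega> - {b}"
  proof
   fix x assume "x \<in> G ` ?K"
   then obtain y where y: "y \<in> ?K" "x = G y" by blast
   have "F x = y" using y(2) diffeoD(2)[OF d] by simp
   then show "x \<in> \<Omega> - {b}" using y(1) K(2) diffeoD(3)[OF d, of x] b by auto
  qed
  show "fi (F x) = 0" if "x \<notin> G ` ?K" for x
  proof (rule support_zero[of _ fi])
   show "F x \<notin> ?K" using that diffeoD(1)[OF d, of x] by (metis image_eqI)
  qed
 qed
qed

lemma norm_pull_le:
 assumes d: "diffeo F G" shows "norm (pull F g x) <= 8 * norm (g (F x))"
proof -
 have n: "norm (v $ j) <= norm v" for v :: "complex^2" and j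
  by (rule power2_le_imp_le) (use exhaust_2[of j] in \<open>auto simp: norm_cvec2\<close>)
 have c: "norm (pull F g x $ i) <= 4 * norm (g (F x))" for i
 proof -
  have "norm (pull F g x $ i) <= \<bar>jac F i 1 x\<bar> * norm (g (F x) $ 1) + \<bar>jac F i 2 x\<bar> * norm (g (F x) $ 2)"
   unfolding pull_def vec_lambda_beta by (rule norm_triangle_le) (simp add: norm_mult)
  also have "... <= 2 * norm (g (F x)) + 2 * norm (g (F x))"
   by (intro add_mono mult_mono diffeoD(6)[OF d] n) auto
  finally show ?thesis by simp
 qed
 have "(norm (pull F g x))^2 <= (4 * norm (g (F x)))^2 + (4 * norm (g (F x)))^2"
  unfolding norm_cvec2[of "pull F g x"] by (intro add_mono power_mono c) auto
 also have "... <= (8 * norm (g (F x)))^2" by (simp add: power_mult_distrib)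
 finally show ?thesis by (rule power2_le_imp_le) simp
qed

lemma pull_diff: "pull F g x - pull F h x = pull F (%x. g x - h x) x"
 by (simp add: pull_def vec_eq_iff algebra_simps)

lemma pull_measurable:
 assumes d: "diffeo F G" and g: "meas g"
 shows "meas (pull F g)"
proof (rule borel_measurable_cvec2)
 have [measurable]: "meas (%x. g (F x) $ j)" for j
  by (rule measurable_compose[OF measurable_compose[OF diffeo_measurable[OF d] g]])
    (intro borel_measurable_continuous_onI continuous_intros)
 have [measurable]: "meas (jac F i j)" for i j
  by (intro borel_M borel_measurable_continuous_onI jac_continuous diffeoD(4)[OF d])
 show "meas (%x. pull F g x $ i)" for i
  unfolding pull_def vec_lambda_beta by measurable
qed

text \<open>The singular weight is carried over because \<open>F\<close> is Lipschitz and sends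
  \<open>b\<close> to \<open>a\<close>: |F x - a| <= 2 |x - b|. The constant 11 = 8 + 1 + 2 collects
  gradient, function and weight, and \<open>L2_diffeo\<close> contributes the factor 3.\<close>

lemma H_limit_pull:
 assumes d: "diffeo F G" and b: "F b = a" and H: "H_limit \<Omega> a u g"
 shows "H_limit \<Omega> b (%x. u (F x)) (pull F g)"
proof -
 have bound: "norm (triple b (%x. v (F x)) (pull F h) x) <= 11 * norm (triple a v h (F x))" for v h x
 proof -
  have w: "norm (v (F x)) / norm (x - b) <= 2 * (norm (v (F x)) / norm (F x - a))"
  proof (cases "x = b")
   case False
   then have "F x ~= a" using diffeoD(1)[OF d, of x] diffeoD(1)[OF d, of b] b by metis
   moreover have "norm (F x - a) <= 2 * norm (x - b)" using diffeoD(5)[OF d, of x b] b by simp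
   ultimately have "norm (v (F x)) / (2 * norm (x - b)) <= norm (v (F x)) / norm (F x - a)"
    using False by (intro divide_left_mono) auto
   then show ?thesis by simp
  qed simp
  have "norm (triple b (%x. v (F x)) (pull F h) x) <= norm (pull F h x) + norm (v (F x)) + norm (v (F x)) / norm (x - b)"
   by (rule norm_triple_le_sum)
  also have "... <= 8 * norm (triple a v h (F x)) + norm (triple a v h (F x)) + 2 * norm (triple a v h (F x))"
   using norm_pull_le[OF d, of h x] w norm_triple_le(1)[of h "F x" a v] norm_triple_le(2)[of v "F x" a h] norm_triple_le(3)[of v "F x" a h]
   by linarith
  finally show ?thesis by simp
 qed
 have mu: "meas (%x. v (F x))" if "meas v" for v :: "real^2 => complex"
  by (rule measurable_compose[OF diffeo_measurable[OF d] that])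
 have Lt: "L2 M (triple b (%x. v (F x)) (pull F h)) \<and> l2 M (triple b (%x. v (F x)) (pull F h)) <= 11 * (3 * l2 M (triple a v h))"
  if "L2 M (triple a v h)" "meas v" "meas h" for v h
 proof -
  note D = L2_diffeo[OF d that(1)]
  note E = L2_dominated[OF D(1) triple_measurable[OF mu[OF that(2)] pull_measurable[OF d that(3)]] AE_I2[OF bound]]
  show ?thesis using E D(2) by simp
 qed
 show ?thesis
 proof (rule H_limit_map[OF H, where T = "%v x. v (F x)" and G = "%v. pull F" and C = 33])
  show "(%x. v (F x)) \<in> test b" "classical_grad (%x. v (F x)) = pull F (classical_grad v)"
   if "v \<in> test a" for v
   using test_functions_diffeo[OF d b that] classical_grad_compose[OF diffeoD(4)[OF d] that] by blast+
  show "L2 M (triple b (%x. v (F x)) (pull F h)) \<and> l2 M (triple b (%x. v (F x)) (pull F h)) <= 33 * l2 M (triple a v h)"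
   if "L2 M (triple a v h)" "meas v" "meas h" for v h
   using Lt[OF that] by simp
 qed (simp_all add: mu pull_measurable[OF d] triple_diff pull_diff)
qed

end

section \<open>Moving the pole\<close>

definition rdot :: "real^2 => complex^2 => complex" where
 "rdot v p = cx (v$1) * p$1 + cx (v$2) * p$2"

lemma norm_rdot: "norm (rdot v p) <= norm v * norm p"
 using norm_real_lincomb[of v p] by (simp add: rdot_def scaleR_conv_of_real)

lemma inner2: "(v :: real^2) \<bullet> w = v$1 * w$1 + v$2 * w$2"
 by (simp add: inner_vec_def sum_2)

lemma axis_nth2: "(axis i 1 :: real^2) $ j = (if i = j then 1 else 0)"
 by (simp add: axis_def)

lemma AB_translate: "AB_potential a al (x + a) = AB_potential 0 al x"
 by (simp add: AB_potential_def)

text \<open>The potential is inversion in the unit circle followed by a quarter turn; this is the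
  distance formula for inversion.\<close>

lemma norm_AB_diff:
 assumes "x ~= 0" "y ~= 0"
 shows "norm (AB_potential 0 1 y - AB_potential 0 1 x) = norm (y - x) / (norm x * norm y)"
proof -
 define X where "X = (norm x)^2"
 define Y where "Y = (norm y)^2"
 have XY: "X ~= 0" "Y ~= 0" using assms by (auto simp: X_def Y_def)
 have x: "X = (x$1)^2 + (x$2)^2" and y: "Y = (y$1)^2 + (y$2)^2" unfolding X_def Y_def by (rule norm_vec2)+
 have A: "AB_potential 0 1 x $ 1 = - (x$2) / X" "AB_potential 0 1 x $ 2 = x$1 / X"
  "AB_potential 0 1 y $ 1 = - (y$2) / Y" "AB_potential 0 1 y $ 2 = y$1 / Y"
  by (simp_all add: AB_potential_nth X_def Y_def)
 have "(norm (AB_potential 0 1 y - AB_potential 0 1 x))^2 = (x$2 / X - y$2 / Y)^2 + (y$1 / Y - x$1 / X)^2"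
  unfolding norm_vec2[of "AB_potential 0 1 y - AB_potential 0 1 x"] by (simp add: A)
 also have "... = ((x$1)^2 + (x$2)^2) / X^2 + ((y$1)^2 + (y$2)^2) / Y^2 - 2 * (x$1 * y$1 + x$2 * y$2) / (X * Y)"
  by (simp add: power2_eq_square diff_divide_distrib add_divide_distrib algebra_simps)
 also have "... = 1 / X + 1 / Y - 2 * (x$1 * y$1 + x$2 * y$2) / (X * Y)"
  unfolding x[symmetric] y[symmetric] using XY by (simp add: power2_eq_square)
 also have "... = (Y + X - 2 * (x$1 * y$1 + x$2 * y$2)) / (X * Y)"
  using XY by (simp add: field_simps)
 also have "Y + X - 2 * (x$1 * y$1 + x$2 * y$2) = (norm (y - x))^2"
  unfolding norm_vec2[of "y - x"] x y by (simp add: power2_eq_square algebra_simps)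
 also have "(norm (y - x))^2 / (X * Y) = (norm (y - x) / (norm x * norm y))^2"
  by (simp add: X_def Y_def power_divide power_mult_distrib)
 finally show ?thesis by (simp add: power2_eq_iff_nonneg)
qed

lemma cip_add_left: "cip (x + y) z = cip x z + cip y z"
 and cip_add_right: "cip z (x + y) = cip z x + cip z y"
 by (simp_all add: cip_eq algebra_simps)

lemma cip_vec_left: "cip (c *s complex_vec n) P = c * cnj (rdot n P)"
 and cip_vec_right: "cip P (c *s complex_vec n) = cnj c * rdot n P"
 by (simp_all add: cip_eq rdot_def complex_vec_def algebra_simps)

text \<open>Linear part of the transformed integrand. \<open>n\<close> is the gradient of the
  cut-off, \<open>a\<close> the displacement, \<open>b\<close> the change of potential;
  \<open>p\<close> and \<open>P\<close> are magnetic gradients, \<open>u\<close> and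
  \<open>v\<close> values. The terms with \<open>n\<close> come from the volume element and the
  Jacobian matrix, those with \<open>b\<close> from the potential.\<close>

definition first_order :: "real^2 => real^2 => real^2 => complex^2 => complex^2 => complex => complex => complex" where
 "first_order n a b p P u v = cx (n \<bullet> a) * cip p P - rdot a p * cnj (rdot n P) - rdot n p * cnj (rdot a P)
   + (rdot b p * cnj v + u * cnj (rdot b P))"

text \<open>The volume factor \<open>J\<close> cancels the denominator in the cross terms, which are
  then linear up to (J - 1) times the potential terms. With the product of the two corrections this
  is the whole remainder; 7 = 1 + 6, where 6 = 3/2 * 2 * 2. The numbers \<open>wu\<close> and
  \<open>wv\<close> stand for |u| / |x| and |v| / |x|, since \<open>b\<close> may be as singular as
  1 / |x|.\<close>

lemma first_order_expansion:
 fixes p P :: "complex^2" and n a b :: "real^2"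
 assumes \<tau>: "norm n * norm a <= \<tau>" "\<tau> <= 1 / 2" and b: "norm b * norm u <= \<tau> * wu" "norm b * norm v <= \<tau> * wv"
  and w: "wu >= 0" "wv >= 0"
 defines "J \<equiv> 1 + n \<bullet> a"
 shows "norm (cx J * cip (p - (rdot a p / cx J) *s complex_vec n + u *s complex_vec b)
    (P - (rdot a P / cx J) *s complex_vec n + v *s complex_vec b) - cip p P - first_order n a b p P u v)
   <= 7 * \<tau>^2 * ((norm p + wu) * (norm P + wv))"
  and "norm (first_order n a b p P u v) <= 3 * \<tau> * ((norm p + wu) * (norm P + wv))"
proof -
 have t0: "\<tau> >= 0" using \<tau>(1) by (smt (verit) mult_nonneg_nonneg norm_ge_zero)
 have na: "\<bar>n \<bullet> a\<bar> <= \<tau>" using Cauchy_Schwarz_ineq2[of n a] \<tau>(1) by linarith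
 have J: "J >= 1 / 2" "J <= 3 / 2" using na \<tau>(2) by (auto simp: J_def)
 then have Jc: "cx J ~= 0" by simp
 define e where "e = (- (rdot a p / cx J)) *s complex_vec n"
 define E where "E = (- (rdot a P / cx J)) *s complex_vec n"
 define f where "f = e + u *s complex_vec b"
 define F where "F = E + v *s complex_vec b"
 have R: "p - (rdot a p / cx J) *s complex_vec n + u *s complex_vec b = p + f"
  "P - (rdot a P / cx J) *s complex_vec n + v *s complex_vec b = P + F"
  by (simp_all add: e_def E_def f_def F_def vec_eq_iff)
 have 1: "cx J * cip p F = - (rdot n p * cnj (rdot a P)) + cx J * (rdot b p * cnj v)"
  unfolding F_def E_def cip_add_right cip_vec_right using Jc by (simp add: field_simps)
 have 2: "cx J * cip f P = - (rdot a p * cnj (rdot n P)) + cx J * (u * cnj (rdot b P))"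
  unfolding f_def e_def cip_add_left cip_vec_left using Jc by (simp add: field_simps)
 have "cx J * cip (p + f) (P + F) = cx J * cip p P + cx J * cip p F
   + cx J * cip f P + cx J * cip f F"
  by (simp add: cip_add_left cip_add_right algebra_simps)
 also have "cx J * cip p P = cip p P + cx (n \<bullet> a) * cip p P" by (simp add: J_def algebra_simps)
 finally have eq: "cx J * cip (p + f) (P + F) - cip p P - first_order n a b p P u v
   = cx (n \<bullet> a) * (rdot b p * cnj v + u * cnj (rdot b P)) + cx J * cip f F"
  unfolding 1 2 first_order_def by (simp add: J_def algebra_simps)
 have bp: "norm (rdot b p * cnj v) <= \<tau> * (norm p * wv)" "norm (u * cnj (rdot b P)) <= \<tau> * (wu * norm P)"
 proof -
  have "norm (rdot b p * cnj v) <= norm b * norm p * norm v" unfolding norm_mult complex_mod_cnj by (intro mult_right_mono norm_rdot) simp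
  also have "... = norm p * (norm b * norm v)" by simp
  also have "... <= norm p * (\<tau> * wv)" by (intro mult_left_mono b) simp
  finally show "norm (rdot b p * cnj v) <= \<tau> * (norm p * wv)" by (simp add: mult_ac)
  have "norm (u * cnj (rdot b P)) <= norm u * (norm b * norm P)" unfolding norm_mult complex_mod_cnj by (intro mult_left_mono norm_rdot) simp
  also have "... = norm P * (norm b * norm u)" by simp
  also have "... <= norm P * (\<tau> * wu)" by (intro mult_left_mono b) simp
  finally show "norm (u * cnj (rdot b P)) <= \<tau> * (wu * norm P)" by (simp add: mult_ac)
 qed
 let ?W = "(norm p + wu) * (norm P + wv)"
 have W: "norm p * wv + wu * norm P <= ?W" "norm p * norm P + norm p * wv + wu * norm P <= ?W"
  using w by (simp_all add: algebra_simps)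
 have bsum: "norm (rdot b p * cnj v + u * cnj (rdot b P)) <= \<tau> * (norm p * wv + wu * norm P)"
  using bp norm_triangle_ineq[of "rdot b p * cnj v" "u * cnj (rdot b P)"] by (simp add: algebra_simps)
 have en: "norm ((- (rdot a q / cx J)) *s complex_vec n) <= 2 * \<tau> * norm q" for q
 proof -
  have "norm ((- (rdot a q / cx J)) *s complex_vec n) = norm (rdot a q) * norm n / J"
   using J by (simp add: norm_smult norm_complex_vec norm_divide)
  also have "... <= (norm a * norm q * norm n) / (1 / 2)"
   using J by (intro frac_le mult_right_mono norm_rdot) auto
  also have "... = 2 * (norm n * norm a) * norm q" by simp
  also have "... <= 2 * \<tau> * norm q" using \<tau>(1) by (intro mult_right_mono mult_left_mono) auto
  finally show ?thesis .
 qed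
 have fn: "norm f <= 2 * \<tau> * (norm p + wu)"
 proof -
  have "norm f <= 2 * \<tau> * norm p + \<tau> * wu"
   unfolding f_def using en[of p] b(1) by (intro norm_triangle_le) (simp add: e_def norm_smult norm_complex_vec mult.commute)
  moreover have "\<tau> * wu <= 2 * \<tau> * wu" using t0 w by simp
  ultimately show ?thesis by (simp add: algebra_simps)
 qed
 have Fn: "norm F <= 2 * \<tau> * (norm P + wv)"
 proof -
  have "norm F <= 2 * \<tau> * norm P + \<tau> * wv"
   unfolding F_def using en[of P] b(2) by (intro norm_triangle_le) (simp add: E_def norm_smult norm_complex_vec mult.commute)
  moreover have "\<tau> * wv <= 2 * \<tau> * wv" using t0 w by simp
  ultimately show ?thesis by (simp add: algebra_simps)
 qed
 have "norm (cx J * cip f F) <= 3 / 2 * (2 * \<tau> * (norm p + wu) * (2 * \<tau> * (norm P + wv)))"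
 proof -
  have "norm (cip f F) <= 2 * \<tau> * (norm p + wu) * (2 * \<tau> * (norm P + wv))"
   using norm_cip[of f F] mult_mono[OF fn Fn] t0 w by (intro order_trans[OF norm_cip] mult_mono fn Fn) auto
  then show ?thesis unfolding norm_mult norm_of_real using J by (intro mult_mono) auto
 qed
 also have "... = 6 * \<tau>^2 * ?W" by (simp add: power2_eq_square)
 finally have fF: "norm (cx J * cip f F) <= 6 * \<tau>^2 * ?W" .
 have "norm (cx (n \<bullet> a) * (rdot b p * cnj v + u * cnj (rdot b P))) <= \<tau> * (\<tau> * (norm p * wv + wu * norm P))"
  unfolding norm_mult[of "cx (n \<bullet> a)"] norm_of_real by (intro mult_mono na bsum t0) simp
 also have "... <= \<tau>^2 * ?W" using mult_left_mono[OF W(1), of "\<tau>^2"] by (simp add: power2_eq_square mult.assoc)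
 finally show "norm (cx J * cip (p - (rdot a p / cx J) *s complex_vec n + u *s complex_vec b)
    (P - (rdot a P / cx J) *s complex_vec n + v *s complex_vec b) - cip p P - first_order n a b p P u v)
   <= 7 * \<tau>^2 * ?W"
  unfolding R eq using fF by (intro norm_triangle_le) linarith
 have c1: "norm (cx (n \<bullet> a) * cip p P) <= \<tau> * (norm p * norm P)"
  unfolding norm_mult norm_of_real by (intro mult_mono na norm_cip t0) simp
 have c2: "norm (rdot c q * cnj (rdot c' Q)) <= norm c * norm c' * (norm q * norm Q)" for c c' q Q
 proof -
  have "norm (rdot c q * cnj (rdot c' Q)) <= (norm c * norm q) * (norm c' * norm Q)"
   unfolding norm_mult complex_mod_cnj by (intro mult_mono norm_rdot) auto
  then show ?thesis by (simp add: mult_ac)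
 qed
 have "norm (rdot a p * cnj (rdot n P)) <= \<tau> * (norm p * norm P)" "norm (rdot n p * cnj (rdot a P)) <= \<tau> * (norm p * norm P)"
  using c2[of a p n P] c2[of n p a P] mult_right_mono[OF \<tau>(1), of "norm p * norm P"] by (simp_all add: mult.commute[of "norm a"])
 then have "norm (first_order n a b p P u v) <= 3 * (\<tau> * (norm p * norm P)) + \<tau> * (norm p * wv + wu * norm P)"
  unfolding first_order_def
  using c1 bsum norm_triangle_ineq norm_triangle_ineq4 by (smt (verit))
 also have "... <= 3 * \<tau> * (norm p * norm P + norm p * wv + wu * norm P)"
  using t0 w by (simp add: algebra_simps)
 also have "... <= 3 * \<tau> * ?W" using W(2) t0 by (intro mult_left_mono) auto
 finally show "norm (first_order n a b p P u v) <= 3 * \<tau> * ?W" .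
qed

section \<open>The flow that moves the pole\<close>

locale cutoff = bounded_domain +
 fixes \<zeta> :: "real^2 => real" and gz :: "real^2 => real^2" and r0 L :: real and K :: "(real^2) set"
 assumes zder: "!!x. (\<zeta> has_derivative (%h. gz x \<bullet> h)) (at x)"
  and zsm: "smooth_on UNIV (%x. cx (\<zeta> x))"
  and r0: "r0 > 0" and z1: "!!x. norm x < r0 ==> \<zeta> x = 1"
  and K: "K \<subseteq> \<Omega>" and zK: "!!x. x \<notin> K ==> \<zeta> x = 0"
  and L: "L > 0" and zL: "!!x. norm (gz x) <= L"
  and zb: "!!x. 0 <= \<zeta> x" "!!x. \<zeta> x <= 1"
begin

definition \<Phi> :: "real^2 => real^2 => real^2" where "\<Phi> a x = x + \<zeta> x *\<^sub>R a"

definition \<Psi> :: "real^2 => real^2 => real^2" where "\<Psi> a = inv (\<Phi> a)"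

definition J :: "real^2 => real^2 => real" where "J a x = 1 + gz x \<bullet> a"

definition small :: "real^2 => bool" where "small a \<longleftrightarrow> norm a * L <= 1 / 2"

lemma gz_partial: "partial_deriv i (%x. cx (\<zeta> x)) x = cx (gz x $ i)"
 using partial_deriv_of_real[OF zder, of i] by (simp add: inner_axis)

lemma gz_smooth: "smooth_on UNIV (%x. cx (gz x $ i))"
 using smooth_on_partial[OF zsm, of i] by (simp only: gz_partial[abs_def])

lemma J_bound: "small a ==> \<bar>J a x - 1\<bar> <= norm (gz x) * norm a" "small a ==> norm (gz x) * norm a <= 1 / 2"
 "small a ==> J a x >= 1 / 2" "small a ==> J a x <= 3 / 2"
proof -
 assume s: "small a"
 have b: "norm (gz x) * norm a <= 1 / 2"
  using mult_right_mono[OF zL[of x], of "norm a"] s by (simp add: small_def mult.commute)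
 show a: "\<bar>J a x - 1\<bar> <= norm (gz x) * norm a" using Cauchy_Schwarz_ineq2[of "gz x" a] by (simp add: J_def)
 show "norm (gz x) * norm a <= 1 / 2" by fact
 show "J a x >= 1 / 2" "J a x <= 3 / 2" using a b by linarith+
qed

lemma \<zeta>_lipschitz: "\<bar>\<zeta> x - \<zeta> y\<bar> <= L * norm (x - y)"
proof -
 have "norm (\<zeta> x - \<zeta> y) <= L * norm (x - y)"
 proof (rule differentiable_bound[of UNIV \<zeta> "%x h. gz x \<bullet> h"])
  show "onorm ((\<bullet>) (gz z)) <= L" for z
  proof (rule onorm_le)
   show "norm (gz z \<bullet> h) <= L * norm h" for h
    using Cauchy_Schwarz_ineq2[of "gz z" h] mult_right_mono[OF zL[of z] norm_ge_zero[of h]] by simp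
  qed
 qed (use zder in auto)
 then show ?thesis by simp
qed

lemma \<Phi>_near: assumes s: "small a" shows "norm (\<Phi> a x - \<Phi> a y - (x - y)) <= 1 / 2 * norm (x - y)"
proof -
 have "norm (\<Phi> a x - \<Phi> a y - (x - y)) = \<bar>\<zeta> x - \<zeta> y\<bar> * norm a"
 proof -
  have "\<Phi> a x - \<Phi> a y - (x - y) = (\<zeta> x - \<zeta> y) *\<^sub>R a" by (simp add: \<Phi>_def algebra_simps)
  then show ?thesis by simp
 qed
 also have "... <= L * norm (x - y) * norm a" by (intro mult_right_mono \<zeta>_lipschitz) simp
 also have "... = (norm a * L) * norm (x - y)" by simp
 also have "... <= 1 / 2 * norm (x - y)" using s unfolding small_def by (intro mult_right_mono) auto
 finally show ?thesis .
qed

lemma \<Phi>_lipschitz: "small a ==> norm (\<Phi> a x - \<Phi> a y) <= 2 * norm (x - y)" "small a ==> norm (x - y) <= 2 * norm (\<Phi> a x - \<Phi> a y)"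
 using \<Phi>_near[of a x y] norm_triangle_ineq2[of "\<Phi> a x - \<Phi> a y" "x - y"] norm_triangle_ineq2[of "x - y" "\<Phi> a x - \<Phi> a y"]
 by (simp_all add: norm_minus_commute[of "x - y" "\<Phi> a x - \<Phi> a y"])

text \<open>The flow is the identity plus a map with Lipschitz constant 1/2. Solving for the
  preimage of y is a fixed point problem for the contraction that sends x to y - \<zeta>(x)
  a.\<close>

lemma \<Phi>_bij: assumes s: "small a" shows "bij (\<Phi> a)"
proof (rule bijI)
 show "inj (\<Phi> a)" using \<Phi>_lipschitz(2)[OF s] by (intro injI) (metis diff_self norm_le_zero_iff norm_zero mult_zero_right right_minus_eq)
 show "surj (\<Phi> a)"
  unfolding surj_def
 proof
  fix y
  have "\<exists>!x. y - \<zeta> x *\<^sub>R a = x"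
  proof (rule banach_fix_type[of "1 / 2"])
   show "\<forall>x. \<forall>x'. dist (y - \<zeta> x *\<^sub>R a) (y - \<zeta> x' *\<^sub>R a) <= 1 / 2 * dist x x'"
    using \<Phi>_near[OF s] by (simp add: dist_norm \<Phi>_def algebra_simps norm_minus_commute)
  qed auto
  then obtain x where "y - \<zeta> x *\<^sub>R a = x" by blast
  then have "y = \<Phi> a x" by (simp add: \<Phi>_def algebra_simps)
  then show "\<exists>x. y = \<Phi> a x" ..
 qed
qed

lemma \<Psi>\<Phi>: "small a ==> \<Psi> a (\<Phi> a x) = x" "small a ==> \<Phi> a (\<Psi> a x) = x"
 using \<Phi>_bij unfolding \<Psi>_def by (simp_all add: bij_is_inj bij_is_surj surj_f_inv_f)

text \<open>Points outside the domain are fixed, and injectivity keeps a point of the domain from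
  landing on one of them.\<close>

lemma \<Phi>_domain: assumes s: "small a" shows "\<Phi> a x \<in> \<Omega> \<longleftrightarrow> x \<in> \<Omega>"
proof -
 have fixed: "\<Phi> a y = y" if "y \<notin> \<Omega>" for y using that zK[of y] K by (auto simp: \<Phi>_def)
 show ?thesis
 proof (cases "\<Phi> a x \<in> \<Omega>")
  case False
  have "\<Phi> a (\<Phi> a x) = \<Phi> a x" by (rule fixed[OF False])
  then have "\<Phi> a x = x" using \<Phi>_bij[OF s] by (metis bij_def injD)
  then show ?thesis by simp
 next
  case True then show ?thesis using fixed[of x] by (cases "x \<in> \<Omega>") auto
 qed
qed

lemma \<Phi>_smooth: "smooth_on UNIV (%x. cx (\<Phi> a x $ j))"
 unfolding \<Phi>_def by simp (intro smooth_on_add smooth_on_mult smooth_on_coord zsm smooth_on_const open_UNIV)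

lemma jac_\<Phi>: "jac (\<Phi> a) i j x = (if i = j then 1 else 0) + gz x $ i * a $ j"
proof -
 have "((%x. \<Phi> a x $ j) has_derivative (%h. h $ j + (gz x \<bullet> h) * a $ j)) (at x)"
  unfolding \<Phi>_def by simp
   (intro has_derivative_add has_derivative_mult_left zder bounded_linear_imp_has_derivative bounded_linear_vec_nth)
 from partial_deriv_of_real[OF this, of i] show ?thesis by (auto simp: jac_def inner_axis axis_nth2)
qed

lemma jdet_\<Phi>: "jdet (\<Phi> a) x = J a x"
 by (simp add: jdet_def jac_\<Phi> J_def inner2 algebra_simps)

lemma \<Psi>_continuous: "small a ==> continuous_on UNIV (\<Psi> a)"
proof -
 assume s: "small a"
 have "dist (\<Psi> a y) (\<Psi> a z) <= 2 * dist y z" for y z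
  using \<Phi>_lipschitz(2)[OF s, of "\<Psi> a y" "\<Psi> a z"] by (simp add: \<Psi>\<Phi>[OF s] dist_norm)
 then have "2-lipschitz_on UNIV (\<Psi> a)" by (auto intro: lipschitz_onI)
 then show ?thesis by (rule lipschitz_on_continuous_on)
qed

text \<open>The derivative of the flow is the identity plus a map of rank one; its inverse is the
  Sherman-Morrison formula, with \<open>J\<close> as denominator.\<close>

lemma \<Psi>_derivative:
 assumes s: "small a"
 shows "(\<Psi> a has_derivative (%h. h - ((gz (\<Psi> a y) \<bullet> h) / J a (\<Psi> a y)) *\<^sub>R a)) (at y)"
proof (rule has_derivative_inverse_basic[where f = "\<Phi> a" and T = UNIV])
 let ?x = "\<Psi> a y"
 show "(\<Phi> a has_derivative (%h. h + (gz ?x \<bullet> h) *\<^sub>R a)) (at ?x)"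
  unfolding \<Phi>_def[abs_def] by (intro has_derivative_add has_derivative_ident has_derivative_scaleR_left zder)
 show "bounded_linear (%h. h - ((gz ?x \<bullet> h) / J a ?x) *\<^sub>R a)"
  by (intro bounded_linear_sub bounded_linear_ident bounded_linear_compose[OF bounded_linear_scaleR_left]
    bounded_linear_compose[OF bounded_linear_divide] bounded_linear_inner_right)
 have J0: "J a ?x ~= 0" using J_bound(3)[OF s, of ?x] by simp
 have "gz ?x \<bullet> (h + (gz ?x \<bullet> h) *\<^sub>R a) / J a ?x = gz ?x \<bullet> h" for h
 proof -
  have "gz ?x \<bullet> (h + (gz ?x \<bullet> h) *\<^sub>R a) = (gz ?x \<bullet> h) * J a ?x" by (simp add: J_def inner_add_right algebra_simps)
  then show ?thesis using J0 by simp
 qed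
 then show "(%h. h - ((gz ?x \<bullet> h) / J a ?x) *\<^sub>R a) \<circ> (%h. h + (gz ?x \<bullet> h) *\<^sub>R a) = id"
  by (auto simp: fun_eq_iff)
 show "isCont (\<Psi> a) y" using \<Psi>_continuous[OF s] by (simp add: continuous_on_eq_continuous_at)
qed (use \<Psi>\<Phi>[OF s] in auto)

lemma \<Psi>_partial:
 assumes s: "small a"
 shows "partial_deriv i (%y. cx (\<Psi> a y $ j)) y
  = cx ((if i = j then 1 else 0) - gz (\<Psi> a y) $ i / J a (\<Psi> a y) * a $ j)"
  "(%y. cx (\<Psi> a y $ j)) differentiable (at y)"
proof -
 have "((%y. \<Psi> a y $ j) has_derivative (%h. (h - ((gz (\<Psi> a y) \<bullet> h) / J a (\<Psi> a y)) *\<^sub>R a) $ j)) (at y)"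
  by (rule bounded_linear.has_derivative[OF bounded_linear_vec_nth \<Psi>_derivative[OF s]])
 note D = this
 from partial_deriv_of_real[OF D, of i]
 show "partial_deriv i (%y. cx (\<Psi> a y $ j)) y
  = cx ((if i = j then 1 else 0) - gz (\<Psi> a y) $ i / J a (\<Psi> a y) * a $ j)"
  by (auto simp: inner_axis axis_nth2)
 show "(%y. cx (\<Psi> a y $ j)) differentiable (at y)"
  unfolding differentiable_def by (rule exI, rule has_derivative_of_real, rule D)
qed

lemma J_smooth: "smooth_on UNIV (%x. cx (J a x))"
 unfolding J_def inner2 by simp (intro smooth_on_add smooth_on_mult smooth_on_const gz_smooth open_UNIV)

text \<open>The partial derivatives of the inverse are smooth functions of the inverse itself.\<close>

lemma \<Psi>_smooth:
 assumes s: "small a"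
 shows "smooth_on UNIV (%y. cx (\<Psi> a y $ j))"
proof -
 define H where "H i j x = cx ((if i = j then 1 else 0) - gz x $ i / J a x * a $ j)" for i j :: 2 and x
 have "smooth_on UNIV (%x. cx (1 / J a x))"
  by (rule smooth_on_inverse[OF open_UNIV J_smooth]) (use J_bound(3)[OF s] in \<open>auto intro: less_le_trans[of 0 "1/2"]\<close>)
 then have "smooth_on UNIV (%x. cx (if i = j then 1 else 0) - cx (gz x $ i) * cx (1 / J a x) * cx (a $ j))" for i j
  by (intro smooth_on_diff smooth_on_mult smooth_on_const gz_smooth open_UNIV)
 then have H: "smooth_on UNIV (H i j)" for i j
  unfolding H_def[abs_def] by simp
 have "Ck_on k UNIV (%y. cx (\<Psi> a y $ j))" for k
 proof (induction k arbitrary: j)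
  case 0
  show ?case using \<Psi>_continuous[OF s] by (auto intro!: continuous_intros)
 next
  case (Suc k)
  have "Ck_on k UNIV (%y. H i j (\<Psi> a y))" for i
   by (rule Ck_on_compose[of UNIV "\<Psi> a" UNIV]) (use Suc H in \<open>auto simp: smooth_on_def\<close>)
  moreover have "partial_deriv i (%y. cx (\<Psi> a y $ j)) = (%y. H i j (\<Psi> a y))" for i
   unfolding H_def \<Psi>_partial(1)[OF s, abs_def] ..
  ultimately show ?case using \<Psi>_partial(2)[OF s] by simp
 qed
 then show ?thesis by (simp add: smooth_on_def)
qed

lemma abs_component_product: "\<bar>v $ i * w $ j\<bar> <= norm v * norm (w :: real^2)" for v :: "real^2"
 unfolding abs_mult by (intro mult_mono component_le_norm_cart) auto

lemma diffeo_\<Phi>: assumes s: "small a" shows "diffeo (\<Phi> a) (\<Psi> a)"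
proof -
 have 1: "\<bar>jac (\<Phi> a) i j x\<bar> <= 2" for i j x
  using abs_component_product[of "gz x" i a j] J_bound(2)[OF s, of x] unfolding jac_\<Phi> by auto
 have 2: "\<bar>jac (\<Psi> a) i j y\<bar> <= 2" for i j y
 proof -
  let ?x = "\<Psi> a y"
  have "\<bar>gz ?x $ i * a $ j / J a ?x\<bar> <= (1 / 2) / (1 / 2)"
   unfolding abs_divide
   using abs_component_product[of "gz ?x" i a j] J_bound(2,3)[OF s, of ?x] by (intro frac_le) auto
  then have "\<bar>gz ?x $ i / J a ?x * a $ j\<bar> <= 1" by simp
  then show ?thesis unfolding jac_def \<Psi>_partial(1)[OF s] by (auto simp del: times_divide_eq_left)
 qed
 have "norm (\<Psi> a y - \<Psi> a z) <= 2 * norm (y - z)" for y z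
  using \<Phi>_lipschitz(2)[OF s, of "\<Psi> a y" "\<Psi> a z"] by (simp add: \<Psi>\<Phi>[OF s])
 then show ?thesis
  unfolding diffeo_def using \<Psi>\<Phi>[OF s] \<Phi>_domain[OF s] \<Phi>_smooth \<Psi>_smooth[OF s] \<Phi>_lipschitz(1)[OF s] 1 2 by simp
qed

lemma \<Phi>_0: "\<Phi> a 0 = a" using z1[of 0] r0 by (simp add: \<Phi>_def)

lemma \<Psi>_pole: "small a ==> \<Psi> a a = 0" using \<Psi>\<Phi>(1)[of a 0] by (simp add: \<Phi>_0)

text \<open>The second summand is the moved potential in the coordinates of the flow minus the old
  one. The first compensates for \<open>moved\<close>, which applies the Jacobian correction to the
  magnetic gradient and not to the gradient alone.\<close>

definition drift :: "real => real^2 => real => real^2 => real^2" where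
 "drift al0 a al x = (al0 * (a \<bullet> AB_potential 0 1 x) / J a x) *\<^sub>R gz x
   + (al *\<^sub>R AB_potential a 1 (\<Phi> a x) - al0 *\<^sub>R AB_potential 0 1 x)"

definition moved :: "real => real^2 => real => (real^2 => complex) => (real^2 => complex^2) => real^2 => complex^2" where
 "moved al0 a al u g x = pgrad 0 al0 u g x - (rdot a (pgrad 0 al0 u g x) / cx (J a x)) *s complex_vec (gz x)
   + u x *s complex_vec (drift al0 a al x)"

text \<open>By the chain rule the pulled-back gradient is q + (a . q) n, with n the gradient of the
  cut-off and q the gradient at the image point. Pairing it with \<open>a\<close> gives
  \<open>J\<close> times a . q, so the quotient by \<open>J\<close> recovers exactly what has to be
  subtracted.\<close>

lemma pgrad_\<Phi>:
 assumes s: "small a"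
 shows "pgrad a al u g (\<Phi> a x) = moved al0 a al (%x. u (\<Phi> a x)) (pull (\<Phi> a) g) x"
proof -
 define A where "A = AB_potential 0 1 x"
 define B where "B = AB_potential a 1 (\<Phi> a x)"
 define n where "n = gz x"
 define q where "q = g (\<Phi> a x)"
 define U where "U = u (\<Phi> a x)"
 define j where "j = 1 + (n$1 * a$1 + n$2 * a$2)"
 have Jj: "J a x = j" by (simp add: J_def j_def n_def inner2)
 have j0: "cx j ~= 0" using J_bound(3)[OF s, of x] by (simp add: Jj)
 define d where "d = cx (a$1) * q$1 + cx (a$2) * q$2"
 have p: "pgrad 0 al0 (%x. u (\<Phi> a x)) (pull (\<Phi> a) g) x $ i
   = \<i> * (q $ i + cx (n $ i) * d) + U * cx (al0 * A $ i)" for i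
  using exhaust_2[of i] unfolding pgrad_def pull_def jac_\<Phi> AB_potential_scale[of 0 al0]
  by (auto simp: complex_vec_def q_def U_def n_def A_def d_def algebra_simps)
 have ad: "rdot a (pgrad 0 al0 (%x. u (\<Phi> a x)) (pull (\<Phi> a) g) x)
   = \<i> * d * cx j + U * cx (al0 * (a \<bullet> A))"
  unfolding rdot_def p by (simp add: d_def j_def inner2 algebra_simps)
 have quot: "rdot a (pgrad 0 al0 (%x. u (\<Phi> a x)) (pull (\<Phi> a) g) x) / cx j
   = \<i> * d + U * cx (al0 * (a \<bullet> A) / j)"
  unfolding ad using j0 by (simp add: add_divide_distrib)
 have "moved al0 a al (%x. u (\<Phi> a x)) (pull (\<Phi> a) g) x $ i = pgrad a al u g (\<Phi> a x) $ i" for i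
 proof -
  have "moved al0 a al (%x. u (\<Phi> a x)) (pull (\<Phi> a) g) x $ i
   = \<i> * (q $ i + cx (n $ i) * d) + U * cx (al0 * A $ i)
    - (\<i> * d + U * cx (al0 * (a \<bullet> A) / j)) * cx (n $ i)
    + U * cx (al0 * (a \<bullet> A) / j * n $ i + (al * B $ i - al0 * A $ i))"
   unfolding moved_def drift_def Jj vector_add_component vector_minus_component vector_smult_component p quot
   by (simp add: complex_vec_def A_def B_def n_def U_def)
  also have "... = \<i> * q $ i + U * cx (al * B $ i)"
   by (simp add: algebra_simps)
  also have "... = pgrad a al u g (\<Phi> a x) $ i"
   unfolding pgrad_def AB_potential_scale[of a al] by (simp add: complex_vec_def q_def U_def B_def)
  finally show ?thesis .
 qed
 then show ?thesis by (simp add: vec_eq_iff)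
qed

lemma J_measurable: "meas (%x. cx (J a x))"
 by (intro borel_M borel_measurable_continuous_onI smooth_on_continuous J_smooth)

lemma gz_measurable: "meas (%x. gz x $ i)"
proof -
 have "meas (%x. Re (cx (gz x $ i)))"
  by (intro borel_M borel_measurable_continuous_onI continuous_on_Re smooth_on_continuous gz_smooth)
 then show ?thesis by simp
qed

lemma drift_measurable: "meas (%x. drift al0 a al x $ i)"
proof -
 have [measurable]: "meas (%x. Re (cx (J a x)))" using J_measurable by measurable
 then have [measurable]: "meas (J a)" by simp
 note [measurable] = gz_measurable
 have "(%x. \<Phi> a x) \<in> borel_measurable borel"
  using has_derivative_jac[OF \<Phi>_smooth]
  by (intro borel_measurable_continuous_onI continuous_at_imp_continuous_on) (auto intro: has_derivative_continuous)
 then have [measurable]: "meas (%x. AB_potential a 1 (\<Phi> a x) $ i)" for i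
  by (intro borel_M measurable_compose[OF _ AB_potential_borel])
 have [measurable]: "meas (%x. AB_potential 0 1 x $ i)" for i by (rule borel_M) measurable
 show ?thesis unfolding drift_def inner2 by simp
qed

lemma moved_measurable:
 assumes p: "meas (pgrad 0 al0 u g)" and [measurable]: "meas u"
 shows "meas (moved al0 a al u g)"
proof (rule borel_measurable_cvec2)
 have [measurable]: "meas (%x. pgrad 0 al0 u g x $ j)" for j
  by (rule measurable_compose[OF p]) (intro borel_measurable_continuous_onI continuous_intros)
 note [measurable] = J_measurable gz_measurable drift_measurable
 show "meas (%x. moved al0 a al u g x $ j)" for j
  unfolding moved_def rdot_def complex_vec_def by simp
qed

text \<open>Within radius \<open>r0\<close> the flow is a translation and the two potentials
  coincide. Beyond it, both arguments of the potential keep distance at least r0 / 2 from 0, and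
  \<open>norm_AB_diff\<close> bounds the difference. The term with \<open>L\<close> comes from the
  Jacobian correction in \<open>drift\<close>.\<close>

lemma drift_bound:
 assumes s: "small a" and a: "norm a <= r0 / 2" and x: "x ~= 0" and al: "\<bar>al\<bar> <= \<bar>al0\<bar> + 1"
 shows "norm (drift al0 a al x - (al - al0) *\<^sub>R AB_potential 0 1 x)
   <= (2 * L * \<bar>al0\<bar> + (\<bar>al0\<bar> + 1) * 2 / r0) * norm a / norm x"
proof -
 define A where "A = AB_potential 0 1 x"
 define B where "B = AB_potential a 1 (\<Phi> a x)"
 have nA: "norm A = 1 / norm x" by (simp add: A_def norm_AB_potential)
 have e: "drift al0 a al x - (al - al0) *\<^sub>R A = (al0 * (a \<bullet> A) / J a x) *\<^sub>R gz x + al *\<^sub>R (B - A)"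
  by (simp add: drift_def A_def B_def algebra_simps)
 have 1: "norm ((al0 * (a \<bullet> A) / J a x) *\<^sub>R gz x) <= 2 * L * \<bar>al0\<bar> * norm a / norm x"
 proof -
  have "\<bar>a \<bullet> A\<bar> <= norm a / norm x" using Cauchy_Schwarz_ineq2[of a A] by (simp add: nA)
  then have "\<bar>al0 * (a \<bullet> A)\<bar> / \<bar>J a x\<bar> <= (\<bar>al0\<bar> * (norm a / norm x)) / (1 / 2)"
   unfolding abs_mult using J_bound(3)[OF s, of x] by (intro frac_le mult_left_mono) auto
  then have "\<bar>al0 * (a \<bullet> A)\<bar> / \<bar>J a x\<bar> * norm (gz x) <= (\<bar>al0\<bar> * (norm a / norm x)) / (1 / 2) * L"
   by (intro mult_mono zL) auto
  then show ?thesis by (simp add: algebra_simps)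
 qed
 have 2: "norm (B - A) <= 2 / r0 * norm a / norm x"
 proof (cases "norm x < r0")
  case True
  then have "\<Phi> a x = x + a" using z1 by (simp add: \<Phi>_def)
  then have "B = A" by (simp add: A_def B_def AB_translate)
  then show ?thesis using r0 by simp
 next
  case False
  define y where "y = x + (\<zeta> x - 1) *\<^sub>R a"
  have "\<Phi> a x = y + a" by (simp add: \<Phi>_def y_def algebra_simps)
  then have By: "B = AB_potential 0 1 y" by (simp add: B_def AB_translate)
  have yx: "norm (y - x) <= norm a" using zb[of x] mult_right_mono[of "\<bar>\<zeta> x - 1\<bar>" 1 "norm a"] by (simp add: y_def)
  have "norm x <= norm y + norm (y - x)" using norm_triangle_ineq4[of y "y - x"] by simp
  then have y: "norm y >= r0 / 2" using False yx a by linarith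
  then have "y ~= 0" using r0 by auto
  have "norm (B - A) = norm (y - x) / (norm x * norm y)" unfolding By A_def by (rule norm_AB_diff[OF x \<open>y ~= 0\<close>])
  also have "... <= norm a / (norm x * (r0 / 2))"
   using yx y r0 x by (intro frac_le mult_left_mono) auto
  finally show ?thesis by (simp add: field_simps)
 qed
 have "norm (al *\<^sub>R (B - A)) <= (\<bar>al0\<bar> + 1) * (2 / r0 * norm a / norm x)"
  unfolding norm_scaleR by (intro mult_mono al 2) auto
 then have "norm (drift al0 a al x - (al - al0) *\<^sub>R A) <= 2 * L * \<bar>al0\<bar> * norm a / norm x + (\<bar>al0\<bar> + 1) * (2 / r0 * norm a / norm x)"
  unfolding e using 1 by (intro norm_triangle_le add_mono)
 then show ?thesis by (simp add: A_def add_divide_distrib distrib_right)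
qed

text \<open>A change of variables in the weak equation. Every test pair at the pole 0 arises from v
  composed with the inverse flow, a member of the form domain at \<open>a\<close>; the gradient that
  \<open>grad\<close> selects for it is identified with \<open>h\<close> almost everywhere by
  uniqueness.\<close>

lemma eigen_transform:
 assumes s: "small a" and u: "u \<in> eigenspace \<Omega> a al \<mu>"
 obtains g where "H_limit \<Omega> 0 (%x. u (\<Phi> a x)) g"
  "!!v h. H_limit \<Omega> 0 v h ==>
   (LINT x|M. cx (J a x) * cip (moved al0 a al (%x. u (\<Phi> a x)) g x) (moved al0 a al v h x))
   = \<mu> * (LINT x|M. cx (J a x) * (u (\<Phi> a x) * cnj (v x)))"
proof -
 note d = diffeo_\<Phi>[OF s]
 have uH: "u \<in> H10 \<Omega> a" using u by (simp add: eigenspace_def)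
 define g where "g = grad \<Omega> a u"
 have Hu: "H_limit \<Omega> a u g" unfolding g_def by (rule H10_grad[OF uH])
 have HU: "H_limit \<Omega> 0 (%x. u (\<Phi> a x)) (pull (\<Phi> a) g)"
  by (rule H_limit_pull[OF d \<Phi>_0 Hu])
 have Jdet: "\<bar>jdet (\<Phi> a) x\<bar> = J a x" for x using J_bound(3)[OF s, of x] by (simp add: jdet_\<Phi>)
 have "(LINT x|M. cx (J a x) * cip (moved al0 a al (%x. u (\<Phi> a x)) (pull (\<Phi> a) g) x) (moved al0 a al v h x))
   = \<mu> * (LINT x|M. cx (J a x) * (u (\<Phi> a x) * cnj (v x)))" if Hv: "H_limit \<Omega> 0 v h" for v h
 proof -
  define w where "w x = v (\<Psi> a x)" for x
  have Hw: "H_limit \<Omega> a w (pull (\<Psi> a) h)"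
   unfolding w_def by (rule H_limit_pull[OF diffeo_sym[OF d] \<Psi>_pole[OF s] Hv])
  then have wH: "w \<in> H10 \<Omega> a" by (auto simp: H10_def)
  define k where "k = grad \<Omega> a w"
  have Hk: "H_limit \<Omega> a w k" unfolding k_def by (rule H10_grad[OF wH])
  have wv: "(%x. w (\<Phi> a x)) = v" by (simp add: w_def fun_eq_iff \<Psi>\<Phi>[OF s])
  have "H_limit \<Omega> 0 v (pull (\<Phi> a) k)" using H_limit_pull[OF d \<Phi>_0 Hk] unfolding wv .
  from H_limit_grad_unique[OF this Hv] have ae: "AE x in M. pull (\<Phi> a) k x = h x" by simp
  have mu: "magnetic_grad \<Omega> a al u = pgrad a al u g" "magnetic_grad \<Omega> a al w = pgrad a al w k"
   by (simp_all add: fun_eq_iff magnetic_grad_def pgrad_def g_def k_def)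
  have "(LINT x|M. cip (magnetic_grad \<Omega> a al u x) (magnetic_grad \<Omega> a al w x)) = \<mu> * (LINT x|M. u x * cnj (w x))"
   using u wH unfolding eigenspace_def cip_def by blast
  then have eq: "(LINT x|M. cip (pgrad a al u g x) (pgrad a al w k x)) = \<mu> * (LINT x|M. u x * cnj (w x))"
   unfolding mu .
  have L1: "integrable M (%x. cip (pgrad a al u g x) (pgrad a al w k x))"
   by (rule L2_bilinear[OF bounded_bilinear_cip H_limit_L2(5)[OF Hu] H_limit_L2(5)[OF Hk]])
  have L2': "integrable M (%x. u x * cnj (w x))"
   by (rule L2_inner_integrable[OF H_limit_L2(3)[OF Hu] H_limit_L2(3)[OF Hk]])
  have LU: "L2 M (%x. pgrad a al u g (\<Phi> a x))" by (rule L2_diffeo(1)[OF d H_limit_L2(5)[OF Hu]])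
  have LV: "L2 M (%x. pgrad a al w k (\<Phi> a x))" by (rule L2_diffeo(1)[OF d H_limit_L2(5)[OF Hk]])
  have ae': "AE x in M. pgrad a al w k (\<Phi> a x) = moved al0 a al v h x"
   using ae
  proof eventually_elim
   case (elim x)
   have "pgrad a al w k (\<Phi> a x) = moved al0 a al v (pull (\<Phi> a) k) x" using pgrad_\<Phi>[OF s, of al w k x al0] unfolding wv .
   then show ?case using elim by (simp add: moved_def pgrad_def)
  qed
  have "(LINT x|M. cip (pgrad a al u g x) (pgrad a al w k x))
    = (LINT x|M. cx (J a x) * cip (pgrad a al u g (\<Phi> a x)) (pgrad a al w k (\<Phi> a x)))"
   using integral_diffeo[OF d borel_measurable_integrable[OF L1]] unfolding Jdet .
  also have "... = (LINT x|M. cx (J a x) * cip (moved al0 a al (%x. u (\<Phi> a x)) (pull (\<Phi> a) g) x) (moved al0 a al v h x))"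
   unfolding pgrad_\<Phi>[OF s, of al u g _ al0]
  proof (rule integral_cong_AE)
   note LU' = LU[unfolded pgrad_\<Phi>[OF s, of al u g _ al0]]
   have Lm: "L2 M (moved al0 a al v h)"
    by (rule L2_cong_AE(1)[OF LV moved_measurable[OF H_limit_L2(5)[OF Hv, THEN L2_measurable] H_limit_L2(3)[OF Hv, THEN L2_measurable]] ae'])
   show "meas (%x. cx (J a x) * cip (moved al0 a al (%x. u (\<Phi> a x)) (pull (\<Phi> a) g) x) (pgrad a al w k (\<Phi> a x)))"
    "meas (%x. cx (J a x) * cip (moved al0 a al (%x. u (\<Phi> a x)) (pull (\<Phi> a) g) x) (moved al0 a al v h x))"
    using borel_measurable_integrable[OF L2_bilinear[OF bounded_bilinear_cip LU' LV]]
     borel_measurable_integrable[OF L2_bilinear[OF bounded_bilinear_cip LU' Lm]] J_measurable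
    by (auto intro: borel_measurable_times)
   show "AE x in M. cx (J a x) * cip (moved al0 a al (%x. u (\<Phi> a x)) (pull (\<Phi> a) g) x) (pgrad a al w k (\<Phi> a x))
    = cx (J a x) * cip (moved al0 a al (%x. u (\<Phi> a x)) (pull (\<Phi> a) g) x) (moved al0 a al v h x)"
    using ae' by eventually_elim simp
  qed
  finally show ?thesis
   using integral_diffeo[OF d borel_measurable_integrable[OF L2']] eq unfolding Jdet
   by (simp add: w_def \<Psi>\<Phi>[OF s])
 qed
 with HU that show ?thesis by blast
qed

end

section \<open>Perturbation of a double eigenvalue\<close>

context bounded_domain
begin

text \<open>A common pointwise majorant: products of two such weights dominate the magnetic terms as
  well as those with a potential of size 1 / |x|, and by Hardy's inequality the L2 norm is bounded
  by the energy.\<close>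

definition wt :: "real => (real^2 => complex) => (real^2 => complex^2) => real^2 => real" where
 "wt al u g x = norm (pgrad 0 al u g x) + norm (u x) / norm x"

lemma wt_nonneg: "wt al u g x >= 0" by (simp add: wt_def)

lemma wt_L2:
 assumes H: "H_limit \<Omega> 0 u g"
 shows "L2 M (wt al u g)"
  "exp ((2 * pi) *\<^sub>R (- \<i> * cx al)) = -1 ==> l2 M (wt al u g) <= (1 + pi) * l2 M (pgrad 0 al u g)"
proof -
 note L = H_limit_L2[OF H]
 have n: "L2 M (%x. norm (f x)) \<and> l2 M (%x. norm (f x)) = l2 M f" if "L2 M f"
  for f :: "real^2 => 'b :: {banach, second_countable_topology}"
  using that by (auto simp: L2_def l2_def)
 have e: "wt al u g = (%x. norm (pgrad 0 al u g x) + norm (u x / cx (norm (x - 0))))"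
  by (simp add: fun_eq_iff wt_def norm_divide)
 note A = L2_add[OF n[OF L(5), THEN conjunct1] n[OF L(4), THEN conjunct1]]
 show "L2 M (wt al u g)" unfolding e by (rule A(1))
 have b: "l2 M (wt al u g) <= l2 M (pgrad 0 al u g) + l2 M (%x. u x / cx (norm (x - 0)))"
  unfolding e using A(2) n[OF L(5), THEN conjunct2] n[OF L(4), THEN conjunct2] by simp
 assume "exp ((2 * pi) *\<^sub>R (- \<i> * cx al)) = -1"
 from b hardy[OF H this] show "l2 M (wt al u g) <= (1 + pi) * l2 M (pgrad 0 al u g)"
  by (simp add: algebra_simps)
qed

lemma wt_bound:
 fixes F :: "real^2 => complex"
 assumes "H_limit \<Omega> 0 u g" "H_limit \<Omega> 0 v h" "meas F" "C >= 0"
  and "!!x. x ~= 0 ==> norm (F x) <= C * (wt al u g x * wt al v h x)"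
 shows "integrable M F" "norm (LINT x|M. F x) <= C * (l2 M (wt al u g) * l2 M (wt al v h))"
proof -
 have "AE x in M. norm (F x) <= C * (norm (wt al u g x) * norm (wt al v h x))"
  using AE_M_neq[of 0] by eventually_elim (use assms(5) in \<open>simp add: wt_nonneg\<close>)
 note * = L2_bound[OF wt_L2(1)[OF assms(1)] wt_L2(1)[OF assms(2)] assms(3) this assms(4)]
 show "integrable M F" "norm (LINT x|M. F x) <= C * (l2 M (wt al u g) * l2 M (wt al v h))" by (rule *)+
qed

lemma component_measurable:
 assumes "meas f" shows "meas (%x. (f x :: complex^2) $ j)"
 by (rule measurable_compose[OF assms]) (intro borel_measurable_continuous_onI continuous_intros)

lemma cnj_measurable: "meas f ==> meas (%x. cnj (f x))"
 by (rule measurable_compose[where N = borel]) (auto intro!: borel_measurable_continuous_onI continuous_intros)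

lemma rdot_measurable:
 assumes [measurable]: "!!j. meas (%x. b x $ j)" and p: "meas p"
 shows "meas (%x. rdot (b x) (p x))"
proof -
 note [measurable] = component_measurable[OF p]
 show ?thesis unfolding rdot_def by measurable
qed

lemma cip_measurable:
 assumes p: "meas p" and q: "meas q"
 shows "meas (%x. cip (p x) (q x))"
proof -
 note [measurable] = component_measurable[OF p] cnj_measurable[OF component_measurable[OF q]]
 show ?thesis unfolding cip_eq by measurable
qed

lemma first_order_measurable:
 assumes n: "!!j. meas (%x. n x $ j)" and b: "!!j. meas (%x. b x $ j)"
  and p: "meas p" and q: "meas q" and u: "meas u" and v: "meas v"
 shows "meas (%x. first_order (n x) a (b x) (p x) (q x) (u x) (v x))"
proof -
 have a: "meas (%x. a $ j)" for j by simp
 note [measurable] = n b u cnj_measurable[OF v] cip_measurable[OF p q] rdot_measurable[OF n p] cnj_measurable[OF rdot_measurable[OF n q]]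
  rdot_measurable[of "%_. a", OF a p] cnj_measurable[OF rdot_measurable[of "%_. a", OF a q]]
  rdot_measurable[OF b p] cnj_measurable[OF rdot_measurable[OF b q]]
 show ?thesis unfolding first_order_def inner2 by measurable
qed

lemma energy_controls:
 assumes al: "exp ((2 * pi) *\<^sub>R (- \<i> * cx al)) = -1"
 obtains K where "K > 0" "!!u g. H_limit \<Omega> 0 u g ==> l2 M (wt al u g) <= K * l2 M (pgrad 0 al u g)"
  "!!u g. H_limit \<Omega> 0 u g ==> l2 M u <= K * l2 M (pgrad 0 al u g)"
proof -
 obtain K where K: "K > 0" "!!u g. H_limit \<Omega> 0 u g ==> l2 M (triple 0 u g) <= K * l2 M (pgrad 0 al u g)"
  using coercive[OF al] by blast
 have 1: "l2 M (wt al u g) <= (K + (1 + pi)) * l2 M (pgrad 0 al u g)" if "H_limit \<Omega> 0 u g" for u g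
  using wt_L2(2)[OF that al] mult_nonneg_nonneg[OF less_imp_le[OF K(1)] l2_nonneg[of M "pgrad 0 al u g"]]
  by (simp add: distrib_right)
 have 2: "l2 M u <= (K + (1 + pi)) * l2 M (pgrad 0 al u g)" if H: "H_limit \<Omega> 0 u g" for u g
 proof -
  have "l2 M u <= 1 * l2 M (triple 0 u g)"
   by (rule L2_dominated(2)[OF H_limit_L2(1)[OF H] L2_measurable[OF H_limit_L2(3)[OF H]]]) (auto simp: norm_triple_le)
  then have "l2 M u <= K * l2 M (pgrad 0 al u g)" using K(2)[OF H] by simp
  moreover have "0 <= (1 + pi) * l2 M (pgrad 0 al u g)"
   using pi_gt_zero l2_nonneg[of M "pgrad 0 al u g"] by (intro mult_nonneg_nonneg) linarith+
  ultimately show ?thesis by (simp add: distrib_right)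
 qed
 have "K + (1 + pi) > 0" using K(1) pi_gt_zero by linarith
 then show ?thesis by (rule that) (rule 1, assumption, rule 2)
qed

lemma mform_hermitian: "mform al v h u g = cnj (mform al u g v h)"
proof -
 have "mform al v h u g = (LINT x|M. cnj (cip (pgrad 0 al u g x) (pgrad 0 al v h x)))"
  unfolding mform_def by (rule b_integral_cong) (simp_all add: cip_eq algebra_simps)
 then show ?thesis unfolding mform_def by simp
qed

lemma L2_inner_hermitian: "ip v u = cnj (ip u v)"
proof -
 have "ip v u = (LINT x|M. cnj (u x * cnj (v x)))"
  unfolding L2_inner_def by (rule b_integral_cong) (simp_all add: algebra_simps)
 then show ?thesis unfolding L2_inner_def by (simp del: complex_cnj_mult)
qed

end

section \<open>Expansion of the transported form and mass\<close>

context cutoff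
begin

definition tform where
 "tform al0 a al u g v h = (LINT x|M. cx (J a x) * cip (moved al0 a al u g x) (moved al0 a al v h x))"

definition tmass where
 "tmass a u v = (LINT x|M. cx (J a x) * (u x * cnj (v x)))"

text \<open>Linear in \<open>drift\<close>, hence not literally linear in the parameters:
  \<open>drift\<close> keeps its nonlinear dependence on them, and its linear part is extracted only
  in \<open>drift_linear\<close>.\<close>

definition fo where
 "fo al0 a al u g v h = (LINT x|M. first_order (gz x) a (drift al0 a al x) (pgrad 0 al0 u g x) (pgrad 0 al0 v h x) (u x) (v x))"

definition gmass where
 "gmass a u v = (LINT x|M. cx (gz x \<bullet> a) * (u x * cnj (v x)))"

text \<open>One Lipschitz constant for all coefficients: \<open>L\<close> for the gradient of the
  cut-off, 1 for the change of circulation, and the constant of \<open>drift_bound\<close> for the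
  rest of the potential.\<close>

definition rate :: "real => real" where
 "rate al0 = L + 1 + (2 * L * \<bar>al0\<bar> + (\<bar>al0\<bar> + 1) * 2 / r0)"

definition dist_par :: "real => real^2 => real => real" where
 "dist_par al0 a al = norm a + \<bar>al - al0\<bar>"

definition near :: "real => real^2 => real => bool" where
 "near al0 a al \<longleftrightarrow> rate al0 * dist_par al0 a al <= 1 / 2 \<and> dist_par al0 a al <= min 1 (r0 / 2)"

lemma rate_ge: "rate al0 >= L" "rate al0 >= 1" "rate al0 > 0"
 using L r0 by (auto simp: rate_def intro!: add_nonneg_nonneg add_pos_nonneg)

lemma near_small:
 assumes "near al0 a al"
 shows "small a" "norm a <= r0 / 2" "\<bar>al\<bar> <= \<bar>al0\<bar> + 1"
  "norm (gz x) * norm a <= rate al0 * dist_par al0 a al"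
  "x ~= 0 ==> norm (drift al0 a al x) <= rate al0 * dist_par al0 a al / norm x"
proof -
 have t: "norm a <= dist_par al0 a al" "\<bar>al - al0\<bar> <= dist_par al0 a al" "0 <= dist_par al0 a al" by (auto simp: dist_par_def)
 have "norm a * L <= dist_par al0 a al * rate al0" using t L rate_ge by (intro mult_mono) auto
 then show s: "small a" using assms by (simp add: near_def small_def mult.commute)
 show a: "norm a <= r0 / 2" "\<bar>al\<bar> <= \<bar>al0\<bar> + 1" using assms t by (auto simp: near_def)
 have "norm (gz x) * norm a <= rate al0 * dist_par al0 a al"
  using zL[of x] t rate_ge(1)[of al0] L by (intro mult_mono) auto
 then show "norm (gz x) * norm a <= rate al0 * dist_par al0 a al" .
 assume x: "x ~= 0"
 define c where "c = 2 * L * \<bar>al0\<bar> + (\<bar>al0\<bar> + 1) * 2 / r0"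
 have c: "c >= 0" using L r0 by (simp add: c_def)
 have "norm (drift al0 a al x) <= norm ((al - al0) *\<^sub>R AB_potential 0 1 x) + c * norm a / norm x"
  using drift_bound[OF s a(1) x a(2)] norm_triangle_ineq2[of "drift al0 a al x" "(al - al0) *\<^sub>R AB_potential 0 1 x"]
  unfolding c_def by linarith
 also have "... = (\<bar>al - al0\<bar> + c * norm a) / norm x" by (simp add: norm_AB_potential add_divide_distrib)
 also have "... <= (rate al0 * dist_par al0 a al) / norm x"
 proof (rule divide_right_mono)
  have "\<bar>al - al0\<bar> + c * norm a <= (1 + c) * dist_par al0 a al"
   using c mult_left_mono[OF t(1) c] t(2) by (simp add: algebra_simps)
  also have "... <= rate al0 * dist_par al0 a al" using L t(3) by (intro mult_right_mono) (auto simp: rate_def c_def)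
  finally show "\<bar>al - al0\<bar> + c * norm a <= rate al0 * dist_par al0 a al" .
 qed simp
 finally show "norm (drift al0 a al x) <= rate al0 * dist_par al0 a al / norm x" .
qed

lemma tform_expansion:
 assumes n: "near al0 a al" and u: "H_limit \<Omega> 0 u g" and v: "H_limit \<Omega> 0 v h"
 defines "\<tau> \<equiv> rate al0 * dist_par al0 a al"
 shows "norm (tform al0 a al u g v h - mform al0 u g v h - fo al0 a al u g v h)
   <= 7 * \<tau>^2 * (l2 M (wt al0 u g) * l2 M (wt al0 v h))"
  "norm (fo al0 a al u g v h) <= 3 * \<tau> * (l2 M (wt al0 u g) * l2 M (wt al0 v h))"
  "integrable M (%x. first_order (gz x) a (drift al0 a al x) (pgrad 0 al0 u g x) (pgrad 0 al0 v h x) (u x) (v x))"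
proof -
 let ?F = "%x. first_order (gz x) a (drift al0 a al x) (pgrad 0 al0 u g x) (pgrad 0 al0 v h x) (u x) (v x)"
 let ?G = "%x. cx (J a x) * cip (moved al0 a al u g x) (moved al0 a al v h x)"
 let ?H = "%x. cip (pgrad 0 al0 u g x) (pgrad 0 al0 v h x)"
 note mu = L2_measurable[OF H_limit_L2(5)[OF u]] L2_measurable[OF H_limit_L2(3)[OF u]]
 note mv = L2_measurable[OF H_limit_L2(5)[OF v]] L2_measurable[OF H_limit_L2(3)[OF v]]
 have t0: "\<tau> >= 0" using rate_ge(3)[of al0] by (simp add: \<tau>_def dist_par_def)
 have t1: "\<tau> <= 1 / 2" using n by (simp add: near_def \<tau>_def)
 have d: "norm (drift al0 a al x) * c <= \<tau> * (c / norm x)" if "x ~= 0" "c >= 0" for x c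
  using mult_right_mono[OF near_small(5)[OF n that(1)] that(2)] by (simp add: \<tau>_def)
 have pw: "norm (?G x - ?H x - ?F x) <= 7 * \<tau>^2 * (wt al0 u g x * wt al0 v h x)"
  "norm (?F x) <= 3 * \<tau> * (wt al0 u g x * wt al0 v h x)" if x: "x ~= 0" for x
  using first_order_expansion[of "gz x" a \<tau> "drift al0 a al x" "u x" "norm (u x) / norm x" "v x" "norm (v x) / norm x" "pgrad 0 al0 u g x" "pgrad 0 al0 v h x"]
   near_small(4)[OF n, of x] t1 d[OF x] unfolding moved_def J_def wt_def \<tau>_def by auto
 have mF: "meas ?F" by (intro first_order_measurable gz_measurable drift_measurable mu mv)
 have mG: "meas ?G" by (intro borel_measurable_times J_measurable cip_measurable moved_measurable mu mv)
 have mH: "meas ?H" by (intro cip_measurable mu mv)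
 show F: "integrable M ?F" by (rule wt_bound(1)[OF u v mF _ pw(2)]) (use t0 in auto)
 show "norm (fo al0 a al u g v h) <= 3 * \<tau> * (l2 M (wt al0 u g) * l2 M (wt al0 v h))"
  unfolding fo_def by (rule wt_bound(2)[OF u v mF _ pw(2)]) (use t0 in auto)
 have m: "meas (%x. ?G x - ?H x - ?F x)" using mF mG mH by (intro borel_measurable_diff)
 note R = wt_bound[OF u v m _ pw(1)]
 have iH: "integrable M ?H" by (rule mform_integrable[OF u v])
 have iR: "integrable M (%x. ?G x - ?H x - ?F x)" using R(1) by simp
 have "integrable M (%x. (?G x - ?H x - ?F x) + (?H x + ?F x))" by (intro b_integrable_add iR iH F)
 then have iG: "integrable M ?G" by simp
 have "(LINT x|M. ?G x - ?H x - ?F x) = tform al0 a al u g v h - mform al0 u g v h - fo al0 a al u g v h"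
  unfolding tform_def mform_def fo_def
  using b_integral_diff[OF b_integrable_diff[OF iG iH] F] b_integral_diff[OF iG iH] by simp
 then show "norm (tform al0 a al u g v h - mform al0 u g v h - fo al0 a al u g v h) <= 7 * \<tau>^2 * (l2 M (wt al0 u g) * l2 M (wt al0 v h))"
  using R(2) by simp
qed

lemma tmass_expansion:
 assumes n: "near al0 a al" and u: "L2 M u" and v: "L2 M v"
 shows "tmass a u v = ip u v + gmass a u v"
  "norm (gmass a u v) <= rate al0 * dist_par al0 a al * (l2 M u * l2 M v)"
  "integrable M (%x. cx (gz x \<bullet> a) * (u x * cnj (v x)))"
proof -
 have t0: "0 <= rate al0 * dist_par al0 a al" using rate_ge(3)[of al0] by (simp add: dist_par_def)
 have m: "meas (%x. cx (gz x \<bullet> a) * (u x * cnj (v x)))"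
 proof -
  note [measurable] = gz_measurable L2_measurable[OF u] cnj_measurable[OF L2_measurable[OF v]]
  show ?thesis unfolding inner2 by measurable
 qed
 have b: "norm (cx (gz x \<bullet> a) * (u x * cnj (v x))) <= rate al0 * dist_par al0 a al * (norm (u x) * norm (v x))" for x
  unfolding norm_mult norm_of_real complex_mod_cnj
  using Cauchy_Schwarz_ineq2[of "gz x" a] near_small(4)[OF n, of x] by (intro mult_right_mono) auto
 note B = L2_bound[OF u v m AE_I2[OF b] t0]
 show i: "integrable M (%x. cx (gz x \<bullet> a) * (u x * cnj (v x)))" by (rule B(1))
 show "norm (gmass a u v) <= rate al0 * dist_par al0 a al * (l2 M u * l2 M v)" unfolding gmass_def by (rule B(2))
 have "cx (J a x) * (u x * cnj (v x)) = u x * cnj (v x) + cx (gz x \<bullet> a) * (u x * cnj (v x))" for x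
  by (simp add: J_def algebra_simps)
 then show "tmass a u v = ip u v + gmass a u v"
  unfolding tmass_def L2_inner_def gmass_def using b_integral_add[OF L2_inner_integrable[OF u v] i] by simp
qed

text \<open>The eigenvalue equation at the perturbed parameter in the coordinates of the flow, so
  that solutions for different poles live in one space.\<close>

definition teq where
 "teq al0 a al \<mu> u g \<longleftrightarrow> H_limit \<Omega> 0 u g \<and> (\<forall>v h. H_limit \<Omega> 0 v h --> tform al0 a al u g v h = cx \<mu> * tmass a u v)"

lemma moved_lin:
 "moved al0 a al (%x. c * u x + v x) (%x. c *s g x + h x) x = c *s moved al0 a al u g x + moved al0 a al v h x"
 unfolding moved_def pgrad_lin
 by (simp add: rdot_def vec_eq_iff algebra_simps add_divide_distrib)

lemma tform_integrable:
 assumes n: "near al0 a al" and u: "H_limit \<Omega> 0 u g" and v: "H_limit \<Omega> 0 v h"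
 shows "integrable M (%x. cx (J a x) * cip (moved al0 a al u g x) (moved al0 a al v h x))"
proof -
 let ?F = "%x. first_order (gz x) a (drift al0 a al x) (pgrad 0 al0 u g x) (pgrad 0 al0 v h x) (u x) (v x)"
 let ?G = "%x. cx (J a x) * cip (moved al0 a al u g x) (moved al0 a al v h x)"
 let ?H = "%x. cip (pgrad 0 al0 u g x) (pgrad 0 al0 v h x)"
 let ?t = "rate al0 * dist_par al0 a al"
 note mu = L2_measurable[OF H_limit_L2(5)[OF u]] L2_measurable[OF H_limit_L2(3)[OF u]]
 note mv = L2_measurable[OF H_limit_L2(5)[OF v]] L2_measurable[OF H_limit_L2(3)[OF v]]
 have d: "norm (drift al0 a al x) * c <= ?t * (c / norm x)" if "x ~= 0" "c >= 0" for x c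
  using mult_right_mono[OF near_small(5)[OF n that(1)] that(2)] by simp
 have t1: "?t <= 1 / 2" using n by (simp add: near_def)
 have pw: "norm (?G x - ?H x - ?F x) <= 7 * ?t^2 * (wt al0 u g x * wt al0 v h x)" if x: "x ~= 0" for x
  using first_order_expansion(1)[of "gz x" a ?t "drift al0 a al x" "u x" "norm (u x) / norm x" "v x" "norm (v x) / norm x" "pgrad 0 al0 u g x" "pgrad 0 al0 v h x"]
   near_small(4)[OF n, of x] t1 d[OF x] unfolding moved_def J_def wt_def by auto
 have m: "meas (%x. ?G x - ?H x - ?F x)"
  by (intro borel_measurable_diff borel_measurable_times J_measurable cip_measurable moved_measurable first_order_measurable
    gz_measurable drift_measurable mu mv)
 have "integrable M (%x. (?G x - ?H x - ?F x) + (?H x + ?F x))"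
  by (intro b_integrable_add wt_bound(1)[OF u v m _ pw] mform_integrable[OF u v] tform_expansion(3)[OF n u v]) simp
 then show ?thesis by simp
qed

lemma tmass_integrable:
 assumes n: "near al0 a al" and u: "L2 M u" and v: "L2 M v"
 shows "integrable M (%x. cx (J a x) * (u x * cnj (v x)))"
proof -
 have "cx (J a x) * (u x * cnj (v x)) = u x * cnj (v x) + cx (gz x \<bullet> a) * (u x * cnj (v x))" for x
  by (simp add: J_def algebra_simps)
 then show ?thesis using b_integrable_add[OF L2_inner_integrable[OF u v] tmass_expansion(3)[OF n u v]] by simp
qed

lemma teq_lin:
 assumes n: "near al0 a al" and u: "teq al0 a al \<mu> u g" and w: "teq al0 a al \<mu> w k"
 shows "teq al0 a al \<mu> (%x. c * u x + w x) (%x. c *s g x + k x)"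
proof -
 have Hu: "H_limit \<Omega> 0 u g" and Hw: "H_limit \<Omega> 0 w k" using u w by (auto simp: teq_def)
 have H: "H_limit \<Omega> 0 (%x. c * u x + w x) (%x. c *s g x + k x)" by (rule H_limit_add[OF H_limit_cmult[OF Hu] Hw])
 have "tform al0 a al (%x. c * u x + w x) (%x. c *s g x + k x) v h = \<mu> * tmass a (%x. c * u x + w x) v" if v: "H_limit \<Omega> 0 v h" for v h
 proof -
  have "tform al0 a al (%x. c * u x + w x) (%x. c *s g x + k x) v h
    = (LINT x|M. c * (cx (J a x) * cip (moved al0 a al u g x) (moved al0 a al v h x))
     + cx (J a x) * cip (moved al0 a al w k x) (moved al0 a al v h x))"
   unfolding tform_def moved_lin cip_add_left cip_cmult_left by (simp add: algebra_simps)
  also have "... = c * tform al0 a al u g v h + tform al0 a al w k v h"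
   unfolding tform_def
   by (subst b_integral_add[OF integrable_mult_right[OF tform_integrable[OF n Hu v]] tform_integrable[OF n Hw v]]) simp
  also have "... = \<mu> * (c * tmass a u v + tmass a w v)" using u w v by (simp add: teq_def algebra_simps)
  also have "c * tmass a u v + tmass a w v = (LINT x|M. c * (cx (J a x) * (u x * cnj (v x))) + cx (J a x) * (w x * cnj (v x)))"
   unfolding tmass_def
   by (subst b_integral_add[OF integrable_mult_right[OF tmass_integrable[OF n H_limit_L2(3)[OF Hu] H_limit_L2(3)[OF v]]]
      tmass_integrable[OF n H_limit_L2(3)[OF Hw] H_limit_L2(3)[OF v]]]) simp
  also have "... = tmass a (%x. c * u x + w x) v" unfolding tmass_def by (simp add: algebra_simps)
  finally show ?thesis .
 qed
 with H show ?thesis by (simp add: teq_def)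
qed

end

text \<open>The two elements of \<open>bool\<close> label the eigenfunctions. The assumption
  \<open>ker\<close> says that they span the eigenspace: an eigenfunction orthogonal to both
  vanishes almost everywhere.\<close>

locale eigenpair = bounded_domain +
 fixes al0 lam :: real and fi :: "bool => real^2 => complex" and k :: "bool => real^2 => complex^2"
 assumes al0: "exp ((2 * pi) *\<^sub>R (- \<i> * cx al0)) = -1"
  and Hfi: "!!i. H_limit \<Omega> 0 (fi i) (k i)"
  and ortho: "!!i j. ip (fi i) (fi j) = (if i = j then 1 else 0)"
  and eig: "!!i v h. H_limit \<Omega> 0 v h ==> mform al0 (fi i) (k i) v h = cx lam * ip (fi i) v"
  and ker: "!!u g. H_limit \<Omega> 0 u g ==> (!!i. ip u (fi i) = 0)
   ==> (!!v h. H_limit \<Omega> 0 v h ==> mform al0 u g v h = cx lam * ip u v) ==> AE x in M. u x = 0"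
begin

abbreviation "en u g \<equiv> l2 M (pgrad 0 al0 u g)"

definition "gap_bound C \<longleftrightarrow> C > 0 \<and> (\<forall>u g \<rho>. H_limit \<Omega> 0 u g --> (\<forall>i. ip u (fi i) = 0) --> 0 <= \<rho>
 --> (\<forall>v h. H_limit \<Omega> 0 v h --> norm (mform al0 u g v h - lam * ip u v) <= \<rho> * en v h) --> en u g <= C * \<rho>)"

lemma eig_right:
 assumes "H_limit \<Omega> 0 v h" shows "mform al0 v h (fi i) (k i) = cx lam * ip v (fi i)"
 unfolding mform_hermitian[of al0 v h] eig[OF assms] L2_inner_hermitian[of v] by simp

lemma gap: "\<exists>C. gap_bound C"
proof (rule spectral_gap[of al0 "range fi" lam, OF al0])
 show "L2 M f" if "f \<in> range fi" for f using that H_limit_L2(3)[OF Hfi] by auto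
 show "AE x in M. u x = 0" if "H_limit \<Omega> 0 u g" "!!f. f \<in> range fi ==> ip u f = 0"
  "!!v h. H_limit \<Omega> 0 v h ==> mform al0 u g v h = lam * ip u v" for u g
  by (rule ker[OF that(1) that(2)[OF rangeI] that(3)])
 show "\<exists>C. gap_bound C" if "C > 0" "!!u g \<rho>. H_limit \<Omega> 0 u g ==> (!!f. f \<in> range fi ==> ip u f = 0)
   ==> 0 <= \<rho> ==> (!!v h. H_limit \<Omega> 0 v h ==> norm (mform al0 u g v h - lam * ip u v) <= \<rho> * en v h)
   ==> en u g <= C * \<rho>" for C
  unfolding gap_bound_def using that by (intro exI[of _ C]) auto
qed

end

lemma norm_diff_add_diff:
 fixes x y z w :: complex
 assumes "norm x <= a" "norm y <= b" "norm z <= c" "norm w <= d"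
 shows "norm ((x - y) + (z - w)) <= (a + b) + (c + d)"
 using norm_triangle_ineq[of "x - y" "z - w"] norm_triangle_ineq4[of x y] norm_triangle_ineq4[of z w] assms by linarith

section \<open>Degenerate perturbation theory\<close>

locale cutoff_eigenpair = cutoff + eigenpair
begin

text \<open>First variation of the form minus \<open>lam\<close> times the mass, as a matrix in the
  unperturbed basis. Where the eigenvalue stays double, it has to be \<mu> - lam times the identity
  up to higher order.\<close>

definition fdiff :: "real^2 => real => bool => bool => complex" where
 "fdiff a al i j = fo al0 a al (fi i) (k i) (fi j) (k j) - lam * gmass a (fi i) (fi j)"

definition "residual_bound C \<longleftrightarrow> C > 0 \<and> (\<forall>a al \<mu> u g v h. near al0 a al --> \<bar>\<mu> - lam\<bar> <= 1 --> teq al0 a al \<mu> u g --> H_limit \<Omega> 0 v h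
 --> norm (mform al0 u g v h - lam * ip u v) <= C * (dist_par al0 a al + \<bar>\<mu> - lam\<bar>) * en u g * en v h)"

text \<open>A solution of the transported equation solves the unperturbed one up to an error of the
  size of the parameter change; the error is measured in unperturbed energies, as
  \<open>gap_bound\<close> requires.\<close>

lemma residual: "\<exists>C. residual_bound C"
proof -
 obtain K where K: "K > 0" "!!u g. H_limit \<Omega> 0 u g ==> l2 M (wt al0 u g) <= K * en u g"
  "!!u g. H_limit \<Omega> 0 u g ==> l2 M u <= K * en u g"
  using energy_controls[OF al0] by blast
 define r where "r = rate al0"
 have r: "r >= 1" using rate_ge by (simp add: r_def)
 define C where "C = (8 + \<bar>lam\<bar>) * r * K^2"
 have "norm (mform al0 u g v h - lam * ip u v) <= C * (dist_par al0 a al + \<bar>\<mu> - lam\<bar>) * en u g * en v h"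
  if n: "near al0 a al" and \<mu>: "\<bar>\<mu> - lam\<bar> <= 1" and u: "teq al0 a al \<mu> u g" and v: "H_limit \<Omega> 0 v h" for a al \<mu> u g v h
 proof -
  have Hu: "H_limit \<Omega> 0 u g" using u by (simp add: teq_def)
  define P where "P = K^2 * (en u g * en v h)"
  have P: "P >= 0" by (simp add: P_def l2_nonneg)
  define t where "t = r * dist_par al0 a al"
  define e where "e = \<bar>\<mu> - lam\<bar>"
  have t: "t >= 0" "t <= 1 / 2" "e >= 0" using n r by (auto simp: t_def e_def dist_par_def near_def r_def)
  have prod: "l2 M f * l2 M f' <= P" if "l2 M f <= K * en u g" "l2 M f' <= K * en v h" for f f' :: "real^2 => 'z :: {banach, second_countable_topology}"
   using mult_mono[OF that] K(1) by (simp add: l2_nonneg P_def power2_eq_square mult_ac)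
  note W = prod[OF K(2)[OF Hu] K(2)[OF v]] and X = prod[OF K(3)[OF Hu] K(3)[OF v]]
  note E = tform_expansion[OF n Hu v] and T = tmass_expansion[OF n H_limit_L2(3)[OF Hu] H_limit_L2(3)[OF v]]
  have eq: "mform al0 u g v h - lam * ip u v
    = (\<mu> * gmass a u v - fo al0 a al u g v h) + (cx (\<mu> - lam) * ip u v
     - (tform al0 a al u g v h - mform al0 u g v h - fo al0 a al u g v h))"
   using u v T(1) by (simp add: teq_def algebra_simps)
  have "norm (mform al0 u g v h - lam * ip u v) <= ((\<bar>lam\<bar> + 1) * (t * P) + 3 * t * P) + (e * P + 7 * t^2 * P)"
   unfolding eq
  proof (rule norm_diff_add_diff)
   show "norm (tform al0 a al u g v h - mform al0 u g v h - fo al0 a al u g v h) <= 7 * t^2 * P"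
    using order_trans[OF E(1) mult_left_mono[OF W]] by (simp add: r_def t_def)
   show "norm (fo al0 a al u g v h) <= 3 * t * P"
    using order_trans[OF E(2) mult_left_mono[OF W]] t unfolding r_def t_def by simp
   have "norm (gmass a u v) <= t * P"
    using order_trans[OF T(2) mult_left_mono[OF X]] t by (simp add: r_def t_def)
   then show "norm (\<mu> * gmass a u v) <= (\<bar>lam\<bar> + 1) * (t * P)"
    unfolding norm_mult norm_of_real using \<mu> by (intro mult_mono) auto
   show "norm (cx (\<mu> - lam) * ip u v) <= e * P"
    unfolding norm_mult norm_of_real e_def
    by (intro mult_left_mono order_trans[OF norm_L2_inner_le[OF H_limit_L2(3)[OF Hu] H_limit_L2(3)[OF v]] X]) simp
  qed
  also have "... = ((\<bar>lam\<bar> + 4) * t + e + 7 * t^2) * P" by (simp add: algebra_simps)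
  \<comment> \<open>|lam| + 1 and 3 come from the mass and from \<open>fo\<close>; 7 t^2 <= 7/2 t
    because t <= 1/2, and the total 15/2 + |lam| is rounded up to 8 + |lam|.\<close>
  also have "... <= ((8 + \<bar>lam\<bar>) * t + (8 + \<bar>lam\<bar>) * (r * e)) * P"
  proof (rule mult_right_mono[OF _ P])
   have "t * t <= 1 / 2 * t" using t by (intro mult_right_mono) auto
   moreover have "1 * e <= (8 + \<bar>lam\<bar>) * (r * e)" using r t mult_mono[of 1 "8 + \<bar>lam\<bar>" e "r * e"] mult_right_mono[of 1 r e] by simp
   ultimately show "(\<bar>lam\<bar> + 4) * t + e + 7 * t^2 <= (8 + \<bar>lam\<bar>) * t + (8 + \<bar>lam\<bar>) * (r * e)"
    using t(1) unfolding power2_eq_square distrib_right by linarith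
  qed
  also have "... = C * (dist_par al0 a al + \<bar>\<mu> - lam\<bar>) * en u g * en v h"
   by (simp add: C_def P_def t_def e_def algebra_simps)
  finally show ?thesis .
 qed
 moreover have "C > 0" using K(1) r by (simp add: C_def)
 ultimately show ?thesis unfolding residual_bound_def by blast
qed

lemma double_eigenspace:
 assumes n: "near al0 a al" and mult: "has_eigen_multiplicity \<Omega> a al \<mu> 2"
 obtains U1 g1 U2 g2 where "teq al0 a al \<mu> U1 g1" "teq al0 a al \<mu> U2 g2"
  "!!z w. AE x in M. z * U1 x + w * U2 x = 0 ==> z = 0 \<and> w = 0"
proof -
 have s: "small a" by (rule near_small(1)[OF n])
 note d = diffeo_\<Phi>[OF s]
 obtain b :: "nat => real^2 => complex" where b: "!!j. j < 2 ==> b j \<in> eigenspace \<Omega> a al \<mu>"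
  and ind: "!!z :: nat => complex. AE x in M. (\<Sum>j<2. z j * b j x) = 0 ==> \<forall>j<2. z j = 0"
  using mult unfolding has_eigen_multiplicity_def by blast
 have eq: "\<exists>g. teq al0 a al \<mu> (%x. b j (\<Phi> a x)) g" if "j < 2" for j
  by (rule eigen_transform[OF s b[OF that], of al0]) (auto simp: teq_def tform_def tmass_def)
 obtain g1 where g1: "teq al0 a al \<mu> (%x. b 0 (\<Phi> a x)) g1" using eq[of 0] by auto
 obtain g2 where g2: "teq al0 a al \<mu> (%x. b 1 (\<Phi> a x)) g2" using eq[of 1] by auto
 have "z = 0 \<and> w = 0" if ae: "AE x in M. z * b 0 (\<Phi> a x) + w * b 1 (\<Phi> a x) = 0" for z w
 proof -
  \<comment> \<open>\<open>teq_lin\<close> adds a second solution with coefficient 1; the zero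
    solution, obtained as (-1) b + b, fills that place.\<close>
  have "teq al0 a al \<mu> (%x. z * b 0 (\<Phi> a x) + (w * b 1 (\<Phi> a x) + 0 * b 1 (\<Phi> a x))) (%x. z *s g1 x + (w *s g2 x + 0 *s g2 x))"
   using teq_lin[OF n g1 teq_lin[OF n g2 teq_lin[OF n g2 g2, of "-1"], of w], of z] by simp
  then have "L2 M (%x. z * b 0 (\<Phi> a x) + w * b 1 (\<Phi> a x))"
   using H_limit_L2(3) unfolding teq_def by fastforce
  from AE_diffeo[OF diffeo_sym[OF d] this ae]
  have "AE x in M. (\<Sum>j<2. (if j = 0 then z else w) * b j x) = 0"
   by (simp add: \<Psi>\<Phi>[OF s] numeral_2_eq_2)
  from ind[OF this] show ?thesis by (metis one_less_numeral_iff pos2 semiring_norm(76) zero_neq_one)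
 qed
 then show ?thesis by (intro that[OF g1 g2]) blast+
qed

lemma teq_scale_add:
 assumes n: "near al0 a al" and "teq al0 a al \<mu> u g" "teq al0 a al \<mu> w h"
 shows "teq al0 a al \<mu> (%x. c * u x + d * w x) (%x. c *s g x + d *s h x)"
proof -
 have "teq al0 a al \<mu> (%x. (d - 1) * w x + w x) (%x. (d - 1) *s h x + h x)" by (rule teq_lin[OF n assms(3) assms(3)])
 moreover have "(%x. (d - 1) * w x + w x) = (%x. d * w x)" "(%x. (d - 1) *s h x + h x) = (%x. d *s h x)"
  by (simp_all add: fun_eq_iff algebra_simps vec_eq_iff)
 ultimately have "teq al0 a al \<mu> (%x. d * w x) (%x. d *s h x)" by simp
 from teq_lin[OF n assms(2) this] show ?thesis .
qed

text \<open>The double eigenspace at a nearby parameter projects isomorphically onto the unperturbed one.\<close>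

definition "projected_basis a al \<mu> i C u g \<longleftrightarrow> teq al0 a al \<mu> u g \<and> (\<forall>j. ip u (fi j) = (if i = j then 1 else 0)) \<and>
 en (%x. u x - fi i x) (%x. g x - k i x) <= C * (dist_par al0 a al + \<bar>\<mu> - lam\<bar>)"

text \<open>The gap inequality is used twice: for solutions orthogonal to both eigenfunctions, which
  it forces to vanish and which shows that the projection is injective, and for the difference
  between a projected basis vector and its eigenfunction, which it bounds by the parameter
  change.\<close>

lemma perturbed_basis:
 obtains C \<delta> where "C > 0" "\<delta> > 0"
  "!!a al \<mu> i. near al0 a al ==> dist_par al0 a al + \<bar>\<mu> - lam\<bar> < \<delta> ==> has_eigen_multiplicity \<Omega> a al \<mu> 2 ==>
   \<exists>u g. projected_basis a al \<mu> i C u g"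
proof -
 obtain Cg where "gap_bound Cg" using gap by blast
 then have Cg: "Cg > 0"
  "!!u g \<rho>. H_limit \<Omega> 0 u g ==> (!!i. ip u (fi i) = 0) ==> 0 <= \<rho>
   ==> (!!v h. H_limit \<Omega> 0 v h ==> norm (mform al0 u g v h - lam * ip u v) <= \<rho> * en v h) ==> en u g <= Cg * \<rho>"
  by (auto simp: gap_bound_def)
 obtain Cr where "residual_bound Cr" using residual by blast
 then have Cr: "Cr > 0"
  "!!a al \<mu> u g v h. near al0 a al ==> \<bar>\<mu> - lam\<bar> <= 1 ==> teq al0 a al \<mu> u g ==> H_limit \<Omega> 0 v h
   ==> norm (mform al0 u g v h - lam * ip u v) <= Cr * (dist_par al0 a al + \<bar>\<mu> - lam\<bar>) * en u g * en v h"
  by (auto simp: residual_bound_def)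
 \<comment> \<open>Makes the product of gap constant, residual constant and parameter change at most
   1/2, so that the unknown energy can be absorbed.\<close>
 define \<delta> where "\<delta> = min 1 (1 / (2 * Cg * Cr))"
 have \<delta>: "\<delta> > 0" using Cg(1) Cr(1) by (simp add: \<delta>_def)
 define P where "P = en (fi False) (k False) + en (fi True) (k True)"
 have P: "en (fi i) (k i) <= P" for i by (cases i) (simp_all add: P_def l2_nonneg)
 have P0: "P >= 0" by (simp add: P_def l2_nonneg)
 define C where "C = 2 * Cg * Cr * P + 1"
 have C: "C > 0" using Cg Cr P0 by (simp add: C_def add_nonneg_pos)
 have "\<exists>u g. projected_basis a al \<mu> i C u g"
  if n: "near al0 a al" and sd: "dist_par al0 a al + \<bar>\<mu> - lam\<bar> < \<delta>" and mult: "has_eigen_multiplicity \<Omega> a al \<mu> 2" for a al \<mu> i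
 proof -
  define e where "e = dist_par al0 a al + \<bar>\<mu> - lam\<bar>"
  have e0: "e >= 0" by (simp add: e_def dist_par_def)
  have \<mu>: "\<bar>\<mu> - lam\<bar> <= 1" using sd by (simp add: \<delta>_def dist_par_def) (smt (verit) norm_ge_zero)
  have e2: "Cg * Cr * e <= 1 / 2"
  proof -
   have "Cg * Cr * e <= Cg * Cr * (1 / (2 * Cg * Cr))"
    using sd Cg Cr by (intro mult_left_mono) (auto simp: e_def \<delta>_def)
   then show ?thesis using Cg Cr by simp
  qed
  \<comment> \<open>For a solution orthogonal to both eigenfunctions, the residual bound and the gap
    give an energy at most half of itself. Hardy's inequality turns zero energy into vanishing
    almost everywhere.\<close>
  have zero: "AE x in M. u x = 0" if u: "teq al0 a al \<mu> u g" and o: "!!j. ip u (fi j) = 0" for u g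
  proof -
   have Hu: "H_limit \<Omega> 0 u g" using u by (simp add: teq_def)
   let ?p = "en u g"
   have "?p <= Cg * (Cr * e * ?p)"
    by (rule Cg(2)[OF Hu o]) (use Cr e0 l2_nonneg[of M "pgrad 0 al0 u g"] Cr(2)[OF n \<mu> u] in \<open>auto simp: e_def\<close>)
   also have "... <= 1 / 2 * ?p" using mult_right_mono[OF e2 l2_nonneg[of M "pgrad 0 al0 u g"]] by (simp add: mult.assoc)
   finally have p0: "?p = 0" using l2_nonneg[of M "pgrad 0 al0 u g"] by simp
   have "l2 M (%x. u x / cx (norm (x - 0))) <= pi * ?p" by (rule hardy[OF Hu al0])
   then have "l2 M (%x. u x / cx (norm (x - 0))) = 0"
    using p0 l2_nonneg[of M "%x. u x / cx (norm (x - 0))"] by simp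
   then have "AE x in M. u x / cx (norm (x - 0)) = 0" using l2_eq_0_iff[OF H_limit_L2(4)[OF Hu]] by blast
   then show ?thesis using AE_M_neq[of 0] by eventually_elim simp
  qed
  obtain U1 g1 U2 g2 where U: "teq al0 a al \<mu> U1 g1" "teq al0 a al \<mu> U2 g2"
   and ind: "!!z w. AE x in M. z * U1 x + w * U2 x = 0 ==> z = 0 \<and> w = 0"
   using double_eigenspace[OF n mult] by blast
  have LU: "L2 M U1" "L2 M U2" using U H_limit_L2(3) unfolding teq_def by blast+
  note Lfi = H_limit_L2(3)[OF Hfi]
  have ip: "ip (%x. z * U1 x + w * U2 x) (fi j) = z * ip U1 (fi j) + w * ip U2 (fi j)" for z w j
   by (subst L2_inner_add_left[OF L2_cmult[OF LU(1)] L2_cmult[OF LU(2)] Lfi]) (simp add: L2_inner_cmult_left)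
  define D where "D = ip U1 (fi False) * ip U2 (fi True) - ip U1 (fi True) * ip U2 (fi False)"
  \<comment> \<open>If the matrix of projections were singular, combinations of \<open>U1\<close>
    and \<open>U2\<close> with these projections as coefficients would be orthogonal to both
    eigenfunctions, hence zero; independence then makes all projections vanish, and
    \<open>U1\<close> itself would be zero.\<close>
  have D: "D ~= 0"
  proof
   assume D0: "D = 0"
   have all0: "ip Uj (fi j) = 0" if "Uj = U1 \<or> Uj = U2" for Uj j
   proof -
    have "!!j. ip (%x. ip U2 (fi i) * U1 x + (- ip U1 (fi i)) * U2 x) (fi j) = 0" for i
     unfolding ip using D0 unfolding D_def by (case_tac i; case_tac j) (auto simp: algebra_simps)
    from zero[OF teq_scale_add[OF n U] this]
    have "AE x in M. ip U2 (fi i) * U1 x + (- ip U1 (fi i)) * U2 x = 0" for i .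
    from ind[OF this] show ?thesis using that by auto
   qed
   have "!!j. ip (%x. 1 * U1 x + 0 * U2 x) (fi j) = 0" unfolding ip using all0 by simp
   from ind[OF zero[OF teq_scale_add[OF n U] this]] show False by simp
  qed
  \<comment> \<open>Cramer's rule for the combination whose projections form the i-th unit
    vector.\<close>
  define z where "z = (if i then - ip U2 (fi False) else ip U2 (fi True)) / D"
  define w where "w = (if i then ip U1 (fi False) else - ip U1 (fi True)) / D"
  define u where "u x = z * U1 x + w * U2 x" for x
  define g where "g x = z *s g1 x + w *s g2 x" for x
  have tu: "teq al0 a al \<mu> u g" unfolding u_def g_def by (rule teq_scale_add[OF n U])
  have Hu: "H_limit \<Omega> 0 u g" using tu by (simp add: teq_def)
  have ou: "ip u (fi j) = (if i = j then 1 else 0)" for j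
  proof -
   have zD: "z * D = (if i then - ip U2 (fi False) else ip U2 (fi True))"
    and wD: "w * D = (if i then ip U1 (fi False) else - ip U1 (fi True))"
    using D by (simp_all add: z_def w_def)
   have e: "ip u (fi j) * D = (z * D) * ip U1 (fi j) + (w * D) * ip U2 (fi j)"
    unfolding u_def ip by (simp add: algebra_simps)
   have "ip u (fi j) * D = (if i = j then D else 0)"
    unfolding e zD wD by (cases i; cases j) (simp_all add: D_def)
   then show ?thesis using D by (auto split: if_splits)
  qed
  define W where "W x = u x - fi i x" for x
  define h where "h x = g x - k i x" for x
  have HW: "H_limit \<Omega> 0 W h" unfolding W_def h_def by (rule H_limit_diff[OF Hu Hfi])
  have oW: "ip W (fi j) = 0" for j
   unfolding W_def L2_inner_diff_left[OF H_limit_L2(3)[OF Hu] Lfi Lfi] ou ortho by simp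
  have rW: "norm (mform al0 W h v f - lam * ip W v) <= (Cr * e * en u g) * en v f"
   if v: "H_limit \<Omega> 0 v f" for v f
  proof -
   have "mform al0 W h v f - lam * ip W v = mform al0 u g v f - lam * ip u v"
    unfolding W_def h_def mform_diff_left[OF Hu Hfi v] L2_inner_diff_left[OF H_limit_L2(3)[OF Hu] Lfi H_limit_L2(3)[OF v]]
     eig[OF v] by (simp add: algebra_simps)
   then show ?thesis using Cr(2)[OF n \<mu> tu v] by (simp add: e_def)
  qed
  let ?q = "en W h"
  have "0 <= Cr * e * en u g" using Cr(1) e0 l2_nonneg[of M "pgrad 0 al0 u g"] by simp
  then have q: "?q <= Cg * (Cr * e * en u g)" by (rule Cg(2)[OF HW oW _ rW])
  have "en u g <= P + ?q"
   using l2_le_add_diff[OF H_limit_L2(5)[OF Hu] H_limit_L2(5)[OF Hfi[of i]], of al0 al0] P[of i]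
   unfolding pgrad_diff W_def h_def by simp
  then have "Cg * (Cr * e * en u g) <= Cg * (Cr * e * (P + ?q))"
   using Cg(1) Cr(1) e0 by (intro mult_left_mono) auto
  with q have "?q <= Cg * (Cr * e * (P + ?q))" by (rule order_trans)
  also have "... = Cg * Cr * P * e + (Cg * Cr * e) * ?q" by (simp add: algebra_simps)
  also have "... <= Cg * Cr * P * e + 1 / 2 * ?q" by (intro add_left_mono mult_right_mono e2 l2_nonneg)
  finally have "?q <= 2 * Cg * Cr * P * e" by simp
  also have "... <= C * e" using e0 by (simp add: C_def algebra_simps)
  finally have "?q <= C * e" .
  then have "en (%x. u x - fi i x) (%x. g x - k i x) <= C * (dist_par al0 a al + \<bar>\<mu> - lam\<bar>)"
   by (simp add: W_def[abs_def] h_def[abs_def] e_def)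
  with tu ou show ?thesis unfolding projected_basis_def by blast
 qed
 show ?thesis by (rule that[OF C \<delta>]) fact
qed

end

lemma first_order_diff:
 "first_order n a b (p - p') P (u - u') v = first_order n a b p P u v - first_order n a b p' P u' v"
 by (simp add: first_order_def rdot_def cip_eq algebra_simps)

context cutoff_eigenpair
begin

lemma fo_diff:
 assumes n: "near al0 a al" and u: "H_limit \<Omega> 0 u g" "H_limit \<Omega> 0 u' g'" and v: "H_limit \<Omega> 0 v h"
 shows "fo al0 a al (%x. u x - u' x) (%x. g x - g' x) v h = fo al0 a al u g v h - fo al0 a al u' g' v h"
 unfolding fo_def pgrad_diff[symmetric] first_order_diff
 by (rule b_integral_diff[OF tform_expansion(3)[OF n u(1) v] tform_expansion(3)[OF n u(2) v]])

lemma gmass_diff: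
 assumes n: "near al0 a al" and u: "L2 M u" "L2 M u'" and v: "L2 M v"
 shows "gmass a (%x. u x - u' x) v = gmass a u v - gmass a u' v"
 unfolding gmass_def
 using b_integral_diff[OF tmass_expansion(3)[OF n u(1) v] tmass_expansion(3)[OF n u(2) v]]
 by (simp add: algebra_simps)

text \<open>The transported equation for a projected basis vector is tested with an unperturbed
  eigenfunction. Both the unperturbed form and the mass are then known exactly, as multiples of 0 or
  1, and the first variation is what remains.\<close>

lemma main_estimate:
 obtains C \<delta> where "C > 0" "\<delta> > 0"
  "!!a al \<mu> i j. near al0 a al ==> dist_par al0 a al + \<bar>\<mu> - lam\<bar> < \<delta> ==> has_eigen_multiplicity \<Omega> a al \<mu> 2 ==>
   norm (fdiff a al i j - (if i = j then cx (\<mu> - lam) else 0))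
    <= C * dist_par al0 a al * (dist_par al0 a al + \<bar>\<mu> - lam\<bar>)"
proof -
 obtain C0 \<delta>0 where C0: "C0 > 0" "\<delta>0 > 0"
  "!!a al \<mu> i. near al0 a al ==> dist_par al0 a al + \<bar>\<mu> - lam\<bar> < \<delta>0 ==> has_eigen_multiplicity \<Omega> a al \<mu> 2 ==>
   \<exists>u g. projected_basis a al \<mu> i C0 u g"
  using perturbed_basis by blast
 obtain K where K: "K > 0" "!!u g. H_limit \<Omega> 0 u g ==> l2 M (wt al0 u g) <= K * en u g"
  "!!u g. H_limit \<Omega> 0 u g ==> l2 M u <= K * en u g"
  using energy_controls[OF al0] by blast
 define P where "P = en (fi False) (k False) + en (fi True) (k True)"
 have P: "en (fi i) (k i) <= P" for i by (cases i) (simp_all add: P_def l2_nonneg)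
 have P0: "P >= 0" by (simp add: P_def l2_nonneg)
 define r where "r = rate al0"
 have r: "r >= 1" "r > 0" using rate_ge by (auto simp: r_def)
 define B where "B = K^2 * (P + C0) * P"
 have B0: "B >= 0" using P0 C0(1) by (simp add: B_def)
 define C where "C = 7 * r^2 * B + 3 * r * (K^2 * C0 * P) + r * B + \<bar>lam\<bar> * r * (K^2 * C0 * P) + 1"
 have C: "C > 0" unfolding C_def using r B0 P0 C0(1) by (intro add_nonneg_pos add_nonneg_nonneg) auto
 have "norm (fdiff a al i j - (if i = j then cx (\<mu> - lam) else 0))
    <= C * dist_par al0 a al * (dist_par al0 a al + \<bar>\<mu> - lam\<bar>)"
  if n: "near al0 a al" and sd: "dist_par al0 a al + \<bar>\<mu> - lam\<bar> < min 1 \<delta>0" and mult: "has_eigen_multiplicity \<Omega> a al \<mu> 2"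
  for a al \<mu> i j
 proof -
  define t where "t = dist_par al0 a al"
  define e where "e = t + \<bar>\<mu> - lam\<bar>"
  have t: "t >= 0" "t <= e" "e <= 1" "\<bar>\<mu> - lam\<bar> <= e" "e >= 0" using sd by (auto simp: t_def e_def dist_par_def)
  have sd': "dist_par al0 a al + \<bar>\<mu> - lam\<bar> < \<delta>0" using sd by simp
  obtain u g where u: "teq al0 a al \<mu> u g" "!!j. ip u (fi j) = (if i = j then 1 else 0)"
   and uW: "en (%x. u x - fi i x) (%x. g x - k i x) <= C0 * e"
   using C0(3)[OF n sd' mult, of i] unfolding e_def t_def projected_basis_def by blast
  have Hu: "H_limit \<Omega> 0 u g" using u by (simp add: teq_def)
  let ?W = "%x. u x - fi i x" let ?h = "%x. g x - k i x"
  have HW: "H_limit \<Omega> 0 ?W ?h" by (rule H_limit_diff[OF Hu Hfi])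
  have Pu: "en u g <= P + C0"
  proof -
   have "C0 * e <= C0" using C0(1) t by simp
   then show ?thesis
    using l2_le_add_diff[OF H_limit_L2(5)[OF Hu] H_limit_L2(5)[OF Hfi[of i]], of al0 al0] P[of i] uW
    unfolding pgrad_diff by simp
  qed
  have prod: "l2 M (f u g) * l2 M (f (fi j) (k j)) <= B" "l2 M (f ?W ?h) * l2 M (f (fi j) (k j)) <= K^2 * C0 * P * e"
   if f: "!!u g. H_limit \<Omega> 0 u g ==> l2 M (f u g) <= K * en u g"
   for f :: "_ => _ => _ => 'z :: {banach, second_countable_topology}"
  proof -
   have p: "l2 M (f (fi j) (k j)) <= K * P"
    by (rule order_trans[OF f[OF Hfi] mult_left_mono[OF P]]) (use K in simp)
   have "l2 M (f u g) * l2 M (f (fi j) (k j)) <= (K * (P + C0)) * (K * P)"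
    by (rule mult_mono[OF order_trans[OF f[OF Hu] mult_left_mono[OF Pu]] p]) (use K P0 C0(1) l2_nonneg in auto)
   then show "l2 M (f u g) * l2 M (f (fi j) (k j)) <= B" by (simp add: B_def power2_eq_square mult_ac)
   have "l2 M (f ?W ?h) * l2 M (f (fi j) (k j)) <= (K * (C0 * e)) * (K * P)"
    by (rule mult_mono[OF order_trans[OF f[OF HW] mult_left_mono[OF uW]] p]) (use K P0 C0(1) t l2_nonneg in auto)
   then show "l2 M (f ?W ?h) * l2 M (f (fi j) (k j)) <= K^2 * C0 * P * e" by (simp add: power2_eq_square mult_ac)
  qed
  note w = prod[of "wt al0", OF K(2)] and m = prod[of "%u g. u", OF K(3)]
  note Lfi = H_limit_L2(3)[OF Hfi]
  have L: "L2 M u" "L2 M ?W" using H_limit_L2(3)[OF Hu] H_limit_L2(3)[OF HW] by auto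
  define E where "E = tform al0 a al u g (fi j) (k j) - mform al0 u g (fi j) (k j) - fo al0 a al u g (fi j) (k j)"
  have rt: "0 <= rate al0 * dist_par al0 a al" using r t by (simp add: r_def t_def)
  have e1: "norm E <= 7 * (r * t)^2 * B"
   unfolding E_def r_def t_def
   by (rule order_trans[OF tform_expansion(1)[OF n Hu Hfi] mult_left_mono[OF w(1)]]) simp_all
  have e2: "norm (fo al0 a al ?W ?h (fi j) (k j)) <= 3 * (r * t) * (K^2 * C0 * P * e)"
   unfolding r_def t_def
   by (rule order_trans[OF tform_expansion(2)[OF n HW Hfi] mult_left_mono[OF w(2)]]) (use rt in simp_all)
  have e3: "norm (cx (\<mu> - lam) * gmass a u (fi j)) <= e * (r * t * B)"
   unfolding norm_mult norm_of_real r_def t_def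
   by (intro mult_mono t order_trans[OF tmass_expansion(2)[OF n L(1) Lfi] mult_left_mono[OF m(1)]])
    (use r t in \<open>simp_all add: r_def t_def\<close>)
  have e4: "norm (cx lam * gmass a ?W (fi j)) <= \<bar>lam\<bar> * (r * t * (K^2 * C0 * P * e))"
   unfolding norm_mult norm_of_real r_def t_def
   by (intro mult_left_mono order_trans[OF tmass_expansion(2)[OF n L(2) Lfi] mult_left_mono[OF m(2)]])
    (use r t in \<open>simp_all add: r_def t_def\<close>)
  have "tform al0 a al u g (fi j) (k j) = cx \<mu> * tmass a u (fi j)" using u(1) Hfi by (simp add: teq_def)
  then have "E = cx \<mu> * ((if i = j then 1 else 0) + gmass a u (fi j)) - lam * (if i = j then 1 else 0)
    - fo al0 a al u g (fi j) (k j)"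
   unfolding E_def tmass_expansion(1)[OF n L(1) Lfi] eig_right[OF Hu] u(2) by simp
  \<comment> \<open>Four errors: the factor \<mu> - lam on the first variation of the mass, the
    quadratic remainder, and the replacement of \<open>u\<close> by \<open>fi i\<close> in the mass
    and in the form. Each carries a factor t, which the absorption at the end depends on.\<close>
  then have "fdiff a al i j - (if i = j then cx (\<mu> - lam) else 0)
   = (cx (\<mu> - lam) * gmass a u (fi j) - E) + (cx lam * gmass a ?W (fi j) - fo al0 a al ?W ?h (fi j) (k j))"
   unfolding fdiff_def gmass_diff[OF n L(1) Lfi Lfi] fo_diff[OF n Hu Hfi Hfi] by (auto simp: algebra_simps)
  then have "norm (fdiff a al i j - (if i = j then cx (\<mu> - lam) else 0))
   <= (e * (r * t * B) + 7 * (r * t)^2 * B) + (\<bar>lam\<bar> * (r * t * (K^2 * C0 * P * e)) + 3 * (r * t) * (K^2 * C0 * P * e))"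
   using norm_diff_add_diff[OF e3 e1 e4 e2] by (rule ord_eq_le_trans[OF arg_cong[of _ _ norm]])
  also have "... <= C * t * e"
  proof -
   have "t * t * (r^2 * B) <= t * e * (r^2 * B)" using t B0 by (intro mult_right_mono mult_left_mono) auto
   moreover have "0 <= t * e" using t by simp
   ultimately show ?thesis by (simp add: C_def algebra_simps power2_eq_square)
  qed
  finally show ?thesis by (simp add: t_def e_def)
 qed
 then show ?thesis using that[of C "min 1 \<delta>0"] C C0(2) by simp
qed

end

section \<open>Leading terms at the pole\<close>

text \<open>\<open>polar_angle\<close> jumps across the positive first axis, but for integer
  \<open>k\<close> the factor is smooth off 0.\<close>

definition spin :: "int => real^2 => complex" where
 "spin k x = exp (\<i> * cx (of_int k * polar_angle x))"

definition mode :: "real => int => real^2 => complex" where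
 "mode s k x = cx (norm x powr s) * spin k x"

text \<open>\<open>logder f s k\<close>: away from 0, \<open>\<nabla>f = f (s \<nabla>log|x| + i k \<nabla>\<theta>)\<close>, where \<open>\<nabla>\<theta>\<close> is the potential \<open>A\<close> of circulation 1.\<close>

definition logder :: "(real^2 => complex) => real => int => bool" where
 "logder f s k \<longleftrightarrow> (\<forall>x. x ~= 0 --> (f has_derivative
   (%h. f x * (cx (s * ((x \<bullet> h) / (norm x)^2)) + \<i> * cx (of_int k * (AB_potential 0 1 x \<bullet> h))))) (at x))"

lemma product_rule_eq: "f * (g * b) + f * a * g = f * g * (a + b)" for f g a b :: complex
 by (simp add: algebra_simps)

lemma log_sum_eq: "cx ((s + s') * X) + \<i> * cx (of_int (k + k') * Y)
  = (cx (s * X) + \<i> * cx (of_int k * Y)) + (cx (s' * X) + \<i> * cx (of_int k' * Y))"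
 by (simp add: algebra_simps)

lemma logder_mult: "logder f s k ==> logder g s' k' ==> logder (%x. f x * g x) (s + s') (k + k')"
 unfolding logder_def
proof (intro allI impI)
 fix x :: "real^2" assume x: "x ~= 0"
 let ?D = "%s k h. cx (s * ((x \<bullet> h) / (norm x)^2)) + \<i> * cx (of_int k * (AB_potential 0 1 x \<bullet> h))"
 assume "\<forall>x. x ~= 0 --> (f has_derivative (%h. f x * (cx (s * ((x \<bullet> h) / (norm x)^2)) + \<i> * cx (of_int k * (AB_potential 0 1 x \<bullet> h))))) (at x)"
  "\<forall>x. x ~= 0 --> (g has_derivative (%h. g x * (cx (s' * ((x \<bullet> h) / (norm x)^2)) + \<i> * cx (of_int k' * (AB_potential 0 1 x \<bullet> h))))) (at x)"
 then have "((%x. f x * g x) has_derivative (%h. f x * (g x * ?D s' k' h) + f x * ?D s k h * g x)) (at x)"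
  using x by (intro has_derivative_mult) auto
 moreover have "?D (s + s') (k + k') h = ?D s k h + ?D s' k' h" for h
  by (rule log_sum_eq)
 then have "(%h. f x * (g x * ?D s' k' h) + f x * ?D s k h * g x) = (%h. f x * g x * ?D (s + s') (k + k') h)"
  by (simp only: product_rule_eq)
 ultimately show "((%x. f x * g x) has_derivative (%h. f x * g x * ?D (s + s') (k + k') h)) (at x)" by simp
qed

lemma logder_cong: "logder f s k ==> (!!x. x ~= 0 ==> f x = g x) ==> logder g s k"
 unfolding logder_def
proof (intro allI impI)
 fix x :: "real^2" assume x: "x ~= 0" and e: "!!x. x ~= 0 ==> f x = g x"
 let ?D = "%h. cx (s * ((x \<bullet> h) / (norm x)^2)) + \<i> * cx (of_int k * (AB_potential 0 1 x \<bullet> h))"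
 assume "\<forall>x. x ~= 0 --> (f has_derivative (%h. f x * (cx (s * ((x \<bullet> h) / (norm x)^2)) + \<i> * cx (of_int k * (AB_potential 0 1 x \<bullet> h))))) (at x)"
 then have "(f has_derivative (%h. f x * ?D h)) (at x)" using x by blast
 then have "(f has_derivative (%h. g x * ?D h)) (at x)" unfolding e[OF x] .
 then show "(g has_derivative (%h. g x * ?D h)) (at x)"
  by (rule has_derivative_transform_within_open[of _ _ _ _ "- {0}"]) (use x e in auto)
qed

lemma logder_cnj: "logder f s k ==> logder (%x. cnj (f x)) s (- k)"
 unfolding logder_def
 by (intro allI impI, rule has_derivative_eq_rhs[OF has_derivative_cnj]) (auto simp: fun_eq_iff)

lemma logder_1: "logder (%x. 1) 0 0" by (simp add: logder_def)

lemma logder_power: "logder f s k ==> logder (%x. f x ^ n) (of_nat n * s) (int n * k)"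
proof (induction n)
 case (Suc n)
 from logder_mult[OF Suc.prems Suc.IH[OF Suc.prems]] show ?case by (simp add: algebra_simps)
qed (simp add: logder_1)

lemma logder_powr: "logder (%x. cx (norm x powr s)) s 0"
 unfolding logder_def
proof (intro allI impI)
 fix x :: "real^2" assume x: "x ~= 0"
 have "((%x. norm x powr s) has_derivative (%h. (h \<bullet> sgn x) * (s * norm x powr (s - 1)))) (at x)"
  by (rule DERIV_compose_FDERIV[OF has_real_derivative_powr has_derivative_norm]) (use x in auto)
 from has_derivative_of_real[OF this]
 show "((%x. cx (norm x powr s)) has_derivative
   (%h. cx (norm x powr s) * (cx (s * ((x \<bullet> h) / (norm x)^2)) + \<i> * cx (of_int 0 * (AB_potential 0 1 x \<bullet> h))))) (at x)"
  by (rule has_derivative_eq_rhs)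
    (use x in \<open>auto simp: fun_eq_iff sgn_div_norm powr_diff inner_commute power2_eq_square divide_simps simp flip: of_real_mult\<close>)
qed

lemma complex_coord_eq: "Complex (x$1) (x$2) = cx (norm x) * spin 1 x"
 using Arg2pi_eq[of "Complex (x$1) (x$2)"]
 by (simp add: spin_def polar_angle_def cmod_def norm_vec2[symmetric] is_Arg_def)

lemma spin_add: "spin (k + l) x = spin k x * spin l x"
 by (simp add: spin_def exp_add[symmetric] algebra_simps)

lemma spin_0: "spin 0 x = 1" by (simp add: spin_def)

lemma cnj_spin: "cnj (spin k x) = spin (- k) x"
 by (simp add: spin_def exp_cnj)

lemma norm_spin: "norm (spin k x) = 1" by (simp add: spin_def)

lemma spin_power: "spin (int n) x = spin 1 x ^ n"
 by (induction n) (simp_all add: spin_0 spin_add)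

lemma spin_unit: "spin k x * cnj (spin k x) = 1"
 by (simp add: cnj_spin spin_add[symmetric] spin_0)

text \<open>The angle itself is never differentiated: x1 + i x2 divided by |x| is the factor with k
  = 1, powers give the nonnegative \<open>k\<close>, and conjugation gives the negative
  ones.\<close>

lemma logder_spin: "logder (spin k) 0 k"
proof -
 have z: "logder (%x. Complex (x$1) (x$2)) 1 1"
  unfolding logder_def
 proof (intro allI impI)
  fix x :: "real^2" assume x: "x ~= 0"
  then have n: "(x$1)^2 + (x$2)^2 ~= 0" by (simp add: norm_vec2[symmetric])
  have "((%x. cx (x$1) + \<i> * cx (x$2)) has_derivative (%h. cx (h$1) + \<i> * cx (h$2))) (at x)"
   by (intro derivative_intros has_derivative_coord)
  then show "((%x. Complex (x$1) (x$2)) has_derivative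
   (%h. Complex (x$1) (x$2) * (cx (1 * ((x \<bullet> h) / (norm x)^2)) + \<i> * cx (of_int 1 * (AB_potential 0 1 x \<bullet> h))))) (at x)"
   unfolding Complex_eq
  proof (rule has_derivative_eq_rhs, intro ext)
   fix h :: "real^2"
   define N where "N = (norm x)^2"
   have N: "N ~= 0" "N = x$1 * x$1 + x$2 * x$2"
    using x by (simp add: N_def) (use norm_vec2[of x] in \<open>simp add: N_def power2_eq_square\<close>)
   have "h$1 = x$1 * ((x$1 * h$1 + x$2 * h$2) / N) - x$2 * ((x$1 * h$2 - x$2 * h$1) / N)"
    "h$2 = x$1 * ((x$1 * h$2 - x$2 * h$1) / N) + x$2 * ((x$1 * h$1 + x$2 * h$2) / N)"
    using N(1) by (simp_all add: field_simps) (simp_all add: N(2) algebra_simps)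
   moreover have "AB_potential 0 1 x \<bullet> h = (x$1 * h$2 - x$2 * h$1) / N"
    by (simp add: inner2 AB_potential_nth N_def diff_divide_distrib)
   ultimately show "cx (h$1) + \<i> * cx (h$2) = (cx (x$1) + \<i> * cx (x$2)) *
     (cx (1 * ((x \<bullet> h) / (norm x)^2)) + \<i> * cx (of_int 1 * (AB_potential 0 1 x \<bullet> h)))"
    unfolding N_def[symmetric] inner2 by (simp add: complex_eq_iff)
  qed
 qed
 have 1: "logder (spin 1) 0 1"
  by (rule logder_cong[OF logder_mult[OF logder_powr[of "-1"] z, simplified]])
    (simp add: complex_coord_eq powr_minus_divide)
 have n: "logder (spin (int n)) 0 (int n)" for n
  using logder_power[OF 1, of n] by (simp add: spin_power[abs_def])
 show ?thesis
 proof (cases k)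
  case (neg n)
  then show ?thesis using logder_cnj[OF n[of "Suc n"]] by (simp add: cnj_spin)
 qed (use n in simp)
qed

lemma logder_mode: "logder (mode s k) s k"
 using logder_mult[OF logder_powr[of s] logder_spin[of k]] by (simp add: mode_def[abs_def])

lemma smooth_on_norm_powr: "smooth_on (- {0}) (%x. cx (norm x powr s))"
proof (rule smooth_on_cong)
 have "(%x :: real^2. cx ((norm x)^2)) = (%x. cx (x$1) * cx (x$1) + cx (x$2) * cx (x$2))"
  by (simp add: norm_vec2) (simp add: power2_eq_square)
 then show "smooth_on (- {0}) (%x :: real^2. cx (((norm x)^2) powr (s / 2)))"
  by (intro smooth_on_powr) (auto intro!: smooth_on_add smooth_on_mult smooth_on_coord)
 show "cx (((norm x)^2) powr (s / 2)) = cx (norm x powr s)" if "x \<in> - {0}" for x :: "real^2"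
  using that by (simp add: powr_powr powr_numeral[symmetric] del: powr_numeral)
qed auto

lemma smooth_on_spin: "smooth_on (- {0}) (spin k)"
proof -
 have 1: "smooth_on (- {0}) (spin 1)"
 proof (rule smooth_on_cong)
  show "smooth_on (- {0}) (%x :: real^2. cx (norm x powr -1) * (cx (x$1) + \<i> * cx (x$2)))"
   by (intro smooth_on_mult smooth_on_add smooth_on_norm_powr smooth_on_coord smooth_on_const) auto
  show "cx (norm x powr -1) * (cx (x$1) + \<i> * cx (x$2)) = spin 1 x" if "x \<in> - {0}" for x
   using that by (simp add: complex_coord_eq powr_minus_divide Complex_eq[symmetric])
 qed auto
 have n: "smooth_on (- {0}) (spin (int n))" for n
  using smooth_on_power[OF _ 1, of n] by (simp add: spin_power[abs_def] open_Compl)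
 show ?thesis
 proof (cases k)
  case (neg n)
  then show ?thesis using smooth_on_cnj[OF _ n[of "Suc n"]] by (simp add: cnj_spin open_Compl)
 qed (use n in simp)
qed

lemma smooth_on_mode: "smooth_on (- {0}) (mode s k)"
 unfolding mode_def[abs_def] by (intro smooth_on_mult smooth_on_norm_powr smooth_on_spin) auto

lemma mode_mult: "mode s k x * mode s' k' x = mode (s + s') (k + k') x"
 by (simp add: mode_def powr_add spin_add)

lemma cnj_mode: "cnj (mode s k x) = mode s (- k) x" by (simp add: mode_def cnj_spin)

lemma norm_mode: "norm (mode s k x) = norm x powr s" by (simp add: mode_def norm_mult norm_spin)

lemma mode_coord: "Complex (x$1) (x$2) / cx ((norm x)^2) = mode (-1) 1 x"
  "Complex (x$1) (- x$2) / cx ((norm x)^2) = mode (-1) (-1) x"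
proof -
 show 1: "Complex (x$1) (x$2) / cx ((norm x)^2) = mode (-1) 1 x"
  by (cases "x = 0") (simp_all add: complex_coord_eq mode_def powr_minus_divide power2_eq_square)
 have "Complex (x$1) (- x$2) = cnj (Complex (x$1) (x$2))" by (simp add: complex_eq_iff)
 then show "Complex (x$1) (- x$2) / cx ((norm x)^2) = mode (-1) (-1) x"
  using arg_cong[OF 1, of cnj] by (simp add: cnj_mode)
qed

lemma partial_deriv_logder:
 assumes "logder f s k" "x ~= 0"
 shows "partial_deriv i f x = f x * (cx (s * (x$i / (norm x)^2)) + \<i> * cx (of_int k * AB_potential 0 1 x $ i))"
 using partial_deriv_eqI[OF assms(1)[unfolded logder_def, rule_format, OF assms(2)], of i] by (simp add: inner_axis)

lemma logder_magnetic:
 assumes "logder f s k" "x ~= 0"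
 shows "classical_magnetic_grad 0 al f x $ 1 = f x * ((\<i> * of_real s * of_real (x$1) - of_real (al - of_int k) * of_real (x$2)) / of_real ((norm x)^2))"
  "classical_magnetic_grad 0 al f x $ 2 = f x * ((\<i> * of_real s * of_real (x$2) + of_real (al - of_int k) * of_real (x$1)) / of_real ((norm x)^2))"
proof -
 note d = partial_deriv_logder[OF assms]
 show "classical_magnetic_grad 0 al f x $ 1 = f x * ((\<i> * of_real s * of_real (x$1) - of_real (al - of_int k) * of_real (x$2)) / of_real ((norm x)^2))"
  "classical_magnetic_grad 0 al f x $ 2 = f x * ((\<i> * of_real s * of_real (x$2) + of_real (al - of_int k) * of_real (x$1)) / of_real ((norm x)^2))"
  unfolding classical_magnetic_grad_nth d AB_potential_nth
  by (simp_all add: algebra_simps add_divide_distrib diff_divide_distrib)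
qed

text \<open>The leading term of the expansion for w = c - i d. As c cos(t/2) + d sin(t/2) is the
  real part of w e^(it/2), the half-angles combine with the factor of circulation 1/2 + m to the
  integer frequencies m + 1 and m.\<close>

definition lead :: "int => complex => real^2 => complex" where
 "lead m w x = (w * mode (1/2) (m + 1) x + cnj w * mode (1/2) m x) / 2"

definition lead_grad :: "int => complex => real^2 => complex^2" where
 "lead_grad m w x = vector [\<i> / 4 * (cnj w * mode (-1/2) (m + 1) x + w * mode (-1/2) m x),
   1 / 4 * (cnj w * mode (-1/2) (m + 1) x - w * mode (-1/2) m x)]"

lemma smooth_on_lead: "smooth_on (- {0}) (lead m w)"
 unfolding lead_def[abs_def] divide_inverse
 by (intro smooth_on_mult smooth_on_add smooth_on_mode smooth_on_const) auto

lemma smooth_on_lead_grad: "smooth_on (- {0}) (%x. lead_grad m w x $ j)"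
proof -
 have "smooth_on (- {0}) (%x. lead_grad m w x $ 1)"
  unfolding lead_grad_def vector_2 by (intro smooth_on_mult smooth_on_add smooth_on_mode smooth_on_const open_Compl closed_singleton)
 moreover have "smooth_on (- {0}) (%x. lead_grad m w x $ 2)"
  unfolding lead_grad_def vector_2 by (intro smooth_on_mult smooth_on_diff smooth_on_mode smooth_on_const open_Compl closed_singleton)
 ultimately show ?thesis using exhaust_2[of j] by auto
qed

lemma mode_shift:
 "mode s k x * (Complex (x$1) (x$2) / cx ((norm x)^2)) = mode (s - 1) (k + 1) x"
 "mode s k x * (Complex (x$1) (- x$2) / cx ((norm x)^2)) = mode (s - 1) (k - 1) x"
 unfolding mode_coord mode_mult by simp_all

text \<open>Along the complex coordinate and its conjugate, the operator lowers the power by 1 and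
  shifts the frequency by +1 or -1. For s = 1/2 and k = m + 1 or k = m one of the two coefficients
  vanishes, which yields the simple form of \<open>lead_grad\<close>.\<close>

lemma mode_magnetic:
 assumes x: "x ~= 0"
 shows "classical_magnetic_grad 0 (1/2 + of_int m) (mode s k) x $ 1 = \<i> / 2 *
   (cx (s + 1/2 + of_int m - of_int k) * mode (s - 1) (k + 1) x
    + cx (s - 1/2 - of_int m + of_int k) * mode (s - 1) (k - 1) x)"
  "classical_magnetic_grad 0 (1/2 + of_int m) (mode s k) x $ 2 = 1 / 2 *
   (cx (s + 1/2 + of_int m - of_int k) * mode (s - 1) (k + 1) x
    - cx (s - 1/2 - of_int m + of_int k) * mode (s - 1) (k - 1) x)"
 unfolding logder_magnetic[OF logder_mode x] mode_shift[symmetric] Complex_eq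
 by (simp_all add: add_divide_distrib diff_divide_distrib algebra_simps)

lemma magnetic_lincomb:
 assumes "f differentiable (at x)" "g differentiable (at x)"
 shows "classical_magnetic_grad 0 al (%x. a * f x + b * g x) x
  = a *s classical_magnetic_grad 0 al f x + b *s classical_magnetic_grad 0 al g x"
 by (simp add: vec_eq_iff classical_magnetic_grad_nth assms algebra_simps
   partial_deriv_add[of "%x. a * f x" x "%x. b * g x"] partial_deriv_cmult)

lemma mode_differentiable: "x ~= 0 ==> mode s k differentiable (at x)"
 using smooth_on_differentiable[OF smooth_on_mode] by simp

lemma magnetic_lead:
 assumes x: "x ~= 0"
 shows "classical_magnetic_grad 0 (1/2 + of_int m) (lead m w) x = lead_grad m w x"
proof -
 have e: "lead m w = (%x. (w / 2) * mode (1/2) (m + 1) x + (cnj w / 2) * mode (1/2) m x)"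
  by (simp add: lead_def[abs_def] add_divide_distrib)
 show ?thesis
  unfolding e magnetic_lincomb[OF mode_differentiable[OF x] mode_differentiable[OF x]]
  unfolding vec_eq_iff forall_2 vector_add_component vector_smult_component mode_magnetic[OF x] lead_grad_def vector_2
  by (simp add: field_simps)
qed

text \<open>Together with \<open>magnetic_lead\<close>: the leading term is annihilated by the
  magnetic Laplacian off the pole. The parts with w and with its conjugate cancel
  separately.\<close>

lemma lead_grad_divergence:
 assumes x: "x ~= 0"
 shows "(\<i> * partial_deriv 1 (%x. lead_grad m w x $ 1) x + of_real (AB_potential 0 (1/2 + of_int m) x $ 1) * lead_grad m w x $ 1)
  + (\<i> * partial_deriv 2 (%x. lead_grad m w x $ 2) x + of_real (AB_potential 0 (1/2 + of_int m) x $ 2) * lead_grad m w x $ 2) = 0"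
proof -
 have e: "(%x. lead_grad m w x $ 1) = (%x. (\<i> / 4 * cnj w) * mode (-1/2) (m + 1) x + (\<i> / 4 * w) * mode (-1/2) m x)"
  "(%x. lead_grad m w x $ 2) = (%x. (1 / 4 * cnj w) * mode (-1/2) (m + 1) x + (- 1 / 4 * w) * mode (-1/2) m x)"
  by (simp_all add: lead_grad_def algebra_simps)
 have "classical_magnetic_grad 0 (1/2 + of_int m) (%x. lead_grad m w x $ 1) x $ 1
   + classical_magnetic_grad 0 (1/2 + of_int m) (%x. lead_grad m w x $ 2) x $ 2 = 0"
  unfolding e magnetic_lincomb[OF mode_differentiable[OF x] mode_differentiable[OF x]]
  unfolding vector_add_component vector_smult_component mode_magnetic[OF x] by (simp add: algebra_simps)
 then show ?thesis unfolding classical_magnetic_grad_nth by (simp add: algebra_simps)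
qed

lemma norm_lead_grad: "norm (lead_grad m w x) <= norm w * norm x powr (-1/2)"
proof -
 have a: "norm (lead_grad m w x $ j) <= 1 / 2 * (norm w * norm x powr (-1/2))" for j
  using exhaust_2[of j] norm_triangle_ineq[of "cnj w * mode (-1/2) (m + 1) x" "w * mode (-1/2) m x"]
   norm_triangle_ineq4[of "cnj w * mode (-1/2) (m + 1) x" "w * mode (-1/2) m x"]
  by (auto simp: lead_grad_def norm_mult norm_mode)
 have "(norm (lead_grad m w x))^2 <= (1 / 2 * (norm w * norm x powr (-1/2)))^2 + (1 / 2 * (norm w * norm x powr (-1/2)))^2"
  unfolding norm_cvec2 by (intro add_mono power_mono a) simp_all
 also have "... <= (norm w * norm x powr (-1/2))^2" by (simp add: power_mult_distrib power_divide)
 finally show ?thesis by (rule power2_le_imp_le) simp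
qed

text \<open>Here \<open>n\<close> is a radial vector; the trace-free symmetric tensor built from the leading gradients pairs with it to a constant.\<close>

lemma lead_grad_tensor:
 assumes "x ~= 0"
 shows "cx (x \<bullet> a) * cip (lead_grad m w x) (lead_grad m v x)
   - rdot a (lead_grad m w x) * cnj (rdot x (lead_grad m v x)) - rdot x (lead_grad m w x) * cnj (rdot a (lead_grad m v x))
  = cx (- Re (Complex (a$1) (a$2) * w * v) / 4)"
proof -
 define r where "r = norm x"
 have r: "r > 0" using assms by (simp add: r_def)
 define p where "p = spin 1 x"
 define q where "q = spin m x"
 define s where "s = cx (r powr (-1/2))"
 have "r powr (-1/2) * r powr (-1/2) * r powr 1 = 1" unfolding powr_add[symmetric] using r by simp
 then have s2: "s * s * cx r = 1" "cnj s = s"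
  unfolding s_def using r by (simp_all flip: of_real_mult)
 have u: "p * cnj p = 1" "q * cnj q = 1" by (simp_all add: p_def q_def spin_unit)
 have m: "mode (-1/2) (m + 1) x = s * p * q" "mode (-1/2) m x = s * q"
  by (simp_all add: mode_def s_def p_def q_def r_def spin_add)
 define A where "A = Complex (a$1) (a$2)"
 have a: "cx (a$1) = (A + cnj A) / 2" "cx (a$2) = (A - cnj A) / (2 * \<i>)"
  by (simp_all add: A_def complex_eq_iff)
 have z: "Complex (x$1) (x$2) = r * p" by (simp add: complex_coord_eq r_def p_def)
 then have zc: "cx r * p = cx (x$1) + \<i> * cx (x$2)"
  "cx r * cnj p = cx (x$1) - \<i> * cx (x$2)"
  using arg_cong[OF z, of cnj] by (simp_all add: complex_eq_iff)
 have x: "cx (x$1) = r * (p + cnj p) / 2" "cx (x$2) = r * (p - cnj p) / (2 * \<i>)"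
  by (simp_all add: distrib_left right_diff_distrib zc)
 have R: "cx (- Re (A * w * v) / 4) = - (A * w * v + cnj (A * w * v)) / 8"
  unfolding complex_add_cnj by simp
 have L: "lead_grad m w x $ 1 = \<i> / 4 * s * q * (cnj w * p + w)" "lead_grad m w x $ 2 = 1 / 4 * s * q * (cnj w * p - w)" for w
  unfolding lead_grad_def m vector_2 by (simp_all add: algebra_simps)
 have xa: "cx (x \<bullet> a) = r * (p * cnj A + cnj p * A) / 2"
  unfolding inner2 of_real_add of_real_mult a x by (simp add: field_simps)
 have c: "cip (lead_grad m w x) (lead_grad m v x) = s * s * (q * cnj q) / 8 * (cnj w * p * (v * cnj p) + w * cnj v)"
  unfolding cip_eq L by (simp add: s2(2) field_simps)
 have ra: "rdot a (lead_grad m w x) = \<i> * s * q / 4 * (cnj A * (cnj w * p) + A * w)" for w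
  unfolding rdot_def L a by (simp add: field_simps)
 have rx: "rdot x (lead_grad m w x) = \<i> * s * q * r / 4 * (cnj p * (cnj w * p) + p * w)" for w
  unfolding rdot_def L x by (simp add: field_simps)
 have "cx (x \<bullet> a) * cip (lead_grad m w x) (lead_grad m v x)
   - rdot a (lead_grad m w x) * cnj (rdot x (lead_grad m v x)) - rdot x (lead_grad m w x) * cnj (rdot a (lead_grad m v x))
  = - (A * w * v + cnj (A * w * v)) / 8 * (s * s * cx r) * (q * cnj q) * (p * cnj p)"
  unfolding xa c ra rx by (simp add: s2(2) field_simps)
 then show ?thesis unfolding s2 u A_def[symmetric] R by simp
qed

section \<open>Smooth cut-off profiles\<close>

lemma poly_over_exp: "((%t :: real. poly p t / exp t) \<longlongrightarrow> 0) at_top"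
proof -
 have "((%t :: real. \<Sum>i\<le>degree p. coeff p i * (t ^ i / exp t)) \<longlongrightarrow> (\<Sum>i\<le>degree p. coeff p i * 0)) at_top"
  by (intro tendsto_intros tendsto_power_div_exp_0)
 then show ?thesis by (simp add: poly_altdef sum_divide_distrib)
qed

text \<open>The classical flat function exp(-1/s) with polynomials in 1/s in front. The polynomials
  make the family closed under differentiation, as \<open>smooth_on_family\<close> demands.\<close>

definition flat :: "real poly => real => real" where
 "flat p s = (if s > 0 then poly p (1 / s) * exp (- 1 / s) else 0)"

lemma flat_derivative: "(flat p has_real_derivative flat ((p - pderiv p) * [:0, 0, 1:]) s) (at s)"
proof -
 consider "s > 0" | "s < 0" | "s = 0" by linarith
 then show ?thesis
 proof cases
  case 1
  have "((%s. poly p (1 / s) * exp (- 1 / s)) has_real_derivative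
    poly (pderiv p) (1 / s) * (- 1 / s^2) * exp (- 1 / s) + exp (- 1 / s) * (1 / s^2) * poly p (1 / s)) (at s)"
   using 1 by (auto intro!: derivative_eq_intros DERIV_chain2[OF poly_DERIV] simp: power2_eq_square)
  moreover have "poly (pderiv p) (1 / s) * (- 1 / s^2) * exp (- 1 / s) + exp (- 1 / s) * (1 / s^2) * poly p (1 / s)
    = flat ((p - pderiv p) * [:0, 0, 1:]) s"
   using 1 by (simp add: flat_def power2_eq_square field_simps)
  ultimately have "((%s. poly p (1 / s) * exp (- 1 / s)) has_real_derivative flat ((p - pderiv p) * [:0, 0, 1:]) s) (at s)" by simp
  then show ?thesis
   by (rule has_field_derivative_transform_within_open[of _ _ _ "{0<..}"]) (use 1 in \<open>auto simp: flat_def\<close>)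
 next
  case 2
  have "((%s. 0) has_real_derivative flat ((p - pderiv p) * [:0, 0, 1:]) s) (at s)" using 2 by (simp add: flat_def)
  then show ?thesis
   by (rule has_field_derivative_transform_within_open[of _ _ _ "{..<0}"]) (use 2 in \<open>auto simp: flat_def\<close>)
 next
  case 3
  have "((%s. poly (pCons 0 p) (inverse s) / exp (inverse s)) \<longlongrightarrow> 0) (at_right 0)"
   by (rule filterlim_compose[OF poly_over_exp filterlim_inverse_at_top_right])
  then have "((%s. flat p s / s) \<longlongrightarrow> 0) (at_right 0)"
   by (rule Lim_transform_eventually)
     (auto simp: eventually_at_filter flat_def inverse_eq_divide exp_minus field_simps)
  moreover have "((%s. flat p s / s) \<longlongrightarrow> 0) (at_left 0)"
   by (rule Lim_transform_eventually[OF tendsto_const]) (auto simp: eventually_at_filter flat_def)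
  ultimately have "((%s. flat p s / s) \<longlongrightarrow> 0) (at 0)" by (simp add: filterlim_at_split)
  then show ?thesis using 3 by (simp add: has_field_derivative_iff flat_def)
 qed
qed

lemma smooth_on_flat:
 assumes "smooth_on UNIV (%x. cx (f x))"
 shows "smooth_on UNIV (%x. cx (flat p (f x)))"
 by (rule smooth_on_family[OF open_UNIV _ assms, of "range flat" UNIV]) (use flat_derivative in blast)+

text \<open>The variable is s = |x|^2 / e^2, which keeps the cut-off smooth at 0; the range starts
  at -1 only to leave room for two-sided derivatives at s = 0. \<open>B\<close> is minus the
  derivative of \<open>\<eta>\<close>, and its lower bound on [1/2, 3/4] later keeps the leading
  coefficient away from 0.\<close>

locale profile =
 fixes B B' \<eta> :: "real => real" and bm b0 :: real
 assumes Bsm: "!!f. smooth_on UNIV (%x. cx (f x)) ==> smooth_on UNIV (%x. cx (B (f x)))"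
  and Bder: "!!s. (B has_real_derivative B' s) (at s)"
  and \<eta>: "!!s. s > -1 ==> (\<eta> has_real_derivative - B s) (at s)"
   "!!s. - 1 <= s ==> s <= 1/4 ==> \<eta> s = 1" "!!s. 1 <= s ==> \<eta> s = 0"
   "!!s. - 1 <= s ==> 0 <= \<eta> s" "!!s. - 1 <= s ==> \<eta> s <= 1"
  and Bz: "!!s. s <= 1/4 \<or> 1 <= s ==> B s = 0" "!!s. s <= 1/4 \<or> 1 <= s ==> B' s = 0"
  and Bb: "bm > 0" "!!s. 0 <= B s" "!!s. B s <= bm" "!!s. \<bar>B' s\<bar> <= bm"
  and b0: "b0 > 0" "!!s. 1/2 <= s ==> s <= 3/4 ==> b0 <= B s"

text \<open>A product of two flat functions is positive exactly on (1/4, 1). Divided by its integral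
  it becomes \<open>B\<close>, and \<open>\<eta>\<close> is 1 minus the primitive of
  \<open>B\<close>.\<close>

lemma profile_exists: "\<exists>B B' \<eta> bm b0. profile B B' \<eta> bm b0"
proof -
 let ?q = "(1 - pderiv 1) * [:0, 0, 1:] :: real poly"
 define b where "b s = flat 1 (1 - s) * flat 1 (s - 1/4)" for s
 define b' where "b' s = flat 1 (1 - s) * flat ?q (s - 1/4) - flat ?q (1 - s) * flat 1 (s - 1/4)" for s
 have d1: "((%s. flat p (1 - s)) has_real_derivative - flat ((p - pderiv p) * [:0, 0, 1:]) (1 - s)) (at s)" for p s
  by (rule DERIV_cong[OF DERIV_chain2[where f = "flat p" and g = "%s. 1 - s" and Db = "-1", OF flat_derivative]])
    (auto intro!: derivative_eq_intros)
 have d2: "((%s. flat p (s - 1/4)) has_real_derivative flat ((p - pderiv p) * [:0, 0, 1:]) (s - 1/4)) (at s)" for p s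
  by (rule DERIV_cong[OF DERIV_chain2[where f = "flat p" and g = "%s. s - 1/4" and Db = 1, OF flat_derivative]])
    (auto intro!: derivative_eq_intros)
 have db: "(b has_real_derivative b' s) (at s)" for s
  using DERIV_mult[OF d1[of 1 s] d2[of 1 s]] by (simp add: b_def[abs_def] b'_def algebra_simps)
 have cb: "continuous_on S b" for S by (meson DERIV_continuous_on db has_field_derivative_at_within)
 have cf: "continuous_on S (%s. flat p (1 - s))" "continuous_on S (%s. flat p (s - 1/4))" for S p
  using DERIV_continuous_on[OF has_field_derivative_at_within[OF d1]] DERIV_continuous_on[OF has_field_derivative_at_within[OF d2]] by blast+
 have cb': "continuous_on S b'" for S unfolding b'_def[abs_def] by (intro continuous_intros cf)
 have b0: "0 <= b s" for s by (simp add: b_def flat_def)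
 have bz: "b s = 0" "b' s = 0" if "s <= 1/4 \<or> 1 <= s" for s using that by (auto simp: b_def b'_def flat_def)
 have bp: "b s > 0" if "1/4 < s" "s < 1" for s using that by (simp add: b_def flat_def)
 have ib: "b integrable_on {c..d}" for c d by (rule integrable_continuous_real[OF cb])
 define c where "c = integral {-1..1} b"
 obtain m where "m \<in> {1/2..3/4}" "\<forall>s\<in>{1/2..3/4}. b m <= b s"
  using continuous_attains_inf[of "{1/2..3/4::real}" b, OF compact_Icc _ cb] by auto
 then have m: "!!s. 1/2 <= s ==> s <= 3/4 ==> b m <= b s" "1/2 <= m" "m <= 3/4" by auto
 have bm0: "b m > 0" using m by (intro bp) auto
 have "0 < b m * (3/4 - 1/2)" using bm0 by simp
 also have "... = integral {1/2..3/4::real} (%s. b m)" by simp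
 also have "... <= integral {1/2..3/4} b" by (intro integral_le ib) (auto intro: m)
 also have "... <= c" unfolding c_def by (intro integral_subset_le ib) (auto intro: b0)
 finally have c: "c > 0" .
 define I where "I s = integral {-1..s} b" for s
 have dI: "(I has_real_derivative b s) (at s)" if "s > -1" for s
 proof -
  have "(I has_real_derivative b s) (at s within {-1..s + 1})"
   unfolding I_def[abs_def] by (rule integral_has_real_derivative[OF cb]) (use that in auto)
  then have "(I has_real_derivative b s) (at s within {-1<..<s + 1})" by (rule DERIV_subset) auto
  then show ?thesis using that by (subst (asm) at_within_open) auto
 qed
 have I0: "I s = 0" if "s <= 1/4" for s
  unfolding I_def by (subst integral_cong[of _ b "%_. 0"]) (use that bz in auto)
 have I1: "I s = c" if "1 <= s" for s
 proof -
  have "integral {-1..1} b + integral {1..s} b = I s"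
   unfolding I_def by (rule Henstock_Kurzweil_Integration.integral_combine) (use that ib in auto)
  moreover have "integral {1..s} b = 0" by (subst integral_cong[of _ b "%_. 0"]) (use bz in auto)
  ultimately show ?thesis by (simp add: c_def)
 qed
 have Ib: "0 <= I s" "I s <= c" if "-1 <= s" for s
 proof -
  show "0 <= I s" unfolding I_def by (intro integral_nonneg ib b0)
  have "I s <= I (max s 1)" unfolding I_def by (intro integral_subset_le ib) (auto intro: b0)
  then show "I s <= c" using I1[of "max s 1"] by simp
 qed
 have "bounded (b ` {0..1})" "bounded (b' ` {0..1})"
  by (intro compact_imp_bounded compact_continuous_image cb cb' compact_Icc)+
 then obtain M1 M2 where M: "\<forall>s\<in>{0..1}. \<bar>b s\<bar> <= M1" "\<forall>s\<in>{0..1}. \<bar>b' s\<bar> <= M2"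
  unfolding bounded_iff by auto
 define bm where "bm = (\<bar>M1\<bar> + \<bar>M2\<bar> + 1) / c"
 have le: "\<bar>b s\<bar> <= \<bar>M1\<bar>" "\<bar>b' s\<bar> <= \<bar>M2\<bar>" for s
 proof -
  have "\<bar>b s\<bar> <= \<bar>M1\<bar> \<and> \<bar>b' s\<bar> <= \<bar>M2\<bar>"
  proof (cases "0 <= s \<and> s <= 1")
   case True
   then have "\<bar>b s\<bar> <= M1" "\<bar>b' s\<bar> <= M2" using M by auto
   then show ?thesis by linarith
  next
   case False
   then have "s <= 1/4 \<or> 1 <= s" by linarith
   then show ?thesis by (simp add: bz)
  qed
  then show "\<bar>b s\<bar> <= \<bar>M1\<bar>" "\<bar>b' s\<bar> <= \<bar>M2\<bar>" by auto
 qed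
 have "profile (%s. b s / c) (%s. b' s / c) (%s. 1 - I s / c) bm (b m / c)"
 proof
  fix f :: "real^2 => real" assume f: "smooth_on UNIV (%x. cx (f x))"
  have f1: "smooth_on UNIV (%x. cx (1 - f x))" "smooth_on UNIV (%x. cx (f x - 1/4))"
   unfolding of_real_diff by (intro smooth_on_diff smooth_on_const f open_UNIV)+
  have "smooth_on UNIV (%x. cx (1 / c) * (cx (flat 1 (1 - f x)) * cx (flat 1 (f x - 1/4))))"
   by (intro smooth_on_mult smooth_on_const smooth_on_flat f1 open_UNIV)
  then show "smooth_on UNIV (%x. cx (b (f x) / c))" by (simp add: b_def)
 next
  show "((%s. b s / c) has_real_derivative b' s / c) (at s)" for s by (rule DERIV_cdivide[OF db])
  show "((%s. 1 - I s / c) has_real_derivative - (b s / c)) (at s)" if "s > -1" for s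
   using DERIV_diff[OF DERIV_const DERIV_cdivide[OF dI[OF that], of c], of 1] by simp
  show "bm > 0" "b m / c > 0" using c bm0 by (simp_all add: bm_def add_nonneg_pos)
  show "b s / c <= bm" "\<bar>b' s / c\<bar> <= bm" for s
   using le[of s] c by (auto simp: bm_def intro!: divide_right_mono)
  show "b m / c <= b s / c" if "1/2 <= s" "s <= 3/4" for s using m(1)[OF that] c by (intro divide_right_mono) auto
 qed (use c b0 bz I0 I1 Ib in \<open>auto simp: divide_le_eq_1\<close>)
then show ?thesis by blast
qed

section \<open>K-real functions\<close>

lemma test_functions_cnj: "u \<in> test_functions S ==> (%x. cnj (u x)) \<in> test_functions S"
proof (rule test_functionsI)
 assume u: "u \<in> test_functions S"
 then show "compact (closure {x. u x ~= 0})" "closure {x. u x ~= 0} \<subseteq> S" by (auto simp: test_functions_def)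
 show "smooth_on UNIV (%x. cnj (u x))" by (intro smooth_on_cnj test_functions_smooth[OF u] open_UNIV)
 show "cnj (u x) = 0" if "x \<notin> closure {x. u x ~= 0}" for x using support_zero[OF that] by simp
qed

section \<open>Divergence identities off the pole\<close>

lemma integral_divergence_off:
 fixes f :: "2 => real^2 => complex"
 assumes u: "u \<in> test_functions (S - {a})" and f: "!!j. smooth_on (- {a}) (f j)"
 shows "(LINT x|lborel. (f 1 x * partial_deriv 1 u x + u x * partial_deriv 1 (f 1) x)
   + (f 2 x * partial_deriv 2 u x + u x * partial_deriv 2 (f 2) x)) = 0"
proof -
 note t = test_functions_mult_off[OF u f]
 have e: "f j x * partial_deriv j u x + u x * partial_deriv j (f j) x = partial_deriv j (%x. f j x * u x) x" for j :: 2 and x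
  using fun_cong[OF classical_grad_mult[OF u f[of j]], of x] by (simp add: classical_grad_def vec_eq_iff)
 have i: "integrable lborel (partial_deriv j (%x. f j x * u x)) \<and> (LINT x|lborel. partial_deriv j (%x. f j x * u x) x) = 0" for j :: 2
 proof -
  note p = test_functions_partial[OF t, of j j]
  obtain R R' where R: "!!x. norm x >= R ==> f j x * u x = 0" "!!x. norm x >= R' ==> partial_deriv j (%x. f j x * u x) x = 0"
   using test_functions_bounded_support[OF t] test_functions_bounded_support[OF p] by metis
  show ?thesis
   using bounded_support_integrable[OF test_functions_continuous[OF p] R(2)]
    integral_partial_deriv[OF test_functions_differentiable[OF t] test_functions_continuous[OF p] R(1)] by auto
 qed
 then show ?thesis unfolding e by (simp add: b_integral_add)
qed

text \<open>The weak form of \<open>lead_grad_divergence\<close>; the test function vanishes near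
  the pole, so the singularity leaves no boundary term.\<close>

lemma lead_weak:
 assumes \<psi>: "\<psi> \<in> test_functions (S - {0})"
 shows "(LINT x|lborel. cip (lead_grad m w x) (classical_magnetic_grad 0 (1/2 + of_int m) \<psi> x)) = 0"
proof -
 let ?f = "%j x. lead_grad m w x $ j" and ?u = "%x. cnj (\<psi> x)"
 have "cip (lead_grad m w x) (classical_magnetic_grad 0 (1/2 + of_int m) \<psi> x)
  = - \<i> * ((?f 1 x * partial_deriv 1 ?u x + ?u x * partial_deriv 1 (?f 1) x) + (?f 2 x * partial_deriv 2 ?u x + ?u x * partial_deriv 2 (?f 2) x))" for x
 proof (cases "x = 0")
  case True
  then have "\<psi> x = 0" "partial_deriv j \<psi> x = 0" for j
   using test_functions_zero[OF \<psi>] test_functions_zero[OF test_functions_partial[OF \<psi>]] by auto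
  then show ?thesis
   by (simp add: cip_eq classical_magnetic_grad_nth partial_deriv_cnj[OF test_functions_differentiable[OF \<psi>]])
 next
  case False
  let ?A = "%j. cx (AB_potential 0 (1/2 + of_int m) x $ j)"
  have "?A 1 * ?f 1 x + ?A 2 * ?f 2 x = - \<i> * (partial_deriv 1 (?f 1) x + partial_deriv 2 (?f 2) x)"
  proof -
   have "?A 1 * ?f 1 x + ?A 2 * ?f 2 x = ((\<i> * partial_deriv 1 (?f 1) x + ?A 1 * ?f 1 x) + (\<i> * partial_deriv 2 (?f 2) x + ?A 2 * ?f 2 x))
     - \<i> * (partial_deriv 1 (?f 1) x + partial_deriv 2 (?f 2) x)" by (simp add: algebra_simps)
   then show ?thesis unfolding lead_grad_divergence[OF False] by simp
  qed
  then have "cnj (\<psi> x) * (?A 1 * ?f 1 x + ?A 2 * ?f 2 x) = cnj (\<psi> x) * (- \<i> * (partial_deriv 1 (?f 1) x + partial_deriv 2 (?f 2) x))" by simp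
  then show ?thesis
   by (simp add: cip_eq classical_magnetic_grad_nth partial_deriv_cnj[OF test_functions_differentiable[OF \<psi>]] algebra_simps)
 qed
 then show ?thesis
  using integral_divergence_off[where f = ?f, OF test_functions_cnj[OF \<psi>] smooth_on_lead_grad] by simp
qed

lemma AB_as_modes:
 "cx (AB_potential 0 1 x $ 1) = (\<i> / 2) * mode (-1) 1 x + (- \<i> / 2) * mode (-1) (-1) x"
 "cx (AB_potential 0 1 x $ 2) = (1 / 2) * mode (-1) 1 x + (1 / 2) * mode (-1) (-1) x"
 unfolding mode_coord[symmetric] AB_potential_nth by (simp_all add: complex_eq_iff field_simps flip: of_real_power)

text \<open>The potential is divergence free off the pole, which is seen by writing its components
  as modes of power -1.\<close>

lemma AB_weak:
 assumes \<psi>: "\<psi> \<in> test_functions (S - {0})"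
 shows "(LINT x|lborel. rdot (AB_potential 0 1 x) (classical_grad \<psi> x)) = 0"
proof -
 let ?f = "%j x. cx (AB_potential 0 1 x $ j)"
 have sm: "smooth_on (- {0}) (?f j)" for j
 proof -
  have "smooth_on (- {0}) (?f 1)" "smooth_on (- {0}) (?f 2)"
   unfolding AB_as_modes by (intro smooth_on_add smooth_on_mult smooth_on_const smooth_on_mode open_Compl closed_singleton)+
  then show ?thesis using exhaust_2[of j] by auto
 qed
 have div: "partial_deriv 1 (?f 1) x + partial_deriv 2 (?f 2) x = 0" if x: "x ~= 0" for x
 proof -
  have p: "partial_deriv i (%x. a * mode (-1) 1 x + b * mode (-1) (-1) x) x
    = a * partial_deriv i (mode (-1) 1) x + b * partial_deriv i (mode (-1) (-1)) x" for i a b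
   using mode_differentiable[OF x]
   by (simp add: partial_deriv_add[of "%x. a * mode (-1) 1 x" x "%x. b * mode (-1) (-1) x"] partial_deriv_cmult)
  show ?thesis
   unfolding AB_as_modes p partial_deriv_logder[OF logder_mode x]
   unfolding AB_potential_nth
   by (simp add: algebra_simps diff_divide_distrib add_divide_distrib)
 qed
 have "rdot (AB_potential 0 1 x) (classical_grad \<psi> x)
  = (?f 1 x * partial_deriv 1 \<psi> x + \<psi> x * partial_deriv 1 (?f 1) x) + (?f 2 x * partial_deriv 2 \<psi> x + \<psi> x * partial_deriv 2 (?f 2) x)" for x
 proof (cases "x = 0")
  case True
  then have "\<psi> x = 0" using test_functions_zero[OF \<psi>] by auto
  then show ?thesis by (simp add: rdot_def classical_grad_def)
 next
  case False
  have "\<psi> x * (partial_deriv 1 (?f 1) x + partial_deriv 2 (?f 2) x) = 0" using div[OF False] by simp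
  then show ?thesis by (simp add: rdot_def classical_grad_def algebra_simps)
 qed
 then show ?thesis using integral_divergence_off[where f = ?f, OF \<psi> sm] by simp
qed

context bounded_domain
begin

lemma H_limit_cnj:
 assumes H: "H_limit \<Omega> a u g"
 shows "H_limit \<Omega> a (%x. cnj (u x)) (%x. cnj_vec (g x))"
proof -
 have nc: "norm (cnj_vec v) = norm v" for v
 proof -
  have "(norm (cnj_vec v))^2 = (norm v)^2" unfolding norm_cvec2 cnj_vec_def by simp
  then show ?thesis by simp
 qed
 have nt: "norm (triple a (%x. cnj (v x)) (%x. cnj_vec (f x)) x) = norm (triple a v f x)" for v f x
  by (rule power2_eq_imp_eq) (simp_all add: norm_triple nc)
 show ?thesis
 proof (rule H_limit_map[OF H, where T = "%v x. cnj (v x)" and G = "%v f x. cnj_vec (f x)" and C = 1])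
  show "classical_grad (%x. cnj (v x)) = (%x. cnj_vec (classical_grad v x))" if "v \<in> test a" for v
   by (simp add: cnj_vec_def classical_grad_def vec_eq_iff fun_eq_iff partial_deriv_cnj[OF test_functions_differentiable[OF that]])
  fix v :: "real^2 => complex" and f :: "real^2 => complex^2"
  assume m: "meas v" "meas f"
  have m': "meas (%x. cnj (v x))" "meas (%x. cnj_vec (f x))"
   using cnj_measurable[OF m(1)] by (auto intro!: borel_measurable_cvec2 simp: cnj_vec_def cnj_measurable[OF component_measurable[OF m(2)]])
  then show "meas (%x. cnj (v x)) \<and> meas (%x. cnj_vec (f x))" by blast
  assume L: "L2 M (triple a v f)"
  have "AE x in M. norm (triple a (%x. cnj (v x)) (%x. cnj_vec (f x)) x) <= 1 * norm (triple a v f x)" by (simp add: nt)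
  from L2_dominated[OF L triple_measurable[OF m'] this]
  show "L2 M (triple a (%x. cnj (v x)) (%x. cnj_vec (f x))) \<and> l2 M (triple a (%x. cnj (v x)) (%x. cnj_vec (f x))) <= 1 * l2 M (triple a v f)"
   by simp
 qed (simp_all add: test_functions_cnj triple_def cnj_vec_def vec_eq_iff diff_divide_distrib)
qed

text \<open>The antiunitary symmetry \<open>u \<mapsto> e\<^bsup>in\<theta>\<^esup> cnj u\<close> anticommutes with \<open>i\<nabla> + A\<close> at circulation \<open>n/2\<close>.\<close>

lemma K_real_pgrad:
 assumes H: "H_limit \<Omega> 0 u g" and K: "AE x in M. spin n x * cnj (u x) = u x"
 shows "AE x in M. \<forall>j. spin n x * cnj (pgrad 0 (of_int n / 2) u g x $ j) = - pgrad 0 (of_int n / 2) u g x $ j"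
proof -
 have g: "classical_grad (spin n) x = (spin n x * \<i> * of_int n) *s complex_vec (AB_potential 0 1 x)" if "x ~= 0" for x
  by (simp add: classical_grad_def vec_eq_iff partial_deriv_logder[OF logder_spin that] complex_vec_def)
 have "H_limit \<Omega> 0 (%x. spin n x * cnj (u x)) (%x. spin n x *s cnj_vec (g x) + cnj (u x) *s classical_grad (spin n) x)"
  by (rule H_limit_mult_off[OF H_limit_cnj[OF H] smooth_on_spin, of _ 1 "\<bar>of_int n\<bar>"])
    (simp_all add: norm_spin g norm_smult norm_mult norm_complex_vec norm_AB_potential)
 from H_limit_grad_unique[OF this H K] AE_M_neq[of 0] K
 show ?thesis
 proof eventually_elim
  case (elim x)
  show ?case
  proof
   fix j
   have "spin n x * cnj (g x $ j) + cnj (u x) * (spin n x * \<i> * of_int n * cx (AB_potential 0 1 x $ j)) = g x $ j"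
    using arg_cong[OF elim(1), of "%v. v $ j"] by (simp add: g[OF elim(2)] cnj_vec_def complex_vec_def mult.assoc)
   then have "spin n x * cnj (g x $ j) = g x $ j - \<i> * of_int n * cx (AB_potential 0 1 x $ j) * (spin n x * cnj (u x))"
    by (simp add: algebra_simps)
   then have s: "spin n x * cnj (g x $ j) = g x $ j - \<i> * of_int n * cx (AB_potential 0 1 x $ j) * u x"
    unfolding elim(3) .
   have "spin n x * cnj (pgrad 0 (of_int n / 2) u g x $ j)
    = - \<i> * (spin n x * cnj (g x $ j)) + (spin n x * cnj (u x)) * cx (of_int n / 2 * AB_potential 0 1 x $ j)"
    by (subst AB_potential_scale) (simp add: pgrad_def complex_vec_def AB_potential_scale[of 0 "of_int n / 2"] algebra_simps)
   also have "... = - pgrad 0 (of_int n / 2) u g x $ j"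
    unfolding s elim(3) by (simp add: pgrad_def complex_vec_def AB_potential_scale[of 0 "of_int n / 2"] algebra_simps)
   finally show "spin n x * cnj (pgrad 0 (of_int n / 2) u g x $ j) = - pgrad 0 (of_int n / 2) u g x $ j" .
  qed
 qed
qed

lemma norm_smult_AB: "norm ((u x :: complex) *s complex_vec (AB_potential 0 1 x)) = norm (u x / cx (norm (x - 0)))"
 by (simp add: norm_smult norm_complex_vec norm_AB_potential norm_divide)

lemma L2_AB:
 assumes H: "H_limit \<Omega> 0 u g"
 shows "L2 M (%x. u x *s complex_vec (AB_potential 0 1 x))"
proof (rule L2_dominated(1)[OF H_limit_L2(4)[OF H], where K = 1])
 have [measurable]: "meas (%x. AB_potential 0 1 x $ j)" for j by (rule borel_M[OF AB_potential_borel])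
 note [measurable] = H_limit_measurable(1)[OF H]
 show "meas (%x. u x *s complex_vec (AB_potential 0 1 x))"
  by (rule borel_measurable_cvec2) (simp add: complex_vec_def)
qed (simp_all add: norm_smult_AB)

text \<open>For test functions the two integrands add up to the potential applied to the gradient of
  u times the conjugate of v, so \<open>AB_weak\<close> gives 0. Both integrals pass to the limit,
  since u / |x| converges in L2.\<close>

lemma AB_pair:
 assumes u: "H_limit \<Omega> 0 u g" and v: "H_limit \<Omega> 0 v h"
 shows "(LINT x|M. cip (g x) (v x *s complex_vec (AB_potential 0 1 x))) + (LINT x|M. cip (u x *s complex_vec (AB_potential 0 1 x)) (h x)) = 0"
proof -
 let ?A = "%u x. (u x :: complex) *s complex_vec (AB_potential 0 1 x)"
 note nA = norm_smult_AB and LA = L2_AB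
 obtain p where p: "!!n. p n \<in> test 0"
  and lp: "(%n. tdist 0 (p n) (classical_grad (p n)) u g) ----> 0"
  using H_limitE[OF u] by blast
 obtain q where q: "!!n. q n \<in> test 0"
  and lq: "(%n. tdist 0 (q n) (classical_grad (q n)) v h) ----> 0"
  using H_limitE[OF v] by blast
 note Hp = test_functions_H_limit[OF p] and Hq = test_functions_H_limit[OF q]
 have comp: "(%n. l2 M (%x. k n x - f x)) ----> 0 \<and> (%n. l2 M (%x. ?A (w n) x - ?A y x)) ----> 0"
  if "!!n. H_limit \<Omega> 0 (w n) (k n)" "H_limit \<Omega> 0 y f" "(%n. tdist 0 (w n) (k n) y f) ----> 0" for w k y f
 proof -
  have "pgrad 0 0 (w n) (k n) x - pgrad 0 0 y f x = \<i> *s (k n x - f x)" for n x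
   by (simp add: pgrad_def AB_potential_scale[of 0 0] complex_vec_def vec_eq_iff algebra_simps)
  then have "norm (pgrad 0 0 (w n) (k n) x - pgrad 0 0 y f x) = norm (k n x - f x)" for n x by (simp only: norm_smult) simp
  then have 1: "(%n. l2 M (%x. k n x - f x)) ----> 0"
   using triple_limit_components(1)[OF that, of 0] by (simp only: l2_def)
  have "?A (w n) x - ?A y x = ?A (%x. w n x - y x) x" for n x by (simp add: vec_eq_iff algebra_simps)
  then have "norm (?A (w n) x - ?A y x) = norm (w n x / cx (norm (x - 0)) - y x / cx (norm (x - 0)))" for n x
   using nA[of "%x. w n x - y x" x] by (simp only: diff_divide_distrib)
  then have "(%n. l2 M (%x. ?A (w n) x - ?A y x)) ----> 0"
   using triple_limit_components(3)[OF that] by (simp only: l2_def)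
  with 1 show ?thesis by simp
 qed
 note cp = comp[OF Hp u lp] and cq = comp[OF Hq v lq]
 have lim: "(%n. (LINT x|M. cip (classical_grad (p n) x) (?A (q n) x)) + (LINT x|M. cip (?A (p n) x) (classical_grad (q n) x)))
   ----> (LINT x|M. cip (g x) (?A v x)) + (LINT x|M. cip (?A u x) (h x))"
  by (intro tendsto_add L2_bilinear_tendsto[OF bounded_bilinear_cip] H_limit_L2(2)[OF Hp] H_limit_L2(2)[OF u] H_limit_L2(2)[OF Hq] H_limit_L2(2)[OF v]
    LA[OF Hp] LA[OF Hq] LA[OF u] LA[OF v] cp[THEN conjunct1] cp[THEN conjunct2] cq[THEN conjunct1] cq[THEN conjunct2])
 have z: "(LINT x|M. cip (classical_grad (p n) x) (?A (q n) x)) + (LINT x|M. cip (?A (p n) x) (classical_grad (q n) x)) = 0" for n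
 proof -
  let ?w = "%x. cnj (q n x) * p n x"
  have t: "?w \<in> test 0"
   by (intro test_functions_mult p smooth_on_cnj test_functions_smooth[OF q]) simp
  have "(LINT x|M. cip (classical_grad (p n) x) (?A (q n) x)) + (LINT x|M. cip (?A (p n) x) (classical_grad (q n) x))
   = (LINT x|M. cip (classical_grad (p n) x) (?A (q n) x) + cip (?A (p n) x) (classical_grad (q n) x))"
   by (rule b_integral_add[symmetric])
     (intro L2_bilinear[OF bounded_bilinear_cip] H_limit_L2(2)[OF Hp] H_limit_L2(2)[OF Hq] LA[OF Hp] LA[OF Hq])+
  also have "... = (LINT x|M. rdot (AB_potential 0 1 x) (classical_grad ?w x))"
   by (rule b_integral_cong)
     (simp_all add: cip_vec_left cip_vec_right rdot_def classical_grad_def partial_deriv_mult partial_deriv_cnj algebra_simps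
     test_functions_differentiable[OF p] test_functions_differentiable[OF q] test_functions_differentiable[OF test_functions_cnj[OF q]])
  also have "... = (LINT x|lborel. rdot (AB_potential 0 1 x) (classical_grad ?w x))"
  proof (rule integral_M)
   note [measurable] = test_functions_partial_borel[OF t]
   show "(%x. rdot (AB_potential 0 1 x) (classical_grad ?w x)) \<in> borel_measurable borel"
    unfolding rdot_def classical_grad_def by simp
   show "rdot (AB_potential 0 1 x) (classical_grad ?w x) = 0" if "x \<notin> \<Omega>" for x
    using that test_functions_zero[OF test_functions_partial[OF t]] by (simp add: rdot_def classical_grad_def)
  qed
  also have "... = 0" by (rule AB_weak[OF t])
  finally show ?thesis .
 qed
 show "(LINT x|M. cip (g x) (?A v x)) + (LINT x|M. cip (?A u x) (h x)) = 0"
  using LIMSEQ_unique[OF lim] unfolding z by simp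
qed

text \<open>Absence of divergence makes the pairing of the potential with the magnetic gradient
  symmetric. The two halves of the variation in the circulation are therefore equal, and the single
  integral of (iii) determines their sum.\<close>

lemma AB_pair_symmetric:
 assumes u: "H_limit \<Omega> 0 u g" and v: "H_limit \<Omega> 0 v h"
 shows "(LINT x|M. cip (u x *s complex_vec (AB_potential 0 1 x)) (pgrad 0 al v h x))
  = (LINT x|M. cip (pgrad 0 al u g x) (v x *s complex_vec (AB_potential 0 1 x)))"
proof -
 let ?A = "%u x. (u x :: complex) *s complex_vec (AB_potential 0 1 x)"
 note b = L2_bilinear[OF bounded_bilinear_cip]
 note i = b[OF H_limit_L2(2)[OF u] L2_AB[OF v]] b[OF L2_AB[OF u] H_limit_L2(2)[OF v]]
  b[OF L2_AB[OF u] H_limit_L2(5)[OF v]] b[OF H_limit_L2(5)[OF u] L2_AB[OF v]]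
 have e: "cip (pgrad 0 al u g x) (?A v x) - cip (?A u x) (pgrad 0 al v h x) = \<i> * (cip (g x) (?A v x) + cip (?A u x) (h x))" for x
  by (simp add: AB_potential_scale[of 0 al] cip_eq pgrad_def complex_vec_def algebra_simps)
 have "(LINT x|M. cip (pgrad 0 al u g x) (?A v x)) - (LINT x|M. cip (?A u x) (pgrad 0 al v h x))
   = \<i> * ((LINT x|M. cip (g x) (?A v x)) + (LINT x|M. cip (?A u x) (h x)))"
  unfolding b_integral_diff[OF i(4,3), symmetric] e
  by (simp add: b_integral_add[OF i(1,2)])
 then show ?thesis using AB_pair[OF u v] by simp
qed

lemma drift_pairing:
 fixes al :: real
 assumes u: "H_limit \<Omega> 0 u g" and v: "H_limit \<Omega> 0 v h" and b: "!!j. meas (%x. b x $ j)"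
  and c: "c >= 0" "!!x. x ~= 0 ==> norm (b x) <= c / norm x"
 defines "D \<equiv> %x. rdot (b x) (pgrad 0 al u g x) * cnj (v x) + u x * cnj (rdot (b x) (pgrad 0 al v h x))"
 shows "integrable M D" "norm (LINT x|M. D x) <= c * (l2 M (wt al u g) * l2 M (wt al v h))"
proof -
 have m: "meas D"
 proof -
  have "meas (%x. first_order 0 0 (b x) (pgrad 0 al u g x) (pgrad 0 al v h x) (u x) (v x))"
   by (intro first_order_measurable b L2_measurable[OF H_limit_L2(5)[OF u]] L2_measurable[OF H_limit_L2(5)[OF v]]
     H_limit_measurable(1)[OF u] H_limit_measurable(1)[OF v]) simp
  then show ?thesis by (simp add: D_def[abs_def] first_order_def rdot_def)
 qed
 have bd: "norm (D x) <= c * (wt al u g x * wt al v h x)" if x: "x ~= 0" for x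
 proof -
  let ?p = "norm (pgrad 0 al u g x)" and ?q = "norm (pgrad 0 al v h x)"
  have "norm (D x) <= norm (rdot (b x) (pgrad 0 al u g x)) * norm (v x) + norm (u x) * norm (rdot (b x) (pgrad 0 al v h x))"
   unfolding D_def using norm_triangle_ineq[of "rdot (b x) (pgrad 0 al u g x) * cnj (v x)" "u x * cnj (rdot (b x) (pgrad 0 al v h x))"]
   by (simp add: norm_mult)
  also have "... <= (c / norm x * ?p) * norm (v x) + norm (u x) * (c / norm x * ?q)"
   by (intro add_mono mult_right_mono mult_left_mono order_trans[OF norm_rdot] c(2) x) auto
  also have "... = c * (?p * (norm (v x) / norm x) + (norm (u x) / norm x) * ?q)" by (simp add: algebra_simps)
  also have "... <= c * (wt al u g x * wt al v h x)"
  proof (intro mult_left_mono c(1))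
   have "P * V + U * Q <= (P + U) * (Q + V)" if "P >= 0" "Q >= 0" "U >= 0" "V >= 0" for P Q U V :: real
    using mult_nonneg_nonneg[of P Q] mult_nonneg_nonneg[of U V] that by (simp add: algebra_simps)
   then show "?p * (norm (v x) / norm x) + (norm (u x) / norm x) * ?q <= wt al u g x * wt al v h x"
    unfolding wt_def by (meson norm_ge_zero divide_nonneg_nonneg)
  qed
  finally show ?thesis .
 qed
 show "integrable M D" by (rule wt_bound(1)[OF u v m c(1) bd])
 show "norm (LINT x|M. D x) <= c * (l2 M (wt al u g) * l2 M (wt al v h))" by (rule wt_bound(2)[OF u v m c(1) bd])
qed

end

section \<open>Localisation at the pole\<close>

text \<open>The stress-energy tensor of the Dirichlet form, contracted with \<open>n\<close> and
  \<open>a\<close>: the part of \<open>first_order\<close> that does not involve the change of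
  potential.\<close>

definition tensor :: "real^2 => real^2 => complex^2 => complex^2 => complex" where
 "tensor n a p P = cx (n \<bullet> a) * cip p P - rdot a p * cnj (rdot n P) - rdot n p * cnj (rdot a P)"

lemma first_order_tensor: "first_order n a b p P u v = tensor n a p P + (rdot b p * cnj v + u * cnj (rdot b P))"
 by (simp add: first_order_def tensor_def)

lemma norm_tensor: "norm (tensor n a p P) <= 3 * (norm n * norm a) * (norm p * norm P)"
proof -
 have 1: "norm (cx (n \<bullet> a) * cip p P) <= (norm n * norm a) * (norm p * norm P)"
  unfolding norm_mult norm_of_real by (intro mult_mono Cauchy_Schwarz_ineq2 norm_cip) auto
 have 2: "norm (rdot v p * cnj (rdot w P)) <= (norm v * norm p) * (norm w * norm P)" for v w
  unfolding norm_mult complex_mod_cnj by (intro mult_mono norm_rdot) auto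
 show ?thesis
  using norm_triangle_ineq4[of "cx (n \<bullet> a) * cip p P - rdot a p * cnj (rdot n P)" "rdot n p * cnj (rdot a P)"]
   norm_triangle_ineq4[of "cx (n \<bullet> a) * cip p P" "rdot a p * cnj (rdot n P)"] 1 2[of a n] 2[of n a]
  unfolding tensor_def by (simp add: mult_ac)
qed

lemma tensor_scale: "tensor (c *\<^sub>R n) a p P = cx c * tensor n a p P"
 by (simp add: tensor_def rdot_def algebra_simps)

text \<open>Replaces \<open>p\<close> and \<open>P\<close> by \<open>p0\<close> and
  \<open>P0\<close> one after the other. The scalar goes with the differences, where it later is the
  bump that turns them into \<open>Y\<close>.\<close>

lemma tensor_telescope: "cx c * tensor n a p P = cx c * tensor n a p0 P0
  + (tensor n a (cx c *s (p - p0)) P + tensor n a p0 (cx c *s (P - P0)))"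
 by (simp add: tensor_def rdot_def cip_eq algebra_simps)

lemma le_add_of_square_le:
 fixes y a b :: real
 assumes "y^2 <= y * a + b^2" "a >= 0" "b >= 0"
 shows "y <= a + b"
proof (rule ccontr)
 assume "\<not> y <= a + b"
 then have y: "y > a + b" by simp
 have "y * a + b^2 <= y * a + y * b" using y assms by (simp add: power2_eq_square mult_right_mono)
 also have "... = y * (a + b)" by (simp add: algebra_simps)
 also have "... < y * y" using y assms by (intro mult_strict_left_mono) auto
 finally show False using assms(1) by (simp add: power2_eq_square)
qed

context bounded_domain
begin

text \<open>The area of the ball is bounded by that of the square of side 2e around it.\<close>

lemma ball_indicator:
 assumes "e > 0"
 shows "L2 M (indicator (cball 0 e) :: real^2 => real)" "l2 M (indicator (cball 0 e) :: real^2 => real) <= 2 * e"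
proof -
 let ?I = "indicator (cball 0 e) :: real^2 => real"
 let ?Q = "cbox (vector [-e, -e]) (vector [e, e]) :: (real^2) set"
 have sub: "cball 0 e \<subseteq> ?Q"
 proof
  fix x :: "real^2" assume "x \<in> cball 0 e"
  then have "\<bar>x$1\<bar> <= e" "\<bar>x$2\<bar> <= e" using component_le_norm_cart[of x 1] component_le_norm_cart[of x 2] by auto
  then show "x \<in> ?Q" by (auto simp: mem_box_cart forall_2)
 qed
 have m: "meas ?I" by (rule borel_M, rule borel_measurable_indicator) simp
 have "(\<integral>\<^sup>+x. ennreal ((norm (?I x))^2) \<partial>M) <= (\<integral>\<^sup>+x. indicator (cball (0 :: real^2) e) x \<partial>lebesgue)"
  by (subst nn_integral_restrict_space, simp add: domain_sets, rule nn_integral_mono) (simp split: split_indicator)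
 also have "... = emeasure lborel (cball (0 :: real^2) e)" by simp
 also have "... <= emeasure lborel ?Q" by (rule emeasure_mono[OF sub]) simp
 also have "... = ennreal ((2 * e)^2)" using assms by (simp add: emeasure_box2(1) power2_eq_square)
 finally have b: "(\<integral>\<^sup>+x. ennreal ((norm (?I x))^2) \<partial>M) <= ennreal ((2 * e)^2)" .
 show L: "L2 M ?I" by (rule L2I_nn_integral[OF m]) (use b in \<open>auto intro: le_less_trans\<close>)
 show "l2 M ?I <= 2 * e" by (rule l2_le_nn_integral[OF L b]) (use assms in simp)
qed

lemma ball_bound:
 fixes F :: "real^2 => 'b :: {banach, second_countable_topology}"
 assumes "e > 0" "meas F" "D >= 0"
  and "!!x. x ~= 0 ==> norm x <= e ==> norm (F x) <= D" "!!x. norm x > e ==> F x = 0"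
 shows "L2 M F" "l2 M F <= D * (2 * e)" "integrable M F" "norm (LINT x|M. F x) <= D * (4 * e^2)"
proof -
 note I = ball_indicator[OF assms(1)]
 have b: "norm (F x) <= D * norm (indicator (cball 0 e) x :: real)" if "x ~= 0" for x
  using assms(4)[OF that] assms(5)[of x] by (cases "norm x <= e") (auto simp: indicator_def)
 have 1: "AE x in M. norm (F x) <= D * norm (indicator (cball 0 e) x :: real)"
  using AE_M_neq[of 0] by eventually_elim (rule b)
 have 2: "AE x in M. norm (F x) <= D * (norm (indicator (cball 0 e) x :: real) * norm (indicator (cball 0 e) x :: real))"
  using 1 by eventually_elim (auto simp: indicator_def)
 show "L2 M F" by (rule L2_dominated(1)[OF I(1) assms(2) 1 assms(3)])
 show "l2 M F <= D * (2 * e)"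
  by (rule order_trans[OF L2_dominated(2)[OF I(1) assms(2) 1 assms(3)] mult_left_mono[OF I(2) assms(3)]])
 show "integrable M F" by (rule L2_bound(1)[OF I(1) I(1) assms(2) 2 assms(3)])
 have "l2 M (indicator (cball 0 e) :: real^2 => real) * l2 M (indicator (cball 0 e) :: real^2 => real) <= (2 * e) * (2 * e)"
  using assms(1) by (intro mult_mono I) (auto simp: l2_nonneg)
 then show "norm (LINT x|M. F x) <= D * (4 * e^2)"
  using order_trans[OF L2_bound(2)[OF I(1) I(1) assms(2) 2 assms(3)] mult_left_mono[OF _ assms(3)]]
  by (simp add: power2_eq_square)
qed

lemma lead_grad_measurable: "lead_grad m w \<in> borel_measurable borel"
 by (rule borel_measurable_cvec2)
   (rule borel_measurable_continuous_countable_exceptions[of "{0}"], auto intro: smooth_on_continuous smooth_on_lead_grad)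

lemma smult_measurable:
 assumes [measurable]: "meas c" and "meas f"
 shows "meas (%x. c x *s (f x :: complex^2))"
proof (rule borel_measurable_cvec2)
 note [measurable] = component_measurable[OF assms(2)]
 show "meas (%x. (c x *s f x) $ j)" for j by simp
qed

text \<open>The leading gradient is orthogonal to \<open>(i\<nabla> + A)(h u)\<close> when \<open>h\<close> is supported away from the pole.\<close>

lemma lead_weak_limit:
 assumes H: "H_limit \<Omega> 0 u g" and h: "h \<in> test 0" "!!x. cnj (h x) = h x"
  and b: "e > 0" "!!x. norm x > e ==> h x = 0" "D >= 0" "E >= 0"
   "!!x. x ~= 0 ==> norm (h x *s lead_grad m w x) <= D" "!!x. x ~= 0 ==> norm (lead_grad m w x) * norm (classical_grad h x) <= E"
 defines "G \<equiv> %x. h x *s g x + u x *s classical_grad h x"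
 shows "integrable M (%x. cip (lead_grad m w x) (pgrad 0 (1/2 + of_int m) (%x. h x * u x) G x))"
  "(LINT x|M. cip (lead_grad m w x) (pgrad 0 (1/2 + of_int m) (%x. h x * u x) G x)) = 0"
proof -
 let ?al = "1/2 + real_of_int m"
 let ?F = "%x. h x *s lead_grad m w x"
 let ?K = "%x. cip (lead_grad m w x) (\<i> *s classical_grad h x)"
 have gz: "classical_grad h x = 0" if "norm x > e" for x
 proof -
  have "partial_deriv i h x = 0" for i
   using partial_deriv_cong[of "{x. e < norm x}" x h "%_. 0" i] that b(2) by (simp add: open_Collect_less continuous_on_norm_id partial_deriv_const)
  then show ?thesis by (simp add: classical_grad_def vec_eq_iff)
 qed
 have mh: "meas h" "meas (classical_grad h)" "meas (lead_grad m w)"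
  by (intro borel_M test_functions_borel[OF h(1)] classical_grad_borel[OF h(1)] lead_grad_measurable)+
 have LF: "L2 M ?F"
  by (rule ball_bound(1)[OF b(1) smult_measurable[OF mh(1) mh(3)] b(3)]) (use b in auto)
 have LK: "L2 M ?K"
 proof (rule ball_bound(1)[OF b(1) _ b(4)])
  show "meas ?K" by (intro cip_measurable mh smult_measurable) simp
  show "norm (?K x) <= E" if "x ~= 0" for x
   using order_trans[OF norm_cip[of "lead_grad m w x" "\<i> *s classical_grad h x"]] b(6)[OF that] by (simp add: norm_smult)
  show "?K x = 0" if "norm x > e" for x using gz[OF that] by (simp add: cip_eq)
 qed
 have eq: "cip (lead_grad m w x) (pgrad 0 ?al (%x. h x * v x) (%x. h x *s f x + v x *s classical_grad h x) x)
  = cip (?F x) (pgrad 0 ?al v f x) + ?K x * cnj (v x)" for v f x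
  by (simp add: cip_eq pgrad_def complex_vec_def h(2) algebra_simps)
 have i: "integrable M (%x. cip (?F x) (pgrad 0 ?al v f x))" "integrable M (%x. ?K x * cnj (v x))" if "H_limit \<Omega> 0 v f" for v f
  using L2_bilinear[OF bounded_bilinear_cip LF H_limit_L2(5)[OF that]] L2_bilinear[OF bounded_bilinear_mult_cnj LK H_limit_L2(3)[OF that]] by auto
 show "integrable M (%x. cip (lead_grad m w x) (pgrad 0 ?al (%x. h x * u x) G x))"
  unfolding G_def eq by (intro b_integrable_add i[OF H])
 obtain p where p: "!!n. p n \<in> test 0"
  and lp: "(%n. tdist 0 (p n) (classical_grad (p n)) u g) ----> 0"
  using H_limitE[OF H] by blast
 note Hp = test_functions_H_limit[OF p]
 have lim: "(%n. (LINT x|M. cip (?F x) (pgrad 0 ?al (p n) (classical_grad (p n)) x)) + (LINT x|M. ?K x * cnj (p n x)))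
   ----> (LINT x|M. cip (?F x) (pgrad 0 ?al u g x)) + (LINT x|M. ?K x * cnj (u x))"
  by (intro tendsto_add L2_bilinear_tendsto[OF bounded_bilinear_cip] L2_bilinear_tendsto[OF bounded_bilinear_mult_cnj]
    LF LK H_limit_L2(5)[OF Hp] H_limit_L2(5)[OF H] H_limit_L2(3)[OF Hp] H_limit_L2(3)[OF H]
    triple_limit_components(1)[OF Hp H lp] triple_limit_components(2)[OF Hp H lp]) (simp_all add: l2_def)
 have z: "(LINT x|M. cip (?F x) (pgrad 0 ?al (p n) (classical_grad (p n)) x)) + (LINT x|M. ?K x * cnj (p n x)) = 0" for n
 proof -
  have t: "(%x. h x * p n x) \<in> test 0" by (rule test_functions_mult[OF p test_functions_smooth[OF h(1)]])
  have "(LINT x|M. cip (?F x) (pgrad 0 ?al (p n) (classical_grad (p n)) x)) + (LINT x|M. ?K x * cnj (p n x))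
   = (LINT x|M. cip (lead_grad m w x) (classical_magnetic_grad 0 ?al (%x. h x * p n x) x))"
  proof -
   have "classical_magnetic_grad 0 ?al (%x. h x * p n x) x
    = pgrad 0 ?al (%x. h x * p n x) (%x. h x *s classical_grad (p n) x + p n x *s classical_grad h x) x" for x
    by (simp only: pgrad_def classical_magnetic_grad_def
      classical_grad_mult[OF p smooth_on_subset[OF test_functions_smooth[OF h(1)] subset_UNIV]])
   then show ?thesis by (simp only: eq b_integral_add[OF i[OF Hp]])
  qed
  also have "... = (LINT x|lborel. cip (lead_grad m w x) (classical_magnetic_grad 0 ?al (%x. h x * p n x) x))"
  proof (rule integral_M)
   have [measurable]: "(%x. f x $ j) \<in> borel_measurable borel" if [measurable]: "f \<in> borel_measurable borel" for f :: "real^2 => complex^2" and j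
    by (rule measurable_compose[OF that]) (intro borel_measurable_continuous_onI continuous_intros)
   note [measurable] = lead_grad_measurable classical_magnetic_grad_borel[OF t]
   have [measurable]: "cnj \<in> borel_measurable borel" by (intro borel_measurable_continuous_onI continuous_intros)
   show "(%x. cip (lead_grad m w x) (classical_magnetic_grad 0 ?al (%x. h x * p n x) x)) \<in> borel_measurable borel"
    unfolding cip_eq by measurable
   show "cip (lead_grad m w x) (classical_magnetic_grad 0 ?al (%x. h x * p n x) x) = 0" if "x \<notin> \<Omega>" for x
   proof -
    have "h x * p n x = 0" "partial_deriv j (%x. h x * p n x) x = 0" for j
     using that test_functions_zero[OF t, of x] test_functions_zero[OF test_functions_partial[OF t], of x] by auto
    then have "classical_magnetic_grad 0 ?al (%x. h x * p n x) x $ j = 0" for j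
     unfolding classical_magnetic_grad_nth by simp
    then show ?thesis by (simp only: cip_eq) simp
   qed
  qed
  also have "... = 0" by (rule lead_weak[OF t])
  finally show ?thesis .
 qed
 show "(LINT x|M. cip (lead_grad m w x) (pgrad 0 ?al (%x. h x * u x) G x)) = 0"
  unfolding G_def eq b_integral_add[OF i[OF H]]
  using LIMSEQ_unique[OF lim] unfolding z by simp
qed

end

text \<open>The remainder is controlled for the functions only, not for their gradients.
  \<open>C0\<close> and \<open>W\<close> serve both indices, and \<open>\<delta>0 <= 1\<close>
  allows powers of the radius to be compared.\<close>

locale expanded = eigenpair + profile +
 fixes m :: int and w :: "bool => complex" and C0 \<delta>0 W :: real
 assumes al0_eq: "al0 = 1/2 + of_int m"
  and \<delta>0: "0 < \<delta>0" "\<delta>0 <= 1" "cball 0 \<delta>0 \<subseteq> \<Omega>"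
  and remainder: "!!i x. 0 < norm x ==> norm x < \<delta>0 ==> norm (fi i x - lead m (w i) x) <= C0 * norm x powr (3/2)"
  and C0: "C0 >= 0" and W: "W > 0" "!!i. norm (w i) <= W"
begin

abbreviation "p i \<equiv> pgrad 0 al0 (fi i) (k i)"
abbreviation "q i \<equiv> lead_grad m (w i)"

definition \<beta> :: "real => real^2 => real" where "\<beta> e x = B ((norm x)^2 / e^2)"
definition g\<beta> :: "real => real^2 => real^2" where "g\<beta> e x = (2 * B' ((norm x)^2 / e^2) / e^2) *\<^sub>R x"

lemma radius_smooth: "smooth_on UNIV (%x :: real^2. cx ((norm x)^2 / e^2))"
proof -
 have e: "(%x :: real^2. cx ((norm x)^2 / e^2))
   = (%x. cx (1 / e^2) * (cx (x$1) * cx (x$1) + cx (x$2) * cx (x$2)))"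
  by (simp add: norm_vec2) (simp add: power2_eq_square)
 show ?thesis unfolding e by (intro smooth_on_mult smooth_on_add smooth_on_coord smooth_on_const open_UNIV)
qed

lemma radius_derivative: "((%x :: real^2. (norm x)^2 / e^2) has_derivative (%h. 2 * (x \<bullet> h) / e^2)) (at x)"
 unfolding power2_norm_eq_inner divide_inverse
 by (auto intro!: derivative_eq_intros simp: inner_commute fun_eq_iff algebra_simps)

lemma \<beta>_derivative: "(\<beta> e has_derivative (%h. g\<beta> e x \<bullet> h)) (at x)"
 unfolding \<beta>_def[abs_def]
 by (rule has_derivative_eq_rhs[OF DERIV_compose_FDERIV[OF Bder radius_derivative]]) (simp add: g\<beta>_def fun_eq_iff)

lemma \<beta>_grad: "classical_grad (%x. cx (\<beta> e x)) x = complex_vec (g\<beta> e x)"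
 by (simp add: classical_grad_def complex_vec_def vec_eq_iff partial_deriv_of_real[OF \<beta>_derivative] inner_axis)

lemma \<beta>_smooth: "smooth_on UNIV (%x. cx (\<beta> e x))"
 unfolding \<beta>_def by (rule Bsm[OF radius_smooth])

lemma \<beta>_zero:
 assumes "e > 0" "norm x <= e / 2 \<or> e <= norm x"
 shows "\<beta> e x = 0" "g\<beta> e x = 0"
proof -
 have "(norm x)^2 / e^2 <= 1/4 \<or> 1 <= (norm x)^2 / e^2"
 proof (cases "norm x <= e / 2")
  case True
  then have "(norm x)^2 <= (e / 2)^2" by (intro power_mono) auto
  then show ?thesis using assms(1) by (simp add: divide_simps power2_eq_square)
 next
  case False
  then have "e^2 <= (norm x)^2" using assms by (intro power_mono) auto
  then show ?thesis using assms(1) by (simp add: divide_simps)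
 qed
 then show "\<beta> e x = 0" "g\<beta> e x = 0" by (simp_all add: \<beta>_def g\<beta>_def Bz)
qed

lemma \<beta>_bound: "0 <= \<beta> e x" "\<beta> e x <= bm" by (simp_all add: \<beta>_def Bb)

lemma g\<beta>_bound:
 assumes "e > 0" shows "norm (g\<beta> e x) <= 2 * bm / e"
proof (cases "norm x <= e")
 case True
 have "norm (g\<beta> e x) <= (2 * bm / e^2) * e"
  unfolding g\<beta>_def norm_scaleR using Bb(4)[of "(norm x)^2 / e^2"] True
  by (intro mult_mono) (auto simp: abs_mult divide_right_mono)
 then show ?thesis using assms by (simp add: power2_eq_square)
next
 case False
 then show ?thesis using \<beta>_zero(2)[OF assms, of x] assms Bb(1) by simp
qed

lemma \<beta>_test:
 assumes "0 < e" "e < \<delta>0"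
 shows "(%x. cx (\<beta> e x)) \<in> test 0"
proof (rule test_functionsI[OF \<beta>_smooth])
 show "compact (cball 0 e - ball 0 (e / 2) :: (real^2) set)" by (intro compact_diff) auto
 show "cball 0 e - ball 0 (e / 2) \<subseteq> \<Omega> - {0}" using assms \<delta>0(3) by force
 show "cx (\<beta> e x) = 0" if "x \<notin> cball 0 e - ball 0 (e / 2)" for x
  using that assms \<beta>_zero(1)[OF assms(1), of x] by auto
qed

lemma near_pole:
 assumes "0 < e" "e < \<delta>0" "x ~= 0" "norm x <= e"
 shows "norm (fi i x - lead m (w i) x) <= C0 * (e * sqrt e)" "norm (fi i x) <= (W + C0) * sqrt e"
proof -
 have s: "norm x powr (1/2) <= sqrt e" using assms by (simp add: powr_half_sqrt)
 have "norm x powr (3/2) = norm x * norm x powr (1/2)" using assms(3) powr_add[of "norm x" 1 "1/2"] by simp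
 also have "... <= e * sqrt e" by (intro mult_mono assms s) (use assms in auto)
 finally have "C0 * norm x powr (3/2) <= C0 * (e * sqrt e)" by (rule mult_left_mono[OF _ C0])
 then show r: "norm (fi i x - lead m (w i) x) <= C0 * (e * sqrt e)" using remainder[of x i] assms by simp
 have "norm (lead m (w i) x) <= norm (w i) * norm x powr (1/2)"
  using norm_triangle_ineq[of "w i * mode (1/2) (m + 1) x" "cnj (w i) * mode (1/2) m x"]
  by (simp add: lead_def norm_mult norm_mode norm_divide)
 also have "... <= W * sqrt e" by (intro mult_mono W s) (use W in auto)
 finally have "norm (lead m (w i) x) <= W * sqrt e" .
 moreover have "C0 * (e * sqrt e) <= C0 * (1 * sqrt e)"
  using assms \<delta>0 C0 by (intro mult_left_mono mult_right_mono) auto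
 ultimately show "norm (fi i x) <= (W + C0) * sqrt e"
  using r norm_triangle_sub[of "fi i x" "lead m (w i) x"] by (simp add: distrib_right)
qed

lemma q_bound:
 assumes "0 < e" "e / 2 <= norm x"
 shows "norm (q i x) <= 2 * W / sqrt e"
proof -
 have "norm x powr (-1/2) = 1 / sqrt (norm x)" by (simp add: powr_minus_divide powr_half_sqrt flip: minus_divide_left)
 also have "... <= 2 / sqrt e"
 proof -
  have "sqrt e <= sqrt (4 * norm x)" using assms by (intro real_sqrt_le_mono) auto
  then have "sqrt e <= 2 * sqrt (norm x)" by (simp add: real_sqrt_mult)
  moreover have "norm x > 0" using assms by auto
  ultimately show ?thesis using assms(1) by (simp add: divide_simps)
 qed
 finally have "norm (w i) * norm x powr (-1/2) <= W * (2 / sqrt e)" by (intro mult_mono W) (use W in auto)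
 then show ?thesis using norm_lead_grad[of m "w i" x] by (simp add: mult.commute)
qed

lemma \<beta>_measurable: "meas (%x. cx (\<beta> e x))" "meas (%x. complex_vec (g\<beta> e x))"
 "meas (q i)"
proof -
 have "continuous_on UNIV (%x. complex_vec (g\<beta> e x))"
  unfolding \<beta>_grad[symmetric] classical_grad_def
  by (intro continuous_on_vec_lambda smooth_on_continuous smooth_on_partial \<beta>_smooth)
 then show "meas (%x. complex_vec (g\<beta> e x))" by (intro borel_M borel_measurable_continuous_onI)
 show "meas (%x. cx (\<beta> e x))"
  by (intro borel_M borel_measurable_continuous_onI smooth_on_continuous \<beta>_smooth)
 show "meas (q i)" by (rule borel_M[OF lead_grad_measurable])
qed

definition Y :: "real => bool => real^2 => complex^2" where
 "Y e i x = cx (\<beta> e x) *s (p i x - q i x)"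

lemma \<beta>q_bound:
 assumes "0 < e" shows "norm (cx (\<beta> e x) *s q i x) <= bm * (2 * W / sqrt e)"
proof (cases "e / 2 <= norm x")
 case True
 then show ?thesis unfolding norm_smult using \<beta>_bound[of e x] assms W(1)
  by (intro mult_mono q_bound) auto
next
 case False
 then show ?thesis using \<beta>_zero(1)[OF assms, of x] assms W(1) Bb(1) by simp
qed

lemma Y_L2:
 assumes e: "0 < e" shows "L2 M (Y e i)"
proof -
 have 1: "L2 M (%x. cx (\<beta> e x) *s p i x)"
 proof (rule L2_dominated(1)[OF H_limit_L2(5)[OF Hfi], where K = bm])
  show "meas (%x. cx (\<beta> e x) *s p i x)"
   by (rule smult_measurable[OF \<beta>_measurable(1) L2_measurable[OF H_limit_L2(5)[OF Hfi]]])
  show "AE x in M. norm (cx (\<beta> e x) *s p i x) <= bm * norm (p i x)"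
   by (rule AE_I2) (use \<beta>_bound in \<open>auto simp: norm_smult intro!: mult_right_mono\<close>)
 qed (use Bb in simp)
 have 2: "L2 M (%x. cx (\<beta> e x) *s q i x)"
 proof (rule ball_bound(1)[OF e smult_measurable[OF \<beta>_measurable(1) \<beta>_measurable(3)]])
  show "norm (cx (\<beta> e x) *s q i x) <= bm * (2 * W / sqrt e)" for x by (rule \<beta>q_bound[OF e])
  show "cx (\<beta> e x) *s q i x = 0" if "norm x > e" for x using \<beta>_zero(1)[OF e, of x] that by simp
 qed (use Bb W e in simp)
 have "Y e i = (%x. cx (\<beta> e x) *s p i x - cx (\<beta> e x) *s q i x)"
  by (simp add: Y_def fun_eq_iff vec_eq_iff algebra_simps)
 then show ?thesis using L2_diff(1)[OF 1 2] by simp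
qed

text \<open>Caccioppoli's inequality for \<open>fi - lead\<close>, which solves the eigenvalue equation up to the small term \<open>lam fi\<close>.\<close>

lemma caccioppoli:
 obtains C where "C > 0" "!!e i. 0 < e ==> e < \<delta>0 ==> l2 M (Y e i) <= C * (e * sqrt e)"
proof -
 define C1 where "C1 = 8 * C0 * bm"
 define C2 where "C2 = \<bar>lam\<bar> * (4 * ((W + C0) * (bm^2 * C0)))"
 have C12: "C1 >= 0" "C2 >= 0" using C0 W(1) Bb(1) by (simp_all add: C1_def C2_def)
 have "l2 M (Y e i) <= (C1 + sqrt C2 + 1) * (e * sqrt e)" if e: "0 < e" "e < \<delta>0" for e i
 proof -
  let ?h = "%x. cx (\<beta> e x)"
  let ?l = "lead m (w i)"
  have e1: "e <= 1" using e \<delta>0 by simp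
  have gh: "classical_grad ?h = (%x. complex_vec (g\<beta> e x))" using \<beta>_grad by blast
  \<comment> \<open>The test function will be the bump times \<open>u\<close>, that is the squared
    bump times the difference of eigenfunction and leading term, as usual for Caccioppoli's
    inequality.\<close>
  define u where "u x = ?h x * fi i x - ?l x * ?h x" for x
  define g where "g x = (?h x *s k i x + fi i x *s classical_grad ?h x) - (?l x *s classical_grad ?h x + ?h x *s classical_grad ?l x)" for x
  have Hu: "H_limit \<Omega> 0 u g"
  proof -
   note t = test_functions_mult_off[OF \<beta>_test[OF e] smooth_on_lead, of m "w i"]
   show ?thesis unfolding u_def[abs_def] g_def[abs_def]
    using H_limit_diff[OF H_limit_mult[OF Hfi[of i] \<beta>_smooth[of e]] test_functions_H_limit[OF t]]
    unfolding classical_grad_mult[OF \<beta>_test[OF e] smooth_on_lead] .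
  qed
  define G where "G x = ?h x *s g x + u x *s classical_grad ?h x" for x
  have Hv: "H_limit \<Omega> 0 (%x. ?h x * u x) G" unfolding G_def[abs_def] by (rule H_limit_mult[OF Hu \<beta>_smooth])
  define P where "P = pgrad 0 al0 (%x. ?h x * u x) G"
  \<comment> \<open>The term in which the derivative falls on the bump; the factor 2 comes from the
    square of the bump.\<close>
  define N where "N x = (2 * \<i> * (fi i x - ?l x)) *s complex_vec (g\<beta> e x)" for x
  have Pe: "P x = ?h x *s (Y e i x + N x)" if x: "x ~= 0" for x
  proof -
   have "q i x = pgrad 0 al0 ?l (classical_grad ?l) x"
    using magnetic_lead[OF x, of m "w i"] by (simp add: al0_eq classical_magnetic_grad_def pgrad_def)
   then show ?thesis
    by (simp add: P_def Y_def N_def G_def u_def g_def gh pgrad_def vec_eq_iff algebra_simps)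
  qed
  have lw: "integrable M (%x. cip (q i x) (P x))" "(LINT x|M. cip (q i x) (P x)) = 0"
  proof -
   have z: "?h x = 0" if "norm x > e" for x using \<beta>_zero(1)[OF e(1), of x] that by simp
   have E: "norm (q i x) * norm (classical_grad ?h x) <= (2 * W / sqrt e) * (2 * bm / e)" for x
   proof (cases "e / 2 <= norm x")
    case True
    then show ?thesis unfolding gh norm_complex_vec using e W(1)
     by (intro mult_mono q_bound g\<beta>_bound) auto
   next
    case False
    then show ?thesis using \<beta>_zero(2)[OF e(1), of x] e W(1) Bb(1) by (simp add: gh complex_vec_def norm_vec_def L2_set_def)
   qed
   have D: "0 <= bm * (2 * W / sqrt e)" "0 <= (2 * W / sqrt e) * (2 * bm / e)" using e W(1) Bb(1) by auto
   note * = lead_weak_limit[OF Hu \<beta>_test[OF e] _ e(1) z D \<beta>q_bound[OF e(1)] E]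
   show "integrable M (%x. cip (q i x) (P x))" "(LINT x|M. cip (q i x) (P x)) = 0"
    using * unfolding P_def G_def[abs_def] al0_eq by simp_all
  qed
  have mN: "meas N"
  proof -
   have [measurable]: "meas ?l"
    by (intro borel_M borel_measurable_continuous_countable_exceptions[of "{0}"]) (auto intro: smooth_on_continuous smooth_on_lead)
   note [measurable] = H_limit_measurable(1)[OF Hfi[of i]]
   show ?thesis unfolding N_def[abs_def] by (rule smult_measurable[OF _ \<beta>_measurable(2)]) measurable
  qed
  have bN: "norm (N x) <= 4 * C0 * bm * sqrt e" if "x ~= 0" "norm x <= e" for x
  proof -
   have "norm (N x) = 2 * (norm (fi i x - ?l x) * norm (g\<beta> e x))" by (simp add: N_def norm_smult norm_mult norm_complex_vec)
   also have "... <= 2 * ((C0 * (e * sqrt e)) * (2 * bm / e))"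
    using e C0 by (intro mult_left_mono mult_mono near_pole(1) g\<beta>_bound that) auto
   finally show ?thesis using e by (simp add: field_simps)
  qed
  have zN: "N x = 0" if "norm x > e" for x using \<beta>_zero(2)[OF e(1), of x] that by (simp add: N_def complex_vec_def vec_eq_iff)
  have D: "0 <= 4 * C0 * bm * sqrt e" using C0 Bb e by simp
  note LN = ball_bound(1,2)[OF e(1) mN D bN zN]
  have lN: "l2 M N <= C1 * (e * sqrt e)" using LN(2) by (simp add: C1_def mult_ac)
  have iP: "integrable M (%x. cip (p i x) (P x))" "(LINT x|M. cip (p i x) (P x)) = lam * ip (fi i) (%x. ?h x * u x)"
   using mform_integrable[OF Hfi Hv] eig[OF Hv] unfolding P_def mform_def by auto
  \<comment> \<open>One factor of the bump passes from \<open>P\<close> to the difference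
    \<open>p i x - q i x\<close> and makes it \<open>Y\<close>. The leading gradient is orthogonal
    to \<open>P\<close>, so the left-hand side integrates to the eigenvalue term alone.\<close>
  have "AE x in M. cip (p i x) (P x) - cip (q i x) (P x) = cip (Y e i x) (Y e i x) + cip (Y e i x) (N x)"
   using AE_M_neq[of 0] by eventually_elim (simp add: Pe cip_eq Y_def algebra_simps)
  then have AEi: "(LINT x|M. cip (p i x) (P x) - cip (q i x) (P x)) = (LINT x|M. cip (Y e i x) (Y e i x) + cip (Y e i x) (N x))"
   by (rule integral_cong_AE[rotated 2])
     (intro borel_measurable_diff borel_measurable_add cip_measurable mN L2_measurable[OF Y_L2[OF e(1)]]
      borel_measurable_integrable[OF iP(1)] borel_measurable_integrable[OF lw(1)])+
  then have id: "lam * ip (fi i) (%x. ?h x * u x) = cx ((l2 M (Y e i))^2) + (LINT x|M. cip (Y e i x) (N x))"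
  proof -
   have "(LINT x|M. cip (Y e i x) (Y e i x)) = cx ((l2 M (Y e i))^2)"
    unfolding cip_self l2_power2 by (rule integral_complex_of_real)
   moreover note b_integral_add[OF L2_bilinear[OF bounded_bilinear_cip Y_L2[OF e(1)] Y_L2[OF e(1)]]
     L2_bilinear[OF bounded_bilinear_cip Y_L2[OF e(1)] LN(1)], of i i i]
   moreover have "(LINT x|M. cip (p i x) (P x) - cip (q i x) (P x)) = lam * ip (fi i) (%x. ?h x * u x)"
    unfolding b_integral_diff[OF iP(1) lw(1)] lw(2) iP(2) by simp
   ultimately show ?thesis using AEi by (simp del: of_real_power)
  qed
  have c1: "norm (LINT x|M. cip (Y e i x) (N x)) <= l2 M (Y e i) * (C1 * (e * sqrt e))"
  proof -
   have "norm (LINT x|M. cip (Y e i x) (N x)) <= 1 * (l2 M (Y e i) * l2 M N)"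
    by (rule L2_bound(2)[OF Y_L2[OF e(1)] LN(1)])
      (use norm_cip in \<open>auto intro!: cip_measurable mN L2_measurable[OF Y_L2[OF e(1)]]\<close>)
   then show ?thesis using mult_left_mono[OF lN l2_nonneg[of M "Y e i"]] by simp
  qed
  have c2: "norm (cx lam * ip (fi i) (%x. ?h x * u x)) <= C2 * e ^ 3"
  proof -
   let ?F = "%x. fi i x * cnj (?h x * u x)"
   have m: "meas ?F"
    using L2_inner_integrable[OF H_limit_L2(3)[OF Hfi[of i]] H_limit_L2(3)[OF Hv]] by (rule borel_measurable_integrable)
   have b: "norm (?F x) <= ((W + C0) * (bm^2 * C0)) * e^2" if x: "x ~= 0" "norm x <= e" for x
   proof -
    have "norm (?F x) = norm (fi i x) * (\<beta> e x * (\<beta> e x * norm (fi i x - ?l x)))"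
    proof -
     have "u x = ?h x * (fi i x - ?l x)" by (simp add: u_def algebra_simps)
     then show ?thesis using \<beta>_bound(1)[of e x] by (simp only: norm_mult complex_mod_cnj norm_of_real abs_of_nonneg)
    qed
    also have "... <= ((W + C0) * sqrt e) * (bm * (bm * (C0 * (e * sqrt e))))"
     using \<beta>_bound[of e x] Bb(1) W(1) C0 e by (intro mult_mono near_pole x e) auto
    also have "... = ((W + C0) * (bm^2 * C0)) * (e * (sqrt e * sqrt e))" by (simp add: power2_eq_square mult_ac)
    finally show ?thesis using e by (simp add: power2_eq_square)
   qed
   have z: "?F x = 0" if "norm x > e" for x using \<beta>_zero(1)[OF e(1), of x] that by simp
   have D: "0 <= ((W + C0) * (bm^2 * C0)) * e^2" using W(1) C0 by simp
   have "norm (ip (fi i) (%x. ?h x * u x)) <= ((W + C0) * (bm^2 * C0)) * e^2 * (4 * e^2)"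
    unfolding L2_inner_def by (rule ball_bound(4)[OF e(1) m D b z])
   then have "norm (cx lam * ip (fi i) (%x. ?h x * u x)) <= \<bar>lam\<bar> * (((W + C0) * (bm^2 * C0)) * e^2 * (4 * e^2))"
    unfolding norm_mult norm_of_real by (intro mult_left_mono) auto
   also have "... = C2 * e ^ 4" by (simp add: C2_def power2_eq_square power4_eq_xxxx)
   also have "... <= C2 * e ^ 3" using C12 e e1 by (intro mult_left_mono power_decreasing) auto
   finally show ?thesis .
  qed
  have e3: "(sqrt C2 * (e * sqrt e))^2 = C2 * e ^ 3" using C12 e by (simp add: power_mult_distrib) (simp add: power3_eq_cube power2_eq_square)
  have "norm (cx ((l2 M (Y e i))^2)) <= norm (cx lam * ip (fi i) (%x. ?h x * u x)) + norm (LINT x|M. cip (Y e i x) (N x))"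
   using norm_triangle_ineq4[of "cx lam * ip (fi i) (%x. ?h x * u x)" "LINT x|M. cip (Y e i x) (N x)"] unfolding id by simp
  then have "(l2 M (Y e i))^2 <= l2 M (Y e i) * (C1 * (e * sqrt e)) + (sqrt C2 * (e * sqrt e))^2"
   unfolding e3 using c1 c2 by (simp del: of_real_power)
  then have "l2 M (Y e i) <= C1 * (e * sqrt e) + sqrt C2 * (e * sqrt e)"
   by (rule le_add_of_square_le) (use C12 e in auto)
  also have "... <= (C1 + sqrt C2 + 1) * (e * sqrt e)" using e by (simp add: distrib_right)
  finally show ?thesis .
 qed
 moreover have "C1 + sqrt C2 + 1 > 0" using C12 by (simp add: add_nonneg_pos)
 ultimately show ?thesis using that by blast
qed

end

section \<open>Limits of the first variation for a shrinking cut-off\<close>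

context expanded
begin

text \<open>The gradient of the cut-off \<eta>(|x|^2 / e^2), because the derivative of
  \<open>\<eta>\<close> is minus \<open>B\<close>.\<close>

definition shift :: "real => real^2 => real^2" where
 "shift e x = (- 2 * \<beta> e x / e^2) *\<^sub>R x"

text \<open>The factor -2 / e^2 of \<open>shift\<close> times the constant -1/4 of
  \<open>lead_grad_tensor\<close> gives 1 / (2 e^2).\<close>

definition weight :: "real => real" where
 "weight e = (LINT x|M. \<beta> e x) / (2 * e^2)"

lemma shift_bound:
 assumes "e > 0" shows "norm (shift e x) <= 2 * bm / e"
proof (cases "norm x <= e")
 case True
 have "norm (shift e x) <= (2 * bm / e^2) * e"
  unfolding shift_def norm_scaleR using \<beta>_bound[of e x] True
  by (intro mult_mono) (auto simp: abs_mult divide_right_mono)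
 then show ?thesis using assms by (simp add: power2_eq_square)
next
 case False
 then show ?thesis using \<beta>_zero(1)[OF assms, of x] assms Bb(1) by (simp add: shift_def)
qed

lemma tensor_measurable:
 assumes "!!j. meas (%x. n x $ j)" "meas p'" "meas q'"
 shows "meas (%x. tensor (n x) a (p' x) (q' x))"
proof -
 have "meas (%x. first_order (n x) a 0 (p' x) (q' x) 0 0)"
  by (rule first_order_measurable) (use assms in simp_all)
 then show ?thesis by (simp add: first_order_tensor)
qed

lemma coord_measurable: "meas (%x. x $ j)"
 by (rule borel_M[OF coord_borel])

text \<open>On the shell carrying the gradient of the cut-off, \<open>shift\<close> has size 1/e,
  the leading gradients have size 1 / sqrt e, and \<open>Y\<close> has L2 norm of order e sqrt e.
  Exchanging the true gradients for the leading ones thus costs at most sqrt e times |a|, while the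
  coefficient \<open>weight e\<close> of the leading part stays away from 0.\<close>

lemma tensor_limit:
 obtains C where "C > 0"
  "!!e a i j. 0 < e ==> e < \<delta>0 ==> norm ((LINT x|M. tensor (shift e x) a (p i x) (p j x))
    - cx (weight e * Re (Complex (a$1) (a$2) * w i * w j))) <= C * sqrt e * norm a"
proof -
 obtain CY where CY: "CY > 0" "!!e i. 0 < e ==> e < \<delta>0 ==> l2 M (Y e i) <= CY * (e * sqrt e)"
  using caccioppoli by blast
 define P where "P = l2 M (p False) + l2 M (p True)"
 have P: "l2 M (p i) <= P" "P >= 0" for i by (cases i) (simp_all add: P_def l2_nonneg)
 define C where "C = 6 * CY * P + 24 * W * CY"
 have C: "C > 0" using CY(1) P(2) W(1) by (simp add: C_def add_nonneg_pos)
 have "norm ((LINT x|M. tensor (shift e x) a (p i x) (p j x))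
    - cx (weight e * Re (Complex (a$1) (a$2) * w i * w j))) <= C * sqrt e * norm a"
  if e: "0 < e" "e < \<delta>0" for e a i j
 proof -
  have e1: "e <= sqrt e"
  proof -
   have "sqrt e * sqrt e <= sqrt e * 1" using e \<delta>0 by (intro mult_left_mono) auto
   then show ?thesis using e by simp
  qed
  define R where "R = Re (Complex (a$1) (a$2) * w i * w j)"
  let ?T1 = "%x. tensor x a (Y e i x) (p j x)" and ?T2 = "%x. tensor x a (q i x) (Y e j x)"
  note mY = L2_measurable[OF Y_L2[OF e(1)]] and mp = L2_measurable[OF H_limit_L2(5)[OF Hfi]]
  have Yz: "Y e i x = 0" if "norm x <= e / 2 \<or> e <= norm x" for i x using \<beta>_zero(1)[OF e(1) that] by (simp add: Y_def)
  have b1: "norm (?T1 x) <= (3 * (e * norm a)) * (norm (Y e i x) * norm (p j x))" for x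
  proof (cases "norm x <= e")
   case True
   then have "3 * (norm x * norm a) * (norm (Y e i x) * norm (p j x)) <= 3 * (e * norm a) * (norm (Y e i x) * norm (p j x))"
    by (intro mult_right_mono mult_left_mono) auto
   then show ?thesis using norm_tensor[of x a "Y e i x" "p j x"] by linarith
  next
   case False
   then have "Y e i x = 0" by (intro Yz) simp
   then show ?thesis using norm_tensor[of x a "Y e i x" "p j x"] e by simp
  qed
  have b2: "norm (?T2 x) <= (3 * (e * norm a) * (2 * W / sqrt e)) * (norm (indicator (cball 0 e) x :: real) * norm (Y e j x))" for x
  proof (cases "norm x <= e \<and> e / 2 <= norm x")
   case True
   then have "3 * (norm x * norm a) * (norm (q i x) * norm (Y e j x)) <= 3 * (e * norm a) * ((2 * W / sqrt e) * norm (Y e j x))"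
    using e W(1) by (intro mult_mono q_bound) auto
   then show ?thesis using norm_tensor[of x a "q i x" "Y e j x"] True by (simp add: mult.assoc)
  next
   case False
   then have "Y e j x = 0" by (intro Yz) linarith
   then show ?thesis using norm_tensor[of x a "q i x" "Y e j x"] by simp
  qed
  note I = ball_indicator[OF e(1)]
  have c0: "0 <= 3 * (e * norm a)" "0 <= 3 * (e * norm a) * (2 * W / sqrt e)" using e W(1) by auto
  note T1 = L2_bound[OF Y_L2[OF e(1)] H_limit_L2(5)[OF Hfi] tensor_measurable[OF coord_measurable mY mp] AE_I2[OF b1] c0(1)]
  note T2 = L2_bound[OF I(1) Y_L2[OF e(1)] tensor_measurable[OF coord_measurable \<beta>_measurable(3) mY] AE_I2[OF b2] c0(2)]
  have n1: "norm (LINT x|M. ?T1 x) <= 3 * (e * norm a) * ((CY * (e * sqrt e)) * P)"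
   by (rule order_trans[OF T1(2)], intro mult_left_mono[OF mult_mono] CY e P c0) (use CY e l2_nonneg in auto)
  have n2: "norm (LINT x|M. ?T2 x) <= 3 * (e * norm a) * (2 * W / sqrt e) * ((2 * e) * (CY * (e * sqrt e)))"
   by (rule order_trans[OF T2(2)], intro mult_left_mono[OF mult_mono] CY e I c0) (use CY e l2_nonneg in auto)
  have ib: "integrable M (%x. cx (\<beta> e x))"
  proof (rule ball_bound(3)[OF e(1) \<beta>_measurable(1), where D = bm])
   show "cx (\<beta> e x) = 0" if "norm x > e" for x using \<beta>_zero(1)[OF e(1), of x] that by simp
  qed (use Bb(1) \<beta>_bound in auto)
  let ?c = "cx (- 2 / e^2)"
  have pw: "tensor (shift e x) a (p i x) (p j x)
   = cx (R / (2 * e^2)) * cx (\<beta> e x) + ?c * (?T1 x + ?T2 x)" if x: "x ~= 0" for x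
  proof -
   have "tensor (shift e x) a (p i x) (p j x) = ?c * (cx (\<beta> e x) * tensor x a (p i x) (p j x))"
    unfolding shift_def tensor_scale by (simp add: mult.assoc)
   also have "cx (\<beta> e x) * tensor x a (p i x) (p j x) = cx (\<beta> e x) * cx (- R / 4) + (?T1 x + ?T2 x)"
    unfolding tensor_telescope[of "\<beta> e x" x a "p i x" "p j x" "q i x" "q j x"] Y_def[symmetric]
    using lead_grad_tensor[OF x, of a m "w i" "w j"] by (simp add: tensor_def R_def)
   also have "?c * (cx (\<beta> e x) * cx (- R / 4) + (?T1 x + ?T2 x))
    = cx (R / (2 * e^2)) * cx (\<beta> e x) + ?c * (?T1 x + ?T2 x)"
   proof -
    have c: "?c * cx (- R / 4) = cx (R / (2 * e^2))" unfolding of_real_mult[symmetric] by simp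
    show ?thesis unfolding c[symmetric] by (simp only: distrib_left mult_ac)
   qed
   finally show ?thesis .
  qed
  have "(LINT x|M. tensor (shift e x) a (p i x) (p j x))
   = (LINT x|M. cx (R / (2 * e^2)) * cx (\<beta> e x) + ?c * (?T1 x + ?T2 x))"
  proof (rule integral_cong_AE)
   show "AE x in M. tensor (shift e x) a (p i x) (p j x) = cx (R / (2 * e^2)) * cx (\<beta> e x) + ?c * (?T1 x + ?T2 x)"
    using AE_M_neq[of 0] by eventually_elim (rule pw)
   have [measurable]: "meas (%x. \<beta> e x)"
    using measurable_compose[OF \<beta>_measurable(1) borel_measurable_Re] by simp
   show "meas (%x. tensor (shift e x) a (p i x) (p j x))"
   proof (rule tensor_measurable[OF _ mp mp])
    note [measurable] = coord_measurable
    show "meas (%x. shift e x $ j)" for j unfolding shift_def by simp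
   qed
   show "meas (%x. cx (R / (2 * e^2)) * cx (\<beta> e x) + ?c * (?T1 x + ?T2 x))"
    by (intro borel_measurable_add borel_measurable_times borel_measurable_const \<beta>_measurable(1)
      borel_measurable_integrable[OF T1(1)] borel_measurable_integrable[OF T2(1)])
  qed
  also have "... = (LINT x|M. cx (R / (2 * e^2)) * cx (\<beta> e x)) + (LINT x|M. ?c * (?T1 x + ?T2 x))"
   by (rule b_integral_add[OF integrable_mult_right[OF ib] integrable_mult_right[OF b_integrable_add[OF T1(1) T2(1)]]])
  also have "(LINT x|M. cx (R / (2 * e^2)) * cx (\<beta> e x)) = cx (weight e * R)"
   unfolding integral_mult_right_zero integral_complex_of_real weight_def by (simp add: field_simps)
  also have "(LINT x|M. ?c * (?T1 x + ?T2 x)) = ?c * ((LINT x|M. ?T1 x) + (LINT x|M. ?T2 x))"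
   unfolding integral_mult_right_zero b_integral_add[OF T1(1) T2(1)] ..
  finally have "(LINT x|M. tensor (shift e x) a (p i x) (p j x)) - cx (weight e * R)
    = ?c * ((LINT x|M. ?T1 x) + (LINT x|M. ?T2 x))" by simp
  then have "norm ((LINT x|M. tensor (shift e x) a (p i x) (p j x)) - cx (weight e * R))
   = 2 / e^2 * norm ((LINT x|M. ?T1 x) + (LINT x|M. ?T2 x))"
   by (simp only: norm_mult norm_of_real) simp
  also have "... <= 2 / e^2 * (norm (LINT x|M. ?T1 x) + norm (LINT x|M. ?T2 x))"
   by (intro mult_left_mono norm_triangle_ineq) simp
  also have "... <= 2 / e^2 * (3 * (e * norm a) * ((CY * (e * sqrt e)) * P)
    + 3 * (e * norm a) * (2 * W / sqrt e) * ((2 * e) * (CY * (e * sqrt e))))"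
   using n1 n2 by (intro mult_left_mono add_mono) auto
  also have "... = 6 * CY * P * sqrt e * norm a + 24 * W * CY * norm a * e"
   using e by (simp add: field_simps power2_eq_square)
  also have "... <= 6 * CY * P * sqrt e * norm a + 24 * W * CY * norm a * sqrt e"
   using e1 W(1) CY(1) by (intro add_left_mono mult_left_mono) auto
  also have "... = C * sqrt e * norm a" by (simp add: C_def algebra_simps)
  finally show ?thesis unfolding R_def .
 qed
 with C that show ?thesis by blast
qed

lemma mass_limit:
 obtains C where "C > 0"
  "!!e a i j. 0 < e ==> e < \<delta>0 ==>
   norm (LINT x|M. cx (shift e x \<bullet> a) * (fi i x * cnj (fi j x))) <= C * sqrt e * norm a"
proof -
 define C where "C = 8 * bm * (W + C0)^2"
 have C: "C > 0" using Bb(1) W(1) C0 by (simp add: C_def add_pos_nonneg)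
 have "norm (LINT x|M. cx (shift e x \<bullet> a) * (fi i x * cnj (fi j x))) <= C * sqrt e * norm a"
  if e: "0 < e" "e < \<delta>0" for e a i j
 proof -
  let ?F = "%x. cx (shift e x \<bullet> a) * (fi i x * cnj (fi j x))"
  let ?D = "(2 * bm / e * norm a) * (((W + C0) * sqrt e) * ((W + C0) * sqrt e))"
  have "norm (LINT x|M. ?F x) <= ?D * (4 * e^2)"
  proof (rule ball_bound(4)[OF e(1)])
   have [measurable]: "meas (%x. \<beta> e x)"
    using measurable_compose[OF \<beta>_measurable(1) borel_measurable_Re] by simp
   note [measurable] = coord_measurable H_limit_measurable(1)[OF Hfi] cnj_measurable[OF H_limit_measurable(1)[OF Hfi]]
   show "meas ?F" unfolding shift_def inner2 by simp
   show "?D >= 0" using e Bb(1) W(1) C0 by simp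
   show "norm (?F x) <= ?D" if "x ~= 0" "norm x <= e" for x
   proof -
    have "\<bar>shift e x \<bullet> a\<bar> <= 2 * bm / e * norm a"
     using order_trans[OF Cauchy_Schwarz_ineq2 mult_right_mono[OF shift_bound[OF e(1)]]] by simp
    then show ?thesis unfolding norm_mult norm_of_real complex_mod_cnj
     using Bb(1) W(1) C0 e by (intro mult_mono near_pole(2) e that) auto
   qed
   show "?F x = 0" if "norm x > e" for x using \<beta>_zero(1)[OF e(1), of x] that by (simp add: shift_def)
  qed
  also have "... = C * (e * e) * norm a" using e by (simp add: C_def power2_eq_square)
  also have "... <= C * sqrt e * norm a"
  proof -
   have "sqrt e <= 1" "e <= 1" using e \<delta>0 by auto
   then have "e * e <= e" "sqrt e * sqrt e <= sqrt e" using e by (simp_all only: mult_left_le less_imp_le real_sqrt_ge_zero)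
   then have "e * e <= sqrt e" using e real_sqrt_mult_self[of e] by linarith
   then show ?thesis using C by (intro mult_right_mono mult_left_mono) auto
  qed
  finally show ?thesis .
 qed
 with C that show ?thesis by blast
qed

text \<open>A rectangle inside the shell e^2/2 <= |x|^2 <= 3 e^2/4, where the bump is at least
  \<open>b0\<close>. Its sides are e/20 and e/10, its area is e^2 / 200, and division by 2 e^2 gives
  1 / 400.\<close>

lemma weight_bound:
 assumes e: "0 < e" "e < \<delta>0"
 shows "b0 / 400 <= weight e"
proof -
 let ?Q = "cbox (vector [3/4 * e, 0]) (vector [4/5 * e, e / 10]) :: (real^2) set"
 have Q: "b0 <= \<beta> e x \<and> x \<in> \<Omega>" if "x \<in> ?Q" for x
 proof -
  have x: "3/4 * e <= x$1" "x$1 <= 4/5 * e" "0 <= x$2" "x$2 <= e / 10" using that by (auto simp: mem_box_cart forall_2)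
  have "(3/4 * e)^2 <= (x$1)^2" "(x$1)^2 <= (4/5 * e)^2" "(x$2)^2 <= (e / 10)^2" using x e by (intro power_mono; simp)+
  then have n: "9/16 * e^2 <= (norm x)^2" "(norm x)^2 <= 65/100 * e^2"
   unfolding norm_vec2 by (simp_all add: power_mult_distrib power_divide add_increasing2)
  then have "1/2 <= (norm x)^2 / e^2" "(norm x)^2 / e^2 <= 3/4" using e by (simp_all add: divide_simps)
  then have "b0 <= \<beta> e x" unfolding \<beta>_def by (rule b0(2))
  moreover have "norm x <= e"
  proof (rule power2_le_imp_le)
   show "(norm x)^2 <= e^2" using n(2) zero_le_power2[of e] by linarith
  qed (use e in simp)
  ultimately show ?thesis using \<delta>0(3) e by auto
 qed
 have mQ: "?Q \<in> sets M" using Q by (subst sets_restrict_space_iff) (auto simp: domain_sets)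
 have eQ: "emeasure M ?Q = ennreal (e^2 / 200)"
 proof -
  have "emeasure M ?Q = emeasure lborel ?Q" using Q by (subst emeasure_restrict_space) (auto simp: domain_sets)
  then show ?thesis using e by (simp add: emeasure_box2(1) power2_eq_square field_simps)
 qed
 have iQ: "integrable M (%x. b0 * indicator ?Q x)" using mQ eQ by (intro integrable_mult_right integrable_real_indicator) auto
 have ib: "integrable M (\<beta> e)"
 proof (rule ball_bound(3)[OF e(1), where D = bm])
  show "meas (\<beta> e)" using measurable_compose[OF \<beta>_measurable(1) borel_measurable_Re] by simp
  show "\<beta> e x = 0" if "norm x > e" for x using \<beta>_zero(1)[OF e(1), of x] that by simp
 qed (use Bb(1) \<beta>_bound in auto)
 have "b0 * (e^2 / 200) = (LINT x|M. b0 * indicator ?Q x)"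
 proof -
  have "?Q \<inter> \<Omega> = ?Q" using Q by blast
  moreover have "measure M ?Q = e^2 / 200" unfolding measure_def eQ by simp
  ultimately show ?thesis using mQ by simp
 qed
 also have "... <= (LINT x|M. \<beta> e x)"
  by (rule integral_mono[OF iQ ib]) (use Q \<beta>_bound in \<open>auto simp: indicator_def\<close>)
 finally show ?thesis using e unfolding weight_def by (simp add: field_simps)
qed

end

section \<open>The contribution of the change of potential\<close>

context cutoff_eigenpair
begin

abbreviation "drift_term b i j \<equiv> %x. rdot (b x) (pgrad 0 al0 (fi i) (k i) x) * cnj (fi j x) + fi i x * cnj (rdot (b x) (pgrad 0 al0 (fi j) (k j) x))"

lemma fdiff_split:
 assumes n: "near al0 a al"
 shows "integrable M (drift_term (drift al0 a al) i j)"
  "fdiff a al i j = (LINT x|M. tensor (gz x) a (pgrad 0 al0 (fi i) (k i) x) (pgrad 0 al0 (fi j) (k j) x))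
   + (LINT x|M. drift_term (drift al0 a al) i j x) - lam * gmass a (fi i) (fi j)"
proof -
 have c: "0 <= rate al0 * dist_par al0 a al" using rate_ge(3)[of al0] by (simp add: dist_par_def)
 show D: "integrable M (drift_term (drift al0 a al) i j)"
  by (rule drift_pairing(1)[OF Hfi Hfi drift_measurable c]) (rule near_small(5)[OF n])
 have "integrable M (%x. first_order (gz x) a (drift al0 a al x) (pgrad 0 al0 (fi i) (k i) x) (pgrad 0 al0 (fi j) (k j) x) (fi i x) (fi j x)
   - drift_term (drift al0 a al) i j x)"
  by (rule b_integrable_diff[OF tform_expansion(3)[OF n Hfi Hfi] D])
 then have T: "integrable M (%x. tensor (gz x) a (pgrad 0 al0 (fi i) (k i) x) (pgrad 0 al0 (fi j) (k j) x))"
  by (simp add: first_order_tensor)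
 show "fdiff a al i j = (LINT x|M. tensor (gz x) a (pgrad 0 al0 (fi i) (k i) x) (pgrad 0 al0 (fi j) (k j) x))
   + (LINT x|M. drift_term (drift al0 a al) i j x) - lam * gmass a (fi i) (fi j)"
  unfolding fdiff_def fo_def first_order_tensor by (simp add: b_integral_add[OF T D])
qed

text \<open>The symmetry fixes the eigenfunctions and reverses the sign of their magnetic gradients.
  Since the drift is a real vector, each product of paired gradient and conjugated function is minus
  its own conjugate, so the integrand is purely imaginary almost everywhere.\<close>

lemma drift_real:
 assumes K: "!!i. AE x in M. spin n x * cnj (fi i x) = fi i x" and aln: "al0 = of_int n / 2" and near: "near al0 a al"
 shows "Re (LINT x|M. drift_term (drift al0 a al) i j x) = 0"
proof -
 have "AE x in M. Re (drift_term (drift al0 a al) i j x) = 0"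
  using K_real_pgrad[OF Hfi K, of i] K_real_pgrad[OF Hfi K, of j] K[of i] K[of j]
 proof eventually_elim
  case (elim x)
  let ?p = "pgrad 0 al0 (fi i) (k i) x" and ?q = "pgrad 0 al0 (fi j) (k j) x" and ?b = "drift al0 a al x"
  have c: "cnj z = cnj (spin n x) * y" if "spin n x * cnj z = y" for y z
  proof -
   have "cnj (spin n x) * (spin n x * cnj z) = (spin n x * cnj (spin n x)) * cnj z" by (simp only: mult_ac)
   then show ?thesis using that by (simp add: spin_unit)
  qed
  have anti: "Re z = 0" if "cnj z = - z" for z using arg_cong[OF that, of Re] by simp
  have "Re (rdot ?b P * cnj (fi l x)) = 0"
   if P: "\<forall>j. spin n x * cnj (P $ j) = - P $ j" and l: "spin n x * cnj (fi l x) = fi l x" for P l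
  proof -
   have "cnj (P $ j) = - (cnj (spin n x) * P $ j)" for j using c[OF P[rule_format]] by simp
   then have r: "cnj (rdot ?b P) = - (cnj (spin n x) * rdot ?b P)" by (simp add: rdot_def algebra_simps)
   have "cnj (rdot ?b P * cnj (fi l x)) = - (rdot ?b P * cnj (fi l x))"
    unfolding complex_cnj_mult complex_cnj_cnj r c[OF l] by (simp add: spin_unit)
   then show ?thesis by (rule anti)
  qed
  then have "Re (rdot ?b ?p * cnj (fi j x)) = 0" "Re (rdot ?b ?q * cnj (fi i x)) = 0"
   using elim unfolding aln by blast+
  then show ?case by (simp add: mult.commute)
 qed
 then have "(LINT x|M. Re (drift_term (drift al0 a al) i j x)) = (LINT x|M. 0)"
  by (rule integral_cong_AE[OF measurable_compose[OF borel_measurable_integrable[OF fdiff_split(1)[OF near]] borel_measurable_Re] borel_measurable_const])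
 then show ?thesis using integral_Re[OF fdiff_split(1)[OF near, of i j]] by simp
qed

text \<open>The drift is (al - al0) times the potential up to |a| / |x|, a size that
  \<open>drift_pairing\<close> integrates. The factor 2 is the symmetry of
  \<open>AB_pair_symmetric\<close>.\<close>

lemma drift_linear:
 obtains C where "C > 0" "!!a al. near al0 a al ==>
  norm ((LINT x|M. drift_term (drift al0 a al) i j x)
   - cx (2 * (al - al0)) * (LINT x|M. rdot (AB_potential 0 1 x) (pgrad 0 al0 (fi i) (k i) x) * cnj (fi j x))) <= C * norm a"
proof -
 let ?A = "AB_potential 0 1"
 let ?\<beta> = "LINT x|M. rdot (?A x) (pgrad 0 al0 (fi i) (k i) x) * cnj (fi j x)"
 define c where "c = 2 * L * \<bar>al0\<bar> + (\<bar>al0\<bar> + 1) * 2 / r0"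
 define w where "w = l2 M (wt al0 (fi i) (k i)) * l2 M (wt al0 (fi j) (k j))"
 have c0: "c >= 0" using L r0 by (simp add: c_def)
 have w0: "w >= 0" by (simp add: w_def l2_nonneg)
 have mA: "meas (%x. ?A x $ j)" for j by (rule borel_M[OF AB_potential_borel])
 have DA: "integrable M (drift_term ?A i j)"
  by (rule drift_pairing(1)[OF Hfi Hfi mA, of 1]) (simp_all add: norm_AB_potential)
 have A2: "(LINT x|M. drift_term ?A i j x) = 2 * ?\<beta>"
 proof -
  note b = L2_bilinear[OF bounded_bilinear_cip]
  note i = b[OF H_limit_L2(5)[OF Hfi] L2_AB[OF Hfi]] b[OF L2_AB[OF Hfi] H_limit_L2(5)[OF Hfi]]
  have "(LINT x|M. drift_term ?A i j x) = (LINT x|M. cip (pgrad 0 al0 (fi i) (k i) x) (fi j x *s complex_vec (?A x))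
    + cip (fi i x *s complex_vec (?A x)) (pgrad 0 al0 (fi j) (k j) x))"
   unfolding cip_vec_left cip_vec_right by (simp add: mult.commute)
  also have "... = 2 * (LINT x|M. cip (pgrad 0 al0 (fi i) (k i) x) (fi j x *s complex_vec (?A x)))"
   by (simp add: b_integral_add[OF i] AB_pair_symmetric[OF Hfi Hfi])
  finally show ?thesis unfolding cip_vec_right by (simp add: mult.commute)
 qed
 have "norm ((LINT x|M. drift_term (drift al0 a al) i j x) - cx (2 * (al - al0)) * ?\<beta>) <= (c * w + 1) * norm a"
  if n: "near al0 a al" for a al
 proof -
  let ?b = "%x. drift al0 a al x - (al - al0) *\<^sub>R ?A x"
  have mb: "meas (%x. ?b x $ j)" for j
  proof -
   note [measurable] = drift_measurable mA
   show ?thesis by simp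
  qed
  note D = drift_pairing[OF Hfi[of i] Hfi[of j] mb mult_nonneg_nonneg[OF c0 norm_ge_zero]
    drift_bound[OF near_small(1,2)[OF n] _ near_small(3)[OF n], folded c_def]]
  have e: "drift_term ?b i j x = drift_term (drift al0 a al) i j x - cx (al - al0) * drift_term ?A i j x" for x
   by (simp add: rdot_def algebra_simps)
  have I: "(LINT x|M. drift_term ?b i j x) = (LINT x|M. drift_term (drift al0 a al) i j x) - cx (al - al0) * (2 * ?\<beta>)"
   unfolding e A2[symmetric]
   by (subst b_integral_diff[OF fdiff_split(1)[OF n] integrable_mult_right[OF DA]]) simp
  have I2: "cx (2 * (al - al0)) * ?\<beta> = cx (al - al0) * (2 * ?\<beta>)" by simp
  have "norm ((LINT x|M. drift_term (drift al0 a al) i j x) - cx (2 * (al - al0)) * ?\<beta>) <= c * norm a * w"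
   unfolding I2 I[symmetric] w_def by (rule D(2))
  also have "... <= (c * w + 1) * norm a" by (simp add: algebra_simps)
  finally show ?thesis .
 qed
 moreover have "c * w + 1 > 0" using c0 w0 by (simp add: add_nonneg_pos)
 ultimately show ?thesis using that by blast
qed

end

section \<open>Isolatedness\<close>

text \<open>Cramer's rule for the two real linear equations prescribing Re (a A) and Re (a D), with
  the complex number a as unknown; up to sign the determinant is the imaginary part on the
  left.\<close>

lemma cross_identity:
 fixes a A D :: complex
 shows "norm a * \<bar>Im (cnj A * D)\<bar> <= norm D * \<bar>Re (a * A)\<bar> + norm A * \<bar>Re (a * D)\<bar>"
proof -
 have "\<i> * cnj a * cx (Im (cnj A * D)) = cx (Re (a * A)) * D - cx (Re (a * D)) * A"
  by (simp add: complex_eq_iff algebra_simps)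
 then have "norm (\<i> * cnj a * cx (Im (cnj A * D))) = norm (cx (Re (a * A)) * D - cx (Re (a * D)) * A)"
  by (rule arg_cong)
 with norm_triangle_ineq4[of "cx (Re (a * A)) * D" "cx (Re (a * D)) * A"]
 show ?thesis unfolding norm_mult norm_of_real norm_ii complex_mod_cnj by (simp only: mult_1 mult.commute)
qed

text \<open>A symmetric matrix is scalar when its off-diagonal entry and the difference of its
  diagonal entries vanish; here these belong to v w and v^2 - w^2. The determinant of the two
  conditions is the one expressing independence of v and w over the reals, up to a positive
  factor.\<close>

lemma cross_squares: "Im (cnj (v * w) * (v^2 - w^2)) = ((norm v)^2 + (norm w)^2) * Im (v * cnj w)"
 by (simp add: power2_eq_square cmod_power2 algebra_simps) (simp add: cmod_def power2_eq_square algebra_simps)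

lemma norm_eq_diff_sum_le:
 fixes u f x y z :: complex
 assumes "u = f - (x + y + z)"
 shows "norm u <= norm f + (norm x + norm y + norm z)"
 using norm_triangle_ineq4[of f "x + y + z"] norm_triangle_ineq[of "x + y" z] norm_triangle_ineq[of x y] unfolding assms by linarith

text \<open>The two estimates add up to 3 Q + 3 E X; the smallness of \<open>E\<close> lets the
  second term take at most half of the left-hand side, and 3 becomes 6.\<close>

lemma absorb:
 fixes X :: real
 assumes "\<kappa>0 > 0" "\<Delta> > 0" "S >= 0" "\<kappa>0 <= \<kappa>" "6 * S * E <= \<kappa>0 * \<Delta>"
  and "X * \<Delta> <= S * (\<bar>RA\<bar> + \<bar>RB\<bar>)" "\<kappa> * \<bar>RA\<bar> <= Q + E * X" "\<kappa> * \<bar>RB\<bar> <= 2 * Q + 2 * (E * X)" "X >= 0"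
 shows "X <= 6 * S / (\<kappa>0 * \<Delta>) * Q"
proof -
 have "\<kappa>0 * \<bar>RA\<bar> <= \<kappa> * \<bar>RA\<bar>" "\<kappa>0 * \<bar>RB\<bar> <= \<kappa> * \<bar>RB\<bar>" using assms(4) by (simp_all add: mult_right_mono)
 then have "\<kappa>0 * (\<bar>RA\<bar> + \<bar>RB\<bar>) <= 3 * Q + 3 * (E * X)" using assms(7,8) by (simp add: distrib_left)
 then have "S * (\<kappa>0 * (\<bar>RA\<bar> + \<bar>RB\<bar>)) <= S * (3 * Q + 3 * (E * X))" using assms(3) by (rule mult_left_mono)
 moreover have "\<kappa>0 * (X * \<Delta>) <= \<kappa>0 * (S * (\<bar>RA\<bar> + \<bar>RB\<bar>))" using assms(1,6) by simp
 ultimately have "\<kappa>0 * \<Delta> * X <= 3 * S * Q + 3 * S * E * X" by (simp add: algebra_simps)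
 moreover have "6 * S * E * X <= \<kappa>0 * \<Delta> * X" using assms(5,9) by (rule mult_right_mono)
 ultimately have "\<kappa>0 * \<Delta> * X <= 6 * S * Q" by linarith
 then show ?thesis using assms(1,2) by (simp add: field_simps)
qed

context expanded
begin

text \<open>Real parts of the matrix bound \<open>a\<close>, and its off-diagonal entry then bounds
  the circulation in terms of \<open>a\<close>. Each bound is t times a quantity that is small near
  the unperturbed parameter, so t is at most half of itself.\<close>

lemma isolated:
 assumes K: "!!i. AE x in M. spin (2 * m + 1) x * cnj (fi i x) = fi i x"
  and w: "Im (w False * cnj (w True)) ~= 0"
  and \<beta>0: "(LINT x|M. rdot (AB_potential 0 1 x) (p False x) * cnj (fi True x)) ~= 0"
 shows "\<exists>\<delta>>0. \<forall>a al \<mu>. norm a + \<bar>al - al0\<bar> + \<bar>\<mu> - lam\<bar> < \<delta> --> has_eigen_multiplicity \<Omega> a al \<mu> 2 --> a = 0 \<and> al = al0"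
proof -
 obtain CT where CT: "CT > 0"
  "!!e a i j. 0 < e ==> e < \<delta>0 ==> norm ((LINT x|M. tensor (shift e x) a (p i x) (p j x))
    - cx (weight e * Re (Complex (a$1) (a$2) * w i * w j))) <= CT * sqrt e * norm a"
  using tensor_limit by blast
 obtain CM where CM: "CM > 0"
  "!!e a i j. 0 < e ==> e < \<delta>0 ==>
   norm (LINT x|M. cx (shift e x \<bullet> a) * (fi i x * cnj (fi j x))) <= CM * sqrt e * norm a"
  using mass_limit by blast
 define wA where "wA = w False * w True"
 define wB where "wB = (w False)^2 - (w True)^2"
 define \<Delta> where "\<Delta> = \<bar>Im (cnj wA * wB)\<bar>"
 have \<Delta>: "\<Delta> > 0"
 proof -
  have "(norm (w False))^2 + (norm (w True))^2 ~= 0" using w by (auto simp: sum_power2_eq_zero_iff)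
  then show ?thesis unfolding \<Delta>_def wA_def wB_def cross_squares using w by (simp only: zero_less_abs_iff mult_eq_0_iff) simp
 qed
 define S where "S = norm wA + norm wB"
 have S: "S >= 0" "norm wA <= S" "norm wB <= S" by (simp_all add: S_def)
 define \<kappa>0 where "\<kappa>0 = b0 / 400"
 have \<kappa>0: "\<kappa>0 > 0" using b0 by (simp add: \<kappa>0_def)
 define E0 where "E0 = CT + \<bar>lam\<bar> * CM"
 have E0: "E0 > 0" using CT(1) CM(1) by (simp add: E0_def add_pos_nonneg)
 define r where "r = \<kappa>0 * \<Delta> / (6 * S * E0 + 1)"
 have SE: "6 * S * E0 + 1 > 0" using S E0 by (simp add: add_nonneg_pos)
 then have r: "r > 0" using \<kappa>0 \<Delta> by (simp add: r_def)
 \<comment> \<open>The second entry makes the localisation error \<open>E\<close>, of order sqrt e,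
   small against the determinant \<open>\<Delta>\<close>. From here on the cut-off is fixed.\<close>
 define e where "e = min (\<delta>0 / 2) (r^2)"
 have e: "0 < e" "e < \<delta>0" using \<delta>0 r by (auto simp: e_def)
 have se: "sqrt e <= r" using r by (intro real_le_lsqrt) (auto simp: e_def)
 define E where "E = E0 * sqrt e"
 have small_E: "6 * S * E <= \<kappa>0 * \<Delta>"
 proof -
  have "6 * S * E <= (6 * S * E0 + 1) * r" unfolding E_def using se S(1) E0 r e
   by (auto simp: distrib_right mult.assoc intro!: add_increasing2 mult_left_mono)
  then show ?thesis using SE by (simp add: r_def)
 qed
 define \<zeta> where "\<zeta> x = \<eta> ((norm x)^2 / e^2)" for x :: "real^2"
 have s1: "(norm x)^2 / e^2 > -1" for x :: "real^2" by (rule less_le_trans[of _ 0]) auto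
 have \<zeta>d: "(\<zeta> has_derivative (%h. shift e x \<bullet> h)) (at x)" for x
  unfolding \<zeta>_def[abs_def]
  by (rule has_derivative_eq_rhs[OF DERIV_compose_FDERIV[OF \<eta>(1)[OF s1] radius_derivative]])
    (simp add: shift_def \<beta>_def fun_eq_iff)
 interpret ce: cutoff_eigenpair \<Omega> \<zeta> "shift e" "e / 2" "2 * bm / e" "cball 0 e" al0 lam fi k
 proof
  show "(\<zeta> has_derivative (%h. shift e x \<bullet> h)) (at x)" for x by (rule \<zeta>d)
  show "smooth_on UNIV (%x. cx (\<zeta> x))"
  proof (rule smooth_onI)
   show "(%x. cx (\<zeta> x)) differentiable (at x)" for x
    using has_derivative_of_real[OF \<zeta>d] by (auto simp: differentiable_def)
   have "smooth_on UNIV (%x. cx (- 2 / e^2) * (cx (\<beta> e x) * cx (x $ i)))" for i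
    by (intro smooth_on_mult smooth_on_const smooth_on_coord \<beta>_smooth open_UNIV)
   moreover have "partial_deriv i (%x. cx (\<zeta> x)) = (%x. cx (- 2 / e^2) * (cx (\<beta> e x) * cx (x $ i)))" for i
    by (simp add: fun_eq_iff partial_deriv_of_real[OF \<zeta>d] shift_def inner_axis)
   ultimately show "smooth_on UNIV (partial_deriv i (%x. cx (\<zeta> x)))" for i by simp
  qed
  show "\<zeta> x = 1" if "norm x < e / 2" for x
  proof -
   have "(norm x)^2 <= (e / 2)^2" using that by (intro power_mono) auto
   then show ?thesis unfolding \<zeta>_def using e(1) s1[of x] by (intro \<eta>(2)) (auto simp: field_simps power2_eq_square)
  qed
  show "\<zeta> x = 0" if "x \<notin> cball 0 e" for x
  proof -
   have "e^2 <= (norm x)^2" using that e(1) by (intro power_mono) auto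
   then show ?thesis unfolding \<zeta>_def using e(1) by (intro \<eta>(3)) (auto simp: field_simps)
  qed
  show "cball 0 e \<subseteq> \<Omega>" using e \<delta>0(3) by force
  show "norm (shift e x) <= 2 * bm / e" for x by (rule shift_bound[OF e(1)])
  show "0 <= \<zeta> x" "\<zeta> x <= 1" for x unfolding \<zeta>_def using s1[of x] by (auto intro: \<eta>(4,5))
 qed (use e Bb(1) in auto)
 obtain C \<delta>1 where C: "C > 0" "\<delta>1 > 0"
  "!!a al \<mu> i j. ce.near al0 a al ==> ce.dist_par al0 a al + \<bar>\<mu> - lam\<bar> < \<delta>1 ==> has_eigen_multiplicity \<Omega> a al \<mu> 2 ==>
   norm (ce.fdiff a al i j - (if i = j then cx (\<mu> - lam) else 0))
    <= C * ce.dist_par al0 a al * (ce.dist_par al0 a al + \<bar>\<mu> - lam\<bar>)"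
  using ce.main_estimate by blast
 define b where "b = (LINT x|M. rdot (AB_potential 0 1 x) (p False x) * cnj (fi True x))"
 obtain CD where CD: "CD > 0" "!!a al. ce.near al0 a al ==>
  norm ((LINT x|M. ce.drift_term (ce.drift al0 a al) False True x) - cx (2 * (al - al0)) * b) <= CD * norm a"
  using ce.drift_linear[of False True] unfolding b_def by blast
 define C3 where "C3 = 6 * S / (\<kappa>0 * \<Delta>) * C"
 define C6 where "C6 = \<bar>weight e\<bar> * norm wA + E + CD"
 define C7 where "C7 = C3 + (C + C6 * C3) / (2 * norm b)"
 have b: "norm b > 0" using \<beta>0 by (simp add: b_def)
 have C3: "C3 >= 0" using C(1) S \<kappa>0 \<Delta> by (simp add: C3_def)
 have C6: "C6 >= 0" using CD(1) E0 e by (simp add: C6_def E_def)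
 have C7: "C7 > 0" using C(1) C3 C6 b by (simp add: C7_def add_nonneg_pos add_pos_nonneg)
 define rt where "rt = ce.rate al0"
 have rt: "rt > 0" using ce.rate_ge(3) by (simp add: rt_def)
 \<comment> \<open>1 / (2 C7) serves the absorption at the end; 1 / (2 rt), 1 and e / 4 give
   \<open>near\<close>, as the cut-off is 1 up to radius e / 2, half of which is e / 4.\<close>
 define \<delta> where "\<delta> = min (min \<delta>1 (1 / (2 * C7))) (min (1 / (2 * rt)) (min 1 (e / 4)))"
 have \<delta>: "\<delta> > 0" using C(2) C7 rt e by (simp add: \<delta>_def)
 have "a = 0 \<and> al = al0" if d: "norm a + \<bar>al - al0\<bar> + \<bar>\<mu> - lam\<bar> < \<delta>" and mult: "has_eigen_multiplicity \<Omega> a al \<mu> 2" for a al \<mu>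
 proof -
  define t where "t = norm a + \<bar>al - al0\<bar>"
  have t: "t >= 0" "ce.dist_par al0 a al = t" "norm a <= t" by (simp_all add: t_def ce.dist_par_def)
  have near: "ce.near al0 a al"
  proof -
   have "t < \<delta>" using d by (simp add: t_def)
   then have "t <= 1 / (2 * rt)" "t <= min 1 (e / 4)" by (simp_all add: \<delta>_def)
   then show ?thesis unfolding ce.near_def t(2) rt_def[symmetric] using rt by (simp add: field_simps)
  qed
  define Q where "Q = C * t * (t + \<bar>\<mu> - lam\<bar>)"
  have main: "norm (ce.fdiff a al i j - (if i = j then cx (\<mu> - lam) else 0)) <= Q" for i j
   using C(3)[OF near _ mult, of i j] d unfolding t(2) Q_def by (simp add: \<delta>_def t_def)
  let ?T = "%i j. LINT x|M. tensor (shift e x) a (p i x) (p j x)"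
  let ?G = "%i j. LINT x|M. cx (shift e x \<bullet> a) * (fi i x * cnj (fi j x))"
  let ?D = "%i j. LINT x|M. ce.drift_term (ce.drift al0 a al) i j x"
  define z where "z = Complex (a$1) (a$2)"
  have nz: "norm z = norm a" by (simp add: z_def cmod_def norm_vec2[symmetric])
  have split: "ce.fdiff a al i j = ?T i j + ?D i j - cx lam * ?G i j" for i j
   using ce.fdiff_split(2)[OF near, of i j] unfolding ce.gmass_def .
  have err: "norm (?T i j - cx (weight e * Re (z * w i * w j)) - cx lam * ?G i j) <= E * norm a" for i j
  proof -
   have "norm (cx lam * ?G i j) <= \<bar>lam\<bar> * (CM * sqrt e * norm a)"
    unfolding norm_mult norm_of_real by (intro mult_left_mono CM(2) e) simp
   then show ?thesis
    using norm_triangle_ineq4[of "?T i j - cx (weight e * Re (z * w i * w j))" "cx lam * ?G i j"] CT(2)[OF e, of a i j]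
    unfolding E_def E0_def z_def by (simp add: algebra_simps)
  qed
  \<comment> \<open>Taking real parts removes the change of potential altogether, including its
    dependence on \<open>a\<close>; only the tensor and the mass remain.\<close>
  have re: "\<bar>Re (ce.fdiff a al i j) - weight e * Re (z * w i * w j)\<bar> <= E * norm a" for i j
  proof -
   have eq: "Re (ce.fdiff a al i j) - weight e * Re (z * w i * w j)
    = Re (?T i j - cx (weight e * Re (z * w i * w j)) - cx lam * ?G i j)"
    using ce.drift_real[OF K _ near, of i j] unfolding split by (simp add: al0_eq)
   show ?thesis unfolding eq by (rule order_trans[OF abs_Re_le_cmod err])
  qed
  have mre: "\<bar>Re (ce.fdiff a al i j - (if i = j then cx (\<mu> - lam) else 0))\<bar> <= Q" for i j
   using order_trans[OF abs_Re_le_cmod main] .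
  have "weight e * \<bar>Re (z * wA)\<bar> <= Q + E * norm a"
  proof -
   have "\<bar>weight e * Re (z * wA)\<bar> <= Q + E * norm a"
    using re[of False True] mre[of False True] by (simp add: wA_def mult.assoc)
   then show ?thesis using weight_bound[OF e] b0 by (simp add: abs_mult)
  qed
  \<comment> \<open>The unknown \<mu> - lam drops out of the difference of the two diagonal
    entries.\<close>
  moreover have "weight e * \<bar>Re (z * wB)\<bar> <= 2 * Q + 2 * (E * norm a)"
  proof -
   have "Re (z * wB) = Re (z * w False * w False) - Re (z * w True * w True)"
    by (simp only: wB_def power2_eq_square right_diff_distrib mult.assoc minus_complex.sel)
   then have "weight e * Re (z * wB) = weight e * Re (z * w False * w False) - weight e * Re (z * w True * w True)"
    by (simp only: right_diff_distrib)
   moreover have "\<bar>Re (ce.fdiff a al False False) - (\<mu> - lam)\<bar> <= Q" "\<bar>Re (ce.fdiff a al True True) - (\<mu> - lam)\<bar> <= Q"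
    using mre[of False False] mre[of True True] by simp_all
   ultimately have "\<bar>weight e * Re (z * wB)\<bar> <= 2 * Q + 2 * (E * norm a)"
    using re[of False False] re[of True True] by linarith
   then show ?thesis using weight_bound[OF e] b0 by (simp add: abs_mult)
  qed
  moreover have "norm a * \<Delta> <= S * (\<bar>Re (z * wA)\<bar> + \<bar>Re (z * wB)\<bar>)"
  proof -
   have "norm wB * \<bar>Re (z * wA)\<bar> + norm wA * \<bar>Re (z * wB)\<bar> <= S * \<bar>Re (z * wA)\<bar> + S * \<bar>Re (z * wB)\<bar>"
    by (intro add_mono mult_right_mono S) auto
   then show ?thesis using cross_identity[of z wA wB] unfolding nz \<Delta>_def by (simp add: distrib_left)
  qed
  ultimately have "norm a <= 6 * S / (\<kappa>0 * \<Delta>) * Q"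
   by (intro absorb[OF \<kappa>0 \<Delta> S(1) _ small_E]) (use weight_bound[OF e] in \<open>auto simp: \<kappa>0_def\<close>)
  then have a: "norm a <= C3 * (t * (t + \<bar>\<mu> - lam\<bar>))" by (simp add: C3_def Q_def mult_ac)
  \<comment> \<open>The off-diagonal entry solved for its part linear in al - al0; everything else
    is bounded by \<open>Q\<close> or by a multiple of |a|.\<close>
  have "2 * (\<bar>al - al0\<bar> * norm b) <= Q + C6 * norm a"
  proof -
   let ?r = "?T False True - cx (weight e * Re (z * w False * w True)) - cx lam * ?G False True"
   let ?d = "?D False True - cx (2 * (al - al0)) * b"
   have "cx (2 * (al - al0)) * b = ce.fdiff a al False True - (?r + cx (weight e * Re (z * w False * w True)) + ?d)"
    unfolding split by simp
   then have "norm (cx (2 * (al - al0)) * b)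
    <= norm (ce.fdiff a al False True) + (norm ?r + norm (cx (weight e * Re (z * w False * w True))) + norm ?d)"
    by (rule norm_eq_diff_sum_le)
   moreover have "norm (cx (weight e * Re (z * w False * w True))) <= \<bar>weight e\<bar> * (norm a * norm wA)"
    unfolding norm_of_real abs_mult using abs_Re_le_cmod[of "z * wA"]
    by (intro mult_left_mono) (simp_all add: norm_mult nz wA_def mult.assoc)
   moreover have "norm (cx (2 * (al - al0)) * b) = 2 * (\<bar>al - al0\<bar> * norm b)"
    by (simp only: norm_mult norm_of_real abs_mult)
   moreover have "norm (ce.fdiff a al False True) <= Q" using main[of False True] by simp
   ultimately have "2 * (\<bar>al - al0\<bar> * norm b) <= Q + (E * norm a + \<bar>weight e\<bar> * (norm a * norm wA) + CD * norm a)"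
    using err[of False True] CD(2)[OF near] by linarith
   then show ?thesis by (simp add: C6_def algebra_simps)
  qed
  also have "... <= (C + C6 * C3) * (t * (t + \<bar>\<mu> - lam\<bar>))"
   using mult_left_mono[OF a C6] by (simp add: Q_def algebra_simps)
  finally have "\<bar>al - al0\<bar> <= (C + C6 * C3) / (2 * norm b) * (t * (t + \<bar>\<mu> - lam\<bar>))"
   using b by (simp add: field_simps)
  with a have "t <= C7 * (t * (t + \<bar>\<mu> - lam\<bar>))" unfolding t_def[of] C7_def distrib_right by (simp add: t_def)
  \<comment> \<open>t + |\<mu> - lam| is below 1 / (2 C7) by the choice of \<delta>, hence t <= t /
    2.\<close>
  also have "... <= C7 * (t * (1 / (2 * C7)))"
   using d t(1) C7 by (intro mult_left_mono) (auto simp: \<delta>_def t_def)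
  also have "... = t / 2" using C7 by simp
  finally have "t = 0" using t(1) by simp
  then show ?thesis by (simp add: t_def add_nonneg_eq_0_iff)
 qed
 with \<delta> show ?thesis by blast
qed

end

section \<open>Passage from the hypotheses to the abstract setting\<close>

lemma polar_coordinates: "x = vector [norm x * cos (polar_angle x), norm x * sin (polar_angle x)]"
proof -
 have "Complex (x$1) (x$2) = cx (norm x) * cis (polar_angle x)"
  using complex_coord_eq[of x] by (simp add: spin_def cis_conv_exp)
 then show ?thesis by (simp add: vec_eq_iff forall_2 complex_eq_iff)
qed

lemma lead_polar:
 "lead m (Complex c (- d)) x = exp (\<i> * cx ((1/2 + of_int m) * polar_angle x))
   * cx (norm x powr (1/2) * (c * cos (polar_angle x / 2) + d * sin (polar_angle x / 2)))"
proof -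
 define t where "t = polar_angle x"
 define h where "h = cis (t / 2)"
 have s: "spin k x = cis (of_int k * t)" for k by (simp add: spin_def t_def cis_conv_exp)
 have h: "h * h = cis t" "h * cnj h = 1" by (simp_all add: h_def cis_mult cis_cnj)
 have m: "spin (m + 1) x = spin m x * (h * h)" by (simp add: s h cis_mult distrib_right)
 have 1: "cx (c * cos (t / 2) + d * sin (t / 2)) = (Complex c (- d) * h + Complex c d * cnj h) / 2"
  by (simp add: complex_eq_iff h_def)
 have "(1/2 + of_int m) * t = of_int m * t + t / 2" by (simp add: algebra_simps)
 then have 2: "exp (\<i> * cx ((1/2 + of_int m) * t)) = spin m x * h"
  by (simp only: s h_def cis_mult cis_conv_exp[symmetric])
 have 3: "cnj (Complex c (- d)) = Complex c d" by (simp add: complex_eq_iff)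
 have 4: "spin m x * h * (R * ((w * h + v * cnj h) / 2)) = (w * (R * spin (m + 1) x) + v * (R * spin m x)) / 2" for R w v
 proof -
  have "spin m x * h * (R * ((w * h + v * cnj h) / 2)) = (w * (R * (spin m x * (h * h))) + v * (R * spin m x * (h * cnj h))) / 2"
   by (simp add: algebra_simps add_divide_distrib)
  then show ?thesis unfolding m h(2) by simp
 qed
 show ?thesis unfolding t_def[symmetric] lead_def mode_def of_real_mult[of "norm x powr (1/2)"] 1 2 3 4 ..
qed

lemma expansion_lead:
 assumes "expansion_at_0 (1/2 + of_int m) u c d"
 obtains C \<delta> where "C >= 0" "\<delta> > 0"
  "!!x. 0 < norm x ==> norm x < \<delta> ==> norm (u x - lead m (Complex c (- d)) x) <= C * norm x powr (3/2)"
proof -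
 obtain C \<delta> where \<delta>: "\<delta> > 0" and C: "!!r t. 0 < r ==> r < \<delta> ==> 0 <= t ==> t <= 2 * pi ==>
    norm (u (vector [r * cos t, r * sin t]) - exp (\<i> * cx ((1/2 + of_int m) * t))
         * cx (r powr (1/2) * (c * cos (t/2) + d * sin (t/2)))) <= C * r powr (3/2)"
  using assms unfolding expansion_at_0_def by blast
 have "norm (u x - lead m (Complex c (- d)) x) <= \<bar>C\<bar> * norm x powr (3/2)" if x: "0 < norm x" "norm x < \<delta>" for x
 proof -
  have t: "0 <= polar_angle x" "polar_angle x <= 2 * pi"
   using Arg2pi_ge_0[of "Complex (x$1) (x$2)"] Arg2pi_lt_2pi[of "Complex (x$1) (x$2)"] by (simp_all add: polar_angle_def)
  have "norm (u x - lead m (Complex c (- d)) x) <= C * norm x powr (3/2)"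
   using C[OF x t] unfolding lead_polar polar_coordinates[symmetric] .
  also have "... <= \<bar>C\<bar> * norm x powr (3/2)" by (intro mult_right_mono) auto
  finally show ?thesis .
 qed
 with \<delta> that[of "\<bar>C\<bar>" \<delta>] show ?thesis by simp
qed

context bounded_domain
begin

text \<open>The definition uses the gradients picked by \<open>grad\<close>, whereas the form
  accepts any admissible gradient; uniqueness almost everywhere identifies the two.\<close>

lemma eigenspace_iff:
 assumes H: "H_limit \<Omega> 0 u g"
 shows "u \<in> eigenspace \<Omega> 0 al lam \<longleftrightarrow> (\<forall>v h. H_limit \<Omega> 0 v h --> mform al u g v h = cx lam * ip u v)"
proof -
 have e: "mform al u g v h = (LINT x|M. cdot (magnetic_grad \<Omega> 0 al u x) (cnj_vec (magnetic_grad \<Omega> 0 al v x)))"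
  if v: "H_limit \<Omega> 0 v h" for v h
 proof -
  have "AE x in M. cip (pgrad 0 al u g x) (pgrad 0 al v h x) = cip (pgrad 0 al u (grad \<Omega> 0 u) x) (pgrad 0 al v (grad \<Omega> 0 v) x)"
   using H_limit_grad[OF H] H_limit_grad[OF v] by eventually_elim (simp add: pgrad_def)
  moreover have "H_limit \<Omega> 0 u (grad \<Omega> 0 u)" "H_limit \<Omega> 0 v (grad \<Omega> 0 v)"
   using H v by (auto intro!: H10_grad simp: H10_def)
  ultimately have "mform al u g v h = mform al u (grad \<Omega> 0 u) v (grad \<Omega> 0 v)"
   unfolding mform_def using H v
   by (intro integral_cong_AE cip_measurable L2_measurable[OF H_limit_L2(5)]) auto
  then show ?thesis by (simp add: mform_def cip_def pgrad_def magnetic_grad_def)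
 qed
 have "u \<in> H10 \<Omega> 0" using H by (auto simp: H10_def)
 then show ?thesis unfolding eigenspace_def L2_inner_def using e by (auto simp: H10_def)
qed

text \<open>Orthonormality makes the coefficient matrix of the two eigenfunctions in the given basis
  invertible. A multiple of \<open>u\<close> by its determinant is therefore a combination of them,
  and orthogonality annihilates the coefficients.\<close>

lemma double_kernel:
 assumes fi: "!!i. L2 M (fi i)" and ortho: "!!i j. ip (fi i) (fi j) = (if i = j then 1 else 0)"
  and mem: "!!i :: bool. fi i \<in> eigenspace \<Omega> a al lam" and mult: "has_eigen_multiplicity \<Omega> a al lam 2"
  and u: "L2 M u" "u \<in> eigenspace \<Omega> a al lam" "!!i. ip u (fi i) = 0"
 shows "AE x in M. u x = 0"
proof -
 obtain b :: "nat => real^2 => complex" where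
  b: "!!u. u \<in> eigenspace \<Omega> a al lam ==> \<exists>z :: nat => complex. AE x in M. u x = (\<Sum>j<2. z j * b j x)"
  using mult unfolding has_eigen_multiplicity_def by blast
 have b2: "\<exists>y z. AE x in M. u x = y * b 0 x + z * b 1 x" if u: "u \<in> eigenspace \<Omega> a al lam" for u
 proof -
  obtain z :: "nat => complex" where "AE x in M. u x = (\<Sum>j<2. z j * b j x)" using b[OF u] by blast
  then have "AE x in M. u x = z 0 * b 0 x + z 1 * b 1 x" by (simp add: numeral_2_eq_2)
  then show ?thesis by blast
 qed
 obtain p q where F: "AE x in M. fi False x = p * b 0 x + q * b 1 x" using b2[OF mem] by blast
 obtain r s where T: "AE x in M. fi True x = r * b 0 x + s * b 1 x" using b2[OF mem] by blast
 obtain y z where U: "AE x in M. u x = y * b 0 x + z * b 1 x" using b2[OF u(2)] by blast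
 have ip: "ip (%x. c * fi False x + d * fi True x) (fi i) = (if i then d else c)" for c d i
  by (simp add: L2_inner_add_left[OF L2_cmult[OF fi] L2_cmult[OF fi] fi] L2_inner_cmult_left ortho)
 have zero: "c = 0 \<and> d = 0" if w: "AE x in M. e * u x = c * fi False x + d * fi True x" for c d e
 proof -
  have m: "meas (%x. e * u x * cnj (fi i x))" "meas (%x. (c * fi False x + d * fi True x) * cnj (fi i x))" for i
   using borel_measurable_integrable[OF L2_inner_integrable[OF L2_cmult[OF u(1), of e] fi]]
    borel_measurable_integrable[OF L2_inner_integrable[OF L2_add(1)[OF L2_cmult[OF fi, of c False] L2_cmult[OF fi, of d True]] fi]] by auto
  have ie: "ip (%x. e * u x) (fi i) = ip (%x. c * fi False x + d * fi True x) (fi i)" for i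
   unfolding L2_inner_def by (rule integral_cong_AE[OF m]) (use w in eventually_elim, simp)
  have "(if i then d else c) = 0" for i using ie[of i] unfolding ip L2_inner_cmult_left u(3) by simp
  from this[of True] this[of False] show ?thesis by simp
 qed
 define D where "D = p * s - q * r"
 have "D ~= 0"
 proof
  assume D: "D = 0"
  have z1: "AE x in M. 0 * u x = s * fi False x + (- q) * fi True x"
   using F T by eventually_elim (use D in \<open>simp add: D_def algebra_simps\<close>)
  have z2: "AE x in M. 0 * u x = r * fi False x + (- p) * fi True x"
   using F T by eventually_elim (use D in \<open>simp add: D_def algebra_simps\<close>)
  have "p = 0" "q = 0" using zero[OF z1] zero[OF z2] by auto
  then have "AE x in M. 0 * u x = 1 * fi False x + 0 * fi True x" using F by simp
  from zero[OF this] show False by simp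
 qed
 have "AE x in M. D * u x = (y * s - z * r) * fi False x + (z * p - y * q) * fi True x"
  using F T U by eventually_elim (simp add: D_def algebra_simps)
 moreover from zero[OF this] have "y * s - z * r = 0" "z * p - y * q = 0" by auto
 ultimately have "AE x in M. D * u x = 0" by simp
 then show ?thesis using \<open>D ~= 0\<close> by simp
qed

end

lemma independent_pairs:
 fixes c1 d1 c2 d2 :: real
 assumes "c2^2 + d2^2 ~= 0" "\<not> (\<exists>\<gamma> :: real. (c1, d1) = (\<gamma> * c2, \<gamma> * d2))"
 shows "Im (Complex c1 (- d1) * cnj (Complex c2 (- d2))) ~= 0"
proof
 assume "Im (Complex c1 (- d1) * cnj (Complex c2 (- d2))) = 0"
 then have e: "c1 * d2 = d1 * c2" by simp
 \<comment> \<open>The coefficient of the orthogonal projection of (c1, d1) onto (c2, d2).\<close>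
 let ?g = "(c1 * c2 + d1 * d2) / (c2^2 + d2^2)"
 have "c1 * (c2^2 + d2^2) = (c1 * c2 + d1 * d2) * c2 + d2 * (c1 * d2 - d1 * c2)"
  "d1 * (c2^2 + d2^2) = (c1 * c2 + d1 * d2) * d2 - c2 * (c1 * d2 - d1 * c2)"
  by (simp_all add: power2_eq_square algebra_simps)
 then have "c1 * (c2^2 + d2^2) = (c1 * c2 + d1 * d2) * c2" "d1 * (c2^2 + d2^2) = (c1 * c2 + d1 * d2) * d2"
  unfolding e by simp_all
 then have "(c1, d1) = (?g * c2, ?g * d2)" using assms(1) by (simp add: field_simps)
 with assms(2) show False by blast
qed

theorem theorem1p6:
  fixes \<Omega> :: "(real^2) set" and \<alpha>\<^sub>0 lam :: real and n\<^sub>0 :: nat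
    and \<phi>\<^sub>1 \<phi>\<^sub>2 :: "real^2 \<Rightarrow> complex" and c\<^sub>1 d\<^sub>1 c\<^sub>2 d\<^sub>2 :: real
  assumes "bounded \<Omega>" and "open \<Omega>" and "simply_connected \<Omega>" and "lipschitz_boundary \<Omega>"
    and "0 \<in> \<Omega>"
    and "\<exists>m :: int. \<alpha>\<^sub>0 = 1/2 + of_int m"
    and "n\<^sub>0 \<ge> 1" and "lam = eigenval \<Omega> 0 \<alpha>\<^sub>0 n\<^sub>0" and "has_eigen_multiplicity \<Omega> 0 \<alpha>\<^sub>0 lam 2"
    and "eigenfunction \<Omega> 0 \<alpha>\<^sub>0 lam \<phi>\<^sub>1" and "eigenfunction \<Omega> 0 \<alpha>\<^sub>0 lam \<phi>\<^sub>2"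
    and "K_real \<Omega> \<alpha>\<^sub>0 \<phi>\<^sub>1" and "K_real \<Omega> \<alpha>\<^sub>0 \<phi>\<^sub>2"
    and "L2_inner \<Omega> \<phi>\<^sub>1 \<phi>\<^sub>1 = 1" and "L2_inner \<Omega> \<phi>\<^sub>2 \<phi>\<^sub>2 = 1" and "L2_inner \<Omega> \<phi>\<^sub>1 \<phi>\<^sub>2 = 0"
    and "expansion_at_0 \<alpha>\<^sub>0 \<phi>\<^sub>1 c\<^sub>1 d\<^sub>1" and "expansion_at_0 \<alpha>\<^sub>0 \<phi>\<^sub>2 c\<^sub>2 d\<^sub>2"
    and "c\<^sub>1\<^sup>2 + d\<^sub>1\<^sup>2 \<noteq> 0" and "c\<^sub>2\<^sup>2 + d\<^sub>2\<^sup>2 \<noteq> 0"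
    and "\<not> (\<exists>\<gamma> :: real. (c\<^sub>1, d\<^sub>1) = (\<gamma> * c\<^sub>2, \<gamma> * d\<^sub>2))"
    and "(LINT x|lebesgue_on \<Omega>. cdot (magnetic_grad \<Omega> 0 \<alpha>\<^sub>0 \<phi>\<^sub>1 x)
            (cnj (\<phi>\<^sub>2 x) *s complex_vec (AB_potential 0 \<alpha>\<^sub>0 x))) \<noteq> 0"
  shows "\<exists>(U :: ((real^2) \<times> real) set) (\<epsilon> :: real).
           open U \<and> (0, \<alpha>\<^sub>0) \<in> U \<and> U \<subseteq> \<Omega> \<times> UNIV \<and> \<epsilon> > 0 \<and>
           {(a, \<alpha>). (a, \<alpha>) \<in> U \<and>
              (\<exists>\<mu> \<in> {lam - \<epsilon> <..< lam + \<epsilon>}. has_eigen_multiplicity \<Omega> a \<alpha> \<mu> 2)} = {(0, \<alpha>\<^sub>0)}"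
proof -
  interpret bounded_domain \<Omega> by unfold_locales (fact assms(1), fact assms(2))
  obtain m where m: "\<alpha>\<^sub>0 = 1/2 + of_int m" using assms(6) by blast
  define \<phi> where "\<phi> i = (if i then \<phi>\<^sub>2 else \<phi>\<^sub>1)" for i
  define k where "k i = grad \<Omega> 0 (\<phi> i)" for i
  have mem: "\<phi> i \<in> eigenspace \<Omega> 0 \<alpha>\<^sub>0 lam" for i using assms(10,11) by (simp add: \<phi>_def eigenfunction_def)
  have H: "H_limit \<Omega> 0 (\<phi> i) (k i)" for i
    unfolding k_def by (rule H10_grad) (use mem in \<open>simp add: eigenspace_def\<close>)
  have o: "L2_inner \<Omega> (\<phi> i) (\<phi> j) = (if i = j then 1 else 0)" for i j
    using assms(14-16) L2_inner_hermitian[of \<phi>\<^sub>2 \<phi>\<^sub>1] by (cases i; cases j) (simp_all add: \<phi>_def)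
  have ep: "eigenpair \<Omega> \<alpha>\<^sub>0 lam \<phi> k"
  proof
    show "exp ((2 * pi) *\<^sub>R (- \<i> * complex_of_real \<alpha>\<^sub>0)) = -1" unfolding m by (rule exp_half_turn)
    show "mform \<alpha>\<^sub>0 (\<phi> i) (k i) v h = complex_of_real lam * L2_inner \<Omega> (\<phi> i) v" if "H_limit \<Omega> 0 v h" for i v h
      using mem that unfolding eigenspace_iff[OF H] by blast
    show "AE x in M. u x = 0" if "H_limit \<Omega> 0 u g" "\<And>i. L2_inner \<Omega> u (\<phi> i) = 0"
      "\<And>v h. H_limit \<Omega> 0 v h \<Longrightarrow> mform \<alpha>\<^sub>0 u g v h = complex_of_real lam * L2_inner \<Omega> u v" for u g
      by (rule double_kernel[OF H_limit_L2(3)[OF H] o mem assms(9) H_limit_L2(3)[OF that(1)] _ that(2)])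
         (use that eigenspace_iff[OF that(1)] in blast)
  qed (fact H, fact o)
  define w where "w i = (if i then Complex c\<^sub>2 (- d\<^sub>2) else Complex c\<^sub>1 (- d\<^sub>1))" for i
  obtain C1 \<delta>1 where C1: "C1 \<ge> 0" "\<delta>1 > 0" "\<And>x. 0 < norm x \<Longrightarrow> norm x < \<delta>1 \<Longrightarrow> norm (\<phi>\<^sub>1 x - lead m (w False) x) \<le> C1 * norm x powr (3/2)"
    using expansion_lead[OF assms(17)[unfolded m]] unfolding w_def by auto
  obtain C2 \<delta>2 where C2: "C2 \<ge> 0" "\<delta>2 > 0" "\<And>x. 0 < norm x \<Longrightarrow> norm x < \<delta>2 \<Longrightarrow> norm (\<phi>\<^sub>2 x - lead m (w True) x) \<le> C2 * norm x powr (3/2)"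
    using expansion_lead[OF assms(18)[unfolded m]] unfolding w_def by auto
  obtain \<rho> where \<rho>: "\<rho> > 0" "cball 0 \<rho> \<subseteq> \<Omega>" using assms(2,5) by (auto simp: open_contains_cball)
  define \<delta>0 where "\<delta>0 = min (min \<delta>1 \<delta>2) (min \<rho> 1)"
  obtain B B' \<eta> bm b0 where prof: "profile B B' \<eta> bm b0" using profile_exists by blast
  interpret ex: expanded \<Omega> \<alpha>\<^sub>0 lam \<phi> k B B' \<eta> bm b0 m w "max C1 C2" \<delta>0 "norm (w False) + norm (w True) + 1"
  proof (intro expanded.intro ep prof expanded_axioms.intro)
    show "norm (\<phi> i x - lead m (w i) x) \<le> max C1 C2 * norm x powr (3/2)" if "0 < norm x" "norm x < \<delta>0" for i x
    proof -
      have "norm (\<phi> i x - lead m (w i) x) \<le> (if i then C2 else C1) * norm x powr (3/2)"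
        using C1(3)[of x] C2(3)[of x] that by (cases i) (auto simp: \<delta>0_def \<phi>_def)
      also have "\<dots> \<le> max C1 C2 * norm x powr (3/2)" by (intro mult_right_mono) auto
      finally show ?thesis .
    qed
    show "norm (w i) \<le> norm (w False) + norm (w True) + 1" for i by (cases i) simp_all
    show "cball 0 \<delta>0 \<subseteq> \<Omega>" using \<rho>(2) by (auto simp: \<delta>0_def)
  qed (use m C1 C2 \<rho> in \<open>auto simp: \<delta>0_def add_nonneg_pos\<close>)
  have K: "AE x in M. spin (2 * m + 1) x * cnj (\<phi> i x) = \<phi> i x" for i
  proof -
    have "exp (\<i> * complex_of_real (2 * \<alpha>\<^sub>0 * polar_angle x)) = spin (2 * m + 1) x" for x
      by (simp add: spin_def m distrib_left add.commute)
    then show ?thesis using assms(12,13) unfolding K_real_def by (cases i) (simp_all add: \<phi>_def)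
  qed
  have w0: "Im (w False * cnj (w True)) \<noteq> 0" unfolding w_def using independent_pairs[OF assms(20,21)] by simp
  have b: "(LINT x|M. rdot (AB_potential 0 1 x) (pgrad 0 \<alpha>\<^sub>0 (\<phi> False) (k False) x) * cnj (\<phi> True x)) \<noteq> 0"
  proof
    assume z: "(LINT x|M. rdot (AB_potential 0 1 x) (pgrad 0 \<alpha>\<^sub>0 (\<phi> False) (k False) x) * cnj (\<phi> True x)) = 0"
    \<comment> \<open>The circulation factors out of the potential, so the integral of (iii) is
      \<open>\<alpha>\<^sub>0\<close> times the one needed here.\<close>
    have "cdot (magnetic_grad \<Omega> 0 \<alpha>\<^sub>0 \<phi>\<^sub>1 x) (cnj (\<phi>\<^sub>2 x) *s complex_vec (AB_potential 0 \<alpha>\<^sub>0 x))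
        = complex_of_real \<alpha>\<^sub>0 * (rdot (AB_potential 0 1 x) (pgrad 0 \<alpha>\<^sub>0 (\<phi> False) (k False) x) * cnj (\<phi> True x))" for x
    proof -
      have "magnetic_grad \<Omega> 0 \<alpha>\<^sub>0 \<phi>\<^sub>1 x = pgrad 0 \<alpha>\<^sub>0 (\<phi> False) (k False) x" by (simp add: magnetic_grad_def pgrad_def k_def \<phi>_def)
      then show ?thesis
        by (simp add: cdot_def rdot_def complex_vec_def AB_potential_scale[of 0 \<alpha>\<^sub>0] \<phi>_def algebra_simps)
    qed
    then show False using assms(22) z by simp
  qed
  have "\<exists>\<delta>>0. \<forall>a \<alpha> \<mu>. norm a + \<bar>\<alpha> - \<alpha>\<^sub>0\<bar> + \<bar>\<mu> - lam\<bar> < \<delta> \<longrightarrow> has_eigen_multiplicity \<Omega> a \<alpha> \<mu> 2 \<longrightarrow> a = 0 \<and> \<alpha> = \<alpha>\<^sub>0"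
    by (rule ex.isolated[OF K w0 b])
  then obtain \<delta> where \<delta>: "\<delta> > 0"
    "\<And>a \<alpha> \<mu>. norm a + \<bar>\<alpha> - \<alpha>\<^sub>0\<bar> + \<bar>\<mu> - lam\<bar> < \<delta> \<Longrightarrow> has_eigen_multiplicity \<Omega> a \<alpha> \<mu> 2 \<Longrightarrow> a = 0 \<and> \<alpha> = \<alpha>\<^sub>0"
    by blast
  \<comment> \<open>One half of \<delta> is spent on the parameters, the other on the
    eigenvalue.\<close>
  define U where "U = {z :: (real^2) \<times> real. norm (fst z) + \<bar>snd z - \<alpha>\<^sub>0\<bar> < \<delta> / 2} \<inter> (\<Omega> \<times> UNIV)"
  have "open U"
    unfolding U_def by (intro open_Int open_Times open_Collect_less continuous_intros assms(2) open_UNIV)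
  moreover have "(0, \<alpha>\<^sub>0) \<in> U" "U \<subseteq> \<Omega> \<times> UNIV" using \<delta>(1) assms(5) by (auto simp: U_def)
  moreover have "{(a, \<alpha>). (a, \<alpha>) \<in> U \<and> (\<exists>\<mu> \<in> {lam - \<delta> / 2 <..< lam + \<delta> / 2}. has_eigen_multiplicity \<Omega> a \<alpha> \<mu> 2)} = {(0, \<alpha>\<^sub>0)}"
  proof (intro equalityI subsetI)
    fix z assume "z \<in> {(a, \<alpha>). (a, \<alpha>) \<in> U \<and> (\<exists>\<mu> \<in> {lam - \<delta> / 2 <..< lam + \<delta> / 2}. has_eigen_multiplicity \<Omega> a \<alpha> \<mu> 2)}"
    then obtain a \<alpha> \<mu> where z: "z = (a, \<alpha>)" "norm a + \<bar>\<alpha> - \<alpha>\<^sub>0\<bar> < \<delta> / 2" "\<mu> \<in> {lam - \<delta> / 2 <..< lam + \<delta> / 2}" "has_eigen_multiplicity \<Omega> a \<alpha> \<mu> 2"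
      by (auto simp: U_def)
    have "\<bar>\<mu> - lam\<bar> < \<delta> / 2" using z(3) by (simp only: greaterThanLessThan_iff abs_less_iff) linarith
    then have "a = 0 \<and> \<alpha> = \<alpha>\<^sub>0" using z by (intro \<delta>(2)) auto
    then show "z \<in> {(0, \<alpha>\<^sub>0)}" using z(1) by simp
  next
    fix z assume "z \<in> {(0 :: real^2, \<alpha>\<^sub>0)}"
    moreover have "lam \<in> {lam - \<delta> / 2 <..< lam + \<delta> / 2}" using \<delta>(1) by simp
    ultimately show "z \<in> {(a, \<alpha>). (a, \<alpha>) \<in> U \<and> (\<exists>\<mu> \<in> {lam - \<delta> / 2 <..< lam + \<delta> / 2}. has_eigen_multiplicity \<Omega> a \<alpha> \<mu> 2)}"
      using assms(9) \<open>(0, \<alpha>\<^sub>0) \<in> U\<close> by blast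
  qed
  ultimately show ?thesis using \<delta>(1) by (intro exI[of _ U] exI[of _ "\<delta> / 2"]) auto
qed

end
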